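(* Let $M\subset\mathbb C^{n+1}$ be a smooth real hypersurface and $p\in M$ a point of finite Catlin multitype with holomorphically nondegenerate model $M_H=\{\operatorname{Im}w=P_C(z,\bar z)\}$, where $P_C$ is a homogeneous polynomial. If the model of $M$ at $p$ is neither a balanced hypersurface (in any multitype coordinates) nor a chain hypersurface, then the automorphisms of $M$ at $p$ are determined by their $1$-jets at $p$; that is, if $g,h\in\mathrm{Aut}(M,p)$ have the same $1$-jet at $p$, then $g=h$ as germs at $p$.
   Context: Multitype and models. A weight is an $n$-tuple of rationals $\Lambda=(\lambda_1,\dots,\lambda_n)$ with $0\le\lambda_j\le\frac12$ and $\lambda_j\ge\lambda_{j+1}$. The variables $w,\operatorname{Re}w,\operatorname{Im}w$ have weight $1$ and $z_j,\bar z_j$ have weight $\lambda_j$; a polynomial is weighted homogeneous of degree $\kappa$ if all its monomials $c\,z^\alpha\bar z^\beta(\operatorname{Re}w)^l$ satisfy $l+\sum_i(\alpha_i+\beta_i)\lambda_i=\kappa$. For a smooth real hypersurface $M\subset\mathbb C^{n+1}$ and a point $p\in M$ of finite type in the sense of Kohn and Bloom–Graham, $\Lambda$ is distinguished if there are local holomorphic coordinates $(z,w)$ vanishing at $p$ in which $M$ is $\operatorname{Im}w=P(z,\bar z)+o_\Lambda(1)$, where $P\ne0$ is weighted homogeneous of degree $1$ without pluriharmonic terms and $o_\Lambda(1)$ is a smooth function whose derivatives of weighted order $\le1$ vanish at the origin. The multitype weight $(\mu_1,\dots,\mu_n)$ is the lexicographic infimum of all distinguished weights; $M$ has finite (Catlin)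 multitype at $p$ if all $\mu_j\neq0$. Coordinates in which $M$ has this form with $\Lambda=(\mu_1,\dots,\mu_n)$ are multitype coordinates; then $P$ is denoted $P_C$, and $M_H=\{\operatorname{Im}w=P_C(z,\bar z)\}$ is the model of $M$ at $p$ (multitype coordinates are not unique, but all models are biholomorphically equivalent). "$P_C$ homogeneous" means that all multitype weights are equal. $M_H$ is holomorphically nondegenerate if there is no nonzero germ at $0$ of a holomorphic vector field tangent to $M_H$. $\mathrm{Aut}(M,p)$ is the stability group: the set of germs at $p$ of biholomorphisms mapping $M$ into itself and fixing $p$. Balanced. $P_C$ (and $M_H$) is balanced if for some nonzero $n$-tuple of real numbers $\Lambda=(\lambda_1,\dots,\lambda_n)$ one can write $P_C=\sum_{|\alpha|_\Lambda=|\bar\alpha|_\Lambda=1}A_{\alpha,\bar\alpha}z^\alpha\bar z^{\bar\alpha}$, where $\alpha,\bar\alpha$ are two independent multiindices and $|\alpha|_\Lambda=\sum_j\lambda_j\alpha_j$. Chain hypersurface. A vector field $Y=\sum_jF_j(z)\partial_{z_j}$ has weight $\mu$ if each $F_j$ is weighted homogeneous of degree $\mu+\mu_j$. A pair of finite sequences $\{U^{(1)},\dots,U^{(l)}\}$, $\{V^{(1)},\dots,V^{(l)}\}$ of $\mathbb C^s$-valued holomorphic weighted homogeneous polynomials in $z$ is a symmetric pair of $Y_s$-chains if $Y(U^{(l)})=0$, $Y(V^{(l)})=0$, $Y(U^{(j)})=A_jU^{(j+1)}$, $Y(V^{(j)})=B_jV^{(j+1)}$ for $j=1,\dots,l-1$,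 where $A_j,B_j$ are invertible $s\times s$ matrices with $A_j=-{}^t\overline{B_{l-j}}$. $M_H$ is a chain hypersurface if there is a nonzero weighted homogeneous holomorphic vector field $Y=\sum_jF_j(z)\partial_{z_j}$ of strictly positive weight such that $P_C=\sum_{j=1}^MT_j$ with $T_j=\operatorname{Re}\big(\sum_{k=1}^{N_j}\langle U_j^{(k)},V_j^{(N_j-k+1)}\rangle\big)$, where $\{U_j^{(k)}\}_{k}$, $\{V_j^{(k)}\}_{k}$ form a symmetric pair of $Y_{s_j}$-chains and $\langle\cdot,\cdot\rangle$ is the usual scalar product of $\mathbb C^{s_j}$. *)

theory Defs
  imports
    "HOL-Analysis.Analysis"
    "HOL-Library.Poly_Mapping"
    "HOL-Library.Fun_Lexorder"
    "Jordan_Normal_Form.Matrix"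
begin

(* The subscript notation is reserved for the vectors of complex^'n; the vectors and matrices of
   the Jordan_Normal_Form entry are used only for C^s-valued chains, where s is not fixed. *)
no_notation vec_index (infixl \<open>$\<close> 100)

section \<open>Smooth and holomorphic maps\<close>

(* f is C-infinity on the open set S: f is Frechet differentiable at every point of S, and so,
   hereditarily, are all its directional derivatives. *)
coinductive smooth_on :: "'a::real_normed_vector set \<Rightarrow> ('a \<Rightarrow> 'b::real_normed_vector) \<Rightarrow> bool"
  for S :: "'a set" where
  "\<lbrakk>\<forall>x\<in>S. f differentiable (at x);
    \<And>v. smooth_on S (\<lambda>x. frechet_derivative f (at x) v)\<rbrakk> \<Longrightarrow> smooth_on S f"

fun iterated_derivative ::
    "'a::real_normed_vector list \<Rightarrow> ('a \<Rightarrow> 'b::real_normed_vector) \<Rightarrow> 'a \<Rightarrow> 'b" where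
  "iterated_derivative [] f = f"
| "iterated_derivative (v # vs) f =
     iterated_derivative vs (\<lambda>x. frechet_derivative f (at x) v)"

(* C^{n+1} with coordinates (z, w). *)
type_synonym 'n cspace = "(complex, 'n) Finite_Cartesian_Product.vec \<times> complex"

definition mult_i :: "'n::finite cspace \<Rightarrow> 'n cspace" where
  "mult_i v = (\<i> *s fst v, \<i> * snd v)"

(* Holomorphic: the real derivative exists and is complex linear. *)
definition holo_map_on :: "'n::finite cspace set \<Rightarrow> ('n cspace \<Rightarrow> 'n cspace) \<Rightarrow> bool" where
  "holo_map_on U f \<longleftrightarrow> open U \<and>
     (\<forall>x\<in>U. \<exists>D. (f has_derivative D) (at x) \<and> (\<forall>v. D (mult_i v) = mult_i (D v)))"

definition biholomorphic :: "'n::finite cspace set \<Rightarrow> 'n cspace set \<Rightarrow> ('n cspace \<Rightarrow> 'n cspace) \<Rightarrow> bool" where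
  "biholomorphic U V f \<longleftrightarrow>
     bij_betw f U V \<and> holo_map_on U f \<and> holo_map_on V (inv_into U f)"

section \<open>Real hypersurfaces\<close>

definition local_defining_function ::
    "'n::finite cspace set \<Rightarrow> 'n cspace set \<Rightarrow> ('n cspace \<Rightarrow> real) \<Rightarrow> bool" where
  "local_defining_function M U \<rho> \<longleftrightarrow>
     open U \<and> smooth_on U \<rho> \<and> M \<inter> U = {q \<in> U. \<rho> q = 0} \<and>
     (\<forall>q\<in>U. frechet_derivative \<rho> (at q) \<noteq> (\<lambda>_. 0))"

definition smooth_hypersurface :: "'n::finite cspace set \<Rightarrow> bool" where
  "smooth_hypersurface M \<longleftrightarrow> (\<forall>q\<in>M. \<exists>U \<rho>. q \<in> U \<and> local_defining_function M U \<rho>)"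

(* The kernel of the differential does not depend on the choice of the defining function. *)
definition tangent_space :: "'n::finite cspace set \<Rightarrow> 'n cspace \<Rightarrow> 'n cspace set" where
  "tangent_space M q =
     {v. \<exists>U \<rho>. q \<in> U \<and> local_defining_function M U \<rho> \<and> frechet_derivative \<rho> (at q) v = 0}"

definition complex_tangent_space :: "'n::finite cspace set \<Rightarrow> 'n cspace \<Rightarrow> 'n cspace set" where
  "complex_tangent_space M q = {v \<in> tangent_space M q. mult_i v \<in> tangent_space M q}"

section \<open>Finite type in the sense of Kohn and Bloom--Graham\<close>

definition lie_bracket ::
    "('a::real_normed_vector \<Rightarrow> 'a) \<Rightarrow> ('a \<Rightarrow> 'a) \<Rightarrow> 'a \<Rightarrow> 'a" where
  "lie_bracket X Y q = frechet_derivative Y (at q) (X q) - frechet_derivative X (at q) (Y q)"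

(* Real sections of the complex tangent bundle, extended smoothly to the ambient open set U. *)
definition cr_field ::
    "'n::finite cspace set \<Rightarrow> 'n cspace set \<Rightarrow> ('n cspace \<Rightarrow> 'n cspace) \<Rightarrow> bool" where
  "cr_field M U X \<longleftrightarrow> smooth_on U X \<and> (\<forall>q \<in> M \<inter> U. X q \<in> complex_tangent_space M q)"

inductive_set cr_brackets ::
    "'n::finite cspace set \<Rightarrow> 'n cspace set \<Rightarrow> ('n cspace \<Rightarrow> 'n cspace) set"
  for M U :: "'n cspace set" where
  "cr_field M U X \<Longrightarrow> X \<in> cr_brackets M U"
| "\<lbrakk>cr_field M U X; Y \<in> cr_brackets M U\<rbrakk> \<Longrightarrow> lie_bracket X Y \<in> cr_brackets M U"

definition finite_type :: "'n::finite cspace set \<Rightarrow> 'n cspace \<Rightarrow> bool" where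
  "finite_type M p \<longleftrightarrow>
     (\<exists>U. open U \<and> p \<in> U \<and> span {X p | X. X \<in> cr_brackets M U} = tangent_space M p)"

section \<open>Weights and weighted homogeneous polynomials\<close>

definition weight :: "('n::{finite,linorder} \<Rightarrow> real) \<Rightarrow> bool" where
  "weight \<Lambda> \<longleftrightarrow> (\<forall>j. \<Lambda> j \<in> \<rat> \<and> 0 \<le> \<Lambda> j \<and> \<Lambda> j \<le> 1/2) \<and> (\<forall>i j. i \<le> j \<longrightarrow> \<Lambda> j \<le> \<Lambda> i)"

definition wdeg :: "('n::finite \<Rightarrow> real) \<Rightarrow> ('n \<Rightarrow> nat) \<Rightarrow> real" where
  "wdeg \<Lambda> \<alpha> = (\<Sum>j\<in>UNIV. \<Lambda> j * real (\<alpha> j))"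

definition monom_eval :: "('n::finite \<Rightarrow> nat) \<Rightarrow> complex ^ 'n \<Rightarrow> complex" where
  "monom_eval \<alpha> z = (\<Prod>j\<in>UNIV. (z $ j) ^ \<alpha> j)"

(* Polynomials in z, and polynomials in (z, cnj z), as finitely supported coefficient families. *)
type_synonym 'n hpoly = "('n \<Rightarrow> nat) \<Rightarrow>\<^sub>0 complex"
type_synonym 'n bipoly = "(('n \<Rightarrow> nat) \<times> ('n \<Rightarrow> nat)) \<Rightarrow>\<^sub>0 complex"

definition heval :: "'n::finite hpoly \<Rightarrow> complex ^ 'n \<Rightarrow> complex" where
  "heval f z = (\<Sum>\<alpha>\<in>Poly_Mapping.keys f. Poly_Mapping.lookup f \<alpha> * monom_eval \<alpha> z)"

definition beval :: "'n::finite bipoly \<Rightarrow> complex ^ 'n \<Rightarrow> complex" where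
  "beval P z = (\<Sum>(\<alpha>, \<beta>)\<in>Poly_Mapping.keys P. Poly_Mapping.lookup P (\<alpha>, \<beta>) * monom_eval \<alpha> z * cnj (monom_eval \<beta> z))"

definition real_valued :: "'n::finite bipoly \<Rightarrow> bool" where
  "real_valued P \<longleftrightarrow> (\<forall>z. beval P z \<in> \<real>)"

definition whomogeneous :: "('n::finite \<Rightarrow> real) \<Rightarrow> real \<Rightarrow> 'n hpoly \<Rightarrow> bool" where
  "whomogeneous \<Lambda> \<kappa> f \<longleftrightarrow> (\<forall>\<alpha>\<in>Poly_Mapping.keys f. wdeg \<Lambda> \<alpha> = \<kappa>)"

definition bi_whomogeneous :: "('n::finite \<Rightarrow> real) \<Rightarrow> real \<Rightarrow> 'n bipoly \<Rightarrow> bool" where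
  "bi_whomogeneous \<Lambda> \<kappa> P \<longleftrightarrow> (\<forall>(\<alpha>, \<beta>)\<in>Poly_Mapping.keys P. wdeg \<Lambda> \<alpha> + wdeg \<Lambda> \<beta> = \<kappa>)"

definition no_pluriharmonic_terms :: "'n::finite bipoly \<Rightarrow> bool" where
  "no_pluriharmonic_terms P \<longleftrightarrow> (\<forall>(\<alpha>, \<beta>)\<in>Poly_Mapping.keys P. \<alpha> \<noteq> (\<lambda>_. 0) \<and> \<beta> \<noteq> (\<lambda>_. 0))"

(* On a standard basis vector of C^n x R this is the weight of the corresponding real coordinate:
   \<Lambda> j for Re z_j and Im z_j, and 1 for Re w. *)
definition direction_weight ::
    "('n::finite \<Rightarrow> real) \<Rightarrow> (complex ^ 'n) \<times> real \<Rightarrow> real" where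
  "direction_weight \<Lambda> v = (\<Sum>j\<in>UNIV. \<Lambda> j * norm (fst v $ j)) + \<bar>snd v\<bar>"

(* r = o_\<Lambda>(1), as a function of (z, Re w).  Derivatives are taken in the real coordinates; at each
   order they span the same space as the derivatives in z, cnj z and Re w. *)
definition small_remainder ::
    "('n::finite \<Rightarrow> real) \<Rightarrow> ((complex ^ 'n) \<times> real \<Rightarrow> real) \<Rightarrow> bool" where
  "small_remainder \<Lambda> r \<longleftrightarrow>
     (\<forall>vs. set vs \<subseteq> Basis \<and> sum_list (map (direction_weight \<Lambda>) vs) \<le> 1 \<longrightarrow>
        iterated_derivative vs r 0 = 0)"

section \<open>Multitype and models\<close>

(* In the local holomorphic coordinates \<phi> = (z, w), vanishing at p, M is given by
   Im w = P(z, cnj z) + o_\<Lambda>(1). *)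
definition weighted_coordinates ::
    "'n::finite cspace set \<Rightarrow> 'n cspace \<Rightarrow> ('n \<Rightarrow> real) \<Rightarrow> ('n cspace \<Rightarrow> 'n cspace) \<Rightarrow>
     'n bipoly \<Rightarrow> bool" where
  "weighted_coordinates M p \<Lambda> \<phi> P \<longleftrightarrow>
     real_valued P \<and> P \<noteq> 0 \<and> bi_whomogeneous \<Lambda> 1 P \<and> no_pluriharmonic_terms P \<and>
     (\<exists>U V W r. p \<in> U \<and> biholomorphic U V \<phi> \<and> \<phi> p = 0 \<and>
        open W \<and> (\<forall>(z, w)\<in>V. (z, Re w) \<in> W) \<and> smooth_on W r \<and> small_remainder \<Lambda> r \<and>
        \<phi> ` (M \<inter> U) = {(z, w) \<in> V. Im w = Re (beval P z) + r (z, Re w)})"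

definition distinguished ::
    "'n::{finite,linorder} cspace set \<Rightarrow> 'n cspace \<Rightarrow> ('n \<Rightarrow> real) \<Rightarrow> bool" where
  "distinguished M p \<Lambda> \<longleftrightarrow> weight \<Lambda> \<and> (\<exists>\<phi> P. weighted_coordinates M p \<Lambda> \<phi> P)"

definition lex_le :: "('n::linorder \<Rightarrow> real) \<Rightarrow> ('n \<Rightarrow> real) \<Rightarrow> bool" where
  "lex_le \<Lambda> \<Lambda>' \<longleftrightarrow> less_fun \<Lambda> \<Lambda>' \<or> \<Lambda> = \<Lambda>'"

(* \<mu> is the infimum of the distinguished weights in the lexicographically ordered set of weights. *)
definition multitype ::
    "'n::{finite,linorder} cspace set \<Rightarrow> 'n cspace \<Rightarrow> ('n \<Rightarrow> real) \<Rightarrow> bool" where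
  "multitype M p \<mu> \<longleftrightarrow> weight \<mu> \<and>
     (\<forall>\<Lambda>. distinguished M p \<Lambda> \<longrightarrow> lex_le \<mu> \<Lambda>) \<and>
     (\<forall>\<nu>. weight \<nu> \<and> (\<forall>\<Lambda>. distinguished M p \<Lambda> \<longrightarrow> lex_le \<nu> \<Lambda>) \<longrightarrow> lex_le \<nu> \<mu>)"

(* P is the polynomial P_C of M at p in some multitype coordinates. *)
definition model_polynomial ::
    "'n::{finite,linorder} cspace set \<Rightarrow> 'n cspace \<Rightarrow> 'n bipoly \<Rightarrow> bool" where
  "model_polynomial M p P \<longleftrightarrow> (\<exists>\<mu> \<phi>. multitype M p \<mu> \<and> weighted_coordinates M p \<mu> \<phi> P)"

definition model_hypersurface :: "'n::finite bipoly \<Rightarrow> 'n cspace set" where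
  "model_hypersurface P = {(z, w). Im w = Re (beval P z)}"

(* Tangency of a holomorphic, i.e. (1,0), vector field X means X \<rho> = 0 on M, so that the real and
   the imaginary part of X are both tangent to M. *)
definition holomorphically_nondegenerate :: "'n::finite cspace set \<Rightarrow> bool" where
  "holomorphically_nondegenerate M \<longleftrightarrow>
     (\<forall>U X. 0 \<in> U \<and> holo_map_on U X \<and> (\<forall>q \<in> M \<inter> U. X q \<in> complex_tangent_space M q) \<longrightarrow>
        eventually (\<lambda>q. X q = 0) (nhds 0))"

definition balanced :: "'n::finite bipoly \<Rightarrow> bool" where
  "balanced P \<longleftrightarrow>
     (\<exists>\<Lambda>. \<Lambda> \<noteq> (\<lambda>_. 0) \<and> (\<forall>(\<alpha>, \<beta>)\<in>Poly_Mapping.keys P. wdeg \<Lambda> \<alpha> = 1 \<and> wdeg \<Lambda> \<beta> = 1))"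

section \<open>Chain hypersurfaces\<close>

(* Y(f) for the vector field Y = sum_j F_j d/dz_j. *)
definition apply_field :: "('n::finite \<Rightarrow> 'n hpoly) \<Rightarrow> (complex ^ 'n \<Rightarrow> complex) \<Rightarrow> complex ^ 'n \<Rightarrow> complex" where
  "apply_field F f z = frechet_derivative f (at z) (\<chi> j. heval (F j) z)"

definition field_weight :: "('n::finite \<Rightarrow> real) \<Rightarrow> real \<Rightarrow> ('n \<Rightarrow> 'n hpoly) \<Rightarrow> bool" where
  "field_weight \<mu> \<kappa> F \<longleftrightarrow> (\<forall>j. whomogeneous \<mu> (\<kappa> + \<mu> j) (F j))"

(* A C^s-valued polynomial is given by its components f i, i < s. *)
definition veval :: "nat \<Rightarrow> (nat \<Rightarrow> 'n::finite hpoly) \<Rightarrow> complex ^ 'n \<Rightarrow> complex Matrix.vec" where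
  "veval s f z = Matrix.vec s (\<lambda>i. heval (f i) z)"

definition vapply_field ::
    "('n::finite \<Rightarrow> 'n hpoly) \<Rightarrow> nat \<Rightarrow> (nat \<Rightarrow> 'n hpoly) \<Rightarrow> complex ^ 'n \<Rightarrow> complex Matrix.vec" where
  "vapply_field F s f z = Matrix.vec s (\<lambda>i. apply_field F (heval (f i)) z)"

definition v_whomogeneous ::
    "('n::finite \<Rightarrow> real) \<Rightarrow> nat \<Rightarrow> (nat \<Rightarrow> 'n hpoly) \<Rightarrow> bool" where
  "v_whomogeneous \<mu> s f \<longleftrightarrow> (\<exists>\<kappa>. \<forall>i<s. whomogeneous \<mu> \<kappa> (f i))"

(* U^(1), ..., U^(l) and V^(1), ..., V^(l) are U 1, ..., U l and V 1, ..., V l. *)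
definition symmetric_chain_pair ::
    "('n::finite \<Rightarrow> real) \<Rightarrow> ('n \<Rightarrow> 'n hpoly) \<Rightarrow> nat \<Rightarrow> nat \<Rightarrow>
     (nat \<Rightarrow> nat \<Rightarrow> 'n hpoly) \<Rightarrow> (nat \<Rightarrow> nat \<Rightarrow> 'n hpoly) \<Rightarrow> bool" where
  "symmetric_chain_pair \<mu> F s l U V \<longleftrightarrow>
     1 \<le> s \<and> 1 \<le> l \<and>
     (\<forall>k\<in>{1..l}. v_whomogeneous \<mu> s (U k) \<and> v_whomogeneous \<mu> s (V k)) \<and>
     (\<forall>z. vapply_field F s (U l) z = 0\<^sub>v s \<and> vapply_field F s (V l) z = 0\<^sub>v s) \<and>
     (\<exists>A B. \<forall>j\<in>{1..l-1}.
        A j \<in> carrier_mat s s \<and> invertible_mat (A j) \<and>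
        B j \<in> carrier_mat s s \<and> invertible_mat (B j) \<and>
        A j = - transpose_mat (map_mat cnj (B (l - j))) \<and>
        (\<forall>z. vapply_field F s (U j) z = A j *\<^sub>v veval s (U (j + 1)) z \<and>
             vapply_field F s (V j) z = B j *\<^sub>v veval s (V (j + 1)) z))"

(* \<mu> is the multitype weight; the scalar product v \<bullet>c w is conjugate linear in w. *)
definition chain_hypersurface :: "('n::finite \<Rightarrow> real) \<Rightarrow> 'n bipoly \<Rightarrow> bool" where
  "chain_hypersurface \<mu> P \<longleftrightarrow>
     (\<exists>F \<kappa> (m::nat) N s U V.
        0 < \<kappa> \<and> field_weight \<mu> \<kappa> F \<and> (\<exists>j. F j \<noteq> 0) \<and>
        (\<forall>j\<in>{1..m}. symmetric_chain_pair \<mu> F (s j) (N j) (U j) (V j)) \<and>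
        (\<forall>z. beval P z = complex_of_real (\<Sum>j=1..m. Re (\<Sum>k=1..N j.
               veval (s j) (U j k) z \<bullet>c veval (s j) (V j (N j - k + 1)) z))))"

section \<open>The stability group\<close>

(* Representatives of the germs in Aut(M, p). *)
definition stability_group :: "'n::finite cspace set \<Rightarrow> 'n cspace \<Rightarrow> ('n cspace \<Rightarrow> 'n cspace) set" where
  "stability_group M p =
     {g. \<exists>U V. p \<in> U \<and> biholomorphic U V g \<and> g ` (M \<inter> U) \<subseteq> M \<and> g p = p}"

definition same_1_jet ::
    "'n::finite cspace \<Rightarrow> ('n cspace \<Rightarrow> 'n cspace) \<Rightarrow> ('n cspace \<Rightarrow> 'n cspace) \<Rightarrow> bool" where
  "same_1_jet p g h \<longleftrightarrow> g p = h p \<and> frechet_derivative g (at p) = frechet_derivative h (at p)"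

definition same_germ ::
    "'n::finite cspace \<Rightarrow> ('n cspace \<Rightarrow> 'n cspace) \<Rightarrow> ('n cspace \<Rightarrow> 'n cspace) \<Rightarrow> bool" where
  "same_germ p g h \<longleftrightarrow> eventually (\<lambda>q. g q = h q) (nhds p)"

end

(* Write P for the homogeneous polynomial of degree d defining the model. The one-variable expansions of
   two automorphisms along t |-> (t z, t^d w) have coefficients that are weighted homogeneous polynomials
   in (z, w), and the first coefficient in which the automorphisms differ is a holomorphic vector field
   tangent to the model. Expanded in powers of w, tangency becomes a system of identities in the ring of
   polynomials in z and its formal conjugate, where a field acts by commuting holomorphic and
   antiholomorphic derivations. The top coefficient of the field in w is either rigid of degree at least 2,
   and then sl2-like strings of the nilpotent derivation exhibit P as a chain polynomial; or linear or
   constant, and then a nilpotency argument for the derivations shows that it annihilates P, contradicting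
   nondegeneracy; or an Euler-type field F with F(P) = c P, and then Jordan coordinates for F are balanced. *)
theory Submission
  imports Defs "HOL-Complex_Analysis.Complex_Analysis" "Jordan_Normal_Form.Jordan_Normal_Form_Existence"
begin

text \<open>The difficult fields are those whose top coefficient is linear or constant in z: the top
  tangency identity controls only the real part of their action on P, and rigidity of P concerns
  degree at least 2 only. The missing information sits in the next lower coefficients. Suitably
  corrected commutators of these with the top one are again symmetries of P, now of degree at least
  2, so they vanish; the resulting commutation relations force nilpotency and then annihilation. M
  is merely smooth, so there is no power series of its defining function to compare. Points of M are
  approached along weighted dilations with t > 0 tending to 0, and each coefficient identity is a
  limit. The common 1-jet is used twice: the shared linear part fixes the factor by which w is
  scaled, and the coefficient of w in the z-components of the difference vanishes. The latter
  excludes w times a constant field, the one constant top coefficient with too few lower companions.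
  Degree d = 2 is excluded beforehand, since then every weight 1 balances P.\<close>

no_notation vec_index (infixl \<open>$\<close> 100)
no_notation fps_nth (infixl \<open>$\<close> 75)

lemmas fcp_eq_iff = Finite_Cartesian_Product.vec_eq_iff

section \<open>Nilpotent derivations of a domain of characteristic 0\<close>

section \<open>Derivations of integral domains\<close>

definition derivation :: "('r::comm_ring_1 \<Rightarrow> 'r) \<Rightarrow> bool" where
  "derivation D \<longleftrightarrow> (\<forall>x y. D (x + y) = D x + D y) \<and> (\<forall>x y. D (x * y) = D x * y + x * D y)"

lemma derivationI:
  "(\<And>x y. D (x + y) = D x + D y) \<Longrightarrow> (\<And>x y. D (x * y) = D x * y + x * D y) \<Longrightarrow> derivation D"
  by (simp add: derivation_def)

context
  fixes D :: "'r::comm_ring_1 \<Rightarrow> 'r"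
  assumes D: "derivation D"
begin

lemma derivation_add: "D (x + y) = D x + D y"
  and derivation_mult: "D (x * y) = D x * y + x * D y"
  using D by (auto simp: derivation_def)

lemma derivation_0: "D 0 = 0"
  using derivation_add[of 0 0] by simp

lemma derivation_1: "D 1 = 0"
  using derivation_mult[of 1 1] by simp

lemma derivation_minus: "D (- x) = - D x"
  using derivation_add[of x "- x"] by (simp add: derivation_0 eq_neg_iff_add_eq_0 add.commute)

lemma derivation_diff: "D (x - y) = D x - D y"
  using derivation_add[of x "- y"] by (simp add: derivation_minus)

lemma derivation_of_nat: "D (of_nat n) = 0"
  by (induction n) (simp_all add: derivation_0 derivation_1 derivation_add)

lemma derivation_numeral: "D (numeral n) = 0"
  using derivation_of_nat[of "numeral n"] by simp

lemma derivation_const_mult: "D a = 0 \<Longrightarrow> D (a * x) = a * D x"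
  by (simp add: derivation_mult)

lemma derivation_sum: "D (sum f A) = (\<Sum>i\<in>A. D (f i))"
  by (induction A rule: infinite_finite_induct) (simp_all add: derivation_0 derivation_add)

lemma derivation_funpow_0: "(D ^^ n) 0 = 0"
  by (induction n) (simp_all add: derivation_0)

lemma derivation_funpow_add: "(D ^^ n) (x + y) = (D ^^ n) x + (D ^^ n) y"
  by (induction n) (simp_all add: derivation_add)

lemma derivation_funpow_sum: "(D ^^ n) (sum f A) = (\<Sum>i\<in>A. (D ^^ n) (f i))"
  by (induction n) (simp_all add: derivation_sum)

lemma derivation_funpow_const_mult: "D a = 0 \<Longrightarrow> (D ^^ n) (a * x) = a * (D ^^ n) x"
  by (induction n) (simp_all add: derivation_mult)

lemma derivation_funpow_mult:
  "(D ^^ n) (x * y) = (\<Sum>i\<le>n. of_nat (n choose i) * ((D ^^ i) x * (D ^^ (n - i)) y))"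
proof (induction n)
  case (Suc n)
  let ?f = "\<lambda>i j. (D ^^ i) x * (D ^^ j) y"
  have "(D ^^ Suc n) (x * y) = (\<Sum>i\<le>n. of_nat (n choose i) * (?f (Suc i) (n - i) + ?f i (Suc (n - i))))"
    by (simp add: Suc.IH derivation_sum derivation_mult derivation_of_nat algebra_simps)
  also have "\<dots> = (\<Sum>i\<le>n. of_nat (n choose i) * ?f (Suc i) (n - i)) +
      (\<Sum>i\<le>n. of_nat (n choose i) * ?f i (Suc n - i))"
    by (simp add: distrib_left sum.distrib Suc_diff_le)
  also have "(\<Sum>i\<le>n. of_nat (n choose i) * ?f i (Suc n - i)) =
      (\<Sum>i\<le>Suc n. of_nat (n choose i) * ?f i (Suc n - i))"
    by (simp add: binomial_eq_0)
  also have "\<dots> = ?f 0 (Suc n) + (\<Sum>i\<le>n. of_nat (n choose Suc i) * ?f (Suc i) (n - i))"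
    by (subst sum.atMost_Suc_shift) (simp del: sum.atMost_Suc)
  also have "(\<Sum>i\<le>n. of_nat (n choose i) * ?f (Suc i) (n - i)) + \<dots> =
      ?f 0 (Suc n) + (\<Sum>i\<le>n. of_nat (Suc n choose Suc i) * ?f (Suc i) (n - i))"
    by (simp add: sum.distrib distrib_right algebra_simps del: sum.atMost_Suc)
  also have "\<dots> = (\<Sum>i\<le>Suc n. of_nat (Suc n choose i) * ?f i (Suc n - i))"
    by (subst sum.atMost_Suc_shift) simp
  finally show ?case .
qed simp

text \<open>In the Leibniz expansion of order m + n every term has at least m derivatives on
  \<open>x\<close> or at least n on \<open>y\<close>.\<close>

lemma derivation_nilpotent_mult:
  assumes "(D ^^ m) x = 0" and "(D ^^ n) y = 0"
  shows "(D ^^ (m + n)) (x * y) = 0"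
proof -
  have *: "(D ^^ k) u = 0" if "(D ^^ l) u = 0" "l \<le> k" for k l u
  proof -
    have "(D ^^ k) u = (D ^^ (k - l)) ((D ^^ l) u)"
      using that(2) by (metis comp_apply funpow_add le_add_diff_inverse2)
    then show ?thesis
      using that(1) by (simp add: derivation_funpow_0)
  qed
  have "(D ^^ i) x * (D ^^ (m + n - i)) y = 0" if "i \<le> m + n" for i
    using *[OF assms(1), of i] *[OF assms(2), of "m + n - i"] by (cases "m \<le> i") auto
  then show ?thesis
    by (simp add: derivation_funpow_mult)
qed

lemma derivation_nilpotent_mono:
  assumes "(D ^^ m) x = 0" and "m \<le> n"
  shows "(D ^^ n) x = 0"
  using assms by (metis comp_apply funpow_add le_add_diff_inverse2 derivation_funpow_0)

text \<open>The index \<open>k\<close> is the degree in s of exp(sD) x. In a domain the top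
  coefficients of such series multiply without cancelling, and the vanishing results below rest on
  this.\<close>

lemma last_nonzero_iterate:
  assumes "(D ^^ N) x = 0" and "x \<noteq> 0"
  obtains k where "(D ^^ k) x \<noteq> 0" and "\<And>j. k < j \<Longrightarrow> (D ^^ j) x = 0"
proof -
  define m where "m = (LEAST j. (D ^^ j) x = 0)"
  have m: "(D ^^ m) x = 0"
    unfolding m_def using assms(1) by (rule LeastI)
  then obtain k where k: "m = Suc k"
    using assms(2) by (cases m) auto
  have "(D ^^ k) x \<noteq> 0"
    using not_less_Least[of k "\<lambda>j. (D ^^ j) x = 0"] k m_def by auto
  then show ?thesis
    using that derivation_nilpotent_mono[OF m] k by (metis Suc_leI)
qed

end

lemma derivation_sum_of: "derivation D \<Longrightarrow> derivation E \<Longrightarrow> derivation (\<lambda>x. D x + E x)"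
  by (simp add: derivation_def algebra_simps)

lemma derivation_diff_of: "derivation D \<Longrightarrow> derivation E \<Longrightarrow> derivation (\<lambda>x. D x - E x)"
  by (simp add: derivation_def algebra_simps)

lemma derivation_commutator:
  "derivation D \<Longrightarrow> derivation E \<Longrightarrow> derivation (\<lambda>x. D (E x) - E (D x))"
  by (simp add: derivation_def algebra_simps)

lemma sum_eq_single:
  assumes "finite A" "a \<in> A" "\<And>i. i \<in> A \<Longrightarrow> i \<noteq> a \<Longrightarrow> f i = 0"
  shows "sum f A = f a"
  using assms by (simp add: sum.remove[of A a] sum.neutral)

(* The exponential series exp(sZ) P is a polynomial in s that solves the Burgers type equation
   d/ds Q = k M (Q^2). Comparing the coefficients of the high powers of s kills M on all of them. *)
lemma nilpotent_burgers:
  fixes P :: "'r::{idom,ring_char_0}"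
  assumes Z: "derivation Z" and M: "derivation M" and comm: "\<And>x. Z (M x) = M (Z x)"
    and "Z k = 0" "k \<noteq> 0" and eq: "Z P = k * M (P * P)" and nil: "(Z ^^ N) P = 0"
  shows "M P = 0"
proof (cases "P = 0")
  case False
  then obtain t where t: "(Z ^^ t) P \<noteq> 0" "\<And>j. t < j \<Longrightarrow> (Z ^^ j) P = 0"
    using last_nonzero_iterate[OF Z nil] by blast
  define q where "q j = (Z ^^ j) P" for j
  have comm': "(Z ^^ j) (M x) = M ((Z ^^ j) x)" for j x
    by (induction j) (simp_all add: comm)
  have step: "q (Suc j) = k * (\<Sum>i\<le>j. of_nat (j choose i) * (M (q i) * q (j - i) + q i * M (q (j - i))))" for j
  proof -
    have "q (Suc j) = (Z ^^ j) (k * M (P * P))"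
      unfolding q_def by (simp add: funpow_swap1 eq)
    also have "\<dots> = k * M ((Z ^^ j) (P * P))"
      using \<open>Z k = 0\<close> by (simp add: derivation_funpow_const_mult[OF Z] comm')
    finally show ?thesis
      by (simp add: derivation_funpow_mult[OF Z] derivation_sum[OF M] q_def
          derivation_const_mult[OF M] derivation_of_nat[OF M] derivation_mult[OF M])
  qed
  have "M (q (t - r)) = 0" if "r \<le> t" for r
    using that
  proof (induction r rule: less_induct)
    case (less r)
    have high: "M (q i) = 0" if "t - r < i" for i
    proof (cases "t < i")
      case True
      then show ?thesis by (simp add: q_def t derivation_0[OF M])
    next
      case False
      then show ?thesis using less.IH[of "t - i"] that less.prems by simp
    qed
    \<comment> \<open>This order isolates the unknown. Since \<open>q\<close> vanishes above
      \<open>t\<close> and \<open>M\<close> kills \<open>q i\<close> for i above t - r, only i = t -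
      r survives in the first sum and i = t in the second. The two survivors are equal and add up
      instead of cancelling, while T \<ge> t makes \<open>q (Suc T)\<close> zero.\<close>
    define T where "T = t + (t - r)"
    have "0 = k * (\<Sum>i\<le>T. of_nat (T choose i) * (M (q i) * q (T - i) + q i * M (q (T - i))))"
      using t(2)[of "Suc T"] step[of T] by (simp add: T_def q_def)
    then have "0 = (\<Sum>i\<le>T. of_nat (T choose i) * (M (q i) * q (T - i) + q i * M (q (T - i))))"
      using \<open>k \<noteq> 0\<close> by simp
    then have "0 = (\<Sum>i\<le>T. of_nat (T choose i) * (M (q i) * q (T - i))) +
        (\<Sum>i\<le>T. of_nat (T choose i) * (q i * M (q (T - i))))"
      by (simp add: distrib_left sum.distrib)
    also have "(\<Sum>i\<le>T. of_nat (T choose i) * (M (q i) * q (T - i))) =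
        of_nat (T choose (t - r)) * (M (q (t - r)) * q (T - (t - r)))"
    proof (rule sum_eq_single)
      fix i assume "i \<in> {..T}" "i \<noteq> t - r"
      then show "of_nat (T choose i) * (M (q i) * q (T - i)) = 0"
        using high[of i] t(2)[of "T - i"] by (cases "t - r < i") (auto simp: T_def q_def)
    qed (auto simp: T_def)
    also have "(\<Sum>i\<le>T. of_nat (T choose i) * (q i * M (q (T - i)))) =
        of_nat (T choose t) * (q t * M (q (T - t)))"
    proof (rule sum_eq_single)
      fix i assume "i \<in> {..T}" "i \<noteq> t"
      then show "of_nat (T choose i) * (q i * M (q (T - i))) = 0"
        using high[of "T - i"] t(2)[of i] by (cases "t < i") (auto simp: T_def q_def)
    qed (auto simp: T_def)
    finally have "of_nat (2 * (T choose t)) * (q t * M (q (t - r))) = 0"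
      using binomial_symmetric[of t T] by (simp add: T_def algebra_simps)
    then show ?case
      using t(1) by (simp add: q_def T_def del: of_nat_mult)
  qed
  from this[of t] show ?thesis
    by (simp add: q_def)
qed (simp add: derivation_0[OF M])

(* If exp(W) is applied to P - 1, the vector field M + (multiple of) Z becomes M alone, which
   respects a grading that K does not. *)
lemma nilpotent_cofactor:
  fixes P K :: "'r::{idom,ring_char_0}"
  assumes M: "derivation M" and Z: "derivation Z" and W: "derivation W"
    and MP: "M P = b * K" and ZP: "Z P = 2 * P * K"
    and MW: "\<And>x. M (W x) = W (M x) + c * Z x" and ZW: "\<And>x. Z (W x) = W (Z x)"
    and "W b = 0" "W c = 0" "c \<noteq> 0" "P \<noteq> 0"
    and nilP: "(W ^^ N) P = 0" and nilK: "(W ^^ N') K = 0"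
  shows "K = 0"
proof (rule ccontr)
  assume "K \<noteq> 0"
  obtain s where s: "(W ^^ s) P \<noteq> 0" "\<And>j. s < j \<Longrightarrow> (W ^^ j) P = 0"
    using last_nonzero_iterate[OF W nilP \<open>P \<noteq> 0\<close>] by blast
  obtain t where t: "(W ^^ t) K \<noteq> 0" "\<And>j. t < j \<Longrightarrow> (W ^^ j) K = 0"
    using last_nonzero_iterate[OF W nilK \<open>K \<noteq> 0\<close>] by blast
  have Zpow: "Z ((W ^^ j) x) = (W ^^ j) (Z x)" for j x
    by (induction j) (simp_all add: ZW)
  \<comment> \<open>The commutator of \<open>M\<close> with the power j + 1 of \<open>W\<close> is
    (j + 1) c times the power j of \<open>W\<close> after \<open>Z\<close>, because \<open>W\<close>
    commutes with \<open>Z\<close> and kills \<open>c\<close>.\<close>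
  have Mpow: "M ((W ^^ Suc j) x) = (W ^^ Suc j) (M x) + of_nat (Suc j) * c * (W ^^ j) (Z x)" for j x
  proof (induction j)
    case (Suc j)
    have "M ((W ^^ Suc (Suc j)) x) = W (M ((W ^^ Suc j) x)) + c * (W ^^ Suc j) (Z x)"
      using MW[of "(W ^^ Suc j) x"] Zpow[of "Suc j" x] by simp
    also have "W (M ((W ^^ Suc j) x)) = (W ^^ Suc (Suc j)) (M x) + of_nat (Suc j) * c * (W ^^ Suc j) (Z x)"
      using \<open>W c = 0\<close> unfolding Suc
      by (simp add: derivation_add[OF W] derivation_mult[OF W] derivation_of_nat[OF W] derivation_1[OF W] derivation_0[OF W])
    finally show ?case by (simp add: algebra_simps)
  qed (simp add: MW)
  \<comment> \<open>The order s + t + 1 exceeds the last nonzero iterates of both \<open>P\<close>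
    and \<open>K\<close>, so \<open>Mpow\<close> leaves only the power s + t of \<open>W\<close> on
    Z P = 2 P K. There the Leibniz rule retains a single product, that of the two last nonzero
    iterates.\<close>
  let ?j = "s + t"
  have "(W ^^ Suc ?j) (M P) = 0"
    using t(2)[of "Suc ?j"] \<open>W b = 0\<close> unfolding MP by (simp only: derivation_funpow_const_mult[OF W]) simp
  then have "of_nat (Suc ?j) * c * (W ^^ ?j) (2 * P * K) = 0"
    using Mpow[of ?j P] s(2)[of "Suc ?j"] by (simp add: ZP derivation_0[OF M] del: funpow.simps of_nat_Suc)
  then have "(W ^^ ?j) (2 * (P * K)) = 0"
    using \<open>c \<noteq> 0\<close> by (simp add: mult.assoc del: of_nat_Suc)
  then have "0 = (W ^^ ?j) (P * K)"
    by (simp add: derivation_funpow_const_mult[OF W] derivation_numeral[OF W])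
  also have "\<dots> = of_nat (?j choose s) * ((W ^^ s) P * (W ^^ (?j - s)) K)"
    unfolding derivation_funpow_mult[OF W]
  proof (rule sum_eq_single)
    fix i assume "i \<in> {..?j}" "i \<noteq> s"
    then show "of_nat (?j choose i) * ((W ^^ i) P * (W ^^ (?j - i)) K) = 0"
      using s(2)[of i] t(2)[of "?j - i"] by (cases "s < i") auto
  qed auto
  finally show False
    using s(1) t(1) by simp
qed

section \<open>Polynomials in z and a formal conjugate, realised as functions on pairs of
  points\<close>

section \<open>The ring of polynomial functions of a point and an independent conjugate point\<close>

text \<open>Polynomials are kept as functions, so that identities can be tested by evaluation and
  derivations are genuine derivatives. Over an infinite field a polynomial is determined by its
  values.\<close>

inductive_set generated_algebra :: "('a \<Rightarrow> complex) set \<Rightarrow> ('a \<Rightarrow> complex) set"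
  for X :: "('a \<Rightarrow> complex) set" where
  const: "(\<lambda>_. c) \<in> generated_algebra X"
| gen: "f \<in> X \<Longrightarrow> f \<in> generated_algebra X"
| add: "f \<in> generated_algebra X \<Longrightarrow> g \<in> generated_algebra X \<Longrightarrow> (\<lambda>x. f x + g x) \<in> generated_algebra X"
| mult: "f \<in> generated_algebra X \<Longrightarrow> g \<in> generated_algebra X \<Longrightarrow> (\<lambda>x. f x * g x) \<in> generated_algebra X"

lemma generated_algebra_uminus: "f \<in> generated_algebra X \<Longrightarrow> (\<lambda>x. - f x) \<in> generated_algebra X"
  using generated_algebra.mult[OF generated_algebra.const[of "-1"], of f] by simp

lemma generated_algebra_diff:
  "f \<in> generated_algebra X \<Longrightarrow> g \<in> generated_algebra X \<Longrightarrow> (\<lambda>x. f x - g x) \<in> generated_algebra X"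
  using generated_algebra.add[OF _ generated_algebra_uminus, of f X g] by simp

lemma generated_algebra_sum:
  "(\<And>i. i \<in> I \<Longrightarrow> f i \<in> generated_algebra X) \<Longrightarrow> (\<lambda>x. \<Sum>i\<in>I. f i x) \<in> generated_algebra X"
  by (induction I rule: infinite_finite_induct) (auto intro: generated_algebra.intros)

lemma generated_algebra_subst:
  assumes "f \<in> generated_algebra X" and "\<And>x. x \<in> X \<Longrightarrow> (\<lambda>y. x (s y)) \<in> generated_algebra Y"
  shows "(\<lambda>y. f (s y)) \<in> generated_algebra Y"
  using assms(1) by induction (auto intro: generated_algebra.intros assms(2))

lemma generated_algebra_id_poly:
  assumes "f \<in> generated_algebra {\<lambda>t. t}"
  obtains p where "f = poly p"
proof -
  have "\<exists>p. f = poly p"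
    using assms
  proof induction
    case (const c) show ?case by (rule exI[of _ "[:c:]"]) auto
  next
    case (gen f) then show ?case by (intro exI[of _ "[:0, 1:]"]) auto
  next
    case (add f g)
    then obtain p q where "f = poly p" "g = poly q" by blast
    then show ?case by (intro exI[of _ "p + q"]) auto
  next
    case (mult f g)
    then obtain p q where "f = poly p" "g = poly q" by blast
    then show ?case by (intro exI[of _ "p * q"]) auto
  qed
  then show ?thesis using that by blast
qed

type_synonym 'n zpair = "(complex ^ 'n) \<times> (complex ^ 'n)"

definition zc :: "'n \<Rightarrow> 'n::finite zpair \<Rightarrow> complex" where "zc j x = fst x $ j"
definition wc :: "'n \<Rightarrow> 'n::finite zpair \<Rightarrow> complex" where "wc j x = snd x $ j"

abbreviation pair_poly :: "('n::finite zpair \<Rightarrow> complex) set" where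
  "pair_poly \<equiv> generated_algebra (range zc \<union> range wc)"

lemma pair_poly_zc [intro]: "zc j \<in> pair_poly" and pair_poly_wc [intro]: "wc j \<in> pair_poly"
  by (auto intro: generated_algebra.gen)

lemma pair_poly_fst: "(\<lambda>x. fst x $ j) \<in> pair_poly" and pair_poly_snd: "(\<lambda>x. snd x $ j) \<in> pair_poly"
  using pair_poly_zc[of j] pair_poly_wc[of j] by (simp_all add: zc_def[abs_def] wc_def[abs_def])

text \<open>Restriction to a complex line reduces the questions about this ring (zero divisors,
  polarisation, homogeneity) to polynomials in one variable.\<close>

lemma pair_poly_line:
  assumes "f \<in> pair_poly"
  obtains p where "\<And>t. f (z + t *s v, w + t *s u) = poly p t"
proof -
  have "(\<lambda>t. f (z + t *s v, w + t *s u)) \<in> generated_algebra {\<lambda>t. t}"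
  proof (rule generated_algebra_subst[OF assms])
    fix x :: "'a zpair \<Rightarrow> complex" assume "x \<in> range zc \<union> range wc"
    moreover have "(\<lambda>y. a + y * b) \<in> generated_algebra {\<lambda>t. t}" for a b :: complex
      by (intro generated_algebra.intros) auto
    ultimately show "(\<lambda>y. x (z + y *s v, w + y *s u)) \<in> generated_algebra {\<lambda>t. t}"
      by (auto simp: zc_def wc_def)
  qed
  then obtain p where "(\<lambda>t. f (z + t *s v, w + t *s u)) = poly p"
    by (rule generated_algebra_id_poly)
  then show ?thesis
    using that by (simp add: fun_eq_iff)
qed

text \<open>Join a point where \<open>f\<close> does not vanish to a point where \<open>g\<close>
  does not: on this complex line both restrict to nonzero polynomials.\<close>

lemma pair_poly_no_zero_divisors:
  assumes "f \<in> pair_poly" "g \<in> pair_poly" "f x \<noteq> 0" "g y \<noteq> 0"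
  shows "\<exists>x. f x * g x \<noteq> 0"
proof -
  obtain p where p: "\<And>t. f (fst x + t *s (fst y - fst x), snd x + t *s (snd y - snd x)) = poly p t"
    using pair_poly_line[OF assms(1)] by blast
  obtain q where q: "\<And>t. g (fst x + t *s (fst y - fst x), snd x + t *s (snd y - snd x)) = poly q t"
    using pair_poly_line[OF assms(2)] by blast
  have "p \<noteq> 0" "q \<noteq> 0"
    using p[of 0] q[of 1] assms(3,4) by auto
  then have "p * q \<noteq> 0" by simp
  then obtain t where "poly (p * q) t \<noteq> 0"
    using poly_eq_poly_eq_iff[of "p * q" 0] by fastforce
  then show ?thesis
    using p[of t] q[of t] by (metis poly_mult)
qed

text \<open>An element stands for a polynomial in z and its conjugate: the actual function is
  \<open>ev Q (z, cnjv z)\<close>, and by \<open>polarisation\<close> it determines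
  \<open>Q\<close>. The freedom of the second argument separates holomorphic from antiholomorphic
  differentiation.\<close>

typedef (overloaded) ('n::finite) pring = "pair_poly :: ('n zpair \<Rightarrow> complex) set"
  morphisms ev Abs_pring
  by (rule exI, rule generated_algebra.const)

setup_lifting type_definition_pring

lemma ev_pair_poly [simp]: "ev Q \<in> pair_poly"
  using ev by blast

lemma pring_eqI: "(\<And>x. ev Q x = ev R x) \<Longrightarrow> Q = R"
  by (simp add: ev_inject[symmetric] fun_eq_iff)

instantiation pring :: (finite) comm_ring_1
begin

lift_definition zero_pring :: "'a pring" is "\<lambda>_. 0" by (rule generated_algebra.const)
lift_definition one_pring :: "'a pring" is "\<lambda>_. 1" by (rule generated_algebra.const)
lift_definition plus_pring :: "'a pring \<Rightarrow> 'a pring \<Rightarrow> 'a pring" is "\<lambda>f g x. f x + g x"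
  by (rule generated_algebra.add)
lift_definition minus_pring :: "'a pring \<Rightarrow> 'a pring \<Rightarrow> 'a pring" is "\<lambda>f g x. f x - g x"
  by (rule generated_algebra_diff)
lift_definition times_pring :: "'a pring \<Rightarrow> 'a pring \<Rightarrow> 'a pring" is "\<lambda>f g x. f x * g x"
  by (rule generated_algebra.mult)
lift_definition uminus_pring :: "'a pring \<Rightarrow> 'a pring" is "\<lambda>f x. - f x"
  by (rule generated_algebra_uminus)

instance
  by standard (transfer; force simp: algebra_simps fun_eq_iff)+

end

lemma ev_0 [simp]: "ev 0 x = 0" and ev_1 [simp]: "ev 1 x = 1"
  and ev_add [simp]: "ev (Q + R) x = ev Q x + ev R x"
  and ev_diff [simp]: "ev (Q - R) x = ev Q x - ev R x"
  and ev_mult [simp]: "ev (Q * R) x = ev Q x * ev R x"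
  and ev_minus [simp]: "ev (- Q) x = - ev Q x"
  by (transfer; simp)+

lemma ev_of_nat [simp]: "ev (of_nat n) x = of_nat n"
  by (induction n) auto

lemma ev_numeral [simp]: "ev (numeral n) x = numeral n"
  using ev_of_nat[of "numeral n" x] by simp

lemma ev_sum [simp]: "ev (sum f A) x = (\<Sum>i\<in>A. ev (f i) x)"
  by (induction A rule: infinite_finite_induct) auto

lemma ev_power [simp]: "ev (Q ^ n) x = ev Q x ^ n"
  by (induction n) auto

lemma ev_prod [simp]: "ev (prod f A) x = (\<Prod>i\<in>A. ev (f i) x)"
  by (induction A rule: infinite_finite_induct) auto

instance pring :: (finite) idom
proof
  fix a b :: "'a pring"
  assume "a \<noteq> 0" "b \<noteq> 0"
  then obtain x y where "ev a x \<noteq> 0" "ev b y \<noteq> 0"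
    by (metis ev_0 pring_eqI)
  then obtain u where "ev a u * ev b u \<noteq> 0"
    using pair_poly_no_zero_divisors[OF ev_pair_poly ev_pair_poly] by blast
  then show "a * b \<noteq> 0"
    by (metis ev_0 ev_mult)
qed

instance pring :: (finite) ring_char_0
proof
  show "inj (of_nat :: nat \<Rightarrow> 'a pring)"
    by (rule injI) (metis ev_of_nat of_nat_eq_iff)
qed

lift_definition cst :: "complex \<Rightarrow> 'n::finite pring" is "\<lambda>c _. c" by (rule generated_algebra.const)
lift_definition Zv :: "'n \<Rightarrow> 'n::finite pring" is zc by blast
lift_definition Wv :: "'n \<Rightarrow> 'n::finite pring" is wc by blast

lemma ev_cst [simp]: "ev (cst c) x = c" and ev_Zv [simp]: "ev (Zv j) x = fst x $ j"
  and ev_Wv [simp]: "ev (Wv j) x = snd x $ j"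
  by (transfer; simp add: zc_def wc_def)+

lemma cst_simps: "cst 0 = 0" "cst 1 = 1" "cst (a + b) = cst a + cst b" "cst (a * b) = cst a * cst b"
  "cst (- a) = - cst a" "cst (a - b) = cst a - cst b"
  by (auto intro: pring_eqI)

lemma cst_eq_0_iff [simp]: "cst a = 0 \<longleftrightarrow> a = 0"
  by (metis cst_simps(1) ev_0 ev_cst)

lemma pring_induct [case_names cst Zv Wv add mult, induct type: pring]:
  assumes "\<And>c. \<Phi> (cst c)" "\<And>j. \<Phi> (Zv j)" "\<And>j. \<Phi> (Wv j)"
    and "\<And>Q R. \<Phi> Q \<Longrightarrow> \<Phi> R \<Longrightarrow> \<Phi> (Q + R)" "\<And>Q R. \<Phi> Q \<Longrightarrow> \<Phi> R \<Longrightarrow> \<Phi> (Q * R)"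
  shows "\<Phi> Q"
proof -
  have "\<exists>R. \<Phi> R \<and> ev R = f" if "f \<in> pair_poly" for f
    using that
  proof (induction rule: generated_algebra.induct)
    case (const c) show ?case by (rule exI[of _ "cst c"]) (auto simp: assms)
  next
    case (gen f)
    then show ?case
    proof
      assume "f \<in> range zc"
      then obtain j where "f = zc j" by blast
      then show ?thesis by (intro exI[of _ "Zv j"]) (auto simp: assms zc_def fun_eq_iff)
    next
      assume "f \<in> range wc"
      then obtain j where "f = wc j" by blast
      then show ?thesis by (intro exI[of _ "Wv j"]) (auto simp: assms wc_def fun_eq_iff)
    qed
  next
    case (add f g)
    then obtain A B where "\<Phi> A" "ev A = f" "\<Phi> B" "ev B = g" by blast
    then show ?case by (intro exI[of _ "A + B"]) (auto simp: assms fun_eq_iff)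
  next
    case (mult f g)
    then obtain A B where "\<Phi> A" "ev A = f" "\<Phi> B" "ev B = g" by blast
    then show ?case by (intro exI[of _ "A * B"]) (auto simp: assms fun_eq_iff)
  qed
  from this[of "ev Q"] show ?thesis
    by (auto simp: ev_inject)
qed

subsection \<open>Conjugation and polarisation\<close>

definition cnjv :: "complex ^ 'n::finite \<Rightarrow> complex ^ 'n" where "cnjv z = (\<chi> j. cnj (z $ j))"

lemma cnjv_nth [simp]: "cnjv z $ j = cnj (z $ j)" by (simp add: cnjv_def)
lemma cnjv_cnjv [simp]: "cnjv (cnjv z) = z" by (simp add: fcp_eq_iff)
lemma cnjv_0 [simp]: "cnjv 0 = 0" by (simp add: fcp_eq_iff)

text \<open>This is complex conjugation of the represented function: at a pair (z,
  \<open>cnjv z\<close>) it takes the conjugate value. Its fixed elements are the real-valued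
  polynomials.\<close>

lift_definition tau :: "'n::finite pring \<Rightarrow> 'n pring"
  is "\<lambda>f x. cnj (f (cnjv (snd x), cnjv (fst x)))"
proof -
  fix f :: "'n zpair \<Rightarrow> complex" assume "f \<in> pair_poly"
  then show "(\<lambda>x. cnj (f (cnjv (snd x), cnjv (fst x)))) \<in> pair_poly"
    by (induction rule: generated_algebra.induct)
      (auto simp: zc_def wc_def intro: generated_algebra.intros pair_poly_fst pair_poly_snd)
qed

lemma ev_tau [simp]: "ev (tau Q) x = cnj (ev Q (cnjv (snd x), cnjv (fst x)))"
  by transfer simp

lemma tau_tau [simp]: "tau (tau Q) = Q"
  by (rule pring_eqI) simp

lemma tau_simps [simp]: "tau 0 = 0" "tau 1 = 1" "tau (Q + R) = tau Q + tau R" "tau (Q - R) = tau Q - tau R"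
  "tau (Q * R) = tau Q * tau R" "tau (- Q) = - tau Q" "tau (cst a) = cst (cnj a)"
  "tau (of_nat m) = of_nat m" "tau (numeral k) = numeral k" "tau (Zv j) = Wv j" "tau (Wv j) = Zv j"
  by (auto intro!: pring_eqI)

lemma tau_sum: "tau (sum f A) = (\<Sum>i\<in>A. tau (f i))"
  by (induction A rule: infinite_finite_induct) auto

lemma derivation_tau: "derivation D \<Longrightarrow> derivation (\<lambda>Q. tau (D (tau Q)))"
  by (simp add: derivation_def)

(* A polynomial that vanishes on the totally real set of the pairs (z, cnj z) vanishes on every
   complex line through such points whose real points lie in that set. *)
lemma polarisation:
  assumes "\<And>z. ev Q (z, cnjv z) = 0"
  shows "Q = 0"
proof (rule pring_eqI)
  fix x :: "'a zpair"
  have re: "complex_of_real (Re c) = c - \<i> * complex_of_real (Im c)" for c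
    by (simp add: complex_eq_iff)
  \<comment> \<open>Every pair is (a + i b, a - i b) with complex vectors \<open>a\<close> and
    \<open>b\<close>. Replacing the i in a = Re a + i Im a, and likewise in b, by a parameter t
    gives a complex line whose real points are conjugate pairs and which passes through
    \<open>x\<close> at t = i.\<close>
  define a where "a = (\<chi> j. (fst x $ j + snd x $ j) / 2)"
  define b where "b = (\<chi> j. (fst x $ j - snd x $ j) / (2 * \<i>))"
  let ?re = "\<lambda>v::complex ^ 'a. \<chi> j. complex_of_real (Re (v $ j))"
  let ?im = "\<lambda>v::complex ^ 'a. \<chi> j. complex_of_real (Im (v $ j))"
  obtain p where p: "\<And>t. ev Q (?re a + \<i> *s ?re b + t *s (?im a + \<i> *s ?im b),
      ?re a - \<i> *s ?re b + t *s (?im a - \<i> *s ?im b)) = poly p t"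
    using pair_poly_line[OF ev_pair_poly, of Q] by metis
  have "poly p (complex_of_real t) = 0" for t
  proof -
    have "?re a - \<i> *s ?re b + complex_of_real t *s (?im a - \<i> *s ?im b) =
        cnjv (?re a + \<i> *s ?re b + complex_of_real t *s (?im a + \<i> *s ?im b))"
      by (simp add: fcp_eq_iff)
    then show ?thesis
      using assms p by metis
  qed
  then have "range complex_of_real \<subseteq> {t. poly p t = 0}"
    by auto
  then have "p = 0"
    using poly_roots_finite[of p] finite_subset infinite_UNIV_char_0
    by (metis finite_imageD inj_of_real)
  then have "ev Q (?re a + \<i> *s ?re b + \<i> *s (?im a + \<i> *s ?im b),
      ?re a - \<i> *s ?re b + \<i> *s (?im a - \<i> *s ?im b)) = 0"
    using p[of \<i>] by simp
  moreover have "?re a + \<i> *s ?re b + \<i> *s (?im a + \<i> *s ?im b) = fst x"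
    by (simp add: fcp_eq_iff re algebra_simps) (simp add: a_def b_def field_simps)?
  moreover have "?re a - \<i> *s ?re b + \<i> *s (?im a - \<i> *s ?im b) = snd x"
    unfolding fcp_eq_iff by (simp add: re algebra_simps) (simp add: a_def b_def field_simps)
  ultimately show "ev Q x = ev 0 x"
    by simp
qed

lemma polarisation_eq: "(\<And>z. ev Q (z, cnjv z) = ev R (z, cnjv z)) \<Longrightarrow> Q = R"
  using polarisation[of "Q - R"] by simp

subsection \<open>Vector fields\<close>

lemma sum_mult_delta: "(\<Sum>j\<in>UNIV. u j * (if j = k then 1 else 0)) = (u (k::'n::finite) :: 'b::semiring_1)"
proof -
  have "(\<Sum>j\<in>UNIV. u j * (if j = k then 1 else 0)) = (\<Sum>j\<in>UNIV. if j = k then u j else 0)"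
    by (intro sum.cong) auto
  then show ?thesis by simp
qed

lemma pair_poly_has_derivative:
  assumes "f \<in> pair_poly"
  obtains A B where "\<And>j. A j \<in> pair_poly" "\<And>j. B j \<in> pair_poly"
    "\<And>x. (f has_derivative (\<lambda>v. \<Sum>j\<in>UNIV. fst v $ j * A j x + snd v $ j * B j x)) (at x)"
proof -
  have "\<exists>A B. (\<forall>j. A j \<in> pair_poly) \<and> (\<forall>j. B j \<in> pair_poly) \<and>
    (\<forall>x. (f has_derivative (\<lambda>v. \<Sum>j\<in>UNIV. fst v $ j * A j x + snd v $ j * B j x)) (at x))"
    using assms
  proof (induction rule: generated_algebra.induct)
    case (const c)
    show ?case by (rule exI[of _ "\<lambda>_ _. 0"], rule exI[of _ "\<lambda>_ _. 0"]) (auto intro: generated_algebra.const)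
  next
    case (gen f)
    then consider k where "f = zc k" | k where "f = wc k" by blast
    then show ?case
    proof cases
      case 1
      have "(zc k has_derivative (\<lambda>v. fst v $ k)) (at x)" for x
        unfolding zc_def[abs_def]
        by (rule bounded_linear.has_derivative[OF bounded_linear_vec_nth]) (rule has_derivative_fst[OF has_derivative_ident])
      moreover have "(\<Sum>j\<in>UNIV. fst v $ j * (if j = k then 1 else 0) + snd v $ j * 0) = fst v $ k" for v :: "'a zpair"
        by (simp add: sum_mult_delta)
      ultimately have "\<forall>x. (f has_derivative (\<lambda>v. \<Sum>j\<in>UNIV. fst v $ j * (if j = k then 1 else 0) + snd v $ j * 0)) (at x)"
        using 1 by simp
      then show ?thesis
        by - (rule exI[of _ "(\<lambda>j _. if j = k then 1 else 0) :: 'a \<Rightarrow> 'a zpair \<Rightarrow> complex"], rule exI[of _ "(\<lambda>_ _. 0) :: 'a \<Rightarrow> 'a zpair \<Rightarrow> complex"],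
            simp add: generated_algebra.const del: mult_zero_right)
    next
      case 2
      have "(wc k has_derivative (\<lambda>v. snd v $ k)) (at x)" for x
        unfolding wc_def[abs_def]
        by (rule bounded_linear.has_derivative[OF bounded_linear_vec_nth]) (rule has_derivative_snd[OF has_derivative_ident])
      moreover have "(\<Sum>j\<in>UNIV. fst v $ j * 0 + snd v $ j * (if j = k then 1 else 0)) = snd v $ k" for v :: "'a zpair"
        by (simp add: sum_mult_delta)
      ultimately have "\<forall>x. (f has_derivative (\<lambda>v. \<Sum>j\<in>UNIV. fst v $ j * 0 + snd v $ j * (if j = k then 1 else 0))) (at x)"
        using 2 by simp
      then show ?thesis
        by - (rule exI[of _ "(\<lambda>_ _. 0) :: 'a \<Rightarrow> 'a zpair \<Rightarrow> complex"], rule exI[of _ "(\<lambda>j _. if j = k then 1 else 0) :: 'a \<Rightarrow> 'a zpair \<Rightarrow> complex"],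
            simp add: generated_algebra.const del: mult_zero_right)
    qed
  next
    case (add f g)
    then obtain A B C D where
      *: "\<forall>j. A j \<in> pair_poly" "\<forall>j. B j \<in> pair_poly" "\<forall>j. C j \<in> pair_poly" "\<forall>j. D j \<in> pair_poly"
      "\<forall>x. (f has_derivative (\<lambda>v. \<Sum>j\<in>UNIV. fst v $ j * A j x + snd v $ j * B j x)) (at x)"
      "\<forall>x. (g has_derivative (\<lambda>v. \<Sum>j\<in>UNIV. fst v $ j * C j x + snd v $ j * D j x)) (at x)"
      by blast
    have "((\<lambda>x. f x + g x) has_derivative
        (\<lambda>v. \<Sum>j\<in>UNIV. fst v $ j * (A j x + C j x) + snd v $ j * (B j x + D j x))) (at x)" for x
      using has_derivative_add[OF *(5)[rule_format, of x] *(6)[rule_format, of x]]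
      by (simp add: sum.distrib algebra_simps)
    moreover have "(\<lambda>x. A j x + C j x) \<in> pair_poly" "(\<lambda>x. B j x + D j x) \<in> pair_poly" for j
      using *(1-4) by (blast intro: generated_algebra.add)+
    ultimately show ?case
      by - (rule exI[of _ "\<lambda>j x. A j x + C j x"], rule exI[of _ "\<lambda>j x. B j x + D j x"], blast)
  next
    case (mult f g)
    then obtain A B C D where
      *: "\<forall>j. A j \<in> pair_poly" "\<forall>j. B j \<in> pair_poly" "\<forall>j. C j \<in> pair_poly" "\<forall>j. D j \<in> pair_poly"
      "\<forall>x. (f has_derivative (\<lambda>v. \<Sum>j\<in>UNIV. fst v $ j * A j x + snd v $ j * B j x)) (at x)"
      "\<forall>x. (g has_derivative (\<lambda>v. \<Sum>j\<in>UNIV. fst v $ j * C j x + snd v $ j * D j x)) (at x)"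
      by blast
    have "((\<lambda>x. f x * g x) has_derivative
        (\<lambda>v. \<Sum>j\<in>UNIV. fst v $ j * (A j x * g x + f x * C j x) + snd v $ j * (B j x * g x + f x * D j x))) (at x)" for x
      using has_derivative_mult[OF *(5)[rule_format, of x] *(6)[rule_format, of x]]
      by (simp add: sum.distrib sum_distrib_left sum_distrib_right algebra_simps)
    moreover have "(\<lambda>x. A j x * g x + f x * C j x) \<in> pair_poly" "(\<lambda>x. B j x * g x + f x * D j x) \<in> pair_poly" for j
      using *(1-4) mult.hyps by (intro generated_algebra.add generated_algebra.mult; simp)+
    ultimately show ?case
      by - (rule exI[of _ "\<lambda>j x. A j x * g x + f x * C j x"], rule exI[of _ "\<lambda>j x. B j x * g x + f x * D j x"], blast)
  qed
  then show ?thesis using that by blast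
qed

lemma axis_nth_mult: "(\<Sum>j\<in>UNIV. axis k (1::complex) $ j * A j) = A k"
proof -
  have "(\<Sum>j\<in>UNIV. axis k (1::complex) $ j * A j) = (\<Sum>j\<in>UNIV. if j = k then A j else 0)"
    by (intro sum.cong) (auto simp: axis_def)
  then show ?thesis by simp
qed

text \<open>A polynomial has a complex linear derivative, so differentiating along the real unit
  vector of a coordinate already yields the complex partial derivative.\<close>

lift_definition dz :: "'n \<Rightarrow> 'n::finite pring \<Rightarrow> 'n pring"
  is "\<lambda>j f x. frechet_derivative f (at x) (axis j 1, 0)"
proof -
  fix k and f :: "'n zpair \<Rightarrow> complex" assume "f \<in> pair_poly"
  then obtain A B where *: "\<And>j. A j \<in> pair_poly" "\<And>j. B j \<in> pair_poly"
    "\<And>x. (f has_derivative (\<lambda>v. \<Sum>j\<in>UNIV. fst v $ j * A j x + snd v $ j * B j x)) (at x)"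
    using pair_poly_has_derivative by blast
  have "(\<lambda>x. frechet_derivative f (at x) (axis k 1, 0)) = A k"
    using frechet_derivative_at[OF *(3), symmetric] by (simp add: axis_nth_mult fun_eq_iff)
  then show "(\<lambda>x. frechet_derivative f (at x) (axis k 1, 0)) \<in> pair_poly"
    using * by simp
qed

lift_definition dw :: "'n \<Rightarrow> 'n::finite pring \<Rightarrow> 'n pring"
  is "\<lambda>j f x. frechet_derivative f (at x) (0, axis j 1)"
proof -
  fix k and f :: "'n zpair \<Rightarrow> complex" assume "f \<in> pair_poly"
  then obtain A B where *: "\<And>j. A j \<in> pair_poly" "\<And>j. B j \<in> pair_poly"
    "\<And>x. (f has_derivative (\<lambda>v. \<Sum>j\<in>UNIV. fst v $ j * A j x + snd v $ j * B j x)) (at x)"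
    using pair_poly_has_derivative by blast
  have "(\<lambda>x. frechet_derivative f (at x) (0, axis k 1)) = B k"
    using frechet_derivative_at[OF *(3), symmetric] by (simp add: axis_nth_mult fun_eq_iff)
  then show "(\<lambda>x. frechet_derivative f (at x) (0, axis k 1)) \<in> pair_poly"
    using * by simp
qed

lemma ev_has_derivative:
  "(ev Q has_derivative (\<lambda>v. \<Sum>j\<in>UNIV. fst v $ j * ev (dz j Q) x + snd v $ j * ev (dw j Q) x)) (at x)"
proof -
  obtain A B where *: "\<And>j. A j \<in> pair_poly" "\<And>j. B j \<in> pair_poly"
    "\<And>x. (ev Q has_derivative (\<lambda>v. \<Sum>j\<in>UNIV. fst v $ j * A j x + snd v $ j * B j x)) (at x)"
    using pair_poly_has_derivative[OF ev_pair_poly] by blast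
  have "ev (dz j Q) x = A j x" "ev (dw j Q) x = B j x" for j
    using frechet_derivative_at[OF *(3), symmetric] by (simp_all add: dz.rep_eq dw.rep_eq axis_nth_mult)
  then show ?thesis using *(3) by simp
qed

lemma ev_differentiable: "ev Q differentiable (at x)"
  using ev_has_derivative differentiable_def by blast

lemma ev_dz: "ev (dz j Q) x = frechet_derivative (ev Q) (at x) (axis j 1, 0)"
  by (rule dz.rep_eq[THEN fun_cong])

lemma ev_dw: "ev (dw j Q) x = frechet_derivative (ev Q) (at x) (0, axis j 1)"
  by (rule dw.rep_eq[THEN fun_cong])

section \<open>Holomorphic and antiholomorphic derivations\<close>

lemma ev_dz_eq: "(ev Q has_derivative D) (at x) \<Longrightarrow> ev (dz j Q) x = D (axis j 1, 0)"
  and ev_dw_eq: "(ev Q has_derivative D) (at x) \<Longrightarrow> ev (dw j Q) x = D (0, axis j 1)"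
  by (simp_all add: ev_dz ev_dw frechet_derivative_at[symmetric])

lemma ev_add_fun: "ev (Q + R) = (\<lambda>x. ev Q x + ev R x)" and ev_mult_fun: "ev (Q * R) = (\<lambda>x. ev Q x * ev R x)"
  by (simp_all add: fun_eq_iff)

lemma derivation_dz: "derivation (dz j)" and derivation_dw: "derivation (dw j)"
proof -
  have add: "(ev (Q + R) has_derivative (\<lambda>v. (\<Sum>j\<in>UNIV. fst v $ j * ev (dz j Q) x + snd v $ j * ev (dw j Q) x) +
      (\<Sum>j\<in>UNIV. fst v $ j * ev (dz j R) x + snd v $ j * ev (dw j R) x))) (at x)" for Q R :: "'a pring" and x
    unfolding ev_add_fun by (intro has_derivative_add ev_has_derivative)
  have mult: "(ev (Q * R) has_derivative (\<lambda>v. ev Q x * (\<Sum>j\<in>UNIV. fst v $ j * ev (dz j R) x + snd v $ j * ev (dw j R) x) +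
      (\<Sum>j\<in>UNIV. fst v $ j * ev (dz j Q) x + snd v $ j * ev (dw j Q) x) * ev R x)) (at x)" for Q R :: "'a pring" and x
    unfolding ev_mult_fun by (intro has_derivative_mult ev_has_derivative)
  show "derivation (dz j)"
    by (rule derivationI; rule pring_eqI) (simp_all add: ev_dz_eq[OF add] ev_dz_eq[OF mult] axis_nth_mult add.commute)
  show "derivation (dw j)"
    by (rule derivationI; rule pring_eqI) (simp_all add: ev_dw_eq[OF add] ev_dw_eq[OF mult] axis_nth_mult add.commute)
qed

lemma ev_const_fun: "ev (cst c) = (\<lambda>x. c)" and ev_Zv_fun: "ev (Zv k) = (\<lambda>x. fst x $ k)"
  and ev_Wv_fun: "ev (Wv k) = (\<lambda>x. snd x $ k)"
  by (simp_all add: fun_eq_iff)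

lemma dz_gens [simp]: "dz j (cst c) = 0" "dz j (Zv k) = (if j = k then 1 else 0)" "dz j (Wv k) = 0"
  and dw_gens [simp]: "dw j (cst c) = 0" "dw j (Zv k) = 0" "dw j (Wv k) = (if j = k then 1 else 0)"
proof -
  have 1: "(ev (cst c) has_derivative (\<lambda>v. 0)) (at x)" for c and x :: "'a zpair"
    unfolding ev_const_fun by (rule has_derivative_const)
  have 2: "(ev (Zv k) has_derivative (\<lambda>v. fst v $ k)) (at x)" for k and x :: "'a zpair"
    unfolding ev_Zv_fun
    by (rule bounded_linear.has_derivative[OF bounded_linear_vec_nth]) (rule has_derivative_fst[OF has_derivative_ident])
  have 3: "(ev (Wv k) has_derivative (\<lambda>v. snd v $ k)) (at x)" for k and x :: "'a zpair"
    unfolding ev_Wv_fun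
    by (rule bounded_linear.has_derivative[OF bounded_linear_vec_nth]) (rule has_derivative_snd[OF has_derivative_ident])
  show "dz j (cst c) = 0" "dz j (Zv k) = (if j = k then 1 else 0)" "dz j (Wv k) = 0"
    "dw j (cst c) = 0" "dw j (Zv k) = 0" "dw j (Wv k) = (if j = k then 1 else 0)"
    by (rule pring_eqI; simp add: ev_dz_eq[OF 1] ev_dz_eq[OF 2] ev_dz_eq[OF 3]
        ev_dw_eq[OF 1] ev_dw_eq[OF 2] ev_dw_eq[OF 3] axis_def)+
qed

lemma derivation_ext:
  fixes D E :: "'n::finite pring \<Rightarrow> 'n pring"
  assumes D: "derivation D" and E: "derivation E"
    and "\<And>c. D (cst c) = E (cst c)" "\<And>j. D (Zv j) = E (Zv j)" "\<And>j. D (Wv j) = E (Wv j)"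
  shows "D Q = E Q"
  by (induction Q) (simp_all add: assms derivation_add[OF D] derivation_add[OF E] derivation_mult[OF D] derivation_mult[OF E])

lemma dw_tau: "dw j Q = tau (dz j (tau Q))"
  by (rule derivation_ext[OF derivation_dw derivation_tau[OF derivation_dz]]) auto

definition Dz :: "('n::finite \<Rightarrow> 'n pring) \<Rightarrow> 'n pring \<Rightarrow> 'n pring" where
  "Dz F Q = (\<Sum>j\<in>UNIV. F j * dz j Q)"

text \<open>The conjugate field, acting on the conjugate variables. If \<open>tau P = P\<close> then
  \<open>Db F P\<close> is the conjugate of \<open>Dz F P\<close>, so \<open>Dz F P + Db F P\<close>
  represents twice the real part of F(P).\<close>

definition Db :: "('n::finite \<Rightarrow> 'n pring) \<Rightarrow> 'n pring \<Rightarrow> 'n pring" where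
  "Db F Q = tau (Dz F (tau Q))"

lemma derivation_Dz: "derivation (Dz F)"
  by (rule derivationI) (simp_all add: Dz_def derivation_add[OF derivation_dz] derivation_mult[OF derivation_dz]
      sum.distrib sum_distrib_left sum_distrib_right algebra_simps)

lemma derivation_Db: "derivation (Db F)"
  unfolding Db_def by (rule derivation_tau[OF derivation_Dz])

lemma Dz_gens [simp]: "Dz F (cst c) = 0" "Dz F (Zv k) = F k" "Dz F (Wv k) = 0"
  by (simp_all add: Dz_def sum_mult_delta)

lemma Db_gens [simp]: "Db F (cst c) = 0" "Db F (Zv k) = 0" "Db F (Wv k) = tau (F k)"
  by (simp_all add: Db_def)

lemma tau_Dz: "tau (Dz F Q) = Db F (tau Q)" and tau_Db: "tau (Db F Q) = Dz F (tau Q)"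
  by (simp_all add: Db_def)

lemma Dz_field_add: "Dz (\<lambda>j. F j + G j) Q = Dz F Q + Dz G Q"
  and Dz_field_diff: "Dz (\<lambda>j. F j - G j) Q = Dz F Q - Dz G Q"
  and Dz_field_mult: "Dz (\<lambda>j. A * F j) Q = A * Dz F Q"
  by (simp_all add: Dz_def sum.distrib sum_subtractf sum_distrib_left algebra_simps)

lemma Dz_commutator: "Dz F (Dz G Q) - Dz G (Dz F Q) = Dz (\<lambda>j. Dz F (G j) - Dz G (F j)) Q"
  by (rule derivation_ext[OF derivation_commutator[OF derivation_Dz derivation_Dz] derivation_Dz])
     (simp_all add: derivation_0[OF derivation_Dz])

definition hol :: "'n::finite pring \<Rightarrow> bool" where
  "hol Q \<longleftrightarrow> (\<forall>z w. ev Q (z, w) = ev Q (z, 0))"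

lemma dw_hol:
  fixes Q :: "'n::finite pring"
  assumes "hol Q" shows "dw j Q = 0"
proof (rule pring_eqI)
  fix x :: "'n zpair"
  have eq: "ev Q = (\<lambda>x. ev Q (fst x, 0))"
    using assms by (auto simp: hol_def fun_eq_iff)
  have "((\<lambda>x. ev Q (fst x, 0)) has_derivative (\<lambda>v. \<Sum>j\<in>UNIV. fst v $ j * ev (dz j Q) (fst x, 0))) (at x)"
    using has_derivative_compose[OF has_derivative_Pair[OF has_derivative_fst[OF has_derivative_ident] has_derivative_const[where c = 0]]
        ev_has_derivative[where Q = Q], where x = x and s = UNIV] by simp
  then have "(ev Q has_derivative (\<lambda>v. \<Sum>j\<in>UNIV. fst v $ j * ev (dz j Q) (fst x, 0))) (at x)"
    by (subst eq)
  from ev_dw_eq[OF this] show "ev (dw j Q) x = ev 0 x"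
    by simp
qed

lemma Db_hol: "hol Q \<Longrightarrow> Db G Q = 0"
proof -
  assume "hol Q"
  then have "tau (dz j (tau Q)) = 0" for j
    using dw_hol[of Q j] by (simp add: dw_tau)
  then show ?thesis
    by (simp add: Db_def Dz_def tau_sum)
qed

lemma Dz_tau_hol: "hol Q \<Longrightarrow> Dz G (tau Q) = 0"
  using Db_hol[of Q G] by (metis tau_Db tau_simps(1))

text \<open>The commutator is a derivation that vanishes on the generators, because antiholomorphic
  fields kill holomorphic coefficients and conversely.\<close>

lemma Dz_Db_commute:
  assumes "\<And>j. hol (F j)" "\<And>j. hol (G j)"
  shows "Dz F (Db G Q) = Db G (Dz F Q)"
proof -
  have "Dz F (Db G Q) - Db G (Dz F Q) = (\<lambda>_. 0) Q"
    by (rule derivation_ext[OF derivation_commutator[OF derivation_Dz derivation_Db]])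
       (simp_all add: derivation_def derivation_0[OF derivation_Dz] derivation_0[OF derivation_Db]
         Db_hol Dz_tau_hol assms)
  then show ?thesis by simp
qed

subsection \<open>Bihomogeneous elements\<close>

definition bihom :: "nat \<Rightarrow> nat \<Rightarrow> 'n::finite pring \<Rightarrow> bool" where
  "bihom p q Q \<longleftrightarrow> (\<forall>s t z w. ev Q (s *s z, t *s w) = s ^ p * t ^ q * ev Q (z, w))"

lemma poly_zero_off_0:
  fixes p :: "complex poly"
  assumes "\<And>s. s \<noteq> 0 \<Longrightarrow> poly p s = 0"
  shows "p = 0"
proof (rule ccontr)
  assume "p \<noteq> 0"
  then have "finite (insert 0 {x. poly p x = 0})"
    using poly_roots_finite[of p] by simp
  moreover have "insert 0 {x. poly p x = 0} = UNIV"
    using assms by auto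
  ultimately show False
    using infinite_UNIV_char_0[where 'a = complex] by simp
qed

text \<open>Both sides are polynomials in each scalar separately, so the identity extends from
  nonzero scalars to zero.\<close>

lemma bihomI:
  assumes *: "\<And>s t z w. s \<noteq> 0 \<Longrightarrow> t \<noteq> 0 \<Longrightarrow> ev Q (s *s z, t *s w) = s ^ p * t ^ q * ev Q (z, w)"
  shows "bihom p q Q"
proof -
  have 1: "ev Q (s *s z, t *s w) = s ^ p * t ^ q * ev Q (z, w)" if "t \<noteq> 0" for s t z w
  proof -
    obtain r where r: "\<And>s. ev Q (0 + s *s z, t *s w + s *s 0) = poly r s"
      using pair_poly_line[OF ev_pair_poly, of Q 0 z "t *s w" 0] by blast
    have "r - monom (t ^ q * ev Q (z, w)) p = 0"
      by (rule poly_zero_off_0) (use r * \<open>t \<noteq> 0\<close> in \<open>simp add: poly_monom algebra_simps flip: r\<close>)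
    then show ?thesis
      using r[of s] by (simp add: poly_monom algebra_simps)
  qed
  have "ev Q (s *s z, t *s w) = s ^ p * t ^ q * ev Q (z, w)" for s t z w
  proof -
    obtain r where r: "\<And>t. ev Q (s *s z + t *s 0, 0 + t *s w) = poly r t"
      using pair_poly_line[OF ev_pair_poly, of Q "s *s z" 0 0 w] by blast
    have "r - monom (s ^ p * ev Q (z, w)) q = 0"
      by (rule poly_zero_off_0) (use r 1 in \<open>simp add: poly_monom algebra_simps flip: r\<close>)
    then show ?thesis
      using r[of t] by (simp add: poly_monom algebra_simps)
  qed
  then show ?thesis by (simp add: bihom_def)
qed

lemma bihom_0 [simp]: "bihom p q 0"
  by (simp add: bihom_def)

lemma bihom_cst [simp]: "bihom 0 0 (cst c)" and bihom_1 [simp]: "bihom 0 0 1"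
  and bihom_numeral [simp]: "bihom 0 0 (numeral k)"
  and bihom_Zv: "bihom 1 0 (Zv j)"
  by (simp_all add: bihom_def)

lemma bihom_add: "bihom p q Q \<Longrightarrow> bihom p q R \<Longrightarrow> bihom p q (Q + R)"
  and bihom_diff: "bihom p q Q \<Longrightarrow> bihom p q R \<Longrightarrow> bihom p q (Q - R)"
  and bihom_minus: "bihom p q Q \<Longrightarrow> bihom p q (- Q)"
  and bihom_mult: "bihom p q Q \<Longrightarrow> bihom p' q' R \<Longrightarrow> bihom (p + p') (q + q') (Q * R)"
  by (simp_all add: bihom_def power_add algebra_simps)

lemma bihom_cst_mult: "bihom p q Q \<Longrightarrow> bihom p q (cst c * Q)"
  using bihom_mult[OF bihom_cst, of p q Q c] by simp

lemma bihom_sum: "(\<And>i. i \<in> A \<Longrightarrow> bihom p q (f i)) \<Longrightarrow> bihom p q (sum f A)"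
  by (induction A rule: infinite_finite_induct) (auto intro: bihom_add)

lemma bihom_power: "bihom p q Q \<Longrightarrow> bihom (m * p) (m * q) (Q ^ m)"
  by (induction m) (auto intro: bihom_mult)

lemma bihom_prod: "(\<And>i. i \<in> A \<Longrightarrow> bihom (p i) (q i) (f i)) \<Longrightarrow> bihom (sum p A) (sum q A) (prod f A)"
  by (induction A rule: infinite_finite_induct) (auto intro: bihom_mult)

lemma cnjv_scale: "cnjv (s *s z) = cnj s *s cnjv z"
  by (simp add: fcp_eq_iff)

lemma bihom_tau: "bihom p q Q \<Longrightarrow> bihom q p (tau Q)"
  by (simp add: bihom_def cnjv_scale mult.commute)

lemma bihom_hol:
  assumes "bihom p 0 Q" shows "hol Q"
  unfolding hol_def
proof (intro allI)
  fix z w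
  show "ev Q (z, w) = ev Q (z, 0)"
    using assms[unfolded bihom_def, rule_format, of 1 z 0 w] by simp
qed

lemma bounded_linear_vector_smult: "bounded_linear ((*s) c :: complex ^ 'n::finite \<Rightarrow> complex ^ 'n)"
  unfolding linear_conv_bounded_linear[symmetric] by (rule linearI) (simp_all add: fcp_eq_iff distrib_left)

text \<open>Differentiating the homogeneity identity gives s times the derivative at the scaled
  point, hence the lowered degree after division by s. For p = 0 the choice s = 0 shows that the
  derivative vanishes; this case is stated apart because p - 1 is truncated.\<close>

lemma dz_bihom:
  assumes "bihom p q Q"
  shows "if p = 0 then dz j Q = 0 else bihom (p - 1) q (dz j Q)"
proof -
  have eq: "s * ev (dz j Q) (s *s z, t *s w) = s ^ p * t ^ q * ev (dz j Q) (z, w)" for s t z w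
  proof -
    have 1: "((\<lambda>x. ev Q (s *s fst x, t *s snd x)) has_derivative
        (\<lambda>v. \<Sum>j\<in>UNIV. s * fst v $ j * ev (dz j Q) (s *s z, t *s w) + t * snd v $ j * ev (dw j Q) (s *s z, t *s w))) (at (z, w))"
      using has_derivative_compose[OF has_derivative_Pair[OF
          bounded_linear.has_derivative[OF bounded_linear_vector_smult[of s] has_derivative_fst[OF has_derivative_ident]]
          bounded_linear.has_derivative[OF bounded_linear_vector_smult[of t] has_derivative_snd[OF has_derivative_ident]]]
          ev_has_derivative, of Q "(z, w)" UNIV] by simp
    have 2: "((\<lambda>x. ev Q (s *s fst x, t *s snd x)) has_derivative
        (\<lambda>v. s ^ p * t ^ q * (\<Sum>j\<in>UNIV. fst v $ j * ev (dz j Q) (z, w) + snd v $ j * ev (dw j Q) (z, w)))) (at (z, w))"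
      using assms ev_has_derivative[of Q "(z, w)"] unfolding bihom_def
      by (simp add: has_derivative_mult_right)
    from has_derivative_unique[OF 1 2, THEN fun_cong, of "(axis j 1, 0)"]
    have "(\<Sum>k\<in>UNIV. axis j 1 $ k * (s * ev (dz k Q) (s *s z, t *s w))) =
        s ^ p * t ^ q * (\<Sum>k\<in>UNIV. axis j 1 $ k * ev (dz k Q) (z, w))"
      by (simp add: mult_ac)
    then show ?thesis by (simp only: axis_nth_mult)
  qed
  show ?thesis
  proof (cases p)
    case 0
    have "ev (dz j Q) (z, w) = 0" for z w
      using eq[of 0 z 1 w] 0 by simp
    then show ?thesis using 0 by (auto intro: pring_eqI)
  next
    case (Suc p')
    have "bihom p' q (dz j Q)"
    proof (rule bihomI)
      fix s t z w assume "(s::complex) \<noteq> 0"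
      then show "ev (dz j Q) (s *s z, t *s w) = s ^ p' * t ^ q * ev (dz j Q) (z, w)"
        using eq[of s z t w] Suc by (simp add: mult.assoc)
    qed
    then show ?thesis using Suc by simp
  qed
qed

text \<open>For p = 0 the result is zero and has every bidegree, so the truncated subtraction does
  no harm.\<close>

lemma bihom_Dz:
  assumes "bihom p q Q" "\<And>j. bihom e 0 (F j)"
  shows "bihom (p + e - 1) q (Dz F Q)"
proof (cases p)
  case 0
  then show ?thesis
    using dz_bihom[OF assms(1)] by (simp add: Dz_def)
next
  case (Suc p')
  have "bihom (e + p') (0 + q) (F j * dz j Q)" for j
    using dz_bihom[OF assms(1), of j] Suc by (intro bihom_mult assms) auto
  then show ?thesis
    unfolding Dz_def Suc by (intro bihom_sum) (simp add: add.commute)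
qed

lemma bihom_Db:
  assumes "bihom p q Q" "\<And>j. bihom e 0 (F j)"
  shows "bihom p (q + e - 1) (Db F Q)"
  unfolding Db_def by (intro bihom_tau bihom_Dz assms)

lemma bihom_at_0:
  assumes "bihom p q Q"
  shows "p \<ge> 1 \<Longrightarrow> ev Q (0, w) = 0" and "q \<ge> 1 \<Longrightarrow> ev Q (z, 0) = 0"
  using assms[unfolded bihom_def, rule_format, of 0 0 1 w] assms[unfolded bihom_def, rule_format, of 1 z 0 0]
  by (simp_all add: power_0_left)

subsection \<open>Components with respect to the degree in the first variable\<close>

lemma zpoly_ex:
  assumes "f \<in> pair_poly"
  shows "\<exists>!p. \<forall>s. f (s *s fst x, snd x) = poly p s"
proof -
  obtain p where p: "\<And>s. f (0 + s *s fst x, snd x + s *s 0) = poly p s"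
    using pair_poly_line[OF assms, of 0 "fst x" "snd x" 0] by blast
  show ?thesis
  proof (rule ex1I[of _ p])
    show "\<forall>s. f (s *s fst x, snd x) = poly p s" using p by simp
    fix q assume "\<forall>s. f (s *s fst x, snd x) = poly q s"
    then have "poly p = poly q" using p by (simp add: fun_eq_iff)
    then show "q = p" by (simp add: poly_eq_poly_eq_iff)
  qed
qed

definition zpoly :: "('n::finite zpair \<Rightarrow> complex) \<Rightarrow> 'n zpair \<Rightarrow> complex poly" where
  "zpoly f x = (THE p. \<forall>s. f (s *s fst x, snd x) = poly p s)"

lemma poly_zpoly: "f \<in> pair_poly \<Longrightarrow> poly (zpoly f x) s = f (s *s fst x, snd x)"
  unfolding zpoly_def by (rule theI'[OF zpoly_ex, THEN spec, symmetric])

lemma zpoly_eqI: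
  assumes "f \<in> pair_poly" "\<And>s. f (s *s fst x, snd x) = poly p s"
  shows "zpoly f x = p"
  unfolding zpoly_def by (rule the1_equality[OF zpoly_ex[OF assms(1)]]) (rule allI, rule assms(2))

text \<open>Reading the component off the dilation of the first variable gives the grading without
  choosing a monomial basis.\<close>

lift_definition zcomp :: "nat \<Rightarrow> 'n::finite pring \<Rightarrow> 'n pring" is "\<lambda>t f x. coeff (zpoly f x) t"
proof -
  fix t and f :: "'n zpair \<Rightarrow> complex" assume "f \<in> pair_poly"
  then show "(\<lambda>x. coeff (zpoly f x) t) \<in> pair_poly"
  proof (induction arbitrary: t rule: generated_algebra.induct)
    case (const c)
    have "zpoly (\<lambda>_. c) x = [:c:]" for x :: "'n zpair"
      by (rule zpoly_eqI) (auto intro: generated_algebra.const)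
    then show ?case by (simp add: generated_algebra.const)
  next
    case (gen f)
    then consider k where "f = zc k" | k where "f = wc k" by blast
    then show ?case
    proof cases
      case 1
      have "zpoly f x = [:0, fst x $ k:]" for x :: "'n zpair"
        using 1 by (intro zpoly_eqI) (auto simp: zc_def)
      then show ?thesis
        by (cases t; cases "t - 1") (auto intro: generated_algebra.const pair_poly_fst)
    next
      case 2
      have "zpoly f x = [:snd x $ k:]" for x :: "'n zpair"
        using 2 by (intro zpoly_eqI) (auto simp: wc_def)
      then show ?thesis
        by (cases t) (auto intro: generated_algebra.const pair_poly_snd)
    qed
  next
    case (add f g)
    have "zpoly (\<lambda>x. f x + g x) x = zpoly f x + zpoly g x" for x
      using add.hyps by (intro zpoly_eqI generated_algebra.add) (auto simp: poly_zpoly)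
    then show ?case using add.IH by (auto intro: generated_algebra.add)
  next
    case (mult f g)
    have "zpoly (\<lambda>x. f x * g x) x = zpoly f x * zpoly g x" for x
      using mult.hyps by (intro zpoly_eqI generated_algebra.mult) (auto simp: poly_zpoly)
    then show ?case
      using mult.IH by (auto simp: coeff_mult intro!: generated_algebra_sum generated_algebra.mult)
  qed
qed

lemma zcomp_add: "zcomp t (Q + R) = zcomp t Q + zcomp t R"
proof (rule pring_eqI)
  fix x
  have "zpoly (ev (Q + R)) x = zpoly (ev Q) x + zpoly (ev R) x"
    by (rule zpoly_eqI) (auto simp: poly_zpoly)
  then show "ev (zcomp t (Q + R)) x = ev (zcomp t Q + zcomp t R) x"
    by (simp add: zcomp.rep_eq)
qed

lemma zcomp_bihom: "bihom p q Q \<Longrightarrow> zcomp t Q = (if p = t then Q else 0)"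
proof (rule pring_eqI)
  fix x assume *: "bihom p q Q"
  have "zpoly (ev Q) x = monom (ev Q x) p"
  proof (rule zpoly_eqI)
    fix s show "ev Q (s *s fst x, snd x) = poly (monom (ev Q x) p) s"
      using *[unfolded bihom_def, rule_format, of s "fst x" 1 "snd x"] by (simp add: poly_monom)
  qed simp
  then show "ev (zcomp t Q) x = ev (if p = t then Q else 0) x"
    by (simp add: zcomp.rep_eq)
qed

lemma zcomp_0 [simp]: "zcomp t 0 = 0"
  using zcomp_bihom[of 0 0 0 t] by simp

lemma zcomp_sum: "zcomp t (sum f A) = (\<Sum>i\<in>A. zcomp t (f i))"
  by (induction A rule: infinite_finite_induct) (auto simp: zcomp_add)

lemma zcomp_cst_mult: "zcomp t (cst c * Q) = cst c * zcomp t Q"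
proof (rule pring_eqI)
  fix x
  have "zpoly (ev (cst c * Q)) x = Polynomial.smult c (zpoly (ev Q) x)"
    by (rule zpoly_eqI) (auto simp: poly_zpoly)
  then show "ev (zcomp t (cst c * Q)) x = ev (cst c * zcomp t Q) x"
    by (simp add: zcomp.rep_eq)
qed

lemma zcomp_diff: "zcomp t (Q - R) = zcomp t Q - zcomp t R"
  using zcomp_add[of t Q "cst (-1) * R"] unfolding zcomp_cst_mult by (simp add: cst_simps)

section \<open>From tangency identities to the annihilation of P\<close>

section \<open>Symmetries of a bihomogeneous real polynomial\<close>

text \<open>Every word of length m + n in the commuting letters \<open>X\<close> and
  \<open>Y\<close> contains m letters \<open>X\<close> or n letters \<open>Y\<close>; the induction
  peels off one letter at a time.\<close>

lemma commuting_nilpotent_sum: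
  fixes X Y :: "'r::ab_group_add \<Rightarrow> 'r"
  assumes add: "\<And>u v. X (u + v) = X u + X v" "\<And>u v. Y (u + v) = Y u + Y v"
    and comm: "\<And>u. X (Y u) = Y (X u)"
    and "(X ^^ m) u = 0" "(Y ^^ n) u = 0"
  shows "((\<lambda>v. X v + Y v) ^^ (m + n)) u = 0"
  using assms(4,5)
proof (induction "m + n" arbitrary: m n u)
  case 0
  then show ?case by simp
next
  case (Suc k)
  have X0: "X 0 = 0" and Y0: "Y 0 = 0"
    using add(1)[of 0 0] add(2)[of 0 0] by simp_all
  have XY: "(Y ^^ j) (X v) = X ((Y ^^ j) v)" "(X ^^ j) (Y v) = Y ((X ^^ j) v)" for j v
    by (induction j) (simp_all add: comm)
  have S0: "((\<lambda>v. X v + Y v) ^^ j) 0 = 0" for j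
    by (induction j) (simp_all add: X0 Y0)
  have Sadd: "((\<lambda>v. X v + Y v) ^^ j) (a + b) = ((\<lambda>v. X v + Y v) ^^ j) a + ((\<lambda>v. X v + Y v) ^^ j) b" for j a b
    by (induction j) (simp_all add: add algebra_simps)
  have "((\<lambda>v. X v + Y v) ^^ k) (X u) = 0"
  proof (cases m)
    case 0
    then show ?thesis using Suc.prems by (simp add: X0 S0)
  next
    case (Suc m')
    show ?thesis
      using Suc.hyps(1)[of m' n "X u"] Suc.hyps(2) Suc.prems Suc
      by (simp add: funpow_swap1 XY X0)
  qed
  moreover have "((\<lambda>v. X v + Y v) ^^ k) (Y u) = 0"
  proof (cases n)
    case 0
    then show ?thesis using Suc.prems by (simp add: Y0 S0)
  next
    case (Suc n')
    show ?thesis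
      using Suc.hyps(1)[of m n' "Y u"] Suc.hyps(2) Suc.prems Suc
      by (simp add: funpow_swap1 XY Y0)
  qed
  moreover have "((\<lambda>v. X v + Y v) ^^ (m + n)) u = ((\<lambda>v. X v + Y v) ^^ k) (X u + Y u)"
    unfolding Suc.hyps(2)[symmetric] funpow_Suc_right by simp
  ultimately show ?case
    by (simp add: Sadd)
qed

definition no_pure_terms :: "'n::finite pring \<Rightarrow> bool" where
  "no_pure_terms Q \<longleftrightarrow> (\<forall>z. ev Q (z, 0) = 0 \<and> ev Q (0, z) = 0)"

lemma no_pure_terms_add: "no_pure_terms Q \<Longrightarrow> no_pure_terms R \<Longrightarrow> no_pure_terms (Q + R)"
  and no_pure_terms_diff: "no_pure_terms Q \<Longrightarrow> no_pure_terms R \<Longrightarrow> no_pure_terms (Q - R)"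
  and no_pure_terms_mult: "no_pure_terms Q \<Longrightarrow> no_pure_terms (R * Q)"
  and no_pure_terms_mult2: "no_pure_terms Q \<Longrightarrow> no_pure_terms (Q * R)"
  by (simp_all add: no_pure_terms_def)

lemma no_pure_terms_sum: "(\<And>i. i \<in> A \<Longrightarrow> no_pure_terms (f i)) \<Longrightarrow> no_pure_terms (sum f A)"
  by (simp add: no_pure_terms_def)

lemma no_pure_terms_bihom: "bihom p q Q \<Longrightarrow> 1 \<le> p \<Longrightarrow> 1 \<le> q \<Longrightarrow> no_pure_terms Q"
  using bihom_at_0 by (auto simp: no_pure_terms_def)

text \<open>On the slice where the second variable is 0, \<open>g\<close> is unchanged while
  \<open>tau g\<close> collapses to its constant term, which is zero in positive degree. The normal
  components of tangent fields are eliminated in this way: P and its derivatives along fields of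
  degree at least 1 contribute mixed terms only.\<close>

lemma pure_terms_vanish:
  assumes "bihom e 0 g" "1 \<le> e" "g - tau g = Q" "no_pure_terms Q"
  shows "g = 0"
proof (rule pring_eqI)
  fix x :: "'a zpair"
  obtain z w where x: "x = (z, w)" by force
  have "ev g (z, w) = ev g (z, 0)"
    using bihom_hol[OF assms(1)] by (simp add: hol_def)
  moreover have "ev g (0, 0) = 0"
    using bihom_at_0(1)[OF assms(1,2)] .
  moreover have "ev (g - tau g) (z, 0) = 0"
    using assms(3,4) by (simp add: no_pure_terms_def)
  moreover have "ev g (0, w) = ev g (0, 0)" for w
    using bihom_hol[OF assms(1)] by (simp add: hol_def)
  ultimately show "ev g x = ev 0 x"
    by (simp add: x)
qed

lemma double_mult_cancel:
  fixes I x y :: "'r::{idom,ring_char_0}"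
  shows "2 * I * x = 2 * I * y \<Longrightarrow> I \<noteq> 0 \<Longrightarrow> x = y"
  by (metis mult_cancel_left no_zero_divisors zero_neq_numeral)

lemma bihom_degree_cong: "bihom p q Q \<Longrightarrow> p = p' \<Longrightarrow> q = q' \<Longrightarrow> bihom p' q' Q"
  by simp

text \<open>The range 1 \<le> p < d of the degree in z encodes both homogeneity of total degree
  \<open>d\<close> and the absence of pluriharmonic terms.\<close>

locale real_bihom =
  fixes P :: "'n::finite pring" and Pc :: "nat \<Rightarrow> 'n pring" and d :: nat
  assumes real: "tau P = P" and nonzero: "P \<noteq> 0"
    and sum_comp: "P = (\<Sum>p\<in>{1..<d}. Pc p)"
    and bihom_comp: "\<And>p. p \<in> {1..<d} \<Longrightarrow> bihom p (d - p) (Pc p)"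
begin

lemma two_le_d: "2 \<le> d"
  using nonzero sum_comp by (cases "2 \<le> d") auto

lemma no_pure_terms_P: "no_pure_terms P"
  unfolding sum_comp using bihom_comp by (intro no_pure_terms_sum no_pure_terms_bihom) auto

lemma no_pure_terms_Dz:
  assumes "\<And>j. bihom e 0 (F j)" "1 \<le> e"
  shows "no_pure_terms (Dz F P)" and "no_pure_terms (Db F P)"
proof -
  show *: "no_pure_terms (Dz F P)"
    unfolding sum_comp derivation_sum[OF derivation_Dz]
  proof (rule no_pure_terms_sum)
    fix p assume "p \<in> {1..<d}"
    then show "no_pure_terms (Dz F (Pc p))"
      using assms by (intro no_pure_terms_bihom[OF bihom_Dz[OF bihom_comp]]) auto
  qed
  then have "no_pure_terms (tau (Dz F P))"
    by (simp add: no_pure_terms_def)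
  then show "no_pure_terms (Db F P)"
    by (simp add: tau_Dz real)
qed

(* Comparing the components of degree p + d + e in z expresses f(P_p) by products of components
   P_a P_b with a, b > p, so that downward induction on p applies. *)
lemma field_nilpotent:
  fixes A A' :: "'n pring \<Rightarrow> 'n pring"
  assumes f: "\<And>j. bihom (d + e + 1) 0 (f j)"
    and A: "derivation A" "\<And>p q Q. bihom p q Q \<Longrightarrow> bihom (p + e) q (A Q)"
    and A': "derivation A'" "\<And>p q Q. bihom p q Q \<Longrightarrow> bihom p (q + e) (A' Q)"
    and eq: "Dz f P + Db f P = cst k * (A (P * P) - A' (P * P))"
    and nilA: "\<And>N Q. (Dz f ^^ N) Q = 0 \<Longrightarrow> \<exists>N. (Dz f ^^ N) (A Q) = 0"
    and nilA': "\<And>N Q. (Dz f ^^ N) Q = 0 \<Longrightarrow> \<exists>N. (Dz f ^^ N) (A' Q) = 0"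
  shows "\<exists>N. (Dz f ^^ N) P = 0"
proof -
  let ?I = "{1..<d}"
  define nil where "nil Q \<longleftrightarrow> (\<exists>N. (Dz f ^^ N) Q = 0)" for Q
  have nil_0: "nil 0"
    unfolding nil_def by (intro exI[of _ 0]) simp
  have nil_add: "nil (Q + R)" if "nil Q" "nil R" for Q R
  proof -
    from that obtain m n where "(Dz f ^^ m) Q = 0" "(Dz f ^^ n) R = 0"
      by (auto simp: nil_def)
    then have "(Dz f ^^ (max m n)) (Q + R) = 0"
      using derivation_nilpotent_mono[OF derivation_Dz, of m f Q "max m n"]
        derivation_nilpotent_mono[OF derivation_Dz, of n f R "max m n"]
      by (simp add: derivation_funpow_add[OF derivation_Dz])
    then show ?thesis by (auto simp: nil_def)
  qed
  have nil_sum: "nil (sum g X)" if "\<And>i. i \<in> X \<Longrightarrow> nil (g i)" for g :: "nat \<times> nat \<Rightarrow> _" and X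
    using that by (induction X rule: infinite_finite_induct) (auto intro: nil_0 nil_add)
  have nil_sum': "nil (sum g X)" if "\<And>i. i \<in> X \<Longrightarrow> nil (g i)" for g :: "nat \<Rightarrow> _" and X
    using that by (induction X rule: infinite_finite_induct) (auto intro: nil_0 nil_add)
  have nil_mult: "nil (Q * R)" if "nil Q" "nil R" for Q R
    using that derivation_nilpotent_mult[OF derivation_Dz, of _ f Q _ R] by (auto simp: nil_def)
  have nil_cst: "nil (cst c * Q)" if "nil Q" for c Q
    using that derivation_funpow_const_mult[OF derivation_Dz, of f "cst c" _ Q] by (auto simp: nil_def)
  have PP: "P * P = (\<Sum>(a, b)\<in>?I \<times> ?I. Pc a * Pc b)"
    unfolding sum_comp by (simp add: sum_product sum.cartesian_product)
  have comp: "Dz f (Pc p) = cst k * ((\<Sum>(a, b)\<in>?I \<times> ?I. if a + b + e = p + d + e then A (Pc a * Pc b) else 0)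
      - (\<Sum>(a, b)\<in>?I \<times> ?I. if a + b = p + d + e then A' (Pc a * Pc b) else 0))"
    if p: "p \<in> ?I" for p
  proof -
    have "zcomp (p + d + e) (Dz f P + Db f P) =
        (\<Sum>a\<in>?I. zcomp (p + d + e) (Dz f (Pc a))) + (\<Sum>a\<in>?I. zcomp (p + d + e) (Db f (Pc a)))"
      by (subst (1 2) sum_comp)
         (simp add: zcomp_add zcomp_sum derivation_sum[OF derivation_Dz] derivation_sum[OF derivation_Db])
    also have "(\<Sum>a\<in>?I. zcomp (p + d + e) (Dz f (Pc a))) = (\<Sum>a\<in>?I. if a = p then Dz f (Pc a) else 0)"
    proof (rule sum.cong)
      fix a assume "a \<in> ?I"
      then have "bihom (a + (d + e + 1) - 1) (d - a) (Dz f (Pc a))"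
        by (intro bihom_Dz bihom_comp f)
      from zcomp_bihom[OF this, of "p + d + e"]
      show "zcomp (p + d + e) (Dz f (Pc a)) = (if a = p then Dz f (Pc a) else 0)"
        by auto
    qed simp
    also have "\<dots> = Dz f (Pc p)" using p by simp
    \<comment> \<open>The antiholomorphic field leaves the degree in z at a < d, out of reach of p +
      d + e.\<close>
    also have "(\<Sum>a\<in>?I. zcomp (p + d + e) (Db f (Pc a))) = 0"
    proof (rule sum.neutral, rule ballI)
      fix a assume "a \<in> ?I"
      then have "bihom a (d - a + (d + e + 1) - 1) (Db f (Pc a))"
        by (intro bihom_Db bihom_comp f)
      from zcomp_bihom[OF this, of "p + d + e"] \<open>a \<in> ?I\<close>
      show "zcomp (p + d + e) (Db f (Pc a)) = 0"
        by auto
    qed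
    finally have "Dz f (Pc p) = zcomp (p + d + e) (cst k * (A (P * P) - A' (P * P)))"
      by (simp add: eq)
    also have "\<dots> = cst k * ((\<Sum>(a, b)\<in>?I \<times> ?I. zcomp (p + d + e) (A (Pc a * Pc b)))
      - (\<Sum>(a, b)\<in>?I \<times> ?I. zcomp (p + d + e) (A' (Pc a * Pc b))))"
      unfolding PP zcomp_cst_mult zcomp_diff derivation_sum[OF A(1)] derivation_sum[OF A'(1)] zcomp_sum
      by (simp add: case_prod_unfold)
    also have "(\<Sum>(a, b)\<in>?I \<times> ?I. zcomp (p + d + e) (A (Pc a * Pc b))) =
        (\<Sum>(a, b)\<in>?I \<times> ?I. if a + b + e = p + d + e then A (Pc a * Pc b) else 0)"
    proof (rule sum.cong)
      fix x assume "x \<in> ?I \<times> ?I"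
      then obtain a b where x: "x = (a, b)" "a \<in> ?I" "b \<in> ?I" by blast
      show "(case x of (a, b) \<Rightarrow> zcomp (p + d + e) (A (Pc a * Pc b))) =
          (case x of (a, b) \<Rightarrow> if a + b + e = p + d + e then A (Pc a * Pc b) else 0)"
        using zcomp_bihom[OF A(2)[OF bihom_mult[OF bihom_comp[OF x(2)] bihom_comp[OF x(3)]]], of "p + d + e"]
        by (simp add: x(1))
    qed simp
    also have "(\<Sum>(a, b)\<in>?I \<times> ?I. zcomp (p + d + e) (A' (Pc a * Pc b))) =
        (\<Sum>(a, b)\<in>?I \<times> ?I. if a + b = p + d + e then A' (Pc a * Pc b) else 0)"
    proof (rule sum.cong)
      fix x assume "x \<in> ?I \<times> ?I"
      then obtain a b where x: "x = (a, b)" "a \<in> ?I" "b \<in> ?I" by blast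
      show "(case x of (a, b) \<Rightarrow> zcomp (p + d + e) (A' (Pc a * Pc b))) =
          (case x of (a, b) \<Rightarrow> if a + b = p + d + e then A' (Pc a * Pc b) else 0)"
        using zcomp_bihom[OF A'(2)[OF bihom_mult[OF bihom_comp[OF x(2)] bihom_comp[OF x(3)]]], of "p + d + e"]
        by (simp add: x(1))
    qed simp
    finally show ?thesis .
  qed
  have nilP: "nil (Pc p)" if "p \<in> ?I" for p
    using that
  proof (induction "d - p" arbitrary: p rule: less_induct)
    case less
    \<comment> \<open>Both indices are at most d - 1, so a + b \<ge> p + d forces each of them above
      \<open>p\<close>. The terms with \<open>A\<close> have a + b = p + d and those with
      \<open>A'\<close> have a + b = p + d + e, so both sums satisfy this bound.\<close>
    have hi: "nil (Pc a * Pc b)" if "a \<in> ?I" "b \<in> ?I" "a + b \<ge> p + d" for a b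
      using that less.prems by (intro nil_mult less.hyps) auto
    have "nil (cst k * ((\<Sum>(a, b)\<in>?I \<times> ?I. if a + b + e = p + d + e then A (Pc a * Pc b) else 0)
      + cst (-1) * (\<Sum>(a, b)\<in>?I \<times> ?I. if a + b = p + d + e then A' (Pc a * Pc b) else 0)))"
    proof (intro nil_cst nil_add nil_sum)
      fix x assume "x \<in> ?I \<times> ?I"
      then show "nil (case x of (a, b) \<Rightarrow> if a + b + e = p + d + e then A (Pc a * Pc b) else 0)"
        using nilA[of _ "Pc (fst x) * Pc (snd x)"] hi[of "fst x" "snd x"] nil_0
        by (auto simp: nil_def split: prod.splits)
    next
      fix x assume "x \<in> ?I \<times> ?I"
      then show "nil (case x of (a, b) \<Rightarrow> if a + b = p + d + e then A' (Pc a * Pc b) else 0)"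
        using nilA'[of _ "Pc (fst x) * Pc (snd x)"] hi[of "fst x" "snd x"] nil_0
        by (auto simp: nil_def split: prod.splits)
    qed
    then have "nil (Dz f (Pc p))"
      unfolding comp[OF less.prems] by (simp add: cst_simps)
    then obtain N where "(Dz f ^^ N) (Dz f (Pc p)) = 0"
      by (auto simp: nil_def)
    then have "(Dz f ^^ Suc N) (Pc p) = 0"
      by (simp add: funpow_swap1)
    then show ?case unfolding nil_def by blast
  qed
  have "nil P"
    by (subst sum_comp) (intro nil_sum' nilP)
  then show ?thesis by (simp add: nil_def)
qed


lemma tau_funpow_Dz: "tau ((Dz f ^^ N) Q) = (Db f ^^ N) (tau Q)"
  by (induction N) (simp_all add: tau_Dz)

lemma nilpotent_conjugate: "(Dz f ^^ N) P = 0 \<Longrightarrow> (Db f ^^ N) P = 0"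
  using tau_funpow_Dz[of N f P] by (simp add: real)

lemma nilpotent_total:
  assumes "\<And>j. hol (f j)" "(Dz f ^^ N) Q = 0" "(Db f ^^ N) Q = 0"
  shows "((\<lambda>R. Dz f R + Db f R) ^^ (N + N)) Q = 0"
  using assms by (intro commuting_nilpotent_sum) (simp_all add: derivation_add[OF derivation_Dz]
      derivation_add[OF derivation_Db] Dz_Db_commute)

lemma nilpotent_difference:
  assumes "\<And>j. hol (f j)" "(Dz f ^^ N) Q = 0" "(Db f ^^ N) Q = 0"
  shows "((\<lambda>R. Dz f R - Db f R) ^^ (N + N)) Q = 0"
proof -
  have "((\<lambda>R. - Db f R) ^^ k) Q = (if even k then (Db f ^^ k) Q else - (Db f ^^ k) Q)" for k
    by (induction k) (simp_all add: derivation_minus[OF derivation_Db])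
  then have "((\<lambda>R. Dz f R + (- Db f R)) ^^ (N + N)) Q = 0"
    using assms by (intro commuting_nilpotent_sum) (simp_all add: derivation_add[OF derivation_Dz]
      derivation_add[OF derivation_Db] derivation_minus[OF derivation_Dz] Dz_Db_commute)
  then show ?thesis by simp
qed

text \<open>The relation \<open>r1\<close> only says that the real part of \<open>f1\<close>
  multiplies P by 2c; it is silent about M = f1 - conj f1. The next coefficient supplies Z P = - i P
  M(P) with Z = f0 + conj f0, and the commutation relation between \<open>f1\<close> and
  \<open>f0\<close> turns this into M P = 0. Both facts together determine f1(P).\<close>

lemma linear_symmetry:
  fixes f1 f0 :: "'n \<Rightarrow> 'n pring" and g1 g0 :: "'n pring" and c :: real
  assumes f1: "\<And>j. bihom 1 0 (f1 j)" and f0: "\<And>j. bihom (d + 1) 0 (f0 j)"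
    and g1: "bihom d 0 g1" and g0: "bihom (2 * d) 0 g0"
    and rigid: "\<And>F e. 2 \<le> e \<Longrightarrow> (\<And>j. bihom e 0 (F j)) \<Longrightarrow> Dz F P + Db F P = 0 \<Longrightarrow> F = (\<lambda>_. 0)"
    and B1: "B1 = g1 - 2 * cst \<i> * Dz f1 P" and B0: "B0 = g0 - 2 * cst \<i> * Dz f0 P"
    and r1: "B1 - tau B1 = - (2 * cst \<i> * (P * (2 * cst (of_real c))))"
    and r0: "B0 - tau B0 = - (cst \<i> * (P * (B1 + tau B1)))"
  shows "Dz f1 P = cst (of_real c) * P"
proof -
  define I :: "'n pring" where "I = cst \<i>"
  define C :: "'n pring" where "C = cst (of_real c)"
  have II: "I * I = -1" and I0: "I \<noteq> 0" and tauI: "tau I = - I" and tauC: "tau C = C"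
    by (simp_all add: I_def C_def) (auto intro!: pring_eqI)
  have const: "Dz F I = 0" "Db F I = 0" "Dz F C = 0" "Db F C = 0" for F
    by (simp_all add: I_def C_def)
  have hol1: "hol (f1 j)" and hol0: "hol (f0 j)" for j
    using bihom_hol f1 f0 by blast+
  note add = derivation_add[OF derivation_Dz] derivation_add[OF derivation_Db]
    and diff = derivation_diff[OF derivation_Dz] derivation_diff[OF derivation_Db]
    and mult = derivation_mult[OF derivation_Dz] derivation_mult[OF derivation_Db]
  have num: "Dz F (numeral k) = 0" "Db F (numeral k) = 0" for F and k
    by (rule derivation_numeral derivation_Dz derivation_Db)+
  have "g1 - tau g1 = 2 * I * (Dz f1 P + Db f1 P) - 4 * I * C * P"
    using r1 by (simp add: B1 tau_Dz real tauI algebra_simps flip: I_def C_def)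
  moreover have "no_pure_terms (2 * I * (Dz f1 P + Db f1 P) - 4 * I * C * P)"
    by (intro no_pure_terms_diff no_pure_terms_mult no_pure_terms_add no_pure_terms_Dz[OF f1] no_pure_terms_P) auto
  ultimately have g1_0: "g1 = 0"
    using pure_terms_vanish[OF g1] two_le_d by simp
  have SP: "Dz f1 P + Db f1 P = 2 * C * P"
  proof -
    have "2 * I * (Dz f1 P + Db f1 P) = 2 * I * (2 * C * P)"
      using r1 by (simp add: B1 g1_0 tau_Dz real tauI algebra_simps del: mult_cancel_left flip: I_def C_def)
    then show ?thesis by (rule double_mult_cancel[OF _ I0])
  qed
  have r0': "g0 - tau g0 = 2 * I * (Dz f0 P + Db f0 P) - 2 * (Dz f1 P - Db f1 P) * P"
  proof -
    have "g0 - tau g0 = 2 * I * (Dz f0 P + Db f0 P) + 2 * (I * I) * (Dz f1 P - Db f1 P) * P"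
      using r0 by (simp add: B0 B1 g1_0 tau_Dz real tauI algebra_simps flip: I_def C_def)
    then show ?thesis unfolding II by (simp add: algebra_simps)
  qed
  have "no_pure_terms (2 * I * (Dz f0 P + Db f0 P) - 2 * (Dz f1 P - Db f1 P) * P)"
    by (intro no_pure_terms_diff no_pure_terms_mult no_pure_terms_add no_pure_terms_Dz[OF f0] no_pure_terms_P) auto
  then have g0_0: "g0 = 0"
    using pure_terms_vanish[OF g0 _ r0'] two_le_d by simp
  have ZP: "Dz f0 P + Db f0 P = - (I * P * (Dz f1 P - Db f1 P))"
  proof -
    have "2 * I * (Dz f0 P + Db f0 P) = 2 * (Dz f1 P - Db f1 P) * P"
      using r0' by (simp only: g0_0 tau_simps) simp
    also have "\<dots> = 2 * I * (- (I * P * (Dz f1 P - Db f1 P)))"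
      using II by Groebner_Basis.algebra
    finally have "2 * I * (Dz f0 P + Db f0 P) = 2 * I * (- (I * P * (Dz f1 P - Db f1 P)))" .
    then show ?thesis by (rule double_mult_cancel[OF _ I0])
  qed

  \<comment> \<open>\<open>Y\<close> is the defect of the relation [f1, f0] = 2 c f0.
    Differentiating the identities \<open>SP\<close> and \<open>ZP\<close> shows that its real part
    annihilates P; its degree d + 1 is at least 2, so rigidity makes it zero.\<close>
  define Y where "Y j = Dz f1 (f0 j) - Dz f0 (f1 j) - 2 * C * f0 j" for j
  have DzY: "Dz Y Q = Dz f1 (Dz f0 Q) - Dz f0 (Dz f1 Q) - 2 * C * Dz f0 Q" for Q
    unfolding Y_def[abs_def] Dz_field_diff Dz_commutator Dz_field_mult by simp
  have DbY: "Db Y Q = Db f1 (Db f0 Q) - Db f0 (Db f1 Q) - 2 * C * Db f0 Q" for Q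
    unfolding Db_def[of Y] DzY by (simp add: tau_Dz tauC)
  have cross: "Dz f1 (Db f0 Q) = Db f0 (Dz f1 Q)" "Dz f0 (Db f1 Q) = Db f1 (Dz f0 Q)"
    "Dz f1 (Db f1 Q) = Db f1 (Dz f1 Q)" "Dz f0 (Db f0 Q) = Db f0 (Dz f0 Q)" for Q
    by (intro Dz_Db_commute hol1 hol0)+
  have "2 * C = cst (2 * of_real c)"
    unfolding C_def by (rule pring_eqI) simp
  then have "bihom (d + 1) 0 (Y j)" for j
    using bihom_Dz[OF f0[of j] f1] bihom_Dz[OF f1[of j] f0] bihom_cst_mult[OF f0[of j], of "2 * of_real c"]
    unfolding Y_def by (intro bihom_diff) simp_all
  moreover have "Dz Y P + Db Y P = 0"
  proof -
    have 1: "Dz f1 (Dz f0 P) + Dz f1 (Db f0 P) =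
        - (I * (Dz f1 P * (Dz f1 P - Db f1 P) + P * (Dz f1 (Dz f1 P) - Dz f1 (Db f1 P))))"
      using arg_cong[OF ZP, of "Dz f1"] const by (simp add: add diff mult derivation_minus[OF derivation_Dz] algebra_simps)
    have 2: "Db f1 (Dz f0 P) + Db f1 (Db f0 P) =
        - (I * (Db f1 P * (Dz f1 P - Db f1 P) + P * (Db f1 (Dz f1 P) - Db f1 (Db f1 P))))"
      using arg_cong[OF ZP, of "Db f1"] const by (simp add: add diff mult derivation_minus[OF derivation_Db] algebra_simps)
    have 3: "Dz F (Dz f1 P) + Dz F (Db f1 P) = 2 * C * Dz F P" for F
      using arg_cong[OF SP, of "Dz F"] const by (simp add: add mult num)
    have 4: "Db F (Dz f1 P) + Db F (Db f1 P) = 2 * C * Db F P" for F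
      using arg_cong[OF SP, of "Db F"] const by (simp add: add mult num)
    have e1: "Dz Y P + Db Y P = (Dz f1 (Dz f0 P) + Dz f1 (Db f0 P)) + (Db f1 (Dz f0 P) + Db f1 (Db f0 P))
        - (Dz f0 (Dz f1 P) + Dz f0 (Db f1 P)) - (Db f0 (Dz f1 P) + Db f0 (Db f1 P)) - 2 * C * (Dz f0 P + Db f0 P)"
      unfolding DzY DbY by (simp add: cross algebra_simps)
    have e2: "Dz f1 (Dz f1 P) - Dz f1 (Db f1 P) + (Db f1 (Dz f1 P) - Db f1 (Db f1 P)) = 2 * C * (Dz f1 P - Db f1 P)"
      using 3[of f1] 4[of f1] cross(3)[of P] by Groebner_Basis.algebra
    have "Dz Y P + Db Y P = - (I * ((Dz f1 P + Db f1 P) * (Dz f1 P - Db f1 P)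
        + P * (2 * C * (Dz f1 P - Db f1 P)))) - 4 * C * (Dz f0 P + Db f0 P)"
      unfolding e1 1 2 3[of f0] 4[of f0] e2[symmetric] by (simp add: algebra_simps)
    then show ?thesis
      unfolding SP ZP by (simp add: algebra_simps)
  qed
  ultimately have "Y = (\<lambda>_. 0)"
    using rigid[of "d + 1" Y] two_le_d by simp
  then have "Dz Y Q = 0" "Db Y Q = 0" for Q
    by (simp_all add: Dz_def Db_def)
  then have com: "Dz f1 (Dz f0 Q) = Dz f0 (Dz f1 Q) + 2 * C * Dz f0 Q"
    "Db f1 (Db f0 Q) = Db f0 (Db f1 Q) + 2 * C * Db f0 Q" for Q
    unfolding DzY DbY by (simp_all add: algebra_simps)

  let ?M = "\<lambda>Q. Dz f1 Q - Db f1 Q" and ?Z = "\<lambda>Q. Dz f0 Q + Db f0 Q"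
  have ZP': "Dz f0 P + Db f0 P = cst (- \<i> / 2) * (Dz f1 (P * P) - Db f1 (P * P))"
  proof -
    have "cst (- \<i> / 2) * 2 = - I"
      unfolding I_def by (auto intro!: pring_eqI)
    then show ?thesis using ZP unfolding mult by Groebner_Basis.algebra
  qed
  \<comment> \<open>Moving \<open>f1\<close> past powers of \<open>f0\<close> only costs a multiple
    of the same power, so \<open>f1\<close> preserves the elements on which \<open>f0\<close> is
    nilpotent.\<close>
  have pow: "(Dz f0 ^^ N) (Dz f1 Q) = Dz f1 ((Dz f0 ^^ N) Q) - of_nat N * 2 * C * (Dz f0 ^^ N) Q" for N Q
  proof (induction N)
    case (Suc N)
    have "(Dz f0 ^^ Suc N) (Dz f1 Q) = Dz f0 (Dz f1 ((Dz f0 ^^ N) Q) - of_nat N * 2 * C * (Dz f0 ^^ N) Q)"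
      by (simp only: funpow.simps o_apply Suc.IH)
    also have "\<dots> = Dz f0 (Dz f1 ((Dz f0 ^^ N) Q)) - of_nat N * 2 * C * Dz f0 ((Dz f0 ^^ N) Q)"
      by (simp add: const diff mult derivation_of_nat[OF derivation_Dz] num)
    finally show ?case by (simp add: com algebra_simps)
  qed simp
  have powb: "(Dz f0 ^^ N) (Db f1 Q) = Db f1 ((Dz f0 ^^ N) Q)" for N Q
    by (induction N) (simp_all add: cross)
  have "\<exists>N. (Dz f0 ^^ N) P = 0"
  proof (rule field_nilpotent[where e = 0 and A = "Dz f1" and A' = "Db f1", OF _ derivation_Dz _ derivation_Db _ ZP'])
    show "bihom (d + 0 + 1) 0 (f0 j)" for j using f0 by simp
    show "bihom (p + 0) q (Dz f1 Q)" if "bihom p q Q" for p q Q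
      using bihom_Dz[OF that f1] by simp
    show "bihom p (q + 0) (Db f1 Q)" if "bihom p q Q" for p q Q
      using bihom_Db[OF that f1] by simp
    show "\<exists>N. (Dz f0 ^^ N) (Dz f1 Q) = 0" if "(Dz f0 ^^ N) Q = 0" for N Q
      using that by (intro exI[of _ N]) (simp add: pow derivation_0[OF derivation_Dz])
    show "\<exists>N. (Dz f0 ^^ N) (Db f1 Q) = 0" if "(Dz f0 ^^ N) Q = 0" for N Q
      using that by (intro exI[of _ N]) (simp add: powb derivation_0[OF derivation_Db])
  qed
  then obtain N where N: "(Dz f0 ^^ N) P = 0" by blast
  have Nb: "(Db f0 ^^ N) P = 0" by (rule nilpotent_conjugate[OF N])
  have "?M P = 0"
  \<comment> \<open>The commutator of M with Z is 2 c W, where W = f0 - conj f0. For c = 0 they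
    commute and the Burgers argument applies. For nonzero c the field W takes over: it commutes with
    Z, and its commutator with M is a multiple of Z.\<close>
  proof (cases "c = 0")
    case True
    then have "C = 0" by (simp add: C_def cst_simps)
    show ?thesis
    proof (rule nilpotent_burgers[of ?Z ?M "cst (- \<i> / 2)"])
      show "derivation ?Z" "derivation ?M"
        by (intro derivation_sum_of derivation_diff_of derivation_Dz derivation_Db)+
      show "Dz f0 (Dz f1 x - Db f1 x) + Db f0 (Dz f1 x - Db f1 x) =
          Dz f1 (Dz f0 x + Db f0 x) - Db f1 (Dz f0 x + Db f0 x)" for x
        using com[of x] cross[of x] \<open>C = 0\<close> by (simp add: add diff)
      show "((\<lambda>Q. Dz f0 Q + Db f0 Q) ^^ (N + N)) P = 0"
        by (rule nilpotent_total[OF hol0 N Nb])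
    qed (simp_all add: ZP')
  next
    case False
    \<comment> \<open>The factor - i / 2 yields Z P = 2 P K and M P = 2 i K, the shape that
      \<open>nilpotent_cofactor\<close> requires.\<close>
    define K where "K = cst (- \<i> / 2) * ?M P"
    have hK: "2 * I * K = ?M P"
    proof -
      have "2 * I * cst (- \<i> / 2) = 1" unfolding I_def by (auto intro!: pring_eqI)
      then show ?thesis unfolding K_def by (metis mult.assoc mult_1)
    qed
    have "(Dz f0 ^^ N) (?M P) = 0" "(Db f0 ^^ N) (?M P) = 0"
    proof -
      have 1: "(Dz f0 ^^ N) (Dz f1 P) = 0" "(Dz f0 ^^ N) (Db f1 P) = 0"
        using N by (simp_all add: pow powb derivation_0[OF derivation_Dz] derivation_0[OF derivation_Db])
      have 2: "(Db f0 ^^ N) (Dz f1 P) = 0" "(Db f0 ^^ N) (Db f1 P) = 0"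
        using 1 tau_funpow_Dz[of N f0 "Db f1 P"] tau_funpow_Dz[of N f0 "Dz f1 P"] by (simp_all add: tau_Dz tau_Db real)
      have minus: "u - v = u + (- 1) * v" for u v :: "'n pring" by simp
      show "(Dz f0 ^^ N) (?M P) = 0" "(Db f0 ^^ N) (?M P) = 0"
        unfolding minus derivation_funpow_add[OF derivation_Dz] derivation_funpow_add[OF derivation_Db]
        by (subst derivation_funpow_const_mult[OF derivation_Dz] derivation_funpow_const_mult[OF derivation_Db];
            simp add: 1 2 derivation_minus[OF derivation_Dz] derivation_minus[OF derivation_Db]
              derivation_1[OF derivation_Dz] derivation_1[OF derivation_Db])+
    qed
    then have "((\<lambda>R. Dz f0 R - Db f0 R) ^^ (N + N)) K = 0"
      unfolding K_def
      by (subst derivation_funpow_const_mult[OF derivation_diff_of[OF derivation_Dz derivation_Db]])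
         (simp_all add: nilpotent_difference[OF hol0])
    moreover have "((\<lambda>R. Dz f0 R - Db f0 R) ^^ (N + N)) P = 0"
      by (rule nilpotent_difference[OF hol0 N Nb])
    moreover have "?M (Dz f0 x - Db f0 x) = Dz f0 (?M x) - Db f0 (?M x) + 2 * C * ?Z x" for x
      using com[of x] cross[of x] by (simp add: add diff algebra_simps)
    moreover have "?Z (Dz f0 x - Db f0 x) = Dz f0 (?Z x) - Db f0 (?Z x)" for x
      using cross[of x] by (simp add: add diff)
    moreover have "?Z P = 2 * P * K"
      using ZP hK II by Groebner_Basis.algebra
    moreover have "C \<noteq> 0" using False by (simp add: C_def)
    ultimately have "K = 0"
      by (intro nilpotent_cofactor[of ?M ?Z "\<lambda>R. Dz f0 R - Db f0 R" P "2 * I" K "2 * C" "N + N" "N + N"])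
         (simp_all add: derivation_diff_of derivation_sum_of derivation_Dz derivation_Db hK nonzero mult const num)
    then show ?thesis using hK by simp
  qed
  then have "2 * Dz f1 P = 2 * (C * P)"
    using SP by Groebner_Basis.algebra
  then show ?thesis by (simp add: C_def)
qed


text \<open>The top field \<open>a\<close> is constant and two lower coefficients are needed. With
  \<open>B\<close> real the identities read (f1 + conj f1) P = P B and (f0 + conj f0) P = - i P (f1
  - conj f1) P. Three commutator relations make \<open>f0\<close> commute with \<open>f1\<close> and
  act nilpotently on P, so the Burgers argument gives f1(P) = conj f1(P); comparing degrees then
  kills f1(P), next \<open>B\<close>, and finally a(P). The lowest commutator has degree d - 1,
  which d \<ge> 3 brings into the range of rigidity.\<close>

lemma translation_symmetry:
  fixes a f1 f0 :: "'n \<Rightarrow> 'n pring" and g g1 g0 :: "'n pring"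
  assumes d: "3 \<le> d" and a: "\<And>j. bihom 0 0 (a j)" and g: "bihom (d - 1) 0 g"
    and f1: "\<And>j. bihom d 0 (f1 j)" and f0: "\<And>j. bihom (2 * d) 0 (f0 j)"
    and g1: "bihom (2 * d - 1) 0 g1" and g0: "bihom (3 * d - 1) 0 g0"
    and rigid: "\<And>F e. 2 \<le> e \<Longrightarrow> (\<And>j. bihom e 0 (F j)) \<Longrightarrow> Dz F P + Db F P = 0 \<Longrightarrow> F = (\<lambda>_. 0)"
    and B: "B = g - 2 * cst \<i> * Dz a P"
    and B1: "B1 = g1 - 2 * cst \<i> * Dz f1 P" and B0: "B0 = g0 - 2 * cst \<i> * Dz f0 P"
    and r2: "tau B = B" and r1: "B1 - tau B1 = - (2 * cst \<i> * (P * B))"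
    and r0: "B0 - tau B0 = - (cst \<i> * (P * (B1 + tau B1)))"
  shows "Dz a P = 0"
proof -
  define I :: "'n pring" where "I = cst \<i>"
  have II: "I * I = -1" and I0: "I \<noteq> 0" and tauI: "tau I = - I"
    by (simp_all add: I_def) (auto intro!: pring_eqI)
  have const: "Dz F I = 0" "Db F I = 0" for F
    by (simp_all add: I_def)
  have hola: "hol (a j)" and hol1: "hol (f1 j)" and hol0: "hol (f0 j)" and holg: "hol g" for j
    using bihom_hol a f1 f0 g by blast+
  note add = derivation_add[OF derivation_Dz] derivation_add[OF derivation_Db]
    and diff = derivation_diff[OF derivation_Dz] derivation_diff[OF derivation_Db]
    and mult = derivation_mult[OF derivation_Dz] derivation_mult[OF derivation_Db]
    and minus = derivation_minus[OF derivation_Dz] derivation_minus[OF derivation_Db]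
  have num: "Dz F (numeral k) = 0" "Db F (numeral k) = 0" for F and k
    by (rule derivation_numeral derivation_Dz derivation_Db)+
  have dg: "Db F g = 0" "Dz F (tau g) = 0" "Db F (tau g) = tau (Dz F g)" for F
    by (simp_all add: Db_hol holg Dz_tau_hol tau_Dz)
  have cross: "Dz a (Db f0 Q) = Db f0 (Dz a Q)" "Dz f0 (Db a Q) = Db a (Dz f0 Q)"
    "Dz a (Db f1 Q) = Db f1 (Dz a Q)" "Dz f1 (Db a Q) = Db a (Dz f1 Q)"
    "Dz f1 (Db f0 Q) = Db f0 (Dz f1 Q)" "Dz f0 (Db f1 Q) = Db f1 (Dz f0 Q)"
    "Dz f1 (Db f1 Q) = Db f1 (Dz f1 Q)" "Dz f0 (Db f0 Q) = Db f0 (Dz f0 Q)" "Dz a (Db a Q) = Db a (Dz a Q)" for Q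
    by (intro Dz_Db_commute hola hol1 hol0)+
  have f1': "1 \<le> d" and f0': "1 \<le> 2 * d" using d by auto
  have E1: "2 * I * (Dz a P + Db a P) = g - tau g"
    using r2 by (simp add: B tau_Dz real tauI algebra_simps flip: I_def)
  have "g1 - tau g1 = 2 * I * (Dz f1 P + Db f1 P) - 2 * I * B * P"
    using r1 by (simp add: B1 tau_Dz real tauI algebra_simps flip: I_def)
  moreover have "no_pure_terms (2 * I * (Dz f1 P + Db f1 P) - 2 * I * B * P)"
    by (intro no_pure_terms_diff no_pure_terms_mult no_pure_terms_add no_pure_terms_Dz[OF f1 f1'] no_pure_terms_P)
  ultimately have g1_0: "g1 = 0"
    using pure_terms_vanish[OF g1] d by simp
  have E2: "Dz f1 P + Db f1 P = P * B"
  proof -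
    have "2 * I * (Dz f1 P + Db f1 P) = 2 * I * (P * B)"
      using r1 by (simp add: B1 g1_0 tau_Dz real tauI algebra_simps del: mult_cancel_left flip: I_def)
    then show ?thesis by (rule double_mult_cancel[OF _ I0])
  qed
  have r0': "g0 - tau g0 = 2 * I * (Dz f0 P + Db f0 P) - 2 * (Dz f1 P - Db f1 P) * P"
  proof -
    have "g0 - tau g0 = 2 * I * (Dz f0 P + Db f0 P) + 2 * (I * I) * (Dz f1 P - Db f1 P) * P"
      using r0 by (simp add: B0 B1 g1_0 tau_Dz real tauI algebra_simps flip: I_def)
    then show ?thesis unfolding II by (simp add: algebra_simps)
  qed
  have "no_pure_terms (2 * I * (Dz f0 P + Db f0 P) - 2 * (Dz f1 P - Db f1 P) * P)"
    by (intro no_pure_terms_diff no_pure_terms_mult no_pure_terms_add no_pure_terms_Dz[OF f0 f0'] no_pure_terms_P)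
  then have g0_0: "g0 = 0"
    using pure_terms_vanish[OF g0 _ r0'] d by simp
  have ZP: "Dz f0 P + Db f0 P = - (I * P * (Dz f1 P - Db f1 P))"
  proof -
    have "2 * I * (Dz f0 P + Db f0 P) = 2 * (Dz f1 P - Db f1 P) * P"
      using r0' by (simp only: g0_0 tau_simps) simp
    also have "\<dots> = 2 * I * (- (I * P * (Dz f1 P - Db f1 P)))"
      using II by Groebner_Basis.algebra
    finally have "2 * I * (Dz f0 P + Db f0 P) = 2 * I * (- (I * P * (Dz f1 P - Db f1 P)))" .
    then show ?thesis by (rule double_mult_cancel[OF _ I0])
  qed
  have B': "B = g - 2 * I * Dz a P" by (simp add: B I_def)
  have DE1: "2 * I * (Dz F (Dz a P) + Dz F (Db a P)) = Dz F g"
    "2 * I * (Db F (Dz a P) + Db F (Db a P)) = - tau (Dz F g)" for F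
    using arg_cong[OF E1, of "Dz F"] arg_cong[OF E1, of "Db F"] const
    by (simp_all add: add diff mult num dg)
  have DE2: "Dz F (Dz f1 P) + Dz F (Db f1 P) = Dz F P * B + P * Dz F B"
    "Db F (Dz f1 P) + Db F (Db f1 P) = Db F P * B + P * Db F B" for F
    using arg_cong[OF E2, of "Dz F"] arg_cong[OF E2, of "Db F"] by (simp_all add: add mult)
  have DB: "Dz F B = Dz F g - 2 * I * Dz F (Dz a P)" "Db F B = - (2 * I * Db F (Dz a P))" for F
    unfolding B' using const by (simp_all add: add diff mult num dg)
  have DZ: "Dz F (Dz f0 P) + Dz F (Db f0 P) =
      - (I * (Dz F P * (Dz f1 P - Db f1 P) + P * (Dz F (Dz f1 P) - Dz F (Db f1 P))))"
    "Db F (Dz f0 P) + Db F (Db f0 P) =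
      - (I * (Db F P * (Dz f1 P - Db f1 P) + P * (Db F (Dz f1 P) - Db F (Db f1 P))))" for F
    using arg_cong[OF ZP, of "Dz F"] arg_cong[OF ZP, of "Db F"] const
    by (simp_all add: add diff mult minus algebra_simps)

  have Xp: "2 * I * Dz a P = g - B" and Xq: "2 * I * Db a P = B - tau g"
    using B' E1 by Groebner_Basis.algebra+

  \<comment> \<open>The correction g a compensates the factor \<open>B\<close> in the identity for
    \<open>f1\<close>. The real part of \<open>Y1\<close> applied to P becomes a difference of pure
    terms, so both sides vanish: [a, f1] = - g a and f1(g) = g^2.\<close>
  define Y1 where "Y1 j = Dz a (f1 j) - Dz f1 (a j) + g * a j" for j
  have DzY1: "Dz Y1 Q = Dz a (Dz f1 Q) - Dz f1 (Dz a Q) + g * Dz a Q" for Q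
    unfolding Y1_def[abs_def] Dz_field_add Dz_field_mult Dz_commutator by simp
  have DbY1: "Db Y1 Q = Db a (Db f1 Q) - Db f1 (Db a Q) + tau g * Db a Q" for Q
    unfolding Db_def[of Y1] DzY1 by (simp add: tau_Dz)
  have hY1: "bihom (d - 1) 0 (Y1 j)" for j
    unfolding Y1_def by (intro bihom_add bihom_diff bihom_degree_cong[OF bihom_Dz[OF f1[of j] a]]
      bihom_degree_cong[OF bihom_Dz[OF a[of j] f1]] bihom_degree_cong[OF bihom_mult[OF g a[of j]]]) (use d in auto)
  have eY1: "2 * I * (Dz Y1 P + Db Y1 P) = (g * g - Dz f1 g) - tau (g * g - Dz f1 g)"
  proof -
    have s1: "Dz a B + Db a B = 0"
      unfolding DB using DE1(1)[of a] cross(9)[of P] by (simp add: algebra_simps)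
    have s2: "Dz a (Dz f1 P) + Db a (Db f1 P) = (Dz a P + Db a P) * B - Db f1 (Dz a P) - Dz f1 (Db a P)"
      using DE2(1)[of a] DE2(2)[of a] s1 cross(3,4)[of P] by Groebner_Basis.algebra
    have "2 * I * (Dz Y1 P + Db Y1 P) = (2 * I * (Dz a P + Db a P)) * B - 2 * I * (Dz f1 (Dz a P) + Dz f1 (Db a P))
        - 2 * I * (Db f1 (Dz a P) + Db f1 (Db a P)) + g * (2 * I * Dz a P) + tau g * (2 * I * Db a P)"
      unfolding DzY1 DbY1 using s2 by Groebner_Basis.algebra
    also have "\<dots> = (g - tau g) * B - Dz f1 g + tau (Dz f1 g) + g * (g - B) + tau g * (B - tau g)"
      unfolding DE1 E1 Xp Xq by simp
    also have "\<dots> = (g * g - Dz f1 g) - tau (g * g - Dz f1 g)"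
      by (simp add: algebra_simps)
    finally show ?thesis .
  qed
  have "g * g - Dz f1 g = 0"
  proof (rule pure_terms_vanish)
    show "bihom (2 * d - 2) 0 (g * g - Dz f1 g)"
      by (intro bihom_diff bihom_degree_cong[OF bihom_mult[OF g g]] bihom_degree_cong[OF bihom_Dz[OF g f1]]) (use d in auto)
    show "no_pure_terms (2 * I * (Dz Y1 P + Db Y1 P))"
      using no_pure_terms_Dz[OF hY1] d by (intro no_pure_terms_mult no_pure_terms_add) auto
  qed (use d eY1 in auto)
  then have f1g: "Dz f1 g = g * g" and "Dz Y1 P + Db Y1 P = 0"
    using eY1 I0 by auto
  then have "Y1 = (\<lambda>_. 0)"
    using rigid[of "d - 1" Y1] d hY1 by simp
  then have "Dz Y1 Q = 0" "Db Y1 Q = 0" for Q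
    by (simp_all add: Dz_def Db_def)
  then have com1: "Dz a (Dz f1 Q) = Dz f1 (Dz a Q) - g * Dz a Q"
    "Db a (Db f1 Q) = Db f1 (Db a Q) - tau g * Db a Q" for Q
    unfolding DzY1 DbY1 by (simp_all add: algebra_simps)

  \<comment> \<open>The same pattern: after adding g f1 only the pure terms of f0(g) remain, which
    gives f0(g) = 0 and [a, f0] = - g f1.\<close>
  define Y2 where "Y2 j = Dz a (f0 j) - Dz f0 (a j) + g * f1 j" for j
  have DzY2: "Dz Y2 Q = Dz a (Dz f0 Q) - Dz f0 (Dz a Q) + g * Dz f1 Q" for Q
    unfolding Y2_def[abs_def] Dz_field_add Dz_field_mult Dz_commutator by simp
  have DbY2: "Db Y2 Q = Db a (Db f0 Q) - Db f0 (Db a Q) + tau g * Db f1 Q" for Q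
    unfolding Db_def[of Y2] DzY2 by (simp add: tau_Dz)
  have hY2: "bihom (2 * d - 1) 0 (Y2 j)" for j
    unfolding Y2_def by (intro bihom_add bihom_diff bihom_degree_cong[OF bihom_Dz[OF f0[of j] a]]
      bihom_degree_cong[OF bihom_Dz[OF a[of j] f0]] bihom_degree_cong[OF bihom_mult[OF g f1[of j]]]) (use d in auto)
  have eY2: "- (2 * I * (Dz Y2 P + Db Y2 P)) = Dz f0 g - tau (Dz f0 g)"
  proof -
    have tf1g: "tau (Dz f1 g) = tau g * tau g" by (simp add: f1g)
    have "2 * I * (Dz a (Dz f1 P) - Dz a (Db f1 P) + Db a (Dz f1 P) - Db a (Db f1 P)) =
        2 * I * (Dz f1 (Dz a P) + Dz f1 (Db a P)) - 2 * I * (Db f1 (Dz a P) + Db f1 (Db a P))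
        - g * (2 * I * Dz a P) + tau g * (2 * I * Db a P)"
      unfolding com1 cross(3)[of P] cross(4)[of P, symmetric] by (simp add: algebra_simps)
    also have "\<dots> = (g + tau g) * B"
      unfolding DE1 Xp Xq f1g tf1g by (simp add: algebra_simps)
    finally have t1: "2 * I * (Dz a (Dz f1 P) - Dz a (Db f1 P) + Db a (Dz f1 P) - Db a (Db f1 P)) = (g + tau g) * B" .
    have "Dz a (Dz f0 P) + Db a (Db f0 P) = - (I * ((Dz a P + Db a P) * (Dz f1 P - Db f1 P)
        + P * (Dz a (Dz f1 P) - Dz a (Db f1 P) + Db a (Dz f1 P) - Db a (Db f1 P)))) - Db f0 (Dz a P) - Dz f0 (Db a P)"
      using DZ(1)[of a] DZ(2)[of a] cross(1,2)[of P] by Groebner_Basis.algebra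
    then have "2 * I * (Dz a (Dz f0 P) + Db a (Db f0 P)) = - (I * ((2 * I * (Dz a P + Db a P)) * (Dz f1 P - Db f1 P)
        + P * (2 * I * (Dz a (Dz f1 P) - Dz a (Db f1 P) + Db a (Dz f1 P) - Db a (Db f1 P)))))
        - 2 * I * Db f0 (Dz a P) - 2 * I * Dz f0 (Db a P)"
      by Groebner_Basis.algebra
    also have "\<dots> = - (I * ((g - tau g) * (Dz f1 P - Db f1 P) + (g + tau g) * (P * B)))
        - 2 * I * Db f0 (Dz a P) - 2 * I * Dz f0 (Db a P)"
      unfolding E1 t1 by (simp add: algebra_simps)
    also have "\<dots> = - (2 * I * (g * Dz f1 P + tau g * Db f1 P)) - 2 * I * Db f0 (Dz a P) - 2 * I * Dz f0 (Db a P)"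
      unfolding E2[symmetric] by Groebner_Basis.algebra
    finally have "- (2 * I * (Dz Y2 P + Db Y2 P)) =
        2 * I * (Dz f0 (Dz a P) + Dz f0 (Db a P)) + 2 * I * (Db f0 (Dz a P) + Db f0 (Db a P))"
      unfolding DzY2 DbY2 by Groebner_Basis.algebra
    then show ?thesis
      unfolding DE1 by simp
  qed
  have "Dz f0 g = 0"
  proof (rule pure_terms_vanish)
    show "bihom (3 * d - 2) 0 (Dz f0 g)"
      by (rule bihom_degree_cong[OF bihom_Dz[OF g f0]]) (use d in auto)
    show "no_pure_terms (- (2 * I) * (Dz Y2 P + Db Y2 P))"
      using no_pure_terms_Dz[OF hY2] d by (intro no_pure_terms_mult no_pure_terms_add) auto
  qed (use d eY2 in auto)
  then have f0g: "Dz f0 g = 0" and "Dz Y2 P + Db Y2 P = 0"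
    using eY2 I0 by auto
  then have "Y2 = (\<lambda>_. 0)"
    using rigid[of "2 * d - 1" Y2] d hY2 by simp
  then have "Dz Y2 Q = 0" "Db Y2 Q = 0" for Q
    by (simp_all add: Dz_def Db_def)
  then have com2: "Dz a (Dz f0 Q) = Dz f0 (Dz a Q) - g * Dz f1 Q"
    "Db a (Db f0 Q) = Db f0 (Db a Q) - tau g * Db f1 Q" for Q
    unfolding DzY2 DbY2 by (simp_all add: algebra_simps)

  \<comment> \<open>Here no correction is added: the relations already found for \<open>g\<close>,
    f1(g) and f0(g) cancel whatever the factor \<open>B\<close> produces, so \<open>f1\<close> and
    \<open>f0\<close> commute.\<close>
  define Y3 where "Y3 j = Dz f1 (f0 j) - Dz f0 (f1 j)" for j
  have DzY3: "Dz Y3 Q = Dz f1 (Dz f0 Q) - Dz f0 (Dz f1 Q)" for Q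
    unfolding Y3_def[abs_def] Dz_commutator by simp
  have DbY3: "Db Y3 Q = Db f1 (Db f0 Q) - Db f0 (Db f1 Q)" for Q
    unfolding Db_def[of Y3] DzY3 by (simp add: tau_Dz)
  have hY3: "bihom (3 * d - 1) 0 (Y3 j)" for j
    unfolding Y3_def by (intro bihom_diff bihom_degree_cong[OF bihom_Dz[OF f0[of j] f1]]
      bihom_degree_cong[OF bihom_Dz[OF f1[of j] f0]]) (use d in auto)
  have "Dz Y3 P + Db Y3 P = 0"
  proof -
    define u v p where "u = Dz f1 P" and "v = Db f1 P" and "p = Dz a P"
    have Bp: "B = g - 2 * I * p" by (simp add: B' p_def)
    have 1: "Dz Y3 P + Db Y3 P = (Dz f1 (Dz f0 P) + Dz f1 (Db f0 P)) + (Db f1 (Dz f0 P) + Db f1 (Db f0 P))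
        - (Dz f0 (Dz f1 P) + Dz f0 (Db f1 P)) - (Db f0 (Dz f1 P) + Db f0 (Db f1 P))"
      unfolding DzY3 DbY3 using cross(5,6)[of P] by simp
    have 2: "Dz f1 u - Db f1 v = (u - v) * B + P * (Dz f1 B - Db f1 B)"
      using DE2[of f1] cross(7)[of P] unfolding u_def v_def by Groebner_Basis.algebra
    have 3: "Dz f1 B - Db f1 B = g * g - 2 * I * (Dz a u + g * p - Dz a v)"
      unfolding DB f1g u_def v_def p_def using com1(1)[of P] cross(3)[of P] by (simp add: algebra_simps)
    have "Dz f0 B + Db f0 B = - (2 * I * (Dz a (Dz f0 P) + Dz a (Db f0 P) + g * u))"
      unfolding DB f0g u_def using com2(1)[of P] cross(1)[of P] by ((simp add: algebra_simps; fail) | Groebner_Basis.algebra)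
    also have "\<dots> = - (2 * I * (- (I * (p * (u - v) + P * (Dz a u - Dz a v))) + g * u))"
      unfolding DZ u_def v_def p_def by simp
    also have "\<dots> = - (2 * p * (u - v)) - 2 * P * (Dz a u - Dz a v) - 2 * I * g * u"
      using II by Groebner_Basis.algebra
    finally have 4: "Dz f0 B + Db f0 B = - (2 * p * (u - v)) - 2 * P * (Dz a u - Dz a v) - 2 * I * g * u" .
    have "Dz Y3 P + Db Y3 P = - (I * ((u + v) * (u - v) + P * (Dz f1 u - Db f1 v)))
        - ((Dz f0 P + Db f0 P) * B + P * (Dz f0 B + Db f0 B))"
      unfolding 1 DZ DE2[of f0] u_def v_def using cross(7)[of P] by ((simp add: algebra_simps; fail) | Groebner_Basis.algebra)
    also have "\<dots> = - (I * ((u + v) * (u - v) + P * ((u - v) * B + P * (g * g - 2 * I * (Dz a u + g * p - Dz a v)))))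
        - (- (I * P * (u - v)) * B + P * (- (2 * p * (u - v)) - 2 * P * (Dz a u - Dz a v) - 2 * I * g * u))"
      unfolding ZP u_def[symmetric] v_def[symmetric] unfolding 2 3 4 ..
    also have "\<dots> = 0"
      using E2[folded u_def v_def] Bp II by Groebner_Basis.algebra
    finally show ?thesis .
  qed
  then have "Y3 = (\<lambda>_. 0)"
    using rigid[of "3 * d - 1" Y3] d hY3 by simp
  then have "Dz Y3 Q = 0" "Db Y3 Q = 0" for Q
    by (simp_all add: Dz_def Db_def)
  then have com3: "Dz f1 (Dz f0 Q) = Dz f0 (Dz f1 Q)" "Db f1 (Db f0 Q) = Db f0 (Db f1 Q)" for Q
    unfolding DzY3 DbY3 by simp_all

  let ?M = "\<lambda>Q. Dz f1 Q - Db f1 Q" and ?Z = "\<lambda>Q. Dz f0 Q + Db f0 Q"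
  have ZP': "Dz f0 P + Db f0 P = cst (- \<i> / 2) * (Dz f1 (P * P) - Db f1 (P * P))"
  proof -
    have "cst (- \<i> / 2) * 2 = - I"
      unfolding I_def by (auto intro!: pring_eqI)
    then show ?thesis using ZP unfolding mult by Groebner_Basis.algebra
  qed
  have pow: "(Dz f0 ^^ N) (Dz f1 Q) = Dz f1 ((Dz f0 ^^ N) Q)" "(Dz f0 ^^ N) (Db f1 Q) = Db f1 ((Dz f0 ^^ N) Q)" for N Q
    by (induction N) (simp_all add: com3 cross)
  have "\<exists>N. (Dz f0 ^^ N) P = 0"
  proof (rule field_nilpotent[where e = "d - 1" and A = "Dz f1" and A' = "Db f1", OF _ derivation_Dz _ derivation_Db _ ZP'])
    show "bihom (d + (d - 1) + 1) 0 (f0 j)" for j using f0[of j] d by (simp add: mult_2)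
    show "bihom (p + (d - 1)) q (Dz f1 Q)" if "bihom p q Q" for p q Q
      using bihom_Dz[OF that f1] d by simp
    show "bihom p (q + (d - 1)) (Db f1 Q)" if "bihom p q Q" for p q Q
      using bihom_Db[OF that f1] d by simp
    show "\<exists>N. (Dz f0 ^^ N) (Dz f1 Q) = 0" "\<exists>N. (Dz f0 ^^ N) (Db f1 Q) = 0" if "(Dz f0 ^^ N) Q = 0" for N Q
      using that by (auto intro!: exI[of _ N] simp: pow derivation_0[OF derivation_Dz] derivation_0[OF derivation_Db])
  qed
  then obtain N where N: "(Dz f0 ^^ N) P = 0" by blast
  have "?M P = 0"
  proof (rule nilpotent_burgers[of ?Z ?M "cst (- \<i> / 2)"])
    show "derivation ?Z" "derivation ?M"
      by (intro derivation_sum_of derivation_diff_of derivation_Dz derivation_Db)+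
    show "Dz f0 (Dz f1 x - Db f1 x) + Db f0 (Dz f1 x - Db f1 x) =
        Dz f1 (Dz f0 x + Db f0 x) - Db f1 (Dz f0 x + Db f0 x)" for x
      using com3[of x] cross[of x] by (simp add: add diff)
    show "((\<lambda>Q. Dz f0 Q + Db f0 Q) ^^ (N + N)) P = 0"
      by (rule nilpotent_total[OF hol0 N nilpotent_conjugate[OF N]])
  qed (simp_all add: ZP')
  then have eq: "Dz f1 P = Db f1 P" by simp
  \<comment> \<open>In f1(P) all degrees in z are at least \<open>d\<close>, in the conjugate
    expression they are below \<open>d\<close>; equality therefore kills every component.\<close>
  have "Dz f1 (Pc p) = 0" if p: "p \<in> {1..<d}" for p
  proof -
    have h: "bihom (k + d - 1) (d - k) (Dz f1 (Pc k))" "bihom k (d - k + d - 1) (Db f1 (Pc k))" if "k \<in> {1..<d}" for k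
      using bihom_Dz[OF bihom_comp[OF that] f1] bihom_Db[OF bihom_comp[OF that] f1] .
    have "zcomp (p + d - 1) (Dz f1 P) = (\<Sum>k\<in>{1..<d}. zcomp (p + d - 1) (Dz f1 (Pc k)))"
      by (subst sum_comp) (simp add: zcomp_sum derivation_sum[OF derivation_Dz])
    also have "\<dots> = (\<Sum>k\<in>{1..<d}. if k = p then Dz f1 (Pc k) else 0)"
      using zcomp_bihom[OF h(1)] d by (intro sum.cong) auto
    also have "\<dots> = Dz f1 (Pc p)" using p by simp
    finally have "Dz f1 (Pc p) = zcomp (p + d - 1) (Db f1 P)" by (simp add: eq)
    also have "\<dots> = (\<Sum>k\<in>{1..<d}. zcomp (p + d - 1) (Db f1 (Pc k)))"
      by (subst sum_comp) (simp add: zcomp_sum derivation_sum[OF derivation_Db])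
    also have "\<dots> = 0"
      using zcomp_bihom[OF h(2)] p by (intro sum.neutral) auto
    finally show ?thesis .
  qed
  then have "Dz f1 P = 0"
    by (subst sum_comp) (simp add: derivation_sum[OF derivation_Dz])
  then have "P * B = 0" using E2 eq by simp
  then have "B = 0" using nonzero by simp
  then have g_eq: "g = 2 * I * Dz a P" using B' by simp
  \<comment> \<open>Now \<open>g\<close> equals 2 i a(P), and a constant holomorphic field leaves
    the conjugate variables in every term of P. A holomorphic \<open>g\<close> of this form is
    zero.\<close>
  have "ev g (z, 0) = 0" for z
  proof -
    have "ev (Dz a P) (z, 0) = (\<Sum>p\<in>{1..<d}. ev (Dz a (Pc p)) (z, 0))"
      by (subst sum_comp) (simp add: derivation_sum[OF derivation_Dz])
    also have "\<dots> = 0"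
      using bihom_at_0(2)[OF bihom_Dz[OF bihom_comp a]] by (intro sum.neutral) auto
    finally show ?thesis by (simp add: g_eq)
  qed
  then have "g = 0"
    using holg by (intro pring_eqI) (auto simp: hol_def)
  then show ?thesis using g_eq I0 by simp
qed

end

section \<open>Translation between coefficient families and ring elements\<close>

section \<open>Coefficient families and chains\<close>

definition mon :: "('n::finite \<Rightarrow> nat) \<Rightarrow> 'n pring" where "mon \<alpha> = (\<Prod>j\<in>UNIV. Zv j ^ \<alpha> j)"

definition term_of :: "complex \<Rightarrow> ('n::finite \<Rightarrow> nat) \<times> ('n \<Rightarrow> nat) \<Rightarrow> 'n pring" where
  "term_of c k = cst c * (mon (fst k) * tau (mon (snd k)))"

definition cplx :: "'n::finite bipoly \<Rightarrow> 'n pring" where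
  "cplx P = (\<Sum>k\<in>Poly_Mapping.keys P. term_of (Poly_Mapping.lookup P k) k)"

lemma ev_mon [simp]: "ev (mon \<alpha>) (z, w) = monom_eval \<alpha> z"
  by (simp add: mon_def monom_eval_def)

lemma mon_add: "mon \<alpha> * mon \<beta> = mon (\<lambda>j. \<alpha> j + \<beta> j)"
  by (simp add: mon_def power_add prod.distrib)

lemma mon_0: "mon (\<lambda>_. 0) = 1"
  by (simp add: mon_def)

lemma mon_axis: "mon (\<lambda>k. if k = j then 1 else 0) = Zv j"
proof -
  have "(\<Prod>k\<in>UNIV. Zv k ^ (if k = j then 1 else 0)) = (\<Prod>k\<in>UNIV. if k = j then Zv k else 1)"
    by (intro prod.cong) auto
  then show ?thesis by (simp add: mon_def)
qed

lemma bihom_mon: "bihom (sum \<alpha> UNIV) 0 (mon \<alpha>)"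
proof -
  have "bihom (\<Sum>j\<in>UNIV. \<alpha> j * 1) (\<Sum>j\<in>UNIV. \<alpha> j * 0) (mon \<alpha>)"
    unfolding mon_def by (intro bihom_prod bihom_power bihom_Zv)
  then show ?thesis by simp
qed

lemma hol_mon: "hol (mon \<alpha>)"
  by (rule bihom_hol[OF bihom_mon])

lemma bihom_term_of: "bihom (sum (fst k) UNIV) (sum (snd k) UNIV) (term_of c k)"
  unfolding term_of_def using bihom_cst_mult[OF bihom_mult[OF bihom_mon bihom_tau[OF bihom_mon]]] by simp

lemma cplx_superset:
  assumes "finite S" "Poly_Mapping.keys P \<subseteq> S"
  shows "cplx P = (\<Sum>k\<in>S. term_of (Poly_Mapping.lookup P k) k)"
  unfolding cplx_def using assms
  by (intro sum.mono_neutral_left) (auto simp: term_of_def cst_simps in_keys_iff)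

lemma cplx_add: "cplx (P + Q) = cplx P + cplx Q"
proof -
  let ?S = "Poly_Mapping.keys P \<union> Poly_Mapping.keys Q"
  have "cplx (P + Q) = (\<Sum>k\<in>?S. term_of (Poly_Mapping.lookup (P + Q) k) k)"
    by (rule cplx_superset) (simp, rule keys_add)
  also have "\<dots> = (\<Sum>k\<in>?S. term_of (Poly_Mapping.lookup P k) k) + (\<Sum>k\<in>?S. term_of (Poly_Mapping.lookup Q k) k)"
    by (simp add: lookup_add term_of_def cst_simps algebra_simps sum.distrib)
  also have "\<dots> = cplx P + cplx Q"
    using cplx_superset[of ?S P] cplx_superset[of ?S Q] by simp
  finally show ?thesis .
qed

lemma cplx_single: "cplx (Poly_Mapping.single k c) = term_of c k"
  by (cases "c = 0") (simp_all add: cplx_def term_of_def cst_simps)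

lemma cplx_0: "cplx 0 = 0"
  by (simp add: cplx_def)

lemma cplx_sum: "cplx (sum f A) = (\<Sum>i\<in>A. cplx (f i))"
  by (induction A rule: infinite_finite_induct) (simp_all add: cplx_0 cplx_add)

lemma keys_sum_singles: "Poly_Mapping.keys (\<Sum>k\<in>S. Poly_Mapping.single k (c k)) \<subseteq> S"
proof
  fix x assume "x \<in> Poly_Mapping.keys (\<Sum>k\<in>S. Poly_Mapping.single k (c k))"
  then have "(\<Sum>k\<in>S. Poly_Mapping.lookup (Poly_Mapping.single k (c k)) x) \<noteq> 0"
    by (simp add: in_keys_iff lookup_sum)
  then obtain k where "k \<in> S" "Poly_Mapping.lookup (Poly_Mapping.single k (c k)) x \<noteq> 0"
    using sum.neutral by meson
  then show "x \<in> S"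
    by (auto simp: lookup_single when_def split: if_splits)
qed

lemma cplx_surj: "\<exists>P. cplx P = Q"
proof (induction Q)
  case (cst c)
  show ?case by (rule exI[of _ "Poly_Mapping.single (\<lambda>_. 0, \<lambda>_. 0) c"]) (simp add: cplx_single term_of_def mon_0)
next
  case (Zv j)
  show ?case
    by (rule exI[of _ "Poly_Mapping.single (\<lambda>k. if k = j then 1 else 0, \<lambda>_. 0) 1"])
      (simp only: cplx_single term_of_def mon_0 mon_axis cst_simps fst_conv snd_conv tau_simps mult_1 mult_1_right)
next
  case (Wv j)
  show ?case
    by (rule exI[of _ "Poly_Mapping.single (\<lambda>_. 0, \<lambda>k. if k = j then 1 else 0) 1"])
      (simp only: cplx_single term_of_def mon_0 mon_axis cst_simps fst_conv snd_conv tau_simps mult_1 mult_1_right)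
next
  case (add Q R)
  then show ?case by (metis cplx_add)
next
  case (mult Q R)
  then obtain A B where AB: "cplx A = Q" "cplx B = R" by blast
  let ?s = "\<lambda>(k, l). Poly_Mapping.single (\<lambda>j. fst k j + fst l j, \<lambda>j. snd k j + snd l j)
      (Poly_Mapping.lookup A k * Poly_Mapping.lookup B l)"
  have "term_of a k * term_of b l = term_of (a * b) (\<lambda>j. fst k j + fst l j, \<lambda>j. snd k j + snd l j)" for a b k l
    by (simp add: term_of_def mon_add[symmetric] cst_simps mult_ac)
  then have "Q * R = cplx (\<Sum>x\<in>Poly_Mapping.keys A \<times> Poly_Mapping.keys B. ?s x)"
    unfolding AB[symmetric] cplx_def[of A] cplx_def[of B] sum_product sum.cartesian_product cplx_sum
    by (intro sum.cong) (auto simp: cplx_single)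
  from this[symmetric] show ?case by (rule exI)
qed

lemma beval_cplx: "beval P z = ev (cplx P) (z, cnjv z)"
  unfolding beval_def cplx_def ev_sum
  by (intro sum.cong) (auto simp: term_of_def)

lemma heval_superset:
  assumes "finite S" "Poly_Mapping.keys F \<subseteq> S"
  shows "heval F z = (\<Sum>\<alpha>\<in>S. Poly_Mapping.lookup F \<alpha> * monom_eval \<alpha> z)"
  unfolding heval_def using assms by (intro sum.mono_neutral_left) (auto simp: in_keys_iff)

lemma heval_sum_singles:
  assumes "finite S"
  shows "heval (\<Sum>\<alpha>\<in>S. Poly_Mapping.single \<alpha> (c \<alpha>)) z = (\<Sum>\<alpha>\<in>S. c \<alpha> * monom_eval \<alpha> z)"
proof -
  have "Poly_Mapping.lookup (\<Sum>\<alpha>\<in>S. Poly_Mapping.single \<alpha> (c \<alpha>)) \<beta> = c \<beta>" if "\<beta> \<in> S" for \<beta>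
    using assms that by (simp add: lookup_sum lookup_single when_def)
  then show ?thesis
    using heval_superset[OF assms keys_sum_singles, of c z] by simp
qed

lemma sum_nat_eq_0_UNIV: "sum \<beta> UNIV = (0::nat) \<longleftrightarrow> \<beta> = (\<lambda>_::'n::finite. 0)"
  by (auto simp: fun_eq_iff)

text \<open>Chain hypersurfaces are defined through coefficient families, where homogeneity is a
  condition on every key. An arbitrary family for \<open>Q\<close> is cut down to the keys
  (\<alpha>, 0) of degree \<open>t\<close>: neither taking the component of degree \<open>t\<close>
  nor setting the second variable to 0 alters the values of \<open>Q\<close>.\<close>

lemma hpoly_of_bihom:
  assumes "bihom t 0 Q"
  obtains F :: "'n::finite hpoly" where "\<And>z w. heval F z = ev Q (z, w)" "\<And>\<alpha>. \<alpha> \<in> Poly_Mapping.keys F \<Longrightarrow> sum \<alpha> UNIV = t"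
proof -
  obtain B where B: "cplx B = Q" using cplx_surj by blast
  let ?K = "Poly_Mapping.keys B"
  let ?S = "{\<alpha> \<in> fst ` ?K. sum \<alpha> UNIV = t}"
  define F where "F = (\<Sum>\<alpha>\<in>?S. Poly_Mapping.single \<alpha> (Poly_Mapping.lookup B (\<alpha>, \<lambda>_. 0)))"
  have fin: "finite ?S" by simp
  have "heval F z = ev Q (z, w)" for z w
  proof -
    have "Q = zcomp t Q" using zcomp_bihom[OF assms, of t] by simp
    also have "\<dots> = (\<Sum>k\<in>?K. zcomp t (term_of (Poly_Mapping.lookup B k) k))"
      unfolding B[symmetric] cplx_def zcomp_sum ..
    also have "\<dots> = (\<Sum>k\<in>?K. if sum (fst k) UNIV = t then term_of (Poly_Mapping.lookup B k) k else 0)"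
      by (intro sum.cong zcomp_bihom[OF bihom_term_of] refl)
    finally have "ev Q (z, w) = ev (\<Sum>k\<in>?K. if sum (fst k) UNIV = t then term_of (Poly_Mapping.lookup B k) k else 0) (z, 0)"
      using bihom_hol[OF assms] by (simp add: hol_def)
    also have "\<dots> = (\<Sum>k\<in>?K. if sum (fst k) UNIV = t \<and> snd k = (\<lambda>_. 0)
        then Poly_Mapping.lookup B k * monom_eval (fst k) z else 0)"
      unfolding ev_sum
    proof (rule sum.cong)
      fix k assume "k \<in> ?K"
      have "ev (tau (mon (snd k))) (z, 0) = (if snd k = (\<lambda>_. 0) then 1 else 0)"
      proof (cases "snd k = (\<lambda>_. 0)")
        case False
        then have "1 \<le> sum (snd k) UNIV"
          using sum_nat_eq_0_UNIV[of "snd k"] by (simp add: Suc_le_eq del: sum_eq_0_iff)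
        then show ?thesis
          using bihom_at_0(2)[OF bihom_tau[OF bihom_mon]] False by simp
      qed (simp add: mon_0)
      then show "ev (if sum (fst k) UNIV = t then term_of (Poly_Mapping.lookup B k) k else 0) (z, 0) =
          (if sum (fst k) UNIV = t \<and> snd k = (\<lambda>_. 0) then Poly_Mapping.lookup B k * monom_eval (fst k) z else 0)"
        by (auto simp: term_of_def simp del: ev_tau)
    qed simp
    also have "\<dots> = (\<Sum>k\<in>{k\<in>?K. sum (fst k) UNIV = t \<and> snd k = (\<lambda>_. 0)}. Poly_Mapping.lookup B k * monom_eval (fst k) z)"
      by (simp add: sum.inter_filter)
    also have "\<dots> = (\<Sum>\<alpha>\<in>{\<alpha>. sum \<alpha> UNIV = t \<and> (\<alpha>, \<lambda>_. 0) \<in> ?K}. Poly_Mapping.lookup B (\<alpha>, \<lambda>_. 0) * monom_eval \<alpha> z)"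
      by (rule sum.reindex_bij_witness[of _ "\<lambda>\<alpha>. (\<alpha>, \<lambda>_. 0)" fst]) auto
    also have "\<dots> = (\<Sum>\<alpha>\<in>?S. Poly_Mapping.lookup B (\<alpha>, \<lambda>_. 0) * monom_eval \<alpha> z)"
    proof (rule sum.mono_neutral_left)
      show "{\<alpha>. sum \<alpha> UNIV = t \<and> (\<alpha>, \<lambda>_. 0) \<in> ?K} \<subseteq> ?S" by force
    qed (auto simp: in_keys_iff)
    also have "\<dots> = heval F z"
      unfolding F_def by (rule heval_sum_singles[OF fin, symmetric])
    finally show ?thesis by simp
  qed
  moreover have "sum \<alpha> UNIV = t" if "\<alpha> \<in> Poly_Mapping.keys F" for \<alpha>
    using that keys_sum_singles[of "\<lambda>\<alpha>. Poly_Mapping.lookup B (\<alpha>, \<lambda>_. 0)" ?S] unfolding F_def by auto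
  ultimately show ?thesis using that by blast
qed

section \<open>Sums of products of a holomorphic and an antiholomorphic factor\<close>

subsection \<open>Tensor rank\<close>

lemma hol_cst: "hol (cst c)" and hol_0: "hol 0"
  and hol_add: "hol Q \<Longrightarrow> hol R \<Longrightarrow> hol (Q + R)"
  and hol_diff: "hol Q \<Longrightarrow> hol R \<Longrightarrow> hol (Q - R)"
  and hol_mult: "hol Q \<Longrightarrow> hol R \<Longrightarrow> hol (Q * R)"
  unfolding hol_def by (simp_all only: ev_cst ev_0 ev_add ev_diff ev_mult) metis+

lemma hol_minus: "hol Q \<Longrightarrow> hol (- Q)"
  using hol_diff[OF hol_0, of Q] by simp

lemma hol_same: "hol Q \<Longrightarrow> fst x = fst y \<Longrightarrow> ev Q x = ev Q y"
  unfolding hol_def by (metis prod.collapse)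

lemmas hol_simps = hol_minus hol_cst hol_0 hol_add hol_diff hol_mult

lemma hol_sum: "(\<And>i. i \<in> A \<Longrightarrow> hol (f i)) \<Longrightarrow> hol (sum f A)"
  by (induction A rule: infinite_finite_induct) (auto intro: hol_simps)

definition lin_indep :: "'i set \<Rightarrow> ('i \<Rightarrow> 'n::finite pring) \<Rightarrow> bool" where
  "lin_indep I b \<longleftrightarrow> (\<forall>c. (\<Sum>i\<in>I. cst (c i) * b i) = 0 \<longrightarrow> (\<forall>i\<in>I. c i = 0))"

lemma lin_indepD: "lin_indep I b \<Longrightarrow> (\<Sum>i\<in>I. cst (c i) * b i) = 0 \<Longrightarrow> i \<in> I \<Longrightarrow> c i = 0"
  by (auto simp: lin_indep_def)

definition linear_functional :: "('n::finite pring \<Rightarrow> complex) \<Rightarrow> bool" where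
  "linear_functional \<phi> \<longleftrightarrow> (\<forall>Q R. \<phi> (Q + R) = \<phi> Q + \<phi> R) \<and> (\<forall>c Q. \<phi> (cst c * Q) = c * \<phi> Q)"

lemma linear_functional_sum:
  assumes "linear_functional \<phi>"
  shows "\<phi> (\<Sum>i\<in>A. cst (c i) * b i) = (\<Sum>i\<in>A. c i * \<phi> (b i))"
proof -
  have "\<phi> 0 = 0"
    using assms unfolding linear_functional_def by (metis cst_simps(1) mult_zero_left)
  then show ?thesis
    using assms by (induction A rule: infinite_finite_induct) (simp_all add: linear_functional_def)
qed

lemma lin_indep_subset:
  assumes "finite J" "I \<subseteq> J" "lin_indep J b"
  shows "lin_indep I b"
  unfolding lin_indep_def
proof (intro allI impI ballI)
  fix c i
  assume *: "(\<Sum>i\<in>I. cst (c i) * b i) = 0" "i \<in> I"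
  let ?c = "\<lambda>i. if i \<in> I then c i else 0"
  have "(\<Sum>i\<in>J. cst (?c i) * b i) = (\<Sum>i\<in>I. cst (?c i) * b i)"
    using assms by (intro sum.mono_neutral_right) (auto simp: cst_simps)
  also have "\<dots> = 0" using * by simp
  finally have "?c i = 0" using *(2) assms(2) by (intro lin_indepD[OF assms(3)]) auto
  then show "c i = 0" using *(2) by simp
qed

text \<open>The ring is infinite-dimensional over the complex numbers; the functionals are assembled
  inductively from point evaluations.\<close>

lemma dual_functionals:
  fixes b :: "'i \<Rightarrow> 'n::finite pring"
  assumes "finite I" "lin_indep I b"
  shows "\<exists>\<phi>. (\<forall>i. linear_functional (\<phi> i)) \<and> (\<forall>i\<in>I. \<forall>k\<in>I. \<phi> i (b k) = (if i = k then 1 else 0))"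
  using assms
proof (induction I rule: finite_induct)
  case empty
  show ?case by (rule exI[of _ "\<lambda>_ _. 0"]) (simp add: linear_functional_def)
next
  case (insert n I)
  have "lin_indep I b"
    using insert by (intro lin_indep_subset[of "insert n I" I b]) auto
  then obtain \<phi> where \<phi>: "\<And>i. linear_functional (\<phi> i)"
    "\<And>i k. i \<in> I \<Longrightarrow> k \<in> I \<Longrightarrow> \<phi> i (b k) = (if i = k then 1 else 0)"
    using insert.IH by blast
  define r where "r = b n - (\<Sum>i\<in>I. cst (\<phi> i (b n)) * b i)"
  have "r \<noteq> 0"
  proof
    assume "r = 0"
    let ?c = "\<lambda>i. if i = n then 1 else - \<phi> i (b n)"
    have "(\<Sum>i\<in>I. cst (?c i) * b i) = - (\<Sum>i\<in>I. cst (\<phi> i (b n)) * b i)"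
      unfolding sum_negf[symmetric] using insert.hyps(2) by (intro sum.cong) (auto simp: cst_simps)
    then have "(\<Sum>i\<in>insert n I. cst (?c i) * b i) = 0"
      using insert.hyps \<open>r = 0\<close> by (simp add: r_def cst_simps)
    then have "?c n = 0"
      by (rule lin_indepD[OF insert.prems]) simp
    then show False by simp
  qed
  then obtain x where x: "ev r x \<noteq> 0" by (metis ev_0 pring_eqI)
  \<comment> \<open>Evaluation at a point where the residue \<open>r\<close> of the new vector is
    nonzero, corrected so as to vanish on the old vectors and normalised by the value of
    \<open>r\<close>.\<close>
  define \<psi> where "\<psi> Q = (ev Q x - (\<Sum>i\<in>I. ev (b i) x * \<phi> i Q)) / ev r x" for Q
  have \<psi>: "linear_functional \<psi>"
    using \<phi>(1) unfolding linear_functional_def \<psi>_def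
    by (auto simp: sum.distrib sum_distrib_left algebra_simps diff_divide_distrib add_divide_distrib)
  have \<psi>I: "\<psi> (b k) = 0" if "k \<in> I" for k
  proof -
    have "(\<Sum>i\<in>I. ev (b i) x * \<phi> i (b k)) = (\<Sum>i\<in>I. if i = k then ev (b i) x else 0)"
      using \<phi>(2) that by (intro sum.cong) auto
    then show ?thesis using that insert.hyps by (simp add: \<psi>_def)
  qed
  have \<psi>n: "\<psi> (b n) = 1"
    using x by (simp add: \<psi>_def r_def mult.commute)
  define \<phi>' where "\<phi>' i = (if i = n then \<psi> else (\<lambda>Q. \<phi> i Q - \<phi> i (b n) * \<psi> Q))" for i
  have "linear_functional (\<phi>' i)" for i
    using \<psi> \<phi>(1)[of i] by (auto simp: \<phi>'_def linear_functional_def algebra_simps)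
  moreover have "\<phi>' i (b k) = (if i = k then 1 else 0)" if "i \<in> insert n I" "k \<in> insert n I" for i k
    using that \<psi>I \<psi>n \<phi>(2) insert.hyps(2) by (auto simp: \<phi>'_def)
  ultimately show ?case by blast
qed

text \<open>Freezing z leaves a linear relation among the \<open>b i\<close> whose coefficients are
  the conjugated values of the \<open>a i\<close>.\<close>

lemma tensor_eq_0:
  assumes "\<And>i. i \<in> I \<Longrightarrow> hol (a i)" "\<And>i. i \<in> I \<Longrightarrow> hol (b i)"
    and "(\<Sum>i\<in>I. a i * tau (b i)) = 0" and "lin_indep I b" and "i \<in> I"
  shows "a i = 0"
proof (rule pring_eqI)
  fix x :: "'b zpair"
  obtain z w where x: "x = (z, w)" by force
  have "(\<Sum>i\<in>I. cst (cnj (ev (a i) (z, 0))) * b i) = 0"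
  proof (rule pring_eqI)
    fix y :: "'b zpair"
    have "0 = ev (\<Sum>i\<in>I. a i * tau (b i)) (z, cnjv (fst y))"
      using assms(3) by simp
    also have "ev (\<Sum>i\<in>I. a i * tau (b i)) (z, cnjv (fst y)) = (\<Sum>i\<in>I. ev (a i) (z, 0) * cnj (ev (b i) (fst y, snd y)))"
      unfolding ev_sum
    proof (rule sum.cong)
      fix i assume "i \<in> I"
      then have "ev (a i) (z, cnjv (fst y)) = ev (a i) (z, 0)" "ev (b i) (fst y, cnjv z) = ev (b i) (fst y, snd y)"
        using assms(1,2) unfolding hol_def by metis+
      then show "ev (a i * tau (b i)) (z, cnjv (fst y)) = ev (a i) (z, 0) * cnj (ev (b i) (fst y, snd y))"
        by simp
    qed simp
    finally have "(\<Sum>i\<in>I. ev (a i) (z, 0) * cnj (ev (b i) (fst y, snd y))) = 0" by simp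
    then have "cnj (\<Sum>i\<in>I. ev (a i) (z, 0) * cnj (ev (b i) (fst y, snd y))) = 0" by simp
    then show "ev (\<Sum>i\<in>I. cst (cnj (ev (a i) (z, 0))) * b i) y = ev 0 y"
      by simp
  qed
  then have "cnj (ev (a i) (z, 0)) = 0"
    by (rule lin_indepD[OF assms(4) _ assms(5)])
  moreover have "ev (a i) (z, w) = ev (a i) (z, 0)"
    using assms(1)[OF assms(5)] unfolding hol_def by blast
  ultimately show "ev (a i) x = ev 0 x"
    by (simp add: x)
qed

lemma tensor_eq_0':
  assumes "\<And>i. i \<in> I \<Longrightarrow> hol (a i)" "\<And>i. i \<in> I \<Longrightarrow> hol (b i)"
    and "(\<Sum>i\<in>I. a i * tau (b i)) = 0" and "lin_indep I a" and "i \<in> I"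
  shows "b i = 0"
proof (rule tensor_eq_0[of I b a])
  have "tau (\<Sum>i\<in>I. a i * tau (b i)) = 0" using assms(3) by simp
  then show "(\<Sum>i\<in>I. b i * tau (a i)) = 0" by (simp add: tau_sum mult.commute)
qed (use assms in auto)

definition tensor_rep :: "'n::finite pring \<Rightarrow> nat set \<Rightarrow> (nat \<Rightarrow> 'n pring) \<Rightarrow> (nat \<Rightarrow> 'n pring) \<Rightarrow> bool" where
  "tensor_rep T I a b \<longleftrightarrow> finite I \<and> (\<forall>i\<in>I. hol (a i) \<and> hol (b i)) \<and> T = (\<Sum>i\<in>I. a i * tau (b i))"

lemma tensor_rep_shorten:
  assumes rep: "tensor_rep T I a b" and "\<not> lin_indep I b"
  shows "\<exists>I' a' b'. tensor_rep T I' a' b' \<and> card I' < card I"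
proof -
  obtain c k where c: "(\<Sum>i\<in>I. cst (c i) * b i) = 0" "k \<in> I" "c k \<noteq> 0"
    using assms(2) unfolding lin_indep_def by blast
  have fin: "finite I" and hol: "\<And>i. i \<in> I \<Longrightarrow> hol (a i)" "\<And>i. i \<in> I \<Longrightarrow> hol (b i)"
    and T: "T = (\<Sum>i\<in>I. a i * tau (b i))"
    using rep by (auto simp: tensor_rep_def)
  let ?I = "I - {k}"
  define a' where "a' i = a i - cst (cnj (c i / c k)) * a k" for i
  have "cst (c k) * b k = - (\<Sum>i\<in>?I. cst (c i) * b i)"
    using c fin by (simp add: sum.remove[of I k] eq_neg_iff_add_eq_0)
  then have "cst (1 / c k) * (cst (c k) * b k) = cst (1 / c k) * (- (\<Sum>i\<in>?I. cst (c i) * b i))" by simp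
  moreover have "cst (1 / c k) * (cst (c k) * b k) = b k"
    using c by (intro pring_eqI) simp
  moreover have "cst (1 / c k) * (- (\<Sum>i\<in>?I. cst (c i) * b i)) = - (\<Sum>i\<in>?I. cst (c i / c k) * b i)"
    by (intro pring_eqI) (simp add: sum_distrib_left sum_divide_distrib)
  ultimately have bk: "b k = - (\<Sum>i\<in>?I. cst (c i / c k) * b i)" by simp
  have "T = a k * tau (b k) + (\<Sum>i\<in>?I. a i * tau (b i))"
    using c fin by (simp add: T sum.remove[of I k])
  also have "tau (b k) = - (\<Sum>i\<in>?I. cst (cnj (c i / c k)) * tau (b i))"
    by (subst bk) (simp add: tau_sum)
  also have "a k * (- (\<Sum>i\<in>?I. cst (cnj (c i / c k)) * tau (b i))) + (\<Sum>i\<in>?I. a i * tau (b i)) =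
      (\<Sum>i\<in>?I. a' i * tau (b i))"
    by (simp add: a'_def algebra_simps sum_subtractf sum_distrib_left)
  finally have "tensor_rep T ?I a' b"
    using fin hol c by (auto simp: tensor_rep_def a'_def intro!: hol_simps)
  then show ?thesis
    using fin c by (metis card_Diff1_less)
qed

lemma tensor_rep_tau: "tensor_rep T I a b \<Longrightarrow> tensor_rep (tau T) I b a"
  by (auto simp: tensor_rep_def tau_sum mult.commute)

text \<open>A representation with the least number of terms is independent on both sides, since a
  relation on either side would let the other terms absorb one of them.\<close>

lemma tensor_rep_independent:
  assumes "tensor_rep T I a b"
  shows "\<exists>I a b. tensor_rep T I a b \<and> lin_indep I a \<and> lin_indep I b"
proof -
  define m where "m = (LEAST m. \<exists>I a b. tensor_rep T I a b \<and> card I = m)"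
  have "\<exists>m I a b. tensor_rep T I a b \<and> card I = m" using assms by blast
  then have "\<exists>I a b. tensor_rep T I a b \<and> card I = m"
    unfolding m_def by (rule LeastI_ex)
  then obtain I a b where *: "tensor_rep T I a b" "card I = m" by blast
  have least: "\<not> (tensor_rep T I' a' b' \<and> card I' < m)" for I' a' b'
    using not_less_Least[of "card I'"] unfolding m_def by blast
  have "lin_indep I b"
    using tensor_rep_shorten[OF *(1)] least *(2) by blast
  moreover have "lin_indep I a"
  proof (rule ccontr)
    assume "\<not> lin_indep I a"
    then obtain I' a' b' where "tensor_rep (tau T) I' a' b'" "card I' < card I"
      using tensor_rep_shorten[OF tensor_rep_tau[OF *(1)]] by blast
    then show False
      using tensor_rep_tau[of "tau T" I' a' b'] least *(2) by simp
  qed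
  ultimately show ?thesis using * by blast
qed


section \<open>Decomposition of an invariant polynomial into chains\<close>

subsection \<open>Chains of a nilpotent field\<close>

text \<open>With U^(k) = Y^(k-1) x and V^(k) = (-1)^(k-1) Y^(k-1) y this pairs U^(k) with V^(l-k+1).
  The signs make Y + conj Y telescope along the sum, so the element is invariant as soon as Y^l
  kills \<open>x\<close> and \<open>y\<close>.\<close>

definition chain_el :: "('n::finite \<Rightarrow> 'n pring) \<Rightarrow> nat \<Rightarrow> 'n pring \<Rightarrow> 'n pring \<Rightarrow> 'n pring" where
  "chain_el Y l x y = (\<Sum>k<l. (Dz Y ^^ k) x * tau (cst ((-1) ^ (l - 1 - k)) * (Dz Y ^^ (l - 1 - k)) y))"

lemma hol_Dz:
  fixes Q :: "'n::finite pring"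
  assumes Y: "\<And>j. hol (Y j)" and Q: "hol Q"
  shows "hol (Dz Y Q)"
proof -
  have "hol (dz j Q)" for j
    unfolding hol_def
  proof (intro allI)
    fix z w :: "complex ^ 'n"
    have eq: "ev Q = (\<lambda>x. ev Q (fst x, 0))"
      using Q by (auto simp: hol_def fun_eq_iff)
    have "((\<lambda>x. ev Q (fst x, 0)) has_derivative (\<lambda>v. \<Sum>j\<in>UNIV. fst v $ j * ev (dz j Q) (z, 0))) (at (z, w))"
      using has_derivative_compose[OF has_derivative_Pair[OF has_derivative_fst[OF has_derivative_ident] has_derivative_const[where c = 0]]
        ev_has_derivative[where Q = Q], where x = "(z, w)" and s = UNIV] by simp
    then have "(ev Q has_derivative (\<lambda>v. \<Sum>j\<in>UNIV. fst v $ j * ev (dz j Q) (z, 0))) (at (z, w))"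
      by (subst eq)
    from ev_dz_eq[OF this] show "ev (dz j Q) (z, w) = ev (dz j Q) (z, 0)"
      by (simp add: axis_nth_mult)
  qed
  then show ?thesis
    unfolding Dz_def by (intro hol_sum hol_mult Y)
qed

lemma hol_Dz_funpow: "(\<And>j. hol (Y j)) \<Longrightarrow> hol Q \<Longrightarrow> hol ((Dz Y ^^ k) Q)"
  by (induction k) (auto intro: hol_Dz)

lemma Dz_funpow_mult_tau:
  assumes "hol b"
  shows "(Dz Y ^^ k) (a * tau b) = (Dz Y ^^ k) a * tau b"
  by (induction k) (simp_all add: derivation_mult[OF derivation_Dz] Dz_tau_hol assms)

lemma Db_funpow_mult_tau:
  assumes "hol a" "\<And>j. hol (Y j)" "hol b"
  shows "(Db Y ^^ k) (a * tau b) = a * tau ((Dz Y ^^ k) b)"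
  by (induction k) (simp_all add: derivation_mult[OF derivation_Db] Db_hol assms tau_Dz)

lemma Db_cst_mult: "Db Y (cst c * Q) = cst c * Db Y Q" and Dz_cst_mult: "Dz Y (cst c * Q) = cst c * Dz Y Q"
  by (simp_all add: derivation_mult[OF derivation_Db] derivation_mult[OF derivation_Dz])

lemma Dz_funpow_cst_mult: "(Dz Y ^^ k) (cst c * Q) = cst c * (Dz Y ^^ k) Q"
  by (rule derivation_funpow_const_mult[OF derivation_Dz]) simp

lemma chain_el_invariant:
  assumes Y: "\<And>j. hol (Y j)" and "hol x" "hol y" and "(Dz Y ^^ l) x = 0" "(Dz Y ^^ l) y = 0"
  shows "Dz Y (chain_el Y l x y) + Db Y (chain_el Y l x y) = 0"
proof (cases l)
  case (Suc m)
  define g where "g k = (Dz Y ^^ k) x * tau (cst ((-1) ^ (l - k)) * (Dz Y ^^ (l - k)) y)" for k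
  have "Dz Y (chain_el Y l x y) + Db Y (chain_el Y l x y) =
      (\<Sum>k<l. Dz Y ((Dz Y ^^ k) x * tau (cst ((-1) ^ (l - 1 - k)) * (Dz Y ^^ (l - 1 - k)) y)) +
        Db Y ((Dz Y ^^ k) x * tau (cst ((-1) ^ (l - 1 - k)) * (Dz Y ^^ (l - 1 - k)) y)))"
    by (simp add: chain_el_def derivation_sum[OF derivation_Dz] derivation_sum[OF derivation_Db] sum.distrib)
  also have "\<dots> = (\<Sum>k<l. g (Suc k) - g k)"
  proof (rule sum.cong)
    fix k assume "k \<in> {..<l}"
    then have k: "l - k = Suc (l - 1 - k)" "l - Suc k = l - 1 - k" by auto
    let ?t = "cst ((-1) ^ (l - 1 - k)) * (Dz Y ^^ (l - 1 - k)) y"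
    have "Dz Y ((Dz Y ^^ k) x * tau ?t) = g (Suc k)"
      using Dz_funpow_mult_tau[of ?t 1 Y] assms unfolding g_def k
      by (simp add: hol_simps hol_Dz_funpow del: tau_simps)
    moreover have "Db Y ((Dz Y ^^ k) x * tau ?t) = - g k"
      using Db_funpow_mult_tau[of "(Dz Y ^^ k) x" Y ?t 1] assms unfolding g_def k
      by (simp add: hol_simps hol_Dz_funpow Dz_cst_mult cst_simps)
    ultimately show "Dz Y ((Dz Y ^^ k) x * tau ?t) + Db Y ((Dz Y ^^ k) x * tau ?t) = g (Suc k) - g k"
      by simp
  qed simp
  also have "\<dots> = g l - g 0"
    by (rule sum_lessThan_telescope)
  also have "\<dots> = 0"
    using assms by (simp add: g_def)
  finally show ?thesis .
qed (simp add: chain_el_def derivation_0[OF derivation_Dz] derivation_0[OF derivation_Db])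

text \<open>The power \<open>l\<close> annihilates every summand but the first; there Y^l falls on
  \<open>x\<close> and, by construction, stands on \<open>y\<close>. This is the term that has to
  match the top of an invariant tensor.\<close>

lemma chain_el_top:
  assumes Y: "\<And>j. hol (Y j)" and "hol x" "hol y" and "(Dz Y ^^ Suc l) x = 0"
  shows "(Dz Y ^^ l) (chain_el Y (Suc l) x y) = (Dz Y ^^ l) x * tau (cst ((-1) ^ l) * (Dz Y ^^ l) y)"
proof -
  have "(Dz Y ^^ l) (chain_el Y (Suc l) x y) =
      (\<Sum>k<Suc l. (Dz Y ^^ (l + k)) x * tau (cst ((-1) ^ (l - k)) * (Dz Y ^^ (l - k)) y))"
    unfolding chain_el_def derivation_funpow_sum[OF derivation_Dz]
    using assms by (intro sum.cong)
      (simp_all add: Dz_funpow_mult_tau hol_simps hol_Dz_funpow funpow_add del: tau_simps)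
  also have "\<dots> = (Dz Y ^^ (l + 0)) x * tau (cst ((-1) ^ (l - 0)) * (Dz Y ^^ (l - 0)) y)"
  proof (rule sum_eq_single)
    fix k :: nat assume "k \<noteq> 0"
    then have "(Dz Y ^^ (l + k)) x = 0"
      using derivation_nilpotent_mono[OF derivation_Dz assms(4), of "l + k"] by simp
    then show "(Dz Y ^^ (l + k)) x * tau (cst ((-1) ^ (l - k)) * (Dz Y ^^ (l - k)) y) = 0" by simp
  qed auto
  finally show ?thesis by simp
qed

lemma tensor_rep_chain_el:
  assumes "\<And>j. hol (Y j)" "hol x" "hol y"
  shows "tensor_rep (chain_el Y l x y) {..<l} (\<lambda>k. (Dz Y ^^ k) x) (\<lambda>k. cst ((-1) ^ (l - 1 - k)) * (Dz Y ^^ (l - 1 - k)) y)"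
  using assms by (auto simp: tensor_rep_def chain_el_def intro!: hol_simps hol_Dz_funpow)

lemma tensor_rep_add:
  assumes "tensor_rep T I a b" "tensor_rep T' I' a' b'"
  shows "\<exists>I a b. tensor_rep (T + T') I a b"
proof -
  let ?I = "(\<lambda>i. 2 * i) ` I \<union> (\<lambda>i. 2 * i + 1) ` I'"
  let ?a = "\<lambda>i. if even i then a (i div 2) else a' (i div 2)"
  let ?b = "\<lambda>i. if even i then b (i div 2) else b' (i div 2)"
  have "(\<Sum>i\<in>?I. ?a i * tau (?b i)) = (\<Sum>i\<in>(\<lambda>i. 2 * i) ` I. ?a i * tau (?b i)) + (\<Sum>i\<in>(\<lambda>i. 2 * i + 1) ` I'. ?a i * tau (?b i))"
    using assms by (intro sum.union_disjoint) (auto simp: tensor_rep_def, presburger)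
  also have "\<dots> = (\<Sum>i\<in>I. a i * tau (b i)) + (\<Sum>i\<in>I'. a' i * tau (b' i))"
    by (subst (1 2) sum.reindex) (auto simp: inj_on_def)
  finally have "tensor_rep (T + T') ?I ?a ?b"
    using assms by (auto simp: tensor_rep_def)
  then show ?thesis by blast
qed

lemma tensor_rep_uminus: "tensor_rep T I a b \<Longrightarrow> tensor_rep (- T) I (\<lambda>i. 0 - a i) b"
  by (auto simp: tensor_rep_def sum_negf intro!: hol_simps)

lemma tensor_rep_diff_sum:
  assumes "tensor_rep T I a b" "\<And>j. j \<in> J \<Longrightarrow> \<exists>I a b. tensor_rep (C j) I a b"
  shows "\<exists>I a b. tensor_rep (T - sum C J) I a b"
  using assms(2)
proof (induction J rule: infinite_finite_induct)
  case (insert j J)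
  then obtain I a b I' a' b' where "tensor_rep (T - sum C J) I a b" "tensor_rep (C j) I' a' b'"
    by (metis insertCI)
  from tensor_rep_add[OF this(1) tensor_rep_uminus[OF this(2)]] show ?case
    using insert.hyps by (simp add: algebra_simps)
qed (use assms(1) in auto)

lemma maximal_independent:
  assumes "finite I"
  obtains J where "J \<subseteq> I" "lin_indep J e" "\<And>i. i \<in> I \<Longrightarrow> \<exists>c. e i = (\<Sum>j\<in>J. cst (c j) * e j)"
proof -
  let ?S = "{J. J \<subseteq> I \<and> lin_indep J e}"
  have "finite ?S" using assms by simp
  moreover have "{} \<in> ?S" by (simp add: lin_indep_def)
  ultimately have "Max (card ` ?S) \<in> card ` ?S" and le: "\<And>J'. J' \<in> ?S \<Longrightarrow> card J' \<le> Max (card ` ?S)"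
    by (auto intro!: Max_in)
  then obtain J where J: "J \<in> ?S" and "card J = Max (card ` ?S)" by auto
  then have max: "\<And>J'. J' \<in> ?S \<Longrightarrow> card J' \<le> card J"
    using le by simp
  have finJ: "finite J" using J assms finite_subset by auto
  have "\<exists>c. e i = (\<Sum>j\<in>J. cst (c j) * e j)" if i: "i \<in> I" for i
  proof (cases "i \<in> J")
    case True
    have "(\<Sum>j\<in>J. cst (if j = i then 1 else 0) * e j) = (\<Sum>j\<in>J. if j = i then e j else 0)"
      by (intro sum.cong) (auto simp: cst_simps)
    then show ?thesis
      using True finJ by (intro exI[of _ "\<lambda>j. if j = i then 1 else 0"]) simp
  next
    case False
    then have "\<not> lin_indep (insert i J) e"
      using max[of "insert i J"] J i finJ by auto
    then obtain c k where c: "(\<Sum>j\<in>insert i J. cst (c j) * e j) = 0" "k \<in> insert i J" "c k \<noteq> 0"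
      unfolding lin_indep_def by blast
    have s: "cst (c i) * e i + (\<Sum>j\<in>J. cst (c j) * e j) = 0"
      using c(1) False finJ by simp
    have ci: "c i \<noteq> 0"
    proof
      assume "c i = 0"
      then have "(\<Sum>j\<in>J. cst (c j) * e j) = 0" using s by (simp add: cst_simps)
      moreover have "k \<in> J" using c \<open>c i = 0\<close> by auto
      ultimately show False using lin_indepD[of J e c k] J c(3) by auto
    qed
    have "e i = cst (1 / c i) * (cst (c i) * e i)"
      using ci by (intro pring_eqI) simp
    also have "cst (c i) * e i = - (\<Sum>j\<in>J. cst (c j) * e j)"
      using s by (simp add: eq_neg_iff_add_eq_0)
    also have "cst (1 / c i) * - (\<Sum>j\<in>J. cst (c j) * e j) = (\<Sum>j\<in>J. cst (- c j / c i) * e j)"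
      by (intro pring_eqI) (simp add: sum_distrib_left sum_divide_distrib sum_negf)
    finally show ?thesis by (intro exI[of _ "\<lambda>j. - c j / c i"])
  qed
  then show ?thesis using that J by blast
qed

text \<open>Y^l acts on the first factors alone and its conjugate on the second factors alone, so
  independence of the opposite side transfers the vanishing to each factor.\<close>

lemma tensor_rep_killed:
  assumes rep: "tensor_rep T I a b" and ind: "lin_indep I a" "lin_indep I b" and Y: "\<And>j. hol (Y j)"
    and "(Dz Y ^^ l) T = 0" "(Db Y ^^ l) T = 0" and "i \<in> I"
  shows "(Dz Y ^^ l) (a i) = 0" "(Dz Y ^^ l) (b i) = 0"
proof -
  have hol: "\<And>i. i \<in> I \<Longrightarrow> hol (a i)" "\<And>i. i \<in> I \<Longrightarrow> hol (b i)" and T: "T = (\<Sum>i\<in>I. a i * tau (b i))"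
    using rep by (auto simp: tensor_rep_def)
  have "(\<Sum>i\<in>I. (Dz Y ^^ l) (a i) * tau (b i)) = 0"
    using assms(5) hol by (simp add: T derivation_funpow_sum[OF derivation_Dz] Dz_funpow_mult_tau)
  then show "(Dz Y ^^ l) (a i) = 0"
    using tensor_eq_0[of I "\<lambda>i. (Dz Y ^^ l) (a i)" b i] hol ind assms(7) Y by (auto intro: hol_Dz_funpow)
  have "(\<Sum>i\<in>I. a i * tau ((Dz Y ^^ l) (b i))) = 0"
    using assms(6) hol Y by (simp add: T derivation_funpow_sum[OF derivation_Db] Db_funpow_mult_tau)
  then show "(Dz Y ^^ l) (b i) = 0"
    using tensor_eq_0'[of I a "\<lambda>i. (Dz Y ^^ l) (b i)" i] hol ind assms(7) Y by (auto intro: hol_Dz_funpow)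
qed

lemma invariant_Db_funpow:
  assumes Y: "\<And>j. hol (Y j)" and "Dz Y T + Db Y T = 0"
  shows "(Dz Y ^^ k) T = cst ((-1) ^ k) * (Db Y ^^ k) T"
proof (induction k)
  case (Suc k)
  have comm: "Dz Y ((Db Y ^^ k) T) = (Db Y ^^ k) (Dz Y T)"
    by (induction k) (simp_all add: Dz_Db_commute[OF Y Y])
  have "(Dz Y ^^ Suc k) T = cst ((-1) ^ k) * (Db Y ^^ k) (Dz Y T)"
    using Suc by (simp add: Dz_cst_mult comm)
  also have "Dz Y T = - Db Y T" using assms(2) by (simp add: eq_neg_iff_add_eq_0)
  also have "(Db Y ^^ k) (- Db Y T) = - (Db Y ^^ k) (Db Y T)"
    by (induction k) (simp_all add: derivation_minus[OF derivation_Db])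
  finally show ?case by (simp add: funpow_swap1 cst_simps)
qed (simp add: cst_simps)

(* The induction lowers the power l of the field that kills the invariant tensor T: the image of T
   under the power l - 1 lies in im (x) im, so that it is matched by a sum of chains of length l. *)
lemma invariant_tensor_chains:
  assumes Y: "\<And>j. hol (Y j)"
    and "tensor_rep T I a b" "\<And>i. i \<in> I \<Longrightarrow> (Dz Y ^^ l) (a i) = 0" "\<And>i. i \<in> I \<Longrightarrow> (Dz Y ^^ l) (b i) = 0"
    and "Dz Y T + Db Y T = 0"
  shows "\<exists>xs. (\<forall>(l, x, y)\<in>set xs. 1 \<le> l \<and> hol x \<and> hol y \<and> (Dz Y ^^ l) x = 0 \<and> (Dz Y ^^ l) y = 0) \<and>
    T = (\<Sum>(l, x, y)\<leftarrow>xs. chain_el Y l x y)"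
  using assms(2-)
proof (induction l arbitrary: T I a b)
  case 0
  then have "T = 0" by (auto simp: tensor_rep_def intro!: sum.neutral)
  then show ?case by (intro exI[of _ "[]"]) simp
next
  case (Suc l)
  have fin: "finite I" and hol: "\<And>i. i \<in> I \<Longrightarrow> hol (a i)" "\<And>i. i \<in> I \<Longrightarrow> hol (b i)"
    and T: "T = (\<Sum>i\<in>I. a i * tau (b i))"
    using Suc.prems(1) by (auto simp: tensor_rep_def)
  \<comment> \<open>Invariance of \<open>T\<close> gives two expressions for Y^l T: one with first
    factors in the image of Y^l (\<open>top1\<close>), one with second factors in that image
    (\<open>top2\<close>). Thinning the \<open>e i\<close> to an independent family makes the two
    comparable.\<close>
  define e where "e i = (Dz Y ^^ l) (a i)" for i
  define m where "m i = cst ((-1) ^ l) * (Dz Y ^^ l) (b i)" for i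
  have hole: "hol (e i)" and holm: "hol (m i)" if "i \<in> I" for i
    using that hol Y unfolding e_def m_def by (auto intro!: hol_mult hol_cst hol_Dz_funpow simp del: cst_simps)
  obtain J where J: "J \<subseteq> I" "lin_indep J e" and "\<And>i. i \<in> I \<Longrightarrow> \<exists>c. e i = (\<Sum>j\<in>J. cst (c j) * e j)"
    using maximal_independent[OF fin] by metis
  then obtain c where c: "\<And>i. i \<in> I \<Longrightarrow> e i = (\<Sum>j\<in>J. cst (c i j) * e j)" by metis
  have finJ: "finite J" using J fin finite_subset by blast
  obtain \<phi> where \<phi>: "\<And>j. linear_functional (\<phi> j)" "\<And>j k. j \<in> J \<Longrightarrow> k \<in> J \<Longrightarrow> \<phi> j (e k) = (if j = k then 1 else 0)"
    using dual_functionals[OF finJ J(2)] by blast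
  define q where "q j = (\<Sum>i\<in>I. cst (cnj (c i j)) * b i)" for j
  \<comment> \<open>Applying the functional dual to \<open>e j\<close> to both expressions of Y^l T
    shows that the coefficient \<open>q j\<close> lies in the image of Y^l; \<open>y j\<close> is,
    up to the sign (-1)^l, the preimage found in this way.\<close>
  define y where "y j = (\<Sum>i\<in>I. cst (cnj (\<phi> j (a i))) * b i)" for j
  have holy: "hol (y j)" and holq: "hol (q j)" for j
    using hol by (auto simp: y_def q_def intro!: hol_sum hol_simps)
  have top1: "(Dz Y ^^ l) T = (\<Sum>j\<in>J. e j * tau (q j))"
  proof -
    have "(Dz Y ^^ l) T = (\<Sum>i\<in>I. e i * tau (b i))"
      using hol by (simp add: T derivation_funpow_sum[OF derivation_Dz] Dz_funpow_mult_tau e_def)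
    also have "\<dots> = (\<Sum>i\<in>I. \<Sum>j\<in>J. cst (c i j) * e j * tau (b i))"
      by (intro sum.cong refl) (subst c, auto simp: sum_distrib_right)
    also have "\<dots> = (\<Sum>j\<in>J. e j * tau (q j))"
      by (subst sum.swap) (simp add: q_def tau_sum sum_distrib_left mult_ac)
    finally show ?thesis .
  qed
  have top2: "(Dz Y ^^ l) T = (\<Sum>i\<in>I. a i * tau (m i))"
  proof -
    have "(Dz Y ^^ l) T = cst ((-1) ^ l) * (Db Y ^^ l) T"
      by (rule invariant_Db_funpow[OF Y Suc.prems(4)])
    also have "(Db Y ^^ l) T = (\<Sum>i\<in>I. a i * tau ((Dz Y ^^ l) (b i)))"
      using hol Y by (simp add: T derivation_funpow_sum[OF derivation_Db] Db_funpow_mult_tau)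
    finally show ?thesis
      by (simp add: m_def sum_distrib_left mult_ac)
  qed
  have qy: "q j = cst ((-1) ^ l) * (Dz Y ^^ l) (y j)" if j: "j \<in> J" for j
  proof -
    have "ev (tau (q j)) (z, w) = ev (\<Sum>i\<in>I. cst (\<phi> j (a i)) * tau (m i)) (z, w)" for z w
    proof -
      have t0: "ev (tau R) (z', w) = ev (tau R) (0, w)" if "hol R" for R z'
      proof -
        have "ev R (cnjv w, cnjv z') = ev R (cnjv w, 0)"
          using that unfolding hol_def by blast
        then show ?thesis by simp
      qed
      have "(\<Sum>k\<in>J. cst (ev (tau (q k)) (0, w)) * e k) = (\<Sum>i\<in>I. cst (ev (tau (m i)) (0, w)) * a i)"
      proof (rule pring_eqI)
        fix x :: "'a zpair"
        have "ev (\<Sum>k\<in>J. cst (ev (tau (q k)) (0, w)) * e k) x = ev (\<Sum>k\<in>J. e k * tau (q k)) (fst x, w)"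
          unfolding ev_sum
        proof (rule sum.cong)
          fix k assume "k \<in> J"
          then have "hol (e k)" using J(1) hole by blast
          then show "ev (cst (ev (tau (q k)) (0, w)) * e k) x = ev (e k * tau (q k)) (fst x, w)"
            using hol_same[of "e k" x "(fst x, w)"] t0[OF holq, of k "fst x"] by (simp del: ev_tau)
        qed simp
        also have "\<dots> = ev (\<Sum>i\<in>I. a i * tau (m i)) (fst x, w)"
          using top1 top2 by simp
        also have "\<dots> = ev (\<Sum>i\<in>I. cst (ev (tau (m i)) (0, w)) * a i) x"
          unfolding ev_sum
        proof (rule sum.cong)
          fix i assume "i \<in> I"
          then show "ev (a i * tau (m i)) (fst x, w) = ev (cst (ev (tau (m i)) (0, w)) * a i) x"
            using hol_same[OF hol(1), of i x "(fst x, w)"] t0[OF holm, of i "fst x"] by (simp del: ev_tau)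
        qed simp
        finally show "ev (\<Sum>k\<in>J. cst (ev (tau (q k)) (0, w)) * e k) x = ev (\<Sum>i\<in>I. cst (ev (tau (m i)) (0, w)) * a i) x" .
      qed
      from arg_cong[OF this, of "\<phi> j"]
      have "(\<Sum>k\<in>J. ev (tau (q k)) (0, w) * \<phi> j (e k)) = (\<Sum>i\<in>I. ev (tau (m i)) (0, w) * \<phi> j (a i))"
        by (simp only: linear_functional_sum[OF \<phi>(1)])
      moreover have "(\<Sum>k\<in>J. ev (tau (q k)) (0, w) * \<phi> j (e k)) = (\<Sum>k\<in>J. if k = j then ev (tau (q k)) (0, w) else 0)"
        using \<phi>(2)[OF j] by (intro sum.cong) auto
      ultimately have "ev (tau (q j)) (0, w) = (\<Sum>i\<in>I. ev (tau (m i)) (0, w) * \<phi> j (a i))"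
        using j finJ by simp
      then show ?thesis
        using t0[OF holq, of j z] t0[OF holm, of _ z] by (simp add: mult.commute del: ev_tau)
    qed
    then have "tau (q j) = (\<Sum>i\<in>I. cst (\<phi> j (a i)) * tau (m i))"
      by (intro pring_eqI) (metis prod.collapse)
    then have "q j = tau (\<Sum>i\<in>I. cst (\<phi> j (a i)) * tau (m i))"
      by (metis tau_tau)
    also have "\<dots> = (\<Sum>i\<in>I. cst (cnj (\<phi> j (a i))) * m i)"
      by (simp add: tau_sum)
    also have "\<dots> = cst ((-1) ^ l) * (Dz Y ^^ l) (y j)"
      unfolding y_def m_def derivation_funpow_sum[OF derivation_Dz] Dz_funpow_cst_mult sum_distrib_left
      by (simp add: mult_ac)
    finally show ?thesis .
  qed
  have ky: "(Dz Y ^^ Suc l) (y j) = 0" for j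
    using Suc.prems(3) unfolding y_def derivation_funpow_sum[OF derivation_Dz]
    by (intro sum.neutral ballI) (subst derivation_funpow_const_mult[OF derivation_Dz], simp_all del: funpow.simps)
  \<comment> \<open>The chains of length l + 1 have the same image under Y^l as \<open>T\<close>, so
    the difference is still invariant and is already killed by the power \<open>l\<close>.\<close>
  define T1 where "T1 = T - (\<Sum>j\<in>J. chain_el Y (Suc l) (a j) (y j))"
  have chains: "\<exists>I' a' b'. tensor_rep (chain_el Y (Suc l) (a j) (y j)) I' a' b'" if "j \<in> J" for j
  proof -
    have "hol (a j)" using J(1) that hol(1) by blast
    from tensor_rep_chain_el[where Y = Y, OF Y this holy[of j], of "Suc l"] show ?thesis by (intro exI)
  qed
  have "\<exists>I' a' b'. tensor_rep T1 I' a' b'"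
    unfolding T1_def by (rule tensor_rep_diff_sum[OF Suc.prems(1)]) (rule chains)
  then obtain I1 a1 b1 where rep1: "tensor_rep T1 I1 a1 b1" "lin_indep I1 a1" "lin_indep I1 b1"
    using tensor_rep_independent by metis
  have inv1: "Dz Y T1 + Db Y T1 = 0"
  proof -
    have "Dz Y T1 + Db Y T1 = (Dz Y T + Db Y T) -
        (\<Sum>j\<in>J. Dz Y (chain_el Y (Suc l) (a j) (y j)) + Db Y (chain_el Y (Suc l) (a j) (y j)))"
      by (simp add: T1_def derivation_diff[OF derivation_Dz] derivation_diff[OF derivation_Db]
          derivation_sum[OF derivation_Dz] derivation_sum[OF derivation_Db] sum.distrib)
    also have "\<dots> = 0"
      using Suc.prems(4) J(1) by (simp add: chain_el_invariant Y hol holy Suc.prems(2) ky subset_eq del: funpow.simps)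
    finally show ?thesis .
  qed
  have kill1: "(Dz Y ^^ l) T1 = 0"
  proof -
    have minus: "u - v = u + cst (- 1) * v" for u v :: "'a pring" by (simp add: cst_simps)
    have "(Dz Y ^^ l) T1 = (Dz Y ^^ l) T - (\<Sum>j\<in>J. (Dz Y ^^ l) (chain_el Y (Suc l) (a j) (y j)))"
      unfolding T1_def minus derivation_funpow_add[OF derivation_Dz]
      by (subst derivation_funpow_const_mult[OF derivation_Dz]) (simp_all add: derivation_funpow_sum[OF derivation_Dz])
    also have "(\<Sum>j\<in>J. (Dz Y ^^ l) (chain_el Y (Suc l) (a j) (y j))) = (\<Sum>j\<in>J. e j * tau (q j))"
    proof (rule sum.cong)
      fix j assume j: "j \<in> J"
      then have "j \<in> I" using J by auto
      show "(Dz Y ^^ l) (chain_el Y (Suc l) (a j) (y j)) = e j * tau (q j)"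
        unfolding qy[OF j] e_def by (rule chain_el_top[OF Y hol(1)[OF \<open>j \<in> I\<close>] holy Suc.prems(2)[OF \<open>j \<in> I\<close>]])
    qed simp
    finally show ?thesis using top1 by simp
  qed
  have "cst ((-1) ^ l) * (Db Y ^^ l) T1 = 0"
    using invariant_Db_funpow[OF Y inv1, of l] kill1 by simp
  then have kill2: "(Db Y ^^ l) T1 = 0" by simp
  obtain xs where xs: "\<forall>(l, x, y)\<in>set xs. 1 \<le> l \<and> hol x \<and> hol y \<and> (Dz Y ^^ l) x = 0 \<and> (Dz Y ^^ l) y = 0"
    "T1 = (\<Sum>(l, x, y)\<leftarrow>xs. chain_el Y l x y)"
    using Suc.IH[OF rep1(1) tensor_rep_killed[OF rep1 Y kill1 kill2] inv1] by blast
  obtain js where js: "set js = J" "distinct js" using finite_distinct_list[OF finJ] by blast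
  let ?ys = "map (\<lambda>j. (Suc l, a j, y j)) js"
  have "T = (\<Sum>(l, x, y)\<leftarrow>?ys @ xs. chain_el Y l x y)"
    using xs(2) js by (simp add: T1_def o_def sum_list_distinct_conv_sum_set algebra_simps)
  moreover have "\<forall>(l, x, y)\<in>set (?ys @ xs). 1 \<le> l \<and> hol x \<and> hol y \<and> (Dz Y ^^ l) x = 0 \<and> (Dz Y ^^ l) y = 0"
    using xs(1) js J(1) hol holy Suc.prems(2) ky by (auto simp del: funpow.simps)
  ultimately show ?case by blast
qed

lemma tensor_rep_cplx: "\<exists>I a b. tensor_rep (cplx P) I a b"
proof -
  have zero: "\<exists>I a b. tensor_rep (0 :: 'a pring) I a b"
    by (intro exI[of _ "{}"]) (simp add: tensor_rep_def)
  have sum_rep: "\<exists>I a b. tensor_rep (sum f K) I a b" if "\<And>k. k \<in> K \<Longrightarrow> \<exists>I a b. tensor_rep (f k) I a b"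
    for f :: "('a \<Rightarrow> nat) \<times> ('a \<Rightarrow> nat) \<Rightarrow> 'a pring" and K
    using that
  proof (induction K rule: infinite_finite_induct)
    case (insert k K)
    then obtain I a b I' a' b' where "tensor_rep (f k) I a b" "tensor_rep (sum f K) I' a' b'"
      by (metis insertCI)
    then show ?case using tensor_rep_add insert.hyps by auto
  qed (use zero in auto)
  have term_rep: "tensor_rep (term_of c k) {0} (\<lambda>_. cst c * mon (fst k)) (\<lambda>_. mon (snd k))" for c and k :: "('a \<Rightarrow> nat) \<times> ('a \<Rightarrow> nat)"
    by (auto simp: tensor_rep_def term_of_def mult.assoc intro!: hol_mult hol_cst hol_mon)
  show ?thesis
    unfolding cplx_def by (rule sum_rep) (intro exI, rule term_rep)
qed

lemma zcomp_decomposition: "\<exists>D. Q = (\<Sum>t\<le>D. zcomp t Q)"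
proof -
  obtain B where B: "cplx B = Q" using cplx_surj by blast
  let ?K = "Poly_Mapping.keys B" and ?T = "\<lambda>k. term_of (Poly_Mapping.lookup B k) k"
  define D where "D = (\<Sum>k\<in>?K. sum (fst k) UNIV)"
  have "(\<Sum>t\<le>D. zcomp t Q) = (\<Sum>t\<le>D. \<Sum>k\<in>?K. if sum (fst k) UNIV = t then ?T k else 0)"
    unfolding B[symmetric] cplx_def zcomp_sum by (intro sum.cong zcomp_bihom[OF bihom_term_of] refl)
  also have "\<dots> = (\<Sum>k\<in>?K. \<Sum>t\<le>D. if sum (fst k) UNIV = t then ?T k else 0)"
    by (rule sum.swap)
  also have "\<dots> = (\<Sum>k\<in>?K. ?T k)"
  proof (rule sum.cong)
    fix k assume "k \<in> ?K"
    then have "sum (fst k) UNIV \<le> D"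
      unfolding D_def by (intro member_le_sum) auto
    then show "(\<Sum>t\<le>D. if sum (fst k) UNIV = t then ?T k else 0) = ?T k" by simp
  qed simp
  finally have "(\<Sum>t\<le>D. zcomp t Q) = Q" by (simp add: B[symmetric] cplx_def)
  then show ?thesis by metis
qed

lemma bihom_zcomp:
  assumes "hol Q" shows "bihom t 0 (zcomp t Q)"
  unfolding bihom_def
proof (intro allI)
  fix s r z w
  have "zpoly (ev Q) (s *s z, r *s w) = pcompose (zpoly (ev Q) (z, w)) [:0, s:]"
  proof (rule zpoly_eqI)
    fix u
    have "ev Q ((u * s) *s z, r *s w) = ev Q ((s * u) *s z, w)"
      using hol_same[OF assms] by (simp add: mult.commute)
    then show "ev Q (u *s fst (s *s z, r *s w), snd (s *s z, r *s w)) = poly (pcompose (zpoly (ev Q) (z, w)) [:0, s:]) u"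
      by (simp add: poly_pcompose poly_zpoly mult.commute)
  qed simp
  then show "ev (zcomp t Q) (s *s z, r *s w) = s ^ t * r ^ 0 * ev (zcomp t Q) (z, w)"
    by (simp add: zcomp.rep_eq coeff_pcompose_linear)
qed

lemma zcomp_Dz:
  assumes Y: "\<And>j. bihom e 0 (Y j)" "2 \<le> e" and "hol Q"
  shows "zcomp (t + (e - 1)) (Dz Y Q) = Dz Y (zcomp t Q)"
proof -
  obtain D where D: "Q = (\<Sum>t\<le>D. zcomp t Q)" using zcomp_decomposition by blast
  have h: "bihom (p + (e - 1)) 0 (Dz Y (zcomp p Q))" for p
    using bihom_Dz[OF bihom_zcomp[OF assms(3), of p] Y(1)] Y(2) by simp
  have "zcomp (t + (e - 1)) (Dz Y Q) = (\<Sum>p\<le>D. zcomp (t + (e - 1)) (Dz Y (zcomp p Q)))"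
    by (subst D) (simp add: derivation_sum[OF derivation_Dz] zcomp_sum)
  also have "\<dots> = (\<Sum>p\<le>D. if p = t then Dz Y (zcomp p Q) else 0)"
    using zcomp_bihom[OF h] by (intro sum.cong) auto
  also have "\<dots> = Dz Y (zcomp t Q)"
  proof (cases "t \<le> D")
    case False
    have "zcomp t Q = (\<Sum>p\<le>D. zcomp t (zcomp p Q))"
      by (subst D) (simp add: zcomp_sum)
    also have "\<dots> = 0"
      using zcomp_bihom[OF bihom_zcomp[OF assms(3)]] False by (intro sum.neutral) auto
    finally show ?thesis using False by (simp add: derivation_0[OF derivation_Dz])
  qed simp
  finally show ?thesis .
qed

lemma zcomp_Dz_funpow:
  assumes Y: "\<And>j. bihom e 0 (Y j)" "2 \<le> e" and "hol Q"
  shows "zcomp (t + l * (e - 1)) ((Dz Y ^^ l) Q) = (Dz Y ^^ l) (zcomp t Q)"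
proof (induction l)
  case (Suc l)
  have "hol ((Dz Y ^^ l) Q)"
    using hol_Dz_funpow[OF bihom_hol[OF Y(1)] assms(3)] .
  from zcomp_Dz[where Y = Y, OF Y this, of "t + l * (e - 1)"] show ?case
    using Suc by (simp add: add_ac)
qed simp

lemma chain_el_bilinear:
  fixes x :: "'a \<Rightarrow> 'c::finite pring" and y :: "'b \<Rightarrow> 'c pring"
  shows "chain_el Y l (sum x A) (sum y B) = (\<Sum>p\<in>A. \<Sum>q\<in>B. chain_el Y l (x p) (y q))"
proof -
  have "chain_el Y l (sum x A) (sum y B) = (\<Sum>k<l. \<Sum>p\<in>A. \<Sum>q\<in>B.
      (Dz Y ^^ k) (x p) * tau (cst ((-1) ^ (l - 1 - k)) * (Dz Y ^^ (l - 1 - k)) (y q)))"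
  proof -
    have "tau (cst c * sum f B) = (\<Sum>q\<in>B. tau (cst c * f q))" for c and f :: "'b \<Rightarrow> 'c pring"
      by (simp add: sum_distrib_left tau_sum)
    then show ?thesis
      unfolding chain_el_def derivation_funpow_sum[OF derivation_Dz] by (simp only: sum_product)
  qed
  also have "\<dots> = (\<Sum>p\<in>A. \<Sum>k<l. \<Sum>q\<in>B.
      (Dz Y ^^ k) (x p) * tau (cst ((-1) ^ (l - 1 - k)) * (Dz Y ^^ (l - 1 - k)) (y q)))"
    by (rule sum.swap)
  also have "\<dots> = (\<Sum>p\<in>A. \<Sum>q\<in>B. chain_el Y l (x p) (y q))"
    unfolding chain_el_def by (intro sum.cong refl sum.swap)
  finally show ?thesis .
qed

definition homogeneous_chain :: "('n::finite \<Rightarrow> 'n pring) \<Rightarrow> nat \<times> 'n pring \<times> 'n pring \<Rightarrow> bool" where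
  "homogeneous_chain Y c \<longleftrightarrow> (case c of (l, x, y) \<Rightarrow>
     1 \<le> l \<and> (\<exists>p. bihom p 0 x) \<and> (\<exists>q. bihom q 0 y) \<and> (Dz Y ^^ l) x = 0 \<and> (Dz Y ^^ l) y = 0)"

text \<open>The definition of a chain demands weighted homogeneous members. As \<open>Y\<close> is
  homogeneous, its powers respect the grading up to a shift, and bilinearity splits a chain into
  homogeneous ones of the same length.\<close>

lemma homogeneous_chains:
  assumes Y: "\<And>j. bihom e 0 (Y j)" "2 \<le> e"
    and "\<forall>(l, x, y)\<in>set xs. 1 \<le> l \<and> hol x \<and> hol y \<and> (Dz Y ^^ l) x = 0 \<and> (Dz Y ^^ l) y = 0"
  shows "\<exists>ys. (\<forall>c\<in>set ys. homogeneous_chain Y c) \<and>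
    (\<Sum>(l, x, y)\<leftarrow>ys. chain_el Y l x y) = (\<Sum>(l, x, y)\<leftarrow>xs. chain_el Y l x y)"
  using assms(3)
proof (induction xs)
  case Nil
  show ?case by (intro exI[of _ "[]"]) simp
next
  case (Cons c xs)
  then obtain ys where ys: "\<forall>c\<in>set ys. homogeneous_chain Y c"
    "(\<Sum>(l, x, y)\<leftarrow>ys. chain_el Y l x y) = (\<Sum>(l, x, y)\<leftarrow>xs. chain_el Y l x y)"
    by auto
  obtain l x y where c: "c = (l, x, y)" by (cases c) auto
  then have *: "1 \<le> l" "hol x" "hol y" "(Dz Y ^^ l) x = 0" "(Dz Y ^^ l) y = 0"
    using Cons.prems by auto
  obtain D E where D: "x = (\<Sum>t\<le>D. zcomp t x)" and E: "y = (\<Sum>t\<le>E. zcomp t y)"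
    using zcomp_decomposition by metis
  let ?f = "\<lambda>(p, q). (l, zcomp p x, zcomp q y)"
  obtain ps where ps: "set ps = {..D} \<times> {..E}" "distinct ps"
    using finite_distinct_list[of "{..D} \<times> {..E}"] by auto
  have "chain_el Y l x y = (\<Sum>p\<le>D. \<Sum>q\<le>E. chain_el Y l (zcomp p x) (zcomp q y))"
    by (subst D, subst E) (rule chain_el_bilinear)
  also have "\<dots> = (\<Sum>pq\<in>set ps. chain_el Y l (zcomp (fst pq) x) (zcomp (snd pq) y))"
    unfolding ps by (simp add: sum.cartesian_product case_prod_unfold)
  also have "\<dots> = (\<Sum>(l, x, y)\<leftarrow>map ?f ps. chain_el Y l x y)"
    using ps(2) by (simp add: sum_list_distinct_conv_sum_set[symmetric] o_def case_prod_unfold)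
  finally have "(\<Sum>(l, x, y)\<leftarrow>map ?f ps @ ys. chain_el Y l x y) = (\<Sum>(l, x, y)\<leftarrow>c # xs. chain_el Y l x y)"
    using ys(2) by (simp add: c)
  moreover have "homogeneous_chain Y (l, zcomp p x, zcomp q y)" for p q
    using bihom_zcomp[OF *(2), of p] bihom_zcomp[OF *(3), of q] *(1)
      zcomp_Dz_funpow[where Y = Y, OF Y *(2), of p l] zcomp_Dz_funpow[where Y = Y, OF Y *(3), of q l] *(4,5)
    by (auto simp: homogeneous_chain_def)
  then have "\<forall>c\<in>set (map ?f ps @ ys). homogeneous_chain Y c"
    using ys(1) by auto
  ultimately show ?case by blast
qed

text \<open>\<open>Y\<close> raises the degree in z by e - 1 \<ge> 1, so Y^d P lives in degrees
  above \<open>d\<close>. By invariance it agrees up to sign with the conjugate power applied to P,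
  whose degrees in z stay below \<open>d\<close>.\<close>

lemma (in real_bihom) invariant_nilpotent:
  assumes Y: "\<And>j. bihom e 0 (Y j)" "2 \<le> e" and inv: "Dz Y P + Db Y P = 0"
  shows "(Dz Y ^^ d) P = 0" "(Db Y ^^ d) P = 0"
proof -
  have hz: "bihom (p + k * (e - 1)) q ((Dz Y ^^ k) Q)" if "bihom p q Q" for p q k Q
  proof (induction k)
    case (Suc k)
    show ?case using bihom_degree_cong[OF bihom_Dz[where F = Y, OF Suc Y(1)]] Y(2) by auto
  qed (use that in simp)
  have hw: "bihom p (q + k * (e - 1)) ((Db Y ^^ k) Q)" if "bihom p q Q" for p q k Q
  proof (induction k)
    case (Suc k)
    show ?case using bihom_degree_cong[OF bihom_Db[where F = Y, OF Suc Y(1)]] Y(2) by auto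
  qed (use that in simp)
  have "(Dz Y ^^ d) (Pc p) = 0" if p: "p \<in> {1..<d}" for p
  proof -
    let ?t = "p + d * (e - 1)"
    have "d \<le> d * (e - 1)" using Y(2) by (cases e) auto
    moreover have "1 \<le> p" using p by simp
    ultimately have t: "d < ?t" by linarith
    have "zcomp ?t ((Dz Y ^^ d) P) = (\<Sum>q\<in>{1..<d}. zcomp ?t ((Dz Y ^^ d) (Pc q)))"
      by (subst sum_comp) (simp add: derivation_funpow_sum[OF derivation_Dz] zcomp_sum)
    also have "\<dots> = (\<Sum>q\<in>{1..<d}. if q = p then (Dz Y ^^ d) (Pc q) else 0)"
      using zcomp_bihom[OF hz[OF bihom_comp]] by (intro sum.cong) auto
    also have "\<dots> = (Dz Y ^^ d) (Pc p)" using p by simp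
    finally have "(Dz Y ^^ d) (Pc p) = zcomp ?t (cst ((-1) ^ d) * (Db Y ^^ d) P)"
      using invariant_Db_funpow[OF bihom_hol[OF Y(1)] inv, of d] by simp
    also have "\<dots> = cst ((-1) ^ d) * (\<Sum>q\<in>{1..<d}. zcomp ?t ((Db Y ^^ d) (Pc q)))"
      unfolding zcomp_cst_mult by (subst sum_comp) (simp add: derivation_funpow_sum[OF derivation_Db] zcomp_sum)
    also have "(\<Sum>q\<in>{1..<d}. zcomp ?t ((Db Y ^^ d) (Pc q))) = 0"
      using zcomp_bihom[OF hw[OF bihom_comp], of _ ?t] t by (intro sum.neutral) auto
    finally show ?thesis by simp
  qed
  then show *: "(Dz Y ^^ d) P = 0"
    by (subst sum_comp) (simp add: derivation_funpow_sum[OF derivation_Dz])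
  show "(Db Y ^^ d) P = 0"
    by (rule nilpotent_conjugate[OF *])
qed

lemma ev_hol_has_derivative:
  "((\<lambda>z. ev Q (z, 0)) has_derivative (\<lambda>v. \<Sum>j\<in>UNIV. v $ j * ev (dz j Q) (z, 0))) (at z)"
  using has_derivative_compose[OF has_derivative_Pair[OF has_derivative_ident has_derivative_const[where c = 0]]
      ev_has_derivative[where Q = Q], where x = z and s = UNIV] by simp

lemma apply_field_ev:
  assumes "\<And>z. heval G z = ev Q (z, 0)" "\<And>j z. heval (F j) z = ev (Y j) (z, 0)"
  shows "apply_field F (heval G) z = ev (Dz Y Q) (z, 0)"
proof -
  have "heval G = (\<lambda>z. ev Q (z, 0))" using assms(1) by (simp add: fun_eq_iff)
  then show ?thesis
    using frechet_derivative_at[OF ev_hol_has_derivative[of Q z], symmetric]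
    by (simp add: apply_field_def assms(2) Dz_def)
qed

lemma wdeg_const: "wdeg (\<lambda>_. m) \<alpha> = m * real (sum \<alpha> UNIV)"
  by (simp add: wdeg_def sum_distrib_left)

text \<open>Scalar chains suffice: for s = 1 the matrices 1 and -1 satisfy the required conjugate
  symmetry, and the -1 accounts for the alternating signs of the second sequence. The function
  \<open>hp\<close> selects coefficient families for homogeneous elements.\<close>

lemma symmetric_chain_pairI:
  assumes c: "homogeneous_chain Y (l, x, y)"
    and F: "\<And>j z. heval (F j) z = ev (Y j) (z, 0)"
    and hp: "\<And>p Q. bihom p 0 Q \<Longrightarrow> (\<forall>z. heval (hp Q) z = ev Q (z, 0)) \<and> (\<exists>t. \<forall>\<alpha>\<in>Poly_Mapping.keys (hp Q). sum \<alpha> UNIV = t)"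
    and Y: "\<And>j. bihom e 0 (Y j)" "2 \<le> e"
  shows "symmetric_chain_pair (\<lambda>_. m) F 1 l (\<lambda>k i. hp ((Dz Y ^^ (k - 1)) x))
    (\<lambda>k i. hp (cst ((-1) ^ (k - 1)) * (Dz Y ^^ (k - 1)) y))"
proof -
  from c obtain p q where h: "1 \<le> l" "bihom p 0 x" "bihom q 0 y" and kill: "(Dz Y ^^ l) x = 0" "(Dz Y ^^ l) y = 0"
    by (auto simp: homogeneous_chain_def)
  have hz: "\<exists>p. bihom p 0 ((Dz Y ^^ k) Q)" if "bihom p 0 Q" for p k Q
  proof (induction k)
    case (Suc k)
    then show ?case using bihom_Dz[OF _ Y(1)] by force
  qed (use that in auto)
  have hx: "\<exists>p. bihom p 0 ((Dz Y ^^ k) x)" and hy: "\<exists>p. bihom p 0 (cst c * (Dz Y ^^ k) y)" for k c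
    using hz[OF h(2)] hz[OF h(3), of k] bihom_cst_mult by blast+
  have ex: "heval (hp ((Dz Y ^^ k) x)) z = ev ((Dz Y ^^ k) x) (z, 0)"
    and ey: "heval (hp (cst c * (Dz Y ^^ k) y)) z = ev (cst c * (Dz Y ^^ k) y) (z, 0)" for k c z
    using hx[of k] hy[of c k] hp by blast+
  have ax: "apply_field F (heval (hp ((Dz Y ^^ k) x))) z = ev ((Dz Y ^^ Suc k) x) (z, 0)"
    and ay: "apply_field F (heval (hp (cst c * (Dz Y ^^ k) y))) z = ev (cst c * (Dz Y ^^ Suc k) y) (z, 0)" for k c z
    using apply_field_ev[OF ex F] apply_field_ev[OF ey F] by (simp_all add: Dz_cst_mult)
  have whx: "v_whomogeneous (\<lambda>_. m) 1 (\<lambda>i. hp Q)" if "\<exists>p. bihom p 0 Q" for Q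
  proof -
    from that hp obtain t where "\<forall>\<alpha>\<in>Poly_Mapping.keys (hp Q). sum \<alpha> UNIV = t" by blast
    then show ?thesis
      unfolding v_whomogeneous_def whomogeneous_def wdeg_const by (intro exI[of _ "m * real t"]) auto
  qed
  define A where "A = (1\<^sub>m 1 :: complex mat)"
  define B where "B = (- 1\<^sub>m 1 :: complex mat)"
  have carrier: "A \<in> carrier_mat 1 1" "B \<in> carrier_mat 1 1"
    by (simp_all add: A_def B_def)
  have "A * A = 1\<^sub>m 1" "B * B = 1\<^sub>m 1"
    unfolding A_def B_def by (simp, rule eq_matI) (auto simp: scalar_prod_def)
  then have inv: "invertible_mat A" "invertible_mat B"
    using carrier unfolding invertible_mat_def inverts_mat_def by (metis carrier_matD(1) carrier_matD(2) square_mat.simps)+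
  have AB: "A = - transpose_mat (map_mat cnj B)"
    unfolding A_def B_def by (rule eq_matI) auto
  have Av: "A *\<^sub>v v = v" "B *\<^sub>v v = - v" if "v \<in> carrier_vec 1" for v
    using that unfolding A_def B_def by auto
  have cv: "veval 1 f z \<in> carrier_vec 1" for f :: "nat \<Rightarrow> 'a hpoly" and z
    by (simp add: veval_def)
  show ?thesis
    unfolding symmetric_chain_pair_def
  proof (intro conjI ballI allI)
    show "1 \<le> (1::nat)" "1 \<le> l" using h by auto
    fix k assume "k \<in> {1..l}"
    show "v_whomogeneous (\<lambda>_. m) 1 (\<lambda>i. hp ((Dz Y ^^ (k - 1)) x))"
      "v_whomogeneous (\<lambda>_. m) 1 (\<lambda>i. hp (cst ((-1) ^ (k - 1)) * (Dz Y ^^ (k - 1)) y))"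
      by (intro whx hx hy)+
  next
    fix z
    have "Suc (l - 1) = l" using h by simp
    then show "vapply_field F 1 (\<lambda>i. hp ((Dz Y ^^ (l - 1)) x)) z = 0\<^sub>v 1"
      "vapply_field F 1 (\<lambda>i. hp (cst ((-1) ^ (l - 1)) * (Dz Y ^^ (l - 1)) y)) z = 0\<^sub>v 1"
      unfolding vapply_field_def ax ay by (auto simp: kill simp del: funpow.simps)
  next
    show "\<exists>A B. \<forall>j\<in>{1..l - 1}. A j \<in> carrier_mat 1 1 \<and> invertible_mat (A j) \<and> B j \<in> carrier_mat 1 1 \<and>
        invertible_mat (B j) \<and> A j = - transpose_mat (map_mat cnj (B (l - j))) \<and>
        (\<forall>z. vapply_field F 1 (\<lambda>i. hp ((Dz Y ^^ (j - 1)) x)) z = A j *\<^sub>v veval 1 (\<lambda>i. hp ((Dz Y ^^ (j + 1 - 1)) x)) z \<and>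
          vapply_field F 1 (\<lambda>i. hp (cst ((-1) ^ (j - 1)) * (Dz Y ^^ (j - 1)) y)) z =
          B j *\<^sub>v veval 1 (\<lambda>i. hp (cst ((-1) ^ (j + 1 - 1)) * (Dz Y ^^ (j + 1 - 1)) y)) z)"
    proof (rule exI[of _ "\<lambda>_. A"], rule exI[of _ "\<lambda>_. B"], intro ballI conjI allI carrier inv AB)
      fix j z assume j: "j \<in> {1..l - 1}"
      then have j': "Suc (j - 1) = j" "j + 1 - 1 = j" by auto
      show "vapply_field F 1 (\<lambda>i. hp ((Dz Y ^^ (j - 1)) x)) z = A *\<^sub>v veval 1 (\<lambda>i. hp ((Dz Y ^^ (j + 1 - 1)) x)) z"
        unfolding Av(1)[OF cv] unfolding j' vapply_field_def ax veval_def ex ..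
      have "(-1::complex) ^ j = - ((-1) ^ (j - 1))"
        by (subst j'(1)[symmetric]) simp
      then show "vapply_field F 1 (\<lambda>i. hp (cst ((-1) ^ (j - 1)) * (Dz Y ^^ (j - 1)) y)) z =
          B *\<^sub>v veval 1 (\<lambda>i. hp (cst ((-1) ^ (j + 1 - 1)) * (Dz Y ^^ (j + 1 - 1)) y)) z"
        unfolding Av(2)[OF cv] unfolding j' vapply_field_def ay veval_def ey by (auto simp del: funpow.simps)
    qed
  qed
qed

lemma chain_hypersurfaceI:
  fixes P :: "'n::finite bipoly"
  assumes "real_bihom (cplx P) Pc d"
    and Y: "\<And>j. bihom e 0 (Y j)" "2 \<le> e" "Y \<noteq> (\<lambda>_. 0)" and inv: "Dz Y (cplx P) + Db Y (cplx P) = 0" and "0 < m"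
  shows "chain_hypersurface (\<lambda>_. m) P"
proof -
  interpret real_bihom "cplx P" Pc d by fact
  have holY: "\<And>j. hol (Y j)" using bihom_hol[OF Y(1)] .
  obtain I a b where rep: "tensor_rep (cplx P) I a b" "lin_indep I a" "lin_indep I b"
    using tensor_rep_cplx tensor_rep_independent by blast
  obtain xs where xs: "\<forall>(l, x, y)\<in>set xs. 1 \<le> l \<and> hol x \<and> hol y \<and> (Dz Y ^^ l) x = 0 \<and> (Dz Y ^^ l) y = 0"
    "cplx P = (\<Sum>(l, x, y)\<leftarrow>xs. chain_el Y l x y)"
    using invariant_tensor_chains[OF holY rep(1) tensor_rep_killed[OF rep holY invariant_nilpotent[OF Y(1,2) inv]] inv] by blast
  obtain ys where ys: "\<forall>c\<in>set ys. homogeneous_chain Y c" "cplx P = (\<Sum>(l, x, y)\<leftarrow>ys. chain_el Y l x y)"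
    using homogeneous_chains[OF Y(1,2) xs(1)] xs(2) by auto
  have "\<forall>j. \<exists>F::'n hpoly. (\<forall>z. heval F z = ev (Y j) (z, 0)) \<and> (\<forall>\<alpha>\<in>Poly_Mapping.keys F. sum \<alpha> UNIV = e)"
    using hpoly_of_bihom[OF Y(1)] by metis
  then obtain F :: "'n \<Rightarrow> 'n hpoly" where F: "\<And>j z. heval (F j) z = ev (Y j) (z, 0)"
    "\<And>j \<alpha>. \<alpha> \<in> Poly_Mapping.keys (F j) \<Longrightarrow> sum \<alpha> UNIV = e"
    by metis
  have "\<forall>Q. \<exists>G::'n hpoly. \<forall>p. bihom p 0 Q \<longrightarrow> (\<forall>z. heval G z = ev Q (z, 0)) \<and> (\<exists>t. \<forall>\<alpha>\<in>Poly_Mapping.keys G. sum \<alpha> UNIV = t)"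
    using hpoly_of_bihom by metis
  then obtain hp :: "'n pring \<Rightarrow> 'n hpoly" where hp: "\<And>p Q. bihom p 0 Q \<Longrightarrow>
      (\<forall>z. heval (hp Q) z = ev Q (z, 0)) \<and> (\<exists>t. \<forall>\<alpha>\<in>Poly_Mapping.keys (hp Q). sum \<alpha> UNIV = t)"
    by metis
  define c where "c j = ys ! (j - 1)" for j
  let ?l = "\<lambda>j. fst (c j)" and ?x = "\<lambda>j. fst (snd (c j))" and ?y = "\<lambda>j. snd (snd (c j))"
  let ?U = "\<lambda>j k (i::nat). hp ((Dz Y ^^ (k - 1)) (?x j))"
  let ?V = "\<lambda>j k (i::nat). hp (cst ((-1) ^ (k - 1)) * (Dz Y ^^ (k - 1)) (?y j))"
  have hc: "homogeneous_chain Y (?l j, ?x j, ?y j)" if "j \<in> {1..length ys}" for j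
    using ys(1) that by (auto simp: c_def)
  have pair: "veval 1 (?U j k) z \<bullet>c veval 1 (?V j (?l j - k + 1)) z =
      ev ((Dz Y ^^ (k - 1)) (?x j) * tau (cst ((-1) ^ (?l j - k)) * (Dz Y ^^ (?l j - k)) (?y j))) (z, cnjv z)"
    if j: "j \<in> {1..length ys}" for j k z
  proof -
    from hc[OF j] obtain p q where pq: "bihom p 0 (?x j)" "bihom q 0 (?y j)" by (auto simp: homogeneous_chain_def)
    have hz: "\<exists>p. bihom p 0 ((Dz Y ^^ k) Q)" if "bihom p 0 Q" for p k Q
    proof (induction k)
      case (Suc k)
      then show ?case using bihom_Dz[OF _ Y(1)] by force
    qed (use that in auto)
    obtain p' q' where h: "bihom p' 0 ((Dz Y ^^ (k - 1)) (?x j))" "bihom q' 0 ((Dz Y ^^ (?l j - k)) (?y j))"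
      using hz[OF pq(1)] hz[OF pq(2)] by metis
    have hU: "heval (?U j k i) z = ev ((Dz Y ^^ (k - 1)) (?x j)) (z, cnjv z)" for i
      using hp[OF h(1)] hol_same[OF bihom_hol[OF h(1)], of "(z, 0)" "(z, cnjv z)"] by simp
    have hV: "heval (?V j (?l j - k + 1) i) z = ev (cst ((-1) ^ (?l j - k)) * (Dz Y ^^ (?l j - k)) (?y j)) (z, cnjv z)" for i
      using hp[OF bihom_cst_mult[OF h(2), of "(-1) ^ (?l j - k)"]]
        hol_same[OF bihom_hol[OF bihom_cst_mult[OF h(2), of "(-1) ^ (?l j - k)"]], of "(z, 0)" "(z, cnjv z)"] by simp
    show ?thesis
      unfolding veval_def scalar_prod_def hU hV by (simp add: scalar_prod_def)
  qed
  have beval: "beval P z = complex_of_real (\<Sum>j=1..length ys. Re (\<Sum>k=1..?l j.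
      veval 1 (?U j k) z \<bullet>c veval 1 (?V j (?l j - k + 1)) z))" for z
  proof -
    have ch: "(\<Sum>k=1..?l j. veval 1 (?U j k) z \<bullet>c veval 1 (?V j (?l j - k + 1)) z) =
        ev (chain_el Y (?l j) (?x j) (?y j)) (z, cnjv z)" if j: "j \<in> {1..length ys}" for j
    proof -
      have "(\<Sum>k=1..?l j. veval 1 (?U j k) z \<bullet>c veval 1 (?V j (?l j - k + 1)) z) =
          (\<Sum>k=1..?l j. ev ((Dz Y ^^ (k - 1)) (?x j) * tau (cst ((-1) ^ (?l j - k)) * (Dz Y ^^ (?l j - k)) (?y j))) (z, cnjv z))"
        by (intro sum.cong refl pair[OF j])
      also have "\<dots> = (\<Sum>k<?l j. ev ((Dz Y ^^ k) (?x j) * tau (cst ((-1) ^ (?l j - 1 - k)) * (Dz Y ^^ (?l j - 1 - k)) (?y j))) (z, cnjv z))"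
        by (rule sum.reindex_bij_witness[of _ Suc "\<lambda>k. k - 1"]) auto
      finally show ?thesis by (simp only: chain_el_def ev_sum)
    qed
    have "ev (cplx P) (z, cnjv z) = (\<Sum>j<length ys. ev (case ys ! j of (l, x, y) \<Rightarrow> chain_el Y l x y) (z, cnjv z))"
      unfolding ys(2) by (simp add: sum_list_sum_nth atLeast0LessThan)
    also have "\<dots> = (\<Sum>j=1..length ys. ev (chain_el Y (?l j) (?x j) (?y j)) (z, cnjv z))"
      by (rule sum.reindex_bij_witness[of _ "\<lambda>j. j - 1" Suc]) (auto simp: c_def case_prod_unfold)
    finally have 1: "beval P z = (\<Sum>j=1..length ys. ev (chain_el Y (?l j) (?x j) (?y j)) (z, cnjv z))"
      by (simp add: beval_cplx)
    \<comment> \<open>A single chain need not be real, but their sum P is, so taking real parts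
      chain by chain does not change the total.\<close>
    have "ev (tau (cplx P)) (z, cnjv z) = ev (cplx P) (z, cnjv z)" by (simp only: real)
    then have re: "complex_of_real (Re (beval P z)) = beval P z"
      by (simp add: beval_cplx complex_eq_iff)
    have "(\<Sum>j=1..length ys. Re (\<Sum>k=1..?l j. veval 1 (?U j k) z \<bullet>c veval 1 (?V j (?l j - k + 1)) z)) =
        (\<Sum>j=1..length ys. Re (ev (chain_el Y (?l j) (?x j) (?y j)) (z, cnjv z)))"
      by (intro sum.cong refl) (simp only: ch)
    also have "\<dots> = Re (beval P z)"
      unfolding 1 by (simp only: Re_sum)
    finally show ?thesis by (simp only: re)
  qed
  have "\<exists>j. F j \<noteq> 0"
  proof (rule ccontr)
    assume "\<not> (\<exists>j. F j \<noteq> 0)"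
    then have "ev (Y j) (z, 0) = 0" for j z
      using F(1)[of j z] by (simp add: heval_def)
    then have "Y j = 0" for j
      using hol_same[OF holY] by (intro pring_eqI) (metis ev_0 fst_conv prod.collapse)
    then show False using Y(3) by auto
  qed
  \<comment> \<open>All variables have weight \<open>m\<close>, so a coefficient of degree
    \<open>e\<close> has weight m e = m (e - 1) + m.\<close>
  moreover have "field_weight (\<lambda>_. m) (m * real (e - 1)) F"
    unfolding field_weight_def whomogeneous_def wdeg_const
  proof (intro allI ballI)
    fix j \<alpha> assume "\<alpha> \<in> Poly_Mapping.keys (F j)"
    then have "sum \<alpha> UNIV = e" by (rule F(2))
    then show "m * real (sum \<alpha> UNIV) = m * real (e - 1) + m"
      using Y(2) by (simp add: of_nat_diff algebra_simps)
  qed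
  moreover have "0 < m * real (e - 1)" using \<open>0 < m\<close> Y(2) by simp
  moreover have "\<forall>j\<in>{1..length ys}. symmetric_chain_pair (\<lambda>_. m) F 1 (?l j) (?U j) (?V j)"
    by (intro ballI symmetric_chain_pairI[where Y = Y and F = F and hp = hp, OF hc F(1) hp Y(1,2)])
  ultimately show ?thesis
    unfolding chain_hypersurface_def using beval
    by (intro exI[of _ F] exI[of _ "m * real (e - 1)"] exI[of _ "length ys"] exI[of _ ?l] exI[of _ "\<lambda>_. 1"] exI[of _ ?U] exI[of _ ?V]) blast
qed

section \<open>Smoothness of the model and fields that annihilate P\<close>

section \<open>Smooth functions and holomorphic nondegeneracy\<close>

lemma smooth_on_differentiable: "smooth_on S f \<Longrightarrow> x \<in> S \<Longrightarrow> f differentiable (at x)"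
  and smooth_on_derivative: "smooth_on S f \<Longrightarrow> smooth_on S (\<lambda>x. frechet_derivative f (at x) v)"
  by (auto elim: smooth_on.cases)

lemma smooth_on_has_derivative:
  "smooth_on S f \<Longrightarrow> x \<in> S \<Longrightarrow> (f has_derivative frechet_derivative f (at x)) (at x)"
  using smooth_on_differentiable frechet_derivative_works by blast

lemma frechet_derivative_cong_open:
  assumes "open S" "x \<in> S" "\<And>y. y \<in> S \<Longrightarrow> f y = g y" "g differentiable (at x)"
  shows "f differentiable (at x)" "frechet_derivative f (at x) = frechet_derivative g (at x)"
proof -
  have "(f has_derivative frechet_derivative g (at x)) (at x)"
    using assms has_derivative_transform_within_open[of g "frechet_derivative g (at x)" x UNIV S f]
    by (simp add: frechet_derivative_works[symmetric])
  then show "f differentiable (at x)" "frechet_derivative f (at x) = frechet_derivative g (at x)"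
    using frechet_derivative_at differentiable_def by metis+
qed

text \<open>A class closed under directional derivatives; its real parts form the invariant for the
  coinductive definition of smoothness.\<close>

inductive_set real_poly_fun :: "('a::real_normed_vector \<Rightarrow> complex) set" where
  "(\<lambda>_. c) \<in> real_poly_fun"
| "bounded_linear f \<Longrightarrow> f \<in> real_poly_fun"
| "f \<in> real_poly_fun \<Longrightarrow> g \<in> real_poly_fun \<Longrightarrow> (\<lambda>x. f x + g x) \<in> real_poly_fun"
| "f \<in> real_poly_fun \<Longrightarrow> g \<in> real_poly_fun \<Longrightarrow> (\<lambda>x. f x * g x) \<in> real_poly_fun"

lemma real_poly_fun_derivative:
  assumes "f \<in> real_poly_fun"
  shows "\<exists>D. (\<forall>x. (f has_derivative D x) (at x)) \<and> (\<forall>v. (\<lambda>x. D x v) \<in> real_poly_fun)"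
  using assms
proof induction
  case (1 c)
  show ?case by (rule exI[of _ "\<lambda>_ _. 0"]) (auto intro: real_poly_fun.intros)
next
  case (2 f)
  then show ?case
    by (intro exI[of _ "\<lambda>_. f"]) (auto intro: real_poly_fun.intros bounded_linear_imp_has_derivative)
next
  case (3 f g)
  then obtain D E where *: "\<And>x. (f has_derivative D x) (at x)" "\<And>v. (\<lambda>x. D x v) \<in> real_poly_fun"
    "\<And>x. (g has_derivative E x) (at x)" "\<And>v. (\<lambda>x. E x v) \<in> real_poly_fun" by blast
  show ?case
    by (rule exI[of _ "\<lambda>x v. D x v + E x v"]) (auto intro!: real_poly_fun.intros(3) has_derivative_add *)
next
  case (4 f g)
  then obtain D E where *: "\<And>x. (f has_derivative D x) (at x)" "\<And>v. (\<lambda>x. D x v) \<in> real_poly_fun"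
    "\<And>x. (g has_derivative E x) (at x)" "\<And>v. (\<lambda>x. E x v) \<in> real_poly_fun" by blast
  show ?case
    by (rule exI[of _ "\<lambda>x v. f x * E x v + D x v * g x"])
      (auto intro!: real_poly_fun.intros(3,4) has_derivative_mult * 4)
qed

lemma smooth_on_Re_real_poly_fun:
  assumes "f \<in> real_poly_fun"
  shows "smooth_on S (\<lambda>x. Re (f x))"
proof -
  have "\<exists>f\<in>real_poly_fun. g = (\<lambda>x. Re (f x)) \<Longrightarrow> smooth_on S g" for g :: "'a \<Rightarrow> real"
  proof (coinduction arbitrary: g)
    case smooth_on
    then obtain f D where f: "g = (\<lambda>x. Re (f x))" "\<And>x. (f has_derivative D x) (at x)" "\<And>v. (\<lambda>x. D x v) \<in> real_poly_fun"
      using real_poly_fun_derivative by blast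
    have g: "(g has_derivative (\<lambda>v. Re (D x v))) (at x)" for x
      unfolding f(1) by (rule bounded_linear.has_derivative[OF bounded_linear_Re f(2)])
    then have "frechet_derivative g (at x) v = Re (D x v)" for x v
      using frechet_derivative_at by metis
    then show ?case
      using g f(3) differentiable_def by (intro exI[of _ g]) fastforce
  qed
  then show ?thesis using assms by blast
qed

lemma beval_real_poly_fun: "(\<lambda>x. ev Q (fst x, cnjv (fst x))) \<in> real_poly_fun"
proof (induction Q)
  case (Zv j)
  show ?case
    by simp (intro real_poly_fun.intros(2) bounded_linear_compose[OF bounded_linear_vec_nth bounded_linear_fst])
next
  case (Wv j)
  show ?case
    by simp (intro real_poly_fun.intros(2) bounded_linear_compose[OF bounded_linear_cnj]
      bounded_linear_compose[OF bounded_linear_vec_nth bounded_linear_fst])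
qed (auto intro: real_poly_fun.intros)

lemma has_derivative_vec_lambda:
  fixes f :: "'n::finite \<Rightarrow> 'a::real_normed_vector \<Rightarrow> complex"
  assumes "\<And>j. (f j has_derivative f' j) F"
  shows "((\<lambda>x. \<chi> j. f j x) has_derivative (\<lambda>v. \<chi> j. f' j v)) F"
proof -
  have eq: "(\<chi> j. u j) = (\<Sum>j\<in>UNIV. axis j (u j))" for u :: "'n \<Rightarrow> complex"
    by (auto simp: fcp_eq_iff axis_def sum.delta' if_distrib)
  have "bounded_linear (axis j :: complex \<Rightarrow> complex ^ 'n)" for j
    unfolding linear_conv_bounded_linear[symmetric]
    by (rule linearI) (auto simp: fcp_eq_iff axis_def)
  then show ?thesis
    unfolding eq by (intro has_derivative_sum bounded_linear.has_derivative[OF _ assms])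
qed

lemma ev_diag_has_derivative:
  "((\<lambda>z. ev Q (z, cnjv z)) has_derivative
    (\<lambda>v. \<Sum>j\<in>UNIV. v $ j * ev (dz j Q) (z, cnjv z) + cnj (v $ j) * ev (dw j Q) (z, cnjv z))) (at z)"
proof -
  have "bounded_linear (cnjv :: complex ^ 'a \<Rightarrow> complex ^ 'a)"
    unfolding linear_conv_bounded_linear[symmetric] by (rule linearI) (simp_all add: fcp_eq_iff)
  from has_derivative_compose[OF has_derivative_Pair[OF has_derivative_ident
        bounded_linear.has_derivative[OF this has_derivative_ident]] ev_has_derivative[where Q = Q], where x = z and s = UNIV]
  show ?thesis by simp
qed

lemma ev_dw_real: "tau Q = Q \<Longrightarrow> ev (dw j Q) (z, cnjv z) = cnj (ev (dz j Q) (z, cnjv z))"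
  by (simp add: dw_tau)

lemma real_ev_has_derivative:
  assumes "tau Q = Q"
  shows "((\<lambda>z. Re (ev Q (z, cnjv z))) has_derivative (\<lambda>v. 2 * Re (\<Sum>j\<in>UNIV. v $ j * ev (dz j Q) (z, cnjv z)))) (at z)"
proof -
  have "(\<lambda>v. Re (\<Sum>j\<in>UNIV. v $ j * ev (dz j Q) (z, cnjv z) + cnj (v $ j) * ev (dw j Q) (z, cnjv z))) =
      (\<lambda>v. 2 * Re (\<Sum>j\<in>UNIV. v $ j * ev (dz j Q) (z, cnjv z)))"
    by (simp add: ev_dw_real[OF assms] sum.distrib fun_eq_iff sum_distrib_left del: complex_cnj_mult flip: complex_cnj_mult)
  then show ?thesis
    using bounded_linear.has_derivative[OF bounded_linear_Re ev_diag_has_derivative[of Q z]] by simp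
qed

lemma norm_vec_smult: "norm (c *s z) = norm c * norm (z :: complex ^ 'n::finite)"
  by (simp add: norm_vec_def L2_set_right_distrib norm_mult)

text \<open>If F(P) = 0, then the field with components \<open>F\<close> and zero w-component is
  tangent to the model together with its multiple by i, so it vanishes near 0. Homogeneity carries
  this to every z.\<close>

lemma nondegenerate_field:
  fixes P :: "'n::finite bipoly" and F :: "'n \<Rightarrow> 'n pring"
  assumes nd: "holomorphically_nondegenerate (model_hypersurface P)" and real: "tau (cplx P) = cplx P"
    and F: "\<And>j. bihom e 0 (F j)" and zero: "Dz F (cplx P) = 0"
  shows "F = (\<lambda>_. 0)"
proof -
  let ?M = "model_hypersurface P"
  define \<rho> :: "'n cspace \<Rightarrow> real" where "\<rho> q = Re (- \<i> * snd q + - ev (cplx P) (fst q, cnjv (fst q)))" for q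
  define X :: "'n cspace \<Rightarrow> 'n cspace" where "X q = (\<chi> j. ev (F j) (fst q, 0), 0)" for q
  have \<rho>': "(\<rho> has_derivative (\<lambda>v. Im (snd v) - 2 * Re (\<Sum>j\<in>UNIV. fst v $ j * ev (dz j (cplx P)) (fst q, cnjv (fst q))))) (at q)" for q
  proof -
    have "\<rho> = (\<lambda>q. Im (snd q) - Re (ev (cplx P) (fst q, cnjv (fst q))))"
      by (simp add: \<rho>_def fun_eq_iff)
    then show ?thesis
      using has_derivative_diff[OF bounded_linear.has_derivative[OF bounded_linear_Im has_derivative_snd[OF has_derivative_ident]]
          has_derivative_compose[OF has_derivative_fst[OF has_derivative_ident] real_ev_has_derivative[OF real]], of q UNIV]
      by simp
  qed
  have fd: "frechet_derivative \<rho> (at q) v = Im (snd v) - 2 * Re (\<Sum>j\<in>UNIV. fst v $ j * ev (dz j (cplx P)) (fst q, cnjv (fst q)))" for q v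
    by (rule fun_cong[OF frechet_derivative_at[OF \<rho>'[of q], symmetric]])
  have "smooth_on UNIV \<rho>"
    unfolding \<rho>_def
  proof (intro smooth_on_Re_real_poly_fun real_poly_fun.intros(3))
    show "(\<lambda>x::'n cspace. - \<i> * snd x) \<in> real_poly_fun"
      by (intro real_poly_fun.intros(2) bounded_linear_compose[OF bounded_linear_mult_right bounded_linear_snd])
    show "(\<lambda>x::'n cspace. - ev (cplx P) (fst x, cnjv (fst x))) \<in> real_poly_fun"
      using beval_real_poly_fun[of "- cplx P"] by simp
  qed
  moreover have "frechet_derivative \<rho> (at q) \<noteq> (\<lambda>_. 0)" for q
  proof
    assume "frechet_derivative \<rho> (at q) = (\<lambda>_. 0)"
    then show False using fd[of q "(0, \<i>)"] by simp
  qed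
  ultimately have ldf: "local_defining_function ?M UNIV \<rho>"
    by (auto simp: local_defining_function_def model_hypersurface_def \<rho>_def beval_cplx)
  have "X q \<in> complex_tangent_space ?M q" for q
  proof -
    have ev_F: "ev (F j) (fst q, 0) = ev (F j) (fst q, cnjv (fst q))" for j
      using hol_same[OF bihom_hol[OF F]] by simp
    have "(\<Sum>j\<in>UNIV. ev (F j) (fst q, 0) * ev (dz j (cplx P)) (fst q, cnjv (fst q))) = ev (Dz F (cplx P)) (fst q, cnjv (fst q))"
      by (simp add: Dz_def ev_F)
    then have s: "(\<Sum>j\<in>UNIV. ev (F j) (fst q, 0) * ev (dz j (cplx P)) (fst q, cnjv (fst q))) = 0"
      by (simp add: zero)
    then have "(\<Sum>j\<in>UNIV. \<i> * ev (F j) (fst q, 0) * ev (dz j (cplx P)) (fst q, cnjv (fst q))) = 0"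
      by (simp add: mult.assoc flip: sum_distrib_left)
    then show ?thesis
      unfolding complex_tangent_space_def tangent_space_def
      using ldf s fd[of q "X q"] fd[of q "mult_i (X q)"] by (auto simp: X_def mult_i_def)
  qed
  moreover have "holo_map_on UNIV X"
    unfolding holo_map_on_def
  proof (intro conjI ballI)
    fix q :: "'n cspace"
    let ?D = "\<lambda>v::'n cspace. ((\<chi> i. \<Sum>j\<in>UNIV. fst v $ j * ev (dz j (F i)) (fst q, 0)) :: complex ^ 'n, 0::complex)"
    have "(X has_derivative ?D) (at q)"
      unfolding X_def
      by (intro has_derivative_Pair has_derivative_const has_derivative_vec_lambda
          has_derivative_compose[OF has_derivative_fst[OF has_derivative_ident] ev_hol_has_derivative])
    moreover have "?D (mult_i v) = mult_i (?D v)" for v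
      by (simp add: mult_i_def fcp_eq_iff sum_distrib_left mult.assoc)
    ultimately show "\<exists>D. (X has_derivative D) (at q) \<and> (\<forall>v. D (mult_i v) = mult_i (D v))"
      by blast
  qed simp
  ultimately have "eventually (\<lambda>q. X q = 0) (nhds 0)"
    using nd[unfolded holomorphically_nondegenerate_def, rule_format, of UNIV X] by simp
  then obtain \<epsilon> where \<epsilon>: "\<epsilon> > 0" "\<And>q. dist q 0 < \<epsilon> \<Longrightarrow> X q = 0"
    unfolding eventually_nhds_metric by blast
  have small: "ev (F j) (z, 0) = 0" if "norm z < \<epsilon>" for z j
    using \<epsilon>(2)[of "(z, 0)"] that by (simp add: X_def zero_prod_def fcp_eq_iff dist_norm norm_Pair)
  have "ev (F j) (z, w) = 0" for j z w
  proof -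
    \<comment> \<open>A nonzero scalar that brings z into the ball of radius \<epsilon>; homogeneity
      then allows division by s^e.\<close>
    define s where "s = complex_of_real (\<epsilon> / (2 * (norm z + 1)))"
    have nz: "norm z + 1 > 0" by (simp add: add_nonneg_pos)
    then have "\<epsilon> / (2 * (norm z + 1)) \<noteq> 0" using \<epsilon>(1) by simp
    then have s0: "s \<noteq> 0" unfolding s_def by (simp only: of_real_eq_0_iff not_False_eq_True)
    have "norm s = \<epsilon> / (2 * (norm z + 1))"
      unfolding s_def norm_of_real using \<epsilon>(1) nz by simp
    then have "norm (s *s z) = (\<epsilon> / 2) * (norm z / (norm z + 1))"
      unfolding norm_vec_smult by simp
    also have "\<dots> < \<epsilon>"
      using \<epsilon>(1) nz by (intro le_less_trans[OF mult_left_le]) (auto simp: divide_le_eq)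
    finally have "0 = ev (F j) (s *s z, 1 *s 0)"
      using small by simp
    also have "\<dots> = s ^ e * ev (F j) (z, 0)"
      using F[of j, unfolded bihom_def, rule_format, of s z 1 0] by simp
    finally show ?thesis
      using s0 hol_same[OF bihom_hol[OF F], of "(z, w)" "(z, 0)" j] by simp
  qed
  then show ?thesis
    by (auto intro!: pring_eqI)
qed

section \<open>Jordan form of a linear field and its polynomial eigenvectors\<close>

section \<open>Diagonalising coordinates\<close>

text \<open>The two features of a Jordan matrix that matter: off-diagonal entries raise the index by
  one and join equal eigenvalues. Hence the off-diagonal part is nilpotent and commutes with the
  diagonal part.\<close>

definition jordan_like :: "complex mat \<Rightarrow> bool" where
  "jordan_like J \<longleftrightarrow> (\<forall>i<dim_row J. \<forall>j<dim_row J. i \<noteq> j \<longrightarrow> J $$ (i, j) \<noteq> 0 \<longrightarrow> j = Suc i \<and> J $$ (i, i) = J $$ (j, j))"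

lemma jordan_like_jordan_matrix: "jordan_like (jordan_matrix n_as)"
proof (induction n_as)
  case Nil
  show ?case by (simp add: jordan_like_def)
next
  case (Cons a n_as)
  obtain n c where a: "a = (n, c)" by force
  let ?J = "jordan_matrix n_as"
  have dim: "dim_row ?J = dim_col ?J" by simp
  have eq: "jordan_matrix (a # n_as) = four_block_mat (jordan_block n c) (0\<^sub>m n (dim_col ?J)) (0\<^sub>m (dim_row ?J) n) ?J"
    by (simp add: a jordan_matrix_def Let_def)
  show ?case
    unfolding jordan_like_def
  proof (intro allI impI)
    fix i j assume ij: "i < dim_row (jordan_matrix (a # n_as))" "j < dim_row (jordan_matrix (a # n_as))"
      "i \<noteq> j" "jordan_matrix (a # n_as) $$ (i, j) \<noteq> 0"
    then have b: "i < n + dim_row ?J" "j < n + dim_row ?J"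
      by (simp_all add: a)
    have ent: "jordan_matrix (a # n_as) $$ (i, j) =
        (if i < n then if j < n then jordan_block n c $$ (i, j) else 0
         else if j < n then 0 else ?J $$ (i - n, j - n))" if "i < n + dim_row ?J" "j < n + dim_row ?J" for i j
      unfolding eq using that dim by (subst index_mat_four_block) auto
    consider "i < n" "j < n" | "\<not> i < n" "\<not> j < n" using ij(4) ent[OF b] by (auto split: if_splits)
    then show "j = Suc i \<and> jordan_matrix (a # n_as) $$ (i, i) = jordan_matrix (a # n_as) $$ (j, j)"
    proof cases
      case 1
      then show ?thesis using ij(3,4) b by (auto simp: ent split: if_splits)
    next
      case 2
      then have "?J $$ (i - n, j - n) \<noteq> 0" "i - n < dim_row ?J" "j - n < dim_row ?J" "i - n \<noteq> j - n"
        using ij(3,4) ent[OF b] b by auto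
      then have "j - n = Suc (i - n)" "?J $$ (i - n, i - n) = ?J $$ (j - n, j - n)"
        using Cons unfolding jordan_like_def by blast+
      then show ?thesis using 2 b by (auto simp: ent)
    qed
  qed
qed

text \<open>A bijection of the index type with an initial segment of the naturals transports the
  Jordan form, and doubles as the rank \<open>r\<close> that off-diagonal entries increase.\<close>

lemma jordan_basis:
  fixes A :: "'n::finite \<Rightarrow> 'n \<Rightarrow> complex"
  obtains T S J :: "'n \<Rightarrow> 'n \<Rightarrow> complex" and r :: "'n \<Rightarrow> nat"
  where "\<And>i k. (\<Sum>j\<in>UNIV. T i j * S j k) = (if i = k then 1 else 0)"
    and "\<And>i k. (\<Sum>j\<in>UNIV. S i j * T j k) = (if i = k then 1 else 0)"
    and "\<And>i k. (\<Sum>j\<in>UNIV. A i j * T j k) = (\<Sum>j\<in>UNIV. T i j * J j k)"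
    and "\<And>i j. i \<noteq> j \<Longrightarrow> J i j \<noteq> 0 \<Longrightarrow> r j = Suc (r i) \<and> J i i = J j j"
proof -
  define n where "n = CARD('n)"
  obtain e :: "'n \<Rightarrow> nat" where e: "bij_betw e UNIV {0..<n}"
    using ex_bij_betw_finite_nat[of "UNIV :: 'n set"] by (auto simp: n_def)
  have re: "(\<Sum>j\<in>UNIV. f (e j)) = (\<Sum>j\<in>{0..<n}. f j)" for f :: "nat \<Rightarrow> complex"
    by (rule sum.reindex_bij_betw[OF e])
  have en: "e i < n" for i using e by (auto simp: bij_betw_def)
  have ei: "e i = e j \<longleftrightarrow> i = j" for i j using e by (auto simp: bij_betw_def inj_on_def)
  define d where "d = inv_into UNIV e"
  have de: "d (e i) = i" for i unfolding d_def using e by (simp add: bij_betw_def)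
  define A' where "A' = mat n n (\<lambda>(i, j). A (d i) (d j))"
  have A': "A' \<in> carrier_mat n n" by (simp add: A'_def)
  obtain as where "char_poly A' = (\<Prod>a\<leftarrow>as. [:- a, 1:])"
    using char_poly_factorized[OF A'] by blast
  then obtain n_as where "jordan_nf A' n_as"
    using jordan_nf_exists[OF A'] by blast
  then obtain m P Q where "{A', jordan_matrix n_as, P, Q} \<subseteq> carrier_mat m m" "P * Q = 1\<^sub>m m" "Q * P = 1\<^sub>m m" "A' = P * jordan_matrix n_as * Q"
    unfolding jordan_nf_def using similar_matD by blast
  moreover from this have "m = n" using A' by auto
  ultimately have c: "jordan_matrix n_as \<in> carrier_mat n n" "P \<in> carrier_mat n n" "Q \<in> carrier_mat n n"
    and PQ: "P * Q = 1\<^sub>m n" "Q * P = 1\<^sub>m n" and AP: "A' = P * jordan_matrix n_as * Q" by auto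
  define J where "J = jordan_matrix n_as"
  have cJ: "J \<in> carrier_mat n n" using c by (simp add: J_def)
  have AP': "A' * P = P * J"
  proof -
    have "A' * P = P * J * (Q * P)"
      unfolding AP J_def[symmetric] using c cJ by (simp add: assoc_mult_mat[of _ n n _ n _ n])
    then show ?thesis using PQ c cJ by simp
  qed
  have ent: "(X * Y) $$ (e i, e k) = (\<Sum>j\<in>UNIV. X $$ (e i, e j) * Y $$ (e j, e k))"
    if "X \<in> carrier_mat n n" "Y \<in> carrier_mat n n" for X Y :: "complex mat" and i k
    using that en by (simp add: scalar_prod_def re[of "\<lambda>j. X $$ (e i, j) * Y $$ (j, e k)"])
  show ?thesis
  proof (rule that[of "\<lambda>i j. P $$ (e i, e j)" "\<lambda>i j. Q $$ (e i, e j)" "\<lambda>i j. J $$ (e i, e j)" e])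
    fix i k
    show "(\<Sum>j\<in>UNIV. P $$ (e i, e j) * Q $$ (e j, e k)) = (if i = k then 1 else 0)"
      using ent[OF c(2,3), of i k] PQ(1) en[of i] en[of k] ei by simp
    show "(\<Sum>j\<in>UNIV. Q $$ (e i, e j) * P $$ (e j, e k)) = (if i = k then 1 else 0)"
      using ent[OF c(3,2), of i k] PQ(2) en[of i] en[of k] ei by simp
    have "A i j = A' $$ (e i, e j)" for j using en de by (simp add: A'_def)
    then show "(\<Sum>j\<in>UNIV. A i j * P $$ (e j, e k)) = (\<Sum>j\<in>UNIV. P $$ (e i, e j) * J $$ (e j, e k))"
      using ent[OF A' c(2), of i k] ent[OF c(2) cJ, of i k] AP' by simp
  next
    fix i j assume "i \<noteq> j" "J $$ (e i, e j) \<noteq> 0"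
    then show "e j = Suc (e i) \<and> J $$ (e i, e i) = J $$ (e j, e j)"
      using jordan_like_jordan_matrix[of n_as] cJ en[of i] en[of j] ei[of i j]
      unfolding jordan_like_def J_def[symmetric] by auto
  qed
qed

text \<open>The second variable is transformed by the conjugate matrix, so that conjugate pairs go
  to conjugate pairs and the substitution commutes with \<open>tau\<close>.\<close>

lift_definition lsubst :: "('n \<Rightarrow> 'n \<Rightarrow> complex) \<Rightarrow> 'n::finite pring \<Rightarrow> 'n pring"
  is "\<lambda>T f x. f (\<chi> i. \<Sum>k\<in>UNIV. T i k * fst x $ k, \<chi> i. \<Sum>k\<in>UNIV. cnj (T i k) * snd x $ k)"
proof -
  fix T :: "'n \<Rightarrow> 'n \<Rightarrow> complex" and f :: "'n zpair \<Rightarrow> complex" assume "f \<in> pair_poly"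
  then show "(\<lambda>x. f (\<chi> i. \<Sum>k\<in>UNIV. T i k * fst x $ k, \<chi> i. \<Sum>k\<in>UNIV. cnj (T i k) * snd x $ k)) \<in> pair_poly"
  proof (rule generated_algebra_subst)
    fix x :: "'n zpair \<Rightarrow> complex" assume "x \<in> range zc \<union> range wc"
    then show "(\<lambda>y. x (\<chi> i. \<Sum>k\<in>UNIV. T i k * fst y $ k, \<chi> i. \<Sum>k\<in>UNIV. cnj (T i k) * snd y $ k)) \<in> pair_poly"
      by (auto simp: zc_def wc_def intro!: generated_algebra_sum generated_algebra.mult generated_algebra.const pair_poly_fst pair_poly_snd)
  qed
qed

definition lmap :: "('n \<Rightarrow> 'n \<Rightarrow> complex) \<Rightarrow> complex ^ 'n::finite \<Rightarrow> complex ^ 'n" where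
  "lmap T y = (\<chi> i. \<Sum>k\<in>UNIV. T i k * y $ k)"

lemma ev_lsubst: "ev (lsubst T Q) (y, cnjv y') = ev Q (lmap T y, cnjv (lmap T y'))"
proof -
  have "(\<chi> i. \<Sum>k\<in>UNIV. cnj (T i k) * cnjv y' $ k) = cnjv (lmap T y')"
    by (simp add: fcp_eq_iff lmap_def)
  then show ?thesis by (simp add: lsubst.rep_eq lmap_def)
qed

lemma lsubst_simps: "lsubst T (Q + R) = lsubst T Q + lsubst T R" "lsubst T (Q * R) = lsubst T Q * lsubst T R"
  "lsubst T (cst c) = cst c" "lsubst T (Zv j) = (\<Sum>k\<in>UNIV. cst (T j k) * Zv k)"
  "lsubst T (Wv j) = (\<Sum>k\<in>UNIV. cst (cnj (T j k)) * Wv k)" "lsubst T 0 = 0"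
  by (auto intro!: pring_eqI simp: lsubst.rep_eq)

lemma lsubst_sum: "lsubst T (sum f A) = (\<Sum>i\<in>A. lsubst T (f i))"
  by (induction A rule: infinite_finite_induct) (auto simp: lsubst_simps)

lemma tau_lsubst: "tau (lsubst T Q) = lsubst T (tau Q)"
  by (rule polarisation_eq) (simp add: ev_lsubst)

lemma lmap_scale: "lmap T (s *s y) = s *s lmap T y"
  by (simp add: lmap_def fcp_eq_iff sum_distrib_left mult_ac)

lemma bihom_lsubst:
  assumes "bihom p q Q" shows "bihom p q (lsubst T Q)"
  unfolding bihom_def
proof (intro allI)
  fix s t z w
  have "ev (lsubst T Q) (s *s z, t *s w) = ev (lsubst T Q) (s *s z, cnjv (cnj t *s cnjv w))"
    by (simp add: cnjv_scale)
  also have "\<dots> = ev Q (s *s lmap T z, t *s cnjv (lmap T (cnjv w)))"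
    unfolding ev_lsubst by (simp add: lmap_scale cnjv_scale)
  also have "\<dots> = s ^ p * t ^ q * ev (lsubst T Q) (z, cnjv (cnjv w))"
    using assms by (simp only: bihom_def ev_lsubst)
  finally show "ev (lsubst T Q) (s *s z, t *s w) = s ^ p * t ^ q * ev (lsubst T Q) (z, w)" by simp
qed

text \<open>Applying D - a to the sum removes the eigenvector for \<open>a\<close> and multiplies
  the others by nonzero scalars.\<close>

lemma eigen_independent:
  fixes R :: "complex \<Rightarrow> 'n::finite pring"
  assumes "finite K" and D: "derivation D" "\<And>c. D (cst c) = 0"
    and "\<And>\<kappa>. \<kappa> \<in> K \<Longrightarrow> D (R \<kappa>) = cst \<kappa> * R \<kappa>" and "sum R K = 0" and "\<kappa> \<in> K"
  shows "R \<kappa> = 0"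
  using assms(1,4,5,6)
proof (induction K arbitrary: R \<kappa> rule: finite_induct)
  case (insert a K)
  have Ra: "sum R K = - R a"
    using insert.prems(2) insert.hyps by (simp add: eq_neg_iff_add_eq_0 add.commute)
  have "(\<Sum>\<kappa>\<in>K. cst \<kappa> * R \<kappa>) = D (sum R K)"
    using insert.prems(1) by (simp add: derivation_sum[OF D(1)])
  also have "\<dots> = cst a * sum R K"
    using insert.prems(1)[of a] by (simp add: Ra derivation_minus[OF D(1)])
  finally have "(\<Sum>\<kappa>\<in>K. cst (\<kappa> - a) * R \<kappa>) = 0"
    by (simp add: cst_simps left_diff_distrib sum_subtractf sum_distrib_left)
  moreover have "D (cst (\<kappa> - a) * R \<kappa>) = cst \<kappa> * (cst (\<kappa> - a) * R \<kappa>)" if "\<kappa> \<in> K" for \<kappa>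
    using derivation_const_mult[OF D(1) D(2), of "\<kappa> - a" "R \<kappa>"] insert.prems(1)[of \<kappa>] that
    by (simp add: mult.left_commute)
  ultimately have "cst (\<kappa> - a) * R \<kappa> = 0" if "\<kappa> \<in> K" for \<kappa>
    using that by (intro insert.IH[of "\<lambda>\<kappa>. cst (\<kappa> - a) * R \<kappa>"])
  then have z: "R \<kappa> = 0" if "\<kappa> \<in> K" for \<kappa>
    using that insert.hyps(2) by fastforce
  then have "R a = 0"
    using insert.prems(2) insert.hyps by simp
  then show ?case using z insert.prems(3) by blast
qed simp

lemma Dz_diag_term_of:
  "Dz (\<lambda>i. cst (e i) * Zv i) (term_of c k) = cst (\<Sum>i\<in>UNIV. e i * of_nat (fst k i)) * term_of c k"
proof -
  let ?D = "Dz (\<lambda>i. cst (e i) * Zv i)"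
  have pow: "?D (Zv i ^ m) = cst (e i * of_nat m) * Zv i ^ m" for i m
    by (induction m) (simp_all add: derivation_1[OF derivation_Dz] derivation_mult[OF derivation_Dz] cst_simps algebra_simps)
  have "?D (\<Prod>i\<in>I. Zv i ^ fst k i) = cst (\<Sum>i\<in>I. e i * of_nat (fst k i)) * (\<Prod>i\<in>I. Zv i ^ fst k i)" for I
  proof (induction I rule: infinite_finite_induct)
    case (insert i I)
    have "?D (\<Prod>i\<in>insert i I. Zv i ^ fst k i) =
        cst (e i * of_nat (fst k i)) * Zv i ^ fst k i * (\<Prod>i\<in>I. Zv i ^ fst k i) +
        Zv i ^ fst k i * (cst (\<Sum>i\<in>I. e i * of_nat (fst k i)) * (\<Prod>i\<in>I. Zv i ^ fst k i))"
      unfolding prod.insert[OF insert.hyps(1,2)] derivation_mult[OF derivation_Dz] pow insert.IH ..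
    then show ?case
      using insert.hyps by (simp add: cst_simps(3) algebra_simps)
  qed (simp_all add: derivation_1[OF derivation_Dz] cst_simps)
  then have "?D (mon (fst k)) = cst (\<Sum>i\<in>UNIV. e i * of_nat (fst k i)) * mon (fst k)"
    unfolding mon_def .
  then show ?thesis
    by (simp add: term_of_def derivation_mult[OF derivation_Dz] Dz_tau_hol[OF hol_mon] mult_ac)
qed

(* A field in Jordan form is the sum of a diagonal field and a commuting locally nilpotent one, so that
   an eigenvector of the field only involves monomials with the same eigenvalue of the diagonal part. *)
lemma jordan_eigenvector_terms:
  fixes J :: "'n::finite \<Rightarrow> 'n \<Rightarrow> complex"
  assumes J: "\<And>i j. i \<noteq> j \<Longrightarrow> J i j \<noteq> 0 \<Longrightarrow> r j = Suc (r i) \<and> J i i = J j j"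
    and eig: "Dz (\<lambda>i. \<Sum>k\<in>UNIV. cst (J i k) * Zv k) Q = cst c * Q"
    and "finite S" and Q: "Q = (\<Sum>k\<in>S. term_of (a k) k)"
  shows "Q = (\<Sum>k\<in>{k\<in>S. (\<Sum>i\<in>UNIV. J i i * of_nat (fst k i)) = c}. term_of (a k) k)"
proof -
  define D where "D = Dz (\<lambda>i. cst (J i i) * Zv i)"
  define N where "N = Dz (\<lambda>i. \<Sum>k\<in>UNIV - {i}. cst (J i k) * Zv k)"
  have derD: "derivation D" and derN: "derivation N" by (simp_all add: D_def N_def derivation_Dz)
  have cst0: "D (cst u) = 0" "N (cst u) = 0" for u by (simp_all add: D_def N_def)
  have split: "Dz (\<lambda>i. \<Sum>k\<in>UNIV. cst (J i k) * Zv k) R = D R + N R" for R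
  proof -
    have "(\<lambda>i. \<Sum>k\<in>UNIV. cst (J i k) * Zv k) =
        (\<lambda>i. cst (J i i) * Zv i + (\<Sum>k\<in>UNIV - {i}. cst (J i k) * Zv k))"
      by (rule ext) (rule sum.remove, simp_all)
    then show ?thesis
      unfolding D_def N_def Dz_field_add[symmetric] by simp
  qed
  have comm: "D (N R) = N (D R)" for R
  proof -
    have "D (\<Sum>k\<in>UNIV - {i}. cst (J i k) * Zv k) = N (cst (J i i) * Zv i)" for i
    proof -
      have "D (\<Sum>k\<in>UNIV - {i}. cst (J i k) * Zv k) = (\<Sum>k\<in>UNIV - {i}. cst (J i k) * (cst (J k k) * Zv k))"
        by (simp add: derivation_sum[OF derD] derivation_const_mult[OF derD] cst0) (simp add: D_def)
      also have "\<dots> = (\<Sum>k\<in>UNIV - {i}. cst (J i i) * (cst (J i k) * Zv k))"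
      proof (rule sum.cong)
        fix k assume "k \<in> UNIV - {i}"
        then show "cst (J i k) * (cst (J k k) * Zv k) = cst (J i i) * (cst (J i k) * Zv k)"
          using J[of i k] by (cases "J i k = 0") (auto simp: cst_simps)
      qed simp
      also have "\<dots> = N (cst (J i i) * Zv i)"
        by (simp add: derivation_const_mult[OF derN] cst0 sum_distrib_left) (simp add: N_def sum_distrib_left)
      finally show ?thesis .
    qed
    then have "D (N R) - N (D R) = Dz (\<lambda>_. 0) R"
      unfolding D_def N_def Dz_commutator by simp
    then show ?thesis by (simp add: Dz_def)
  qed
  \<comment> \<open>\<open>N\<close> sends a variable to variables of the next rank, hence is
    nilpotent on the finitely many variables; sums and the Leibniz rule extend this to all
    polynomials.\<close>
  have nilZ: "\<exists>m. (N ^^ m) (Zv i) = 0" for i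
  proof (induction "Max (range r) - r i" arbitrary: i rule: less_induct)
    case less
    have "\<exists>m. (N ^^ m) (cst (J i k) * Zv k) = 0" if "k \<in> UNIV - {i}" for k
    proof (cases "J i k = 0")
      case True
      then show ?thesis by (intro exI[of _ 0]) (simp add: cst_simps)
    next
      case False
      then have "r k = Suc (r i)" using J that by auto
      moreover have "r k \<le> Max (range r)" by (intro Max_ge) auto
      ultimately have "Max (range r) - r k < Max (range r) - r i" by linarith
      then obtain m where "(N ^^ m) (Zv k) = 0" using less.hyps by blast
      then show ?thesis
        using derivation_funpow_const_mult[OF derN cst0(2)] by (intro exI[of _ m]) simp
    qed
    then obtain m where m: "\<And>k. k \<in> UNIV - {i} \<Longrightarrow> (N ^^ m k) (cst (J i k) * Zv k) = 0" by metis
    define M where "M = Max (range m)"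
    have "(N ^^ M) (\<Sum>k\<in>UNIV - {i}. cst (J i k) * Zv k) = 0"
      unfolding derivation_funpow_sum[OF derN]
    proof (rule sum.neutral, rule ballI)
      fix k assume "k \<in> UNIV - {i}"
      moreover have "m k \<le> M" unfolding M_def by (intro Max_ge) auto
      ultimately show "(N ^^ M) (cst (J i k) * Zv k) = 0"
        using derivation_nilpotent_mono[OF derN m] by blast
    qed
    moreover have "N (Zv i) = (\<Sum>k\<in>UNIV - {i}. cst (J i k) * Zv k)" by (simp add: N_def)
    ultimately have "(N ^^ Suc M) (Zv i) = 0" by (simp add: funpow_swap1)
    then show ?case by blast
  qed
  have nil: "\<exists>m. (N ^^ m) R = 0" for R
  proof (induction R)
    case (cst u) show ?case by (intro exI[of _ 1]) (simp add: cst0)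
  next
    case (Zv i) show ?case by (rule nilZ)
  next
    case (Wv i) show ?case by (intro exI[of _ 1]) (simp add: N_def)
  next
    case (add A B)
    then obtain m n where "(N ^^ m) A = 0" "(N ^^ n) B = 0" by blast
    then have "(N ^^ (m + n)) A = 0" "(N ^^ (m + n)) B = 0"
      using derivation_nilpotent_mono[OF derN] by (meson le_add1 le_add2)+
    then show ?case by (intro exI[of _ "m + n"]) (simp add: derivation_funpow_add[OF derN])
  next
    case (mult A B)
    then show ?case using derivation_nilpotent_mult[OF derN] by blast
  qed
  define \<kappa> where "\<kappa> k = (\<Sum>i\<in>UNIV. J i i * of_nat (fst k i))" for k :: "('n \<Rightarrow> nat) \<times> ('n \<Rightarrow> nat)"
  define E where "E u = (\<Sum>k\<in>{k\<in>S. \<kappa> k = u}. term_of (a k) k)" for u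
  have DE: "D (E u) = cst u * E u" for u
    unfolding E_def derivation_sum[OF derD] sum_distrib_left
    by (intro sum.cong) (auto simp: D_def Dz_diag_term_of \<kappa>_def)
  have QE: "Q = sum E (\<kappa> ` S)"
    unfolding Q E_def using \<open>finite S\<close> by (simp add: sum.image_gen)
  have zero: "E u = 0" if u: "u \<in> \<kappa> ` S" "u \<noteq> c" for u
  proof -
    \<comment> \<open>Splitting the eigenvalue equation along the eigenvalues u of \<open>D\<close>
      gives (N + u - c) E u = 0 for each of them. Thus \<open>N\<close> multiplies
      \<open>E u\<close> by c - u, and local nilpotency leaves \<open>E u\<close> zero unless u =
      c.\<close>
    let ?R = "\<lambda>u. N (E u) + cst (u - c) * E u"
    have "sum ?R (\<kappa> ` S) = N Q + D Q - cst c * Q"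
      unfolding QE derivation_sum[OF derN] derivation_sum[OF derD] DE
      by (simp add: sum.distrib cst_simps algebra_simps sum_subtractf sum_distrib_left)
    also have "\<dots> = 0" using eig[unfolded split] by (simp add: algebra_simps)
    finally have "sum ?R (\<kappa> ` S) = 0" .
    moreover have "D (?R v) = cst v * ?R v" for v
      by (simp only: derivation_add[OF derD] comm DE derivation_const_mult[OF derN cst0(2)] derivation_const_mult[OF derD cst0(1)])
        (simp add: algebra_simps)
    ultimately have "?R u = 0"
      using eigen_independent[OF _ derD cst0(1), of "\<kappa> ` S" ?R u] u(1) \<open>finite S\<close> by blast
    then have NE: "N (E u) = cst (c - u) * E u" by (simp add: cst_simps algebra_simps eq_neg_iff_add_eq_0)
    have "(N ^^ m) (E u) = cst ((c - u) ^ m) * E u" for m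
    proof (induction m)
      case (Suc m)
      then have "(N ^^ Suc m) (E u) = N (cst ((c - u) ^ m) * E u)" by simp
      also have "\<dots> = cst ((c - u) ^ m) * (cst (c - u) * E u)"
        by (simp only: derivation_const_mult[OF derN cst0(2)] NE)
      finally show ?case by (simp only: power_Suc cst_simps(4) mult_ac)
    qed (simp add: cst_simps)
    moreover obtain m where "(N ^^ m) (E u) = 0" using nil by blast
    ultimately show ?thesis using u(2) by simp
  qed
  have "Q = (\<Sum>u\<in>\<kappa> ` S. if u = c then E u else 0)"
    by (subst QE) (intro sum.cong, auto simp: zero)
  also have "\<dots> = E c"
  proof (cases "c \<in> \<kappa> ` S")
    case False
    then have "E c = 0" unfolding E_def by (intro sum.neutral) auto
    moreover have "(\<Sum>u\<in>\<kappa> ` S. if u = c then E u else 0) = 0" using False by (intro sum.neutral) auto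
    ultimately show ?thesis by simp
  qed (use \<open>finite S\<close> in simp)
  finally show ?thesis by (simp add: E_def \<kappa>_def)
qed


section \<open>Multitype coordinates are stable under linear changes of z when all weights are
  equal\<close>

section \<open>Linear changes of the coordinates\<close>

lemma smooth_comp_linear:
  assumes L: "bounded_linear L" and W: "open W" "smooth_on W r" and g: "\<And>x. L x \<in> W \<Longrightarrow> g x = r (L x)" and x: "L x \<in> W"
  shows "g differentiable (at x)" "frechet_derivative g (at x) v = frechet_derivative r (at (L x)) (L v)"
proof -
  have "open (L -` W)"
    using W(1) L by (intro continuous_open_vimage) (auto simp: linear_continuous_on continuous_on_eq_continuous_at dest: linear_continuous_at)
  moreover have d: "((\<lambda>x. r (L x)) has_derivative (\<lambda>v. frechet_derivative r (at (L x)) (L v))) (at x)"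
    by (rule has_derivative_compose[OF bounded_linear_imp_has_derivative[OF L] smooth_on_has_derivative[OF W(2) x]])
  moreover from this have dd: "(\<lambda>x. r (L x)) differentiable (at x)"
    unfolding differentiable_def by blast
  moreover have "x \<in> L -` W" "\<And>y. y \<in> L -` W \<Longrightarrow> g y = r (L y)" using g x by auto
  ultimately show "g differentiable (at x)" "frechet_derivative g (at x) v = frechet_derivative r (at (L x)) (L v)"
    using frechet_derivative_cong_open[of "L -` W" x g "\<lambda>x. r (L x)"] frechet_derivative_at[OF d, symmetric]
    by auto
qed

lemma smooth_on_comp_linear:
  assumes L: "bounded_linear L" and W: "open W" "smooth_on W r" and g: "\<And>x. L x \<in> W \<Longrightarrow> g x = r (L x)"
  shows "smooth_on (L -` W) g"
proof -
  have "\<exists>r. smooth_on W r \<and> (\<forall>x. L x \<in> W \<longrightarrow> g x = r (L x)) \<Longrightarrow> smooth_on (L -` W) g" for g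
  proof (coinduction arbitrary: g)
    case smooth_on
    then obtain r where r: "smooth_on W r" "\<And>x. L x \<in> W \<Longrightarrow> g x = r (L x)" by blast
    have "\<exists>r'. smooth_on W r' \<and> (\<forall>x. L x \<in> W \<longrightarrow> frechet_derivative g (at x) v = r' (L x))" for v
      using smooth_comp_linear(2)[OF L W(1) r] smooth_on_derivative[OF r(1), of "L v"] by blast
    then show ?case
      using smooth_comp_linear(1)[OF L W(1) r] by (intro exI[of _ g]) auto
  qed
  then show ?thesis using assms by blast
qed

lemma iterated_derivative_comp_linear:
  assumes "bounded_linear L" "open W" "smooth_on W r" "\<And>x. L x \<in> W \<Longrightarrow> g x = r (L x)" "L x \<in> W"
  shows "iterated_derivative vs g x = iterated_derivative (map L vs) r (L x)"
  using assms(3,4)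
proof (induction vs arbitrary: g r)
  case (Cons v vs)
  have "iterated_derivative vs (\<lambda>x. frechet_derivative g (at x) v) x =
      iterated_derivative (map L vs) (\<lambda>x. frechet_derivative r (at x) (L v)) (L x)"
    by (rule Cons.IH) (use smooth_on_derivative[OF Cons.prems(1)] smooth_comp_linear(2)[OF assms(1,2) Cons.prems] in auto)
  then show ?case by simp
qed (use assms(5) in auto)

lemma iterated_derivative_linear_combination:
  fixes f :: "'i \<Rightarrow> 'a::real_normed_vector \<Rightarrow> real"
  assumes "open W" "\<And>b. b \<in> B \<Longrightarrow> smooth_on W (f b)" "\<And>x. x \<in> W \<Longrightarrow> g x = (\<Sum>b\<in>B. c b * f b x)" "x \<in> W"
  shows "iterated_derivative vs g x = (\<Sum>b\<in>B. c b * iterated_derivative vs (f b) x)"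
  using assms(2,3)
proof (induction vs arbitrary: g f)
  case (Cons v vs)
  have d: "((\<lambda>x. \<Sum>b\<in>B. c b * f b x) has_derivative (\<lambda>v. \<Sum>b\<in>B. c b * frechet_derivative (f b) (at x) v)) (at x)" if "x \<in> W" for x
    using Cons.prems(1) that by (intro has_derivative_sum has_derivative_mult_right smooth_on_has_derivative)
  have "frechet_derivative g (at x) v = (\<Sum>b\<in>B. c b * frechet_derivative (f b) (at x) v)" if "x \<in> W" for x
  proof -
    have dd: "(\<lambda>x. \<Sum>b\<in>B. c b * f b x) differentiable (at x)"
      using d[OF that] unfolding differentiable_def by blast
    show ?thesis
      using frechet_derivative_cong_open(2)[OF assms(1) that Cons.prems(2) dd]
        frechet_derivative_at[OF d[OF that], symmetric] by simp
  qed
  then have "iterated_derivative vs (\<lambda>x. frechet_derivative g (at x) v) x =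
      (\<Sum>b\<in>B. c b * iterated_derivative vs (\<lambda>x. frechet_derivative (f b) (at x) v) x)"
    by (intro Cons.IH[of "\<lambda>b x. frechet_derivative (f b) (at x) v"] smooth_on_derivative Cons.prems(1))
  then show ?case by simp
qed (use assms(4) in auto)

text \<open>An iterated derivative is multilinear in its directions, so vanishing on tuples of basis
  vectors of the same length is enough.\<close>

lemma iterated_derivative_vanish_span:
  fixes r :: "'a::euclidean_space \<Rightarrow> real"
  assumes "open W" "x \<in> W" "smooth_on W r" "finite B"
    and "\<And>bs. set bs \<subseteq> B \<Longrightarrow> length bs = length vs \<Longrightarrow> iterated_derivative bs r x = 0"
    and "\<And>v. v \<in> set vs \<Longrightarrow> v = (\<Sum>b\<in>B. inner v b *\<^sub>R b)"
  shows "iterated_derivative vs r x = 0"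
  using assms(3,5,6)
proof (induction vs arbitrary: r)
  case (Cons v vs)
  have "frechet_derivative r (at y) v = (\<Sum>b\<in>B. inner v b * frechet_derivative r (at y) b)" if "y \<in> W" for y
  proof -
    have "linear (frechet_derivative r (at y))"
      using smooth_on_differentiable[OF Cons.prems(1) that] by (rule linear_frechet_derivative)
    then have "frechet_derivative r (at y) (\<Sum>b\<in>B. inner v b *\<^sub>R b) = (\<Sum>b\<in>B. inner v b * frechet_derivative r (at y) b)"
      by (simp add: linear_sum linear_cmul)
    then show ?thesis using Cons.prems(3)[of v] by simp
  qed
  then have "iterated_derivative (v # vs) r x = (\<Sum>b\<in>B. inner v b * iterated_derivative vs (\<lambda>y. frechet_derivative r (at y) b) x)"
    using iterated_derivative_linear_combination[where f = "\<lambda>b y. frechet_derivative r (at y) b" and B = B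
        and g = "\<lambda>y. frechet_derivative r (at y) v" and c = "inner v" and vs = vs, OF assms(1) smooth_on_derivative[OF Cons.prems(1)] _ assms(2)]
    by simp
  also have "\<dots> = 0"
  proof (rule sum.neutral, rule ballI)
    fix b assume "b \<in> B"
    then have "iterated_derivative vs (\<lambda>y. frechet_derivative r (at y) b) x = 0"
      using Cons.prems(2)[of "b # _"] Cons.prems(3)
      by (intro Cons.IH smooth_on_derivative Cons.prems(1)) auto
    then show "inner v b * iterated_derivative vs (\<lambda>y. frechet_derivative r (at y) b) x = 0" by simp
  qed
  finally show ?case .
qed simp

definition z_basis :: "((complex ^ 'n::finite) \<times> real) set" where
  "z_basis = (\<lambda>b. (b, 0)) ` Basis"

lemma Basis_eq_z_basis: "(Basis :: ((complex ^ 'n::finite) \<times> real) set) = insert (0, 1) z_basis"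
  by (auto simp: Basis_prod_def z_basis_def)

lemma direction_weight_z_basis:
  assumes "b \<in> z_basis" shows "direction_weight (\<lambda>_. m) b = m"
proof -
  obtain j u where "b = (axis j u, 0)" "u \<in> Basis"
    using assms by (auto simp: z_basis_def Basis_vec_def)
  moreover from this have "(\<Sum>i\<in>UNIV. m * norm (axis j u $ i)) = (\<Sum>i\<in>UNIV. if i = j then m else 0)"
    by (intro sum.cong) (auto simp: axis_def)
  ultimately show ?thesis
    by (simp add: direction_weight_def)
qed

lemma z_basis_expansion:
  fixes z :: "complex ^ 'n::finite"
  shows "(z, 0) = (\<Sum>b\<in>z_basis. inner (z, 0) b *\<^sub>R b)"
proof -
  have "(\<Sum>b\<in>z_basis. inner (z, 0::real) b *\<^sub>R b) = (\<Sum>b\<in>Basis. inner (z, 0::real) (b, 0) *\<^sub>R (b, 0))"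
    unfolding z_basis_def by (subst sum.reindex) (auto simp: inj_on_def)
  also have "\<dots> = (\<Sum>b\<in>Basis. (inner z b *\<^sub>R b, 0))" by simp
  also have "\<dots> = (\<Sum>b\<in>Basis. inner z b *\<^sub>R b, 0)"
    by (simp add: prod_eq_iff fst_sum snd_sum)
  finally show ?thesis by (simp add: euclidean_representation)
qed

lemma weight_sum_z: "set vs \<subseteq> z_basis \<Longrightarrow> sum_list (map (direction_weight (\<lambda>_. m)) vs) = m * real (length vs)"
  by (induction vs) (auto simp: direction_weight_z_basis algebra_simps)

text \<open>The direction of Re w exhausts the admissible weight 1 by itself, and every other
  direction has positive weight.\<close>

lemma weight_sum_u:
  fixes vs :: "((complex ^ 'n::finite) \<times> real) list"
  assumes "set vs \<subseteq> insert (0, 1) z_basis" "(0, 1) \<in> set vs" "0 < m"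
    "sum_list (map (direction_weight (\<lambda>_. m)) vs) \<le> 1"
  shows "vs = [(0, 1)]"
proof -
  have w01: "direction_weight (\<lambda>_. m) (0 :: complex ^ 'n, 1) = 1" by (simp add: direction_weight_def)
  have w: "0 < direction_weight (\<lambda>_. m) v" if "v \<in> insert (0, 1) z_basis" for v :: "(complex ^ 'n) \<times> real"
    using that assms(3) by (auto simp: w01 direction_weight_z_basis)
  obtain as bs where vs: "vs = as @ (0, 1) # bs" using assms(2) by (meson split_list)
  have nn: "0 \<le> sum_list (map (direction_weight (\<lambda>_. m)) xs)" if "set xs \<subseteq> insert (0, 1) z_basis" for xs :: "((complex ^ 'n) \<times> real) list"
    using that w by (intro sum_list_nonneg) (auto intro: less_imp_le)
  have pos: "0 < sum_list (map (direction_weight (\<lambda>_. m)) xs)" if "set xs \<subseteq> insert (0, 1) z_basis" "xs \<noteq> []" for xs :: "((complex ^ 'n) \<times> real) list"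
    using that w nn by (cases xs) (auto intro: add_pos_nonneg)
  have sub: "set as \<subseteq> insert (0, 1) z_basis" "set bs \<subseteq> insert (0, 1) z_basis"
    using assms(1) by (auto simp: vs)
  have "sum_list (map (direction_weight (\<lambda>_. m)) as) + sum_list (map (direction_weight (\<lambda>_. m)) bs) \<le> 0"
    using assms(4) by (simp add: vs w01)
  then have "as = []" "bs = []"
    using pos[OF sub(1)] pos[OF sub(2)] nn[OF sub(1)] nn[OF sub(2)] by linarith+
  then show ?thesis using vs by simp
qed

text \<open>All z-directions have the same weight, so a linear change of z turns an admissible tuple
  into combinations of admissible tuples of the same length. A tuple that contains the direction of
  Re w consists of it alone, and this direction is fixed.\<close>

lemma small_remainder_linear:
  fixes T :: "complex ^ 'n::finite \<Rightarrow> complex ^ 'n" and r :: "(complex ^ 'n) \<times> real \<Rightarrow> real"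
  assumes "open W" "0 \<in> W" "smooth_on W r" "small_remainder (\<lambda>_. m) r" "0 < m" and T: "bounded_linear T"
  shows "small_remainder (\<lambda>_. m) (\<lambda>x. r (T (fst x), snd x))"
  unfolding small_remainder_def
proof (intro allI impI)
  fix vs :: "((complex ^ 'n) \<times> real) list"
  assume vs: "set vs \<subseteq> Basis \<and> sum_list (map (direction_weight (\<lambda>_. m)) vs) \<le> 1"
  let ?L = "\<lambda>x::(complex ^ 'n) \<times> real. (T (fst x), snd x)"
  have L: "bounded_linear ?L"
    by (intro bounded_linear_Pair bounded_linear_compose[OF T] bounded_linear_fst bounded_linear_snd)
  have T0: "T 0 = 0" using T by (simp add: linear_0 bounded_linear.linear)
  have L0: "?L 0 = 0" by (simp add: T0 zero_prod_def)
  have "iterated_derivative vs (\<lambda>x. r (?L x)) 0 = iterated_derivative (map ?L vs) r (?L 0)"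
    by (rule iterated_derivative_comp_linear[OF L assms(1,3)]) (use L0 assms(2) in auto)
  also have "\<dots> = iterated_derivative (map ?L vs) r 0" by (simp only: L0)
  also have "\<dots> = 0"
  proof (cases "(0, 1) \<in> set vs")
    case True
    then have "vs = [(0, 1)]"
      using vs assms(5) by (intro weight_sum_u[of vs m]) (auto simp: Basis_eq_z_basis)
    then have "map ?L vs = vs" by (simp add: T0)
    then show ?thesis using assms(4) vs unfolding small_remainder_def by simp
  next
    case False
    then have z: "set vs \<subseteq> z_basis" using vs by (auto simp: Basis_eq_z_basis)
    show ?thesis
    proof (rule iterated_derivative_vanish_span[OF assms(1,2,3), of z_basis])
      show "finite (z_basis :: ((complex ^ 'n) \<times> real) set)" by (simp add: z_basis_def)
      fix bs :: "((complex ^ 'n) \<times> real) list" assume "set bs \<subseteq> z_basis" "length bs = length (map ?L vs)"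
      then have "set bs \<subseteq> Basis" "sum_list (map (direction_weight (\<lambda>_. m)) bs) \<le> 1"
        using vs weight_sum_z[OF z, of m] weight_sum_z[of bs m] unfolding Basis_eq_z_basis by (blast, simp)
      then show "iterated_derivative bs r 0 = 0"
        using assms(4)[unfolded small_remainder_def] by blast
    next
      fix v assume "v \<in> set (map ?L vs)"
      then obtain u where u: "v = (T u, 0)" using z by (auto simp: z_basis_def)
      show "v = (\<Sum>b\<in>z_basis. inner v b *\<^sub>R b)" unfolding u by (rule z_basis_expansion)
    qed
  qed
  finally show "iterated_derivative vs (\<lambda>x. r (T (fst x), snd x)) 0 = 0" .
qed

lemma holo_map_on_compose:
  assumes "holo_map_on U f" "holo_map_on V g" "f ` U \<subseteq> V"
  shows "holo_map_on U (\<lambda>x. g (f x))"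
  unfolding holo_map_on_def
proof (intro conjI ballI)
  show "open U" using assms(1) by (simp add: holo_map_on_def)
  fix x assume x: "x \<in> U"
  obtain D where D: "(f has_derivative D) (at x)" "\<And>v. D (mult_i v) = mult_i (D v)"
    using assms(1) x by (auto simp: holo_map_on_def)
  obtain E where E: "(g has_derivative E) (at (f x))" "\<And>v. E (mult_i v) = mult_i (E v)"
    using assms(2,3) x by (force simp: holo_map_on_def)
  show "\<exists>D. ((\<lambda>x. g (f x)) has_derivative D) (at x) \<and> (\<forall>v. D (mult_i v) = mult_i (D v))"
    using has_derivative_compose[OF D(1) E(1)] D(2) E(2) by (intro exI[of _ "\<lambda>v. E (D v)"]) simp
qed

lemma holo_map_on_cong:
  assumes "holo_map_on U f" "\<And>x. x \<in> U \<Longrightarrow> f x = g x"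
  shows "holo_map_on U g"
  unfolding holo_map_on_def
proof (intro conjI ballI)
  show "open U" using assms(1) by (simp add: holo_map_on_def)
  fix x assume x: "x \<in> U"
  obtain D where D: "(f has_derivative D) (at x)" "\<forall>v. D (mult_i v) = mult_i (D v)"
    using assms(1) x by (auto simp: holo_map_on_def)
  have "(g has_derivative D) (at x)"
    by (rule has_derivative_transform_within_open[OF D(1) \<open>open U\<close> x assms(2)])
  then show "\<exists>D. (g has_derivative D) (at x) \<and> (\<forall>v. D (mult_i v) = mult_i (D v))" using D(2) by blast
qed

lemma bounded_linear_lmap: "bounded_linear (lmap T)"
  unfolding linear_conv_bounded_linear[symmetric]
  by (rule linearI) (simp_all add: lmap_def fcp_eq_iff sum.distrib distrib_left scaleR_sum_right)

lemma holo_map_on_lmap: "holo_map_on UNIV (\<lambda>x. (lmap T (fst x), snd x))"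
  unfolding holo_map_on_def
proof (intro conjI ballI)
  fix x :: "'a cspace"
  have "bounded_linear (\<lambda>x::'a cspace. (lmap T (fst x), snd x))"
    by (intro bounded_linear_Pair bounded_linear_compose[OF bounded_linear_lmap] bounded_linear_fst bounded_linear_snd)
  then show "\<exists>D. ((\<lambda>x. (lmap T (fst x), snd x)) has_derivative D) (at x) \<and> (\<forall>v. D (mult_i v) = mult_i (D v))"
    by (intro exI[of _ "\<lambda>x. (lmap T (fst x), snd x)"] conjI bounded_linear_imp_has_derivative)
      (auto simp: mult_i_def lmap_scale)
qed simp

text \<open>The coordinates change by \<open>S\<close>, while the polynomial and the remainder are
  composed with its inverse \<open>T\<close>.\<close>

lemma weighted_coordinates_lmap:
  fixes P B :: "'n::finite bipoly"
  assumes wc: "weighted_coordinates M p (\<lambda>_. m) \<phi> P" and "0 < m"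
    and TS: "\<And>z. lmap T (lmap S z) = z" "\<And>z. lmap S (lmap T z) = z"
    and B: "cplx B = lsubst T (cplx P)" "B \<noteq> 0" "bi_whomogeneous (\<lambda>_. m) 1 B" "no_pluriharmonic_terms B"
  shows "weighted_coordinates M p (\<lambda>_. m) (\<lambda>q. (lmap S (fst (\<phi> q)), snd (\<phi> q))) B"
proof -
  obtain U V W r where c: "real_valued P" "p \<in> U" "biholomorphic U V \<phi>" "\<phi> p = 0" "open W" "\<forall>(z, w)\<in>V. (z, Re w) \<in> W"
    "smooth_on W r" "small_remainder (\<lambda>_. m) r"
    "\<phi> ` (M \<inter> U) = {(z, w) \<in> V. Im w = Re (beval P z) + r (z, Re w)}"
    using wc by (auto simp: weighted_coordinates_def)
  let ?S = "\<lambda>x::'n cspace. (lmap S (fst x), snd x)" and ?T = "\<lambda>x::'n cspace. (lmap T (fst x), snd x)"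
  let ?\<phi> = "\<lambda>q. ?S (\<phi> q)" and ?V = "?T -` V"
  let ?L = "\<lambda>x::(complex ^ 'n) \<times> real. (lmap T (fst x), snd x)"
  have beval: "beval B y = beval P (lmap T y)" for y
    by (simp add: beval_cplx B(1) ev_lsubst)
  have ST: "?S (?T x) = x" "?T (?S x) = x" for x by (simp_all add: TS)
  have bij: "bij_betw \<phi> U V" and h: "holo_map_on U \<phi>" "holo_map_on V (inv_into U \<phi>)"
    using c(3) by (auto simp: biholomorphic_def)
  have SV: "?S ` V = ?V"
  proof (intro Set.set_eqI iffI)
    fix x assume "x \<in> ?S ` V"
    then show "x \<in> ?V" by (auto simp: TS)
  next
    fix x assume "x \<in> ?V"
    then have "?S (?T x) \<in> ?S ` V" by (intro imageI) simp
    then show "x \<in> ?S ` V" unfolding ST(1) .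
  qed
  have bij': "bij_betw ?\<phi> U ?V"
  proof -
    have "bij_betw ?S V ?V"
      unfolding SV[symmetric] by (intro inj_on_imp_bij_betw inj_on_inverseI[of _ ?T]) (simp add: TS)
    from bij_betw_trans[OF bij this] show ?thesis by (simp add: o_def)
  qed
  have inv: "inv_into U ?\<phi> x = inv_into U \<phi> (?T x)" if "x \<in> ?V" for x
  proof (rule inv_into_f_eq)
    show "inj_on ?\<phi> U" using bij' by (simp add: bij_betw_def)
    show "inv_into U \<phi> (?T x) \<in> U"
      using that bij by (intro inv_into_into) (auto simp: bij_betw_def)
    show "?\<phi> (inv_into U \<phi> (?T x)) = x"
      using that bij ST by (simp add: bij_betw_def f_inv_into_f)
  qed
  have "holo_map_on U ?\<phi>"
    using holo_map_on_compose[OF h(1) holo_map_on_lmap] by simp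
  moreover have "bounded_linear ?T"
    by (intro bounded_linear_Pair bounded_linear_compose[OF bounded_linear_lmap] bounded_linear_fst bounded_linear_snd)
  then have oV: "open ?V"
    using h(2) by (intro continuous_open_vimage linear_continuous_at) (simp_all add: holo_map_on_def)
  have "holo_map_on ?V ?T"
    using holo_map_on_lmap[of T] oV unfolding holo_map_on_def by blast
  then have "holo_map_on ?V (\<lambda>x. inv_into U \<phi> (?T x))"
    using h(2) by (rule holo_map_on_compose) auto
  then have "holo_map_on ?V (inv_into U ?\<phi>)"
    by (rule holo_map_on_cong) (simp add: inv)
  ultimately have bih: "biholomorphic U ?V ?\<phi>"
    using bij' by (simp add: biholomorphic_def)
  have L: "bounded_linear ?L"
    by (intro bounded_linear_Pair bounded_linear_compose[OF bounded_linear_lmap] bounded_linear_fst bounded_linear_snd)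
  have "0 \<in> V" using c(2,4) bij by (auto simp: bij_betw_def)
  then have W0: "0 \<in> W" using c(6) by (force simp: zero_prod_def)
  have "real_valued B" using c(1) by (simp add: real_valued_def beval)
  moreover have "?\<phi> p = 0" by (simp add: c(4)) (simp add: lmap_def zero_prod_def fcp_eq_iff)
  moreover have "open (?L -` W)"
    using c(5) by (intro continuous_open_vimage linear_continuous_at L)
  moreover have "\<forall>(z, w)\<in>?V. (z, Re w) \<in> ?L -` W" using c(6) by auto
  moreover have "smooth_on (?L -` W) (\<lambda>x. r (?L x))"
    by (rule smooth_on_comp_linear[OF L c(5,7)]) simp
  moreover have "small_remainder (\<lambda>_. m) (\<lambda>x. r (?L x))"
    by (rule small_remainder_linear[OF c(5) W0 c(7,8) \<open>0 < m\<close> bounded_linear_lmap])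
  moreover have "?\<phi> ` (M \<inter> U) = {(z, w) \<in> ?V. Im w = Re (beval B z) + r (?L (z, Re w))}"
  proof -
    have "?\<phi> ` (M \<inter> U) = ?S ` (\<phi> ` (M \<inter> U))" by (simp add: image_image)
    also have "\<dots> = {(z, w) \<in> ?V. Im w = Re (beval B z) + r (?L (z, Re w))}"
      unfolding c(9)
    proof (intro Set.set_eqI iffI)
      fix x assume "x \<in> ?S ` {(z, w) \<in> V. Im w = Re (beval P z) + r (z, Re w)}"
      then show "x \<in> {(z, w) \<in> ?V. Im w = Re (beval B z) + r (?L (z, Re w))}"
        by (auto simp: beval TS)
    next
      fix x assume "x \<in> {(z, w) \<in> ?V. Im w = Re (beval B z) + r (?L (z, Re w))}"
      then have "?T x \<in> {(z, w) \<in> V. Im w = Re (beval P z) + r (z, Re w)}"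
        by (auto simp: beval)
      then have "?S (?T x) \<in> ?S ` {(z, w) \<in> V. Im w = Re (beval P z) + r (z, Re w)}" by (rule imageI)
      then show "x \<in> ?S ` {(z, w) \<in> V. Im w = Re (beval P z) + r (z, Re w)}" unfolding ST(1) .
    qed
    finally show ?thesis .
  qed
  ultimately show ?thesis
    unfolding weighted_coordinates_def using B(2-4) c(2) bih by blast
qed

section \<open>An Euler-type field produces balanced multitype coordinates\<close>

section \<open>Balanced coordinates\<close>

lemma lmap_lmap:
  assumes "\<And>i k. (\<Sum>j\<in>UNIV. T i j * S j k) = (if i = k then 1 else 0)"
  shows "lmap T (lmap S z) = z"
proof -
  have "(\<Sum>k\<in>UNIV. T i k * (\<Sum>l\<in>UNIV. S k l * z $ l)) = (\<Sum>l\<in>UNIV. (\<Sum>k\<in>UNIV. T i k * S k l) * z $ l)" for i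
    by (simp add: sum_distrib_left sum_distrib_right mult.assoc) (rule sum.swap)
  also have "\<dots> i = z $ i" for i
    by (simp add: assms if_distrib[of "\<lambda>x. x * _"] cong: if_cong)
  finally show ?thesis by (simp add: lmap_def fcp_eq_iff)
qed

text \<open>In the coordinates y with z = T y the linear field with matrix \<open>A\<close> has
  matrix \<open>J\<close>.\<close>

lemma Dz_lsubst:
  fixes A T J :: "'n::finite \<Rightarrow> 'n \<Rightarrow> complex"
  assumes AT: "\<And>i k. (\<Sum>j\<in>UNIV. A i j * T j k) = (\<Sum>j\<in>UNIV. T i j * J j k)"
  shows "Dz (\<lambda>i. \<Sum>k\<in>UNIV. cst (J i k) * Zv k) (lsubst T Q) = lsubst T (Dz (\<lambda>i. \<Sum>k\<in>UNIV. cst (A i k) * Zv k) Q)"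
proof (induction Q)
  case (Zv j)
  have swap: "(\<Sum>k\<in>UNIV. X j k * (\<Sum>l\<in>UNIV. Y k l * u l)) = (\<Sum>l\<in>UNIV. (\<Sum>k\<in>UNIV. X j k * Y k l) * u l)"
    for X Y :: "'n \<Rightarrow> 'n \<Rightarrow> complex" and u
    by (simp add: sum_distrib_left sum_distrib_right mult.assoc) (rule sum.swap)
  show ?case
    by (rule pring_eqI)
      (simp add: lsubst_simps lsubst_sum derivation_sum[OF derivation_Dz] derivation_mult[OF derivation_Dz] swap AT)
next
  case (Wv j)
  then show ?case
    by (simp add: lsubst_simps lsubst_sum derivation_sum[OF derivation_Dz] derivation_mult[OF derivation_Dz])
qed (simp_all add: lsubst_simps derivation_add[OF derivation_Dz] derivation_mult[OF derivation_Dz])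

lemma bihom_linear:
  fixes Q :: "'n::finite pring"
  assumes "bihom 1 0 Q"
  shows "Q = (\<Sum>k\<in>UNIV. cst (ev (dz k Q) (0, 0)) * Zv k)"
proof (rule pring_eqI)
  fix x :: "(complex ^ 'n) \<times> (complex ^ 'n)"
  have h: "hol Q" using assms by (rule bihom_hol)
  let ?z = "fst x"
  have L: "bounded_linear (\<lambda>t::real. (of_real t *s ?z, 0 :: complex ^ 'n))"
    unfolding linear_conv_bounded_linear[symmetric]
  proof (rule linearI)
    fix b c :: real
    show "(of_real (b + c) *s ?z, 0 :: complex ^ 'n) = (of_real b *s ?z, 0) + (of_real c *s ?z, 0)"
      by (simp add: fcp_eq_iff algebra_simps)
    show "(of_real (b *\<^sub>R c) *s ?z, 0 :: complex ^ 'n) = b *\<^sub>R (of_real c *s ?z, 0)"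
      by (simp add: fcp_eq_iff scaleR_conv_of_real[where 'a = complex] mult.assoc)
  qed
  have d1: "((\<lambda>t::real. ev Q (of_real t *s ?z, 0)) has_derivative
      (\<lambda>t. \<Sum>j\<in>UNIV. (of_real t *s ?z) $ j * ev (dz j Q) (0, 0))) (at 0)"
    using has_derivative_compose[OF bounded_linear_imp_has_derivative[OF L] ev_has_derivative[of Q], of 0 UNIV] by simp
  have eq: "(\<lambda>t::real. ev Q (of_real t *s ?z, 0)) = (\<lambda>t. of_real t * ev Q x)"
  proof
    fix t :: real
    have "ev Q (of_real t *s ?z, 0) = ev Q (of_real t *s ?z, 1 *s snd x)"
      by (rule hol_same[OF h]) simp
    moreover have "ev Q (of_real t *s ?z, 1 *s snd x) = of_real t ^ 1 * 1 ^ 0 * ev Q (?z, snd x)"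
      using assms unfolding bihom_def by blast
    ultimately show "ev Q (of_real t *s ?z, 0) = of_real t * ev Q x" by simp
  qed
  have d2: "((\<lambda>t::real. of_real t * ev Q x) has_derivative (\<lambda>t. of_real t * ev Q x)) (at 0)"
    by (auto intro!: derivative_eq_intros)
  have "(\<lambda>t::real. of_real t * ev Q x) = (\<lambda>t. \<Sum>j\<in>UNIV. (of_real t *s ?z) $ j * ev (dz j Q) (0, 0))"
    by (rule has_derivative_unique[OF d2 d1[unfolded eq]])
  from fun_cong[OF this, of 1] show "ev Q x = ev (\<Sum>k\<in>UNIV. cst (ev (dz k Q) (0, 0)) * Zv k) x"
    by (simp add: mult.commute)
qed

definition wcomp :: "nat \<Rightarrow> 'n::finite pring \<Rightarrow> 'n pring" where "wcomp q Q = tau (zcomp q (tau Q))"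

lemma wcomp_bihom: "bihom p q Q \<Longrightarrow> wcomp t Q = (if q = t then Q else 0)"
  unfolding wcomp_def by (simp add: zcomp_bihom[OF bihom_tau])

lemma wcomp_0: "wcomp t 0 = 0" by (simp add: wcomp_def)

lemma wcomp_add: "wcomp t (Q + R) = wcomp t Q + wcomp t R"
  by (simp add: wcomp_def zcomp_add)

text \<open>This is the projection to the bidegrees (p, d - p) with 1 \<le> p < d, in which P lives.
  It allows an expansion into monomials to be cut down to these bidegrees without appeal to
  uniqueness of coefficients.\<close>

definition real_part :: "nat \<Rightarrow> 'n::finite pring \<Rightarrow> 'n pring" where
  "real_part d Q = (\<Sum>p\<in>{1..<d}. wcomp (d - p) (zcomp p Q))"

lemma real_part_sum: "real_part d (sum f S) = (\<Sum>k\<in>S. real_part d (f k))"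
  by (induction S rule: infinite_finite_induct)
    (simp_all add: real_part_def wcomp_0 zcomp_add wcomp_add sum.distrib)

lemma real_part_bihom:
  assumes "bihom a b Q"
  shows "real_part d Q = (if a \<in> {1..<d} \<and> b = d - a then Q else 0)"
proof -
  have "wcomp (d - p) (zcomp p Q) = (if a = p then (if b = d - a then Q else 0) else 0)" for p
    by (simp add: zcomp_bihom[OF assms] wcomp_bihom[OF assms] wcomp_0)
  then show ?thesis by (simp add: real_part_def)
qed

text \<open>In Jordan coordinates P is a sum of monomials on which the diagonal part of the field
  has eigenvalue \<open>c\<close>, in the holomorphic and, by reality, in the conjugate exponents.
  Since \<open>c\<close> is real and nonzero, the real parts of the diagonal entries divided by
  \<open>c\<close> are balancing weights.\<close>

lemma balanced_coordinates:
  fixes P :: "'n::finite bipoly" and c :: real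
  assumes wc: "weighted_coordinates M p (\<lambda>_. m) \<phi> P" and m: "0 < m" "m * real d = 1"
    and rb: "real_bihom (cplx P) Pc d"
    and f1: "\<And>j. bihom 1 0 (f1 j)" and eig: "Dz f1 (cplx P) = cst (of_real c) * cplx P" and c: "c \<noteq> 0"
  shows "\<exists>\<phi> Q. weighted_coordinates M p (\<lambda>_. m) \<phi> Q \<and> balanced Q"
proof -
  interpret real_bihom "cplx P" Pc d by (rule rb)
  define A where "A i k = ev (dz k (f1 i)) (0, 0)" for i k
  have f1A: "f1 = (\<lambda>i. \<Sum>k\<in>UNIV. cst (A i k) * Zv k)"
    unfolding A_def by (rule ext) (rule bihom_linear[OF f1])
  obtain T S J :: "'n \<Rightarrow> 'n \<Rightarrow> complex" and r :: "'n \<Rightarrow> nat" where TS: "\<And>i k. (\<Sum>j\<in>UNIV. T i j * S j k) = (if i = k then 1 else 0)"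
    "\<And>i k. (\<Sum>j\<in>UNIV. S i j * T j k) = (if i = k then 1 else 0)"
    and AT: "\<And>i k. (\<Sum>j\<in>UNIV. A i j * T j k) = (\<Sum>j\<in>UNIV. T i j * J j k)"
    and J: "\<And>i j. i \<noteq> j \<Longrightarrow> J i j \<noteq> 0 \<Longrightarrow> r j = Suc (r i) \<and> J i i = J j j"
    by (rule jordan_basis[of A]) blast
  define R where "R = lsubst T (cplx P)"
  define ok where "ok \<alpha> \<longleftrightarrow> (\<Sum>i\<in>UNIV. J i i * of_nat (\<alpha> i)) = of_real c" for \<alpha>
  have tauR: "tau R = R" by (simp add: R_def tau_lsubst real)
  have R0: "R \<noteq> 0"
  proof
    assume "R = 0"
    then have "ev (cplx P) (lmap T (lmap S z), cnjv (lmap T (lmap S z))) = 0" for z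
      unfolding R_def using ev_lsubst[of T "cplx P" "lmap S z" "lmap S z"] by simp
    then have "cplx P = 0" by (intro polarisation) (simp add: lmap_lmap[OF TS(1)])
    then show False using nonzero by simp
  qed
  have eigR: "Dz (\<lambda>i. \<Sum>k\<in>UNIV. cst (J i k) * Zv k) R = cst (of_real c) * R"
    unfolding R_def Dz_lsubst[OF AT] f1A[symmetric] eig by (simp add: lsubst_simps)
  have filter: "R = (\<Sum>k\<in>{k\<in>K. ok (fst k)}. term_of (a k) k)" if "finite K" "R = (\<Sum>k\<in>K. term_of (a k) k)" for K a
    unfolding ok_def by (rule jordan_eigenvector_terms[OF J eigR that])
  obtain B where "cplx B = R" using cplx_surj by blast
  then have "R = (\<Sum>k\<in>Poly_Mapping.keys B. term_of (Poly_Mapping.lookup B k) k)" by (simp add: cplx_def)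
  from filter[OF finite_keys this] obtain K a where
    K: "finite K" "\<And>k. k \<in> K \<Longrightarrow> ok (fst k)" "R = (\<Sum>k\<in>K. term_of (a k) k)"
    using finite_keys[of B] by (intro that[of "{k \<in> Poly_Mapping.keys B. ok (fst k)}"]) auto
  \<comment> \<open>\<open>R\<close> is real, so conjugating the filtered expansion gives another
    one with the two exponents exchanged; filtering again imposes the eigenvalue condition on both
    exponents.\<close>
  have "R = (\<Sum>k\<in>K. tau (term_of (a k) k))" using tauR K(3) by (simp flip: tau_sum)
  also have "\<dots> = (\<Sum>k\<in>K. term_of (cnj (a k)) (prod.swap k))"
    by (simp add: term_of_def mult_ac)
  also have "\<dots> = (\<Sum>k\<in>prod.swap ` K. term_of (cnj (a (prod.swap k))) k)"
    by (subst sum.reindex) simp_all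
  finally have "R = (\<Sum>k\<in>prod.swap ` K. term_of (cnj (a (prod.swap k))) k)" .
  from filter[OF _ this] K(1,2) obtain K2 b where
    K2: "finite K2" "\<And>k. k \<in> K2 \<Longrightarrow> ok (fst k) \<and> ok (snd k)" "R = (\<Sum>k\<in>K2. term_of (b k) k)"
    by (intro that[of "{k \<in> prod.swap ` K. ok (fst k)}"]) auto
  define good where "good k \<longleftrightarrow> sum (fst k) UNIV \<in> {1..<d} \<and> sum (snd k) UNIV = d - sum (fst k) UNIV"
    for k :: "('n \<Rightarrow> nat) \<times> ('n \<Rightarrow> nat)"
  have "real_part d R = R"
  proof -
    have "R = (\<Sum>p\<in>{1..<d}. lsubst T (Pc p))" unfolding R_def by (subst sum_comp) (rule lsubst_sum)
    then have "real_part d R = (\<Sum>p\<in>{1..<d}. real_part d (lsubst T (Pc p)))" by (simp only: real_part_sum)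
    also have "\<dots> = (\<Sum>p\<in>{1..<d}. lsubst T (Pc p))"
      by (rule sum.cong[OF refl]) (subst real_part_bihom[OF bihom_lsubst[OF bihom_comp]], auto)
    finally show ?thesis using \<open>R = (\<Sum>p\<in>{1..<d}. lsubst T (Pc p))\<close> by simp
  qed
  moreover have "real_part d R = (\<Sum>k\<in>K2. real_part d (term_of (b k) k))"
    by (subst K2(3)) (rule real_part_sum)
  moreover have "\<dots> = (\<Sum>k\<in>K2. if good k then term_of (b k) k else 0)"
    by (rule sum.cong[OF refl]) (simp add: real_part_bihom[OF bihom_term_of] good_def)
  moreover have "\<dots> = (\<Sum>k\<in>{k\<in>K2. good k}. term_of (b k) k)"
    using K2(1) by (simp add: sum.inter_filter)
  ultimately have R: "R = (\<Sum>k\<in>{k\<in>K2. good k}. term_of (b k) k)" by simp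
  define Q where "Q = (\<Sum>k\<in>{k\<in>K2. good k}. Poly_Mapping.single k (b k))"
  have cQ: "cplx Q = lsubst T (cplx P)"
    unfolding Q_def cplx_sum cplx_single R[symmetric] R_def ..
  have keys: "k \<in> K2 \<and> good k" if "k \<in> Poly_Mapping.keys Q" for k
    using that keys_sum_singles[where S = "{k\<in>K2. good k}" and c = b] by (auto simp: Q_def)
  have Q0: "Q \<noteq> 0" using cQ R0 by (auto simp: R_def cplx_0)
  have "bi_whomogeneous (\<lambda>_. m) 1 Q"
    unfolding bi_whomogeneous_def
  proof (clarify)
    fix \<alpha> \<beta> assume "(\<alpha>, \<beta>) \<in> Poly_Mapping.keys Q"
    then have "sum \<alpha> UNIV + sum \<beta> UNIV = d" using keys[of "(\<alpha>, \<beta>)"] by (auto simp: good_def)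
    then have "m * real (sum \<alpha> UNIV) + m * real (sum \<beta> UNIV) = m * real d"
      by (metis distrib_left of_nat_add)
    then show "wdeg (\<lambda>_. m) \<alpha> + wdeg (\<lambda>_. m) \<beta> = 1" unfolding wdeg_const m(2) .
  qed
  moreover have "no_pluriharmonic_terms Q"
    unfolding no_pluriharmonic_terms_def using keys by (fastforce simp: good_def)
  ultimately have "weighted_coordinates M p (\<lambda>_. m) (\<lambda>q. (lmap S (fst (\<phi> q)), snd (\<phi> q))) Q"
    using weighted_coordinates_lmap[OF wc m(1) lmap_lmap[OF TS(1)] lmap_lmap[OF TS(2)] cQ Q0] by blast
  moreover have "balanced Q"
    unfolding balanced_def
  proof (intro exI[of _ "\<lambda>i. Re (J i i) / c"] conjI)
    have wd: "wdeg (\<lambda>i. Re (J i i) / c) \<alpha> = 1" if "ok \<alpha>" for \<alpha>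
    proof -
      have "(\<Sum>i\<in>UNIV. Re (J i i) * real (\<alpha> i)) = c"
        using arg_cong[OF that[unfolded ok_def], of Re] by simp
      then have "(\<Sum>i\<in>UNIV. Re (J i i) * real (\<alpha> i)) / c = 1" using c by simp
      then show ?thesis by (simp add: wdeg_def sum_divide_distrib)
    qed
    then show "\<forall>(\<alpha>, \<beta>)\<in>Poly_Mapping.keys Q. wdeg (\<lambda>i. Re (J i i) / c) \<alpha> = 1 \<and> wdeg (\<lambda>i. Re (J i i) / c) \<beta> = 1"
      using keys K2(2) by fastforce
    have "Poly_Mapping.keys Q \<noteq> {}" using Q0 by simp
    then obtain k where "k \<in> Poly_Mapping.keys Q" by blast
    then have "wdeg (\<lambda>i. Re (J i i) / c) (fst k) = 1" using keys K2(2) wd by blast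
    then have "(\<lambda>i. Re (J i i) / c) = (\<lambda>_. 0) \<Longrightarrow> wdeg (\<lambda>_. 0) (fst k) = 1" by simp
    then show "(\<lambda>i. Re (J i i) / c) \<noteq> (\<lambda>_. 0)" by (auto simp: wdeg_def)
  qed
  ultimately show ?thesis by blast
qed

section \<open>Tangency as a system of identities in powers of Re w\<close>

section \<open>Tangent fields of the model\<close>

lemma poly_real_points_0:
  fixes p :: "'n::finite pring poly"
  assumes "\<And>u::real. poly p (cst (of_real u)) = 0"
  shows "p = 0"
proof (rule ccontr)
  assume "p \<noteq> 0"
  then have "finite {x. poly p x = 0}" by (rule poly_roots_finite)
  moreover have "range (\<lambda>u::real. cst (of_real u)) \<subseteq> {x. poly p x = 0}" using assms by auto
  moreover have "inj (\<lambda>u::real. cst (of_real u) :: 'n pring)"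
  proof (rule injI)
    fix u v :: real assume "cst (of_real u) = (cst (of_real v) :: 'n pring)"
    then have "ev (cst (of_real u) :: 'n pring) (0, 0) = ev (cst (of_real v) :: 'n pring) (0, 0)" by simp
    then show "u = v" by simp
  qed
  ultimately show False
    using finite_subset finite_imageD infinite_UNIV_char_0 by blast
qed

lemma coeff_shift_power: "coeff ([:a, 1:] ^ j) k = (if k \<le> j then of_nat (j choose k) * a ^ (j - k) else (0::'a::comm_ring_1))"
proof (cases "k \<le> j")
  case False
  have "degree ([:a, 1:] ^ j) \<le> j" using degree_power_le[of "[:a, 1:]" j] by simp
  then show ?thesis using False by (simp add: coeff_eq_0)
qed (simp add: coeff_linear_poly_power)

context real_bihom
begin

text \<open>On the model w = u + i P, so tangency says that a polynomial in the real parameter u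
  with coefficients in the ring is real. The three relations are its coefficients at u^J, u^(J-1)
  and u^(J-2).\<close>

lemma tangency_coefficients:
  fixes B :: "nat \<Rightarrow> 'n pring"
  assumes top: "\<forall>j>J. B j = 0" and "J \<le> N"
    and tangent: "\<And>z (u::real). (\<Sum>j\<le>N. (of_real u + \<i> * ev P (z, cnjv z)) ^ j * ev (B j) (z, cnjv z)) \<in> \<real>"
  shows "tau (B J) = B J"
    and "1 \<le> J \<Longrightarrow> B (J - 1) - tau (B (J - 1)) = - (2 * cst \<i> * (P * (of_nat J * B J)))"
    and "2 \<le> J \<Longrightarrow> B (J - 2) - tau (B (J - 2)) =
      - (cst \<i> * (P * (of_nat (J - 1) * B (J - 1) + tau (of_nat (J - 1) * B (J - 1)))))"
proof -
  let ?I = "cst \<i> :: 'n pring"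
  define p where "p = (\<Sum>j\<le>N. [:?I * P, 1:] ^ j * [:B j:]) - (\<Sum>j\<le>N. [:- (?I * P), 1:] ^ j * [:tau (B j):])"
  have "p = 0"
  proof (rule poly_real_points_0)
    fix u :: real
    define R where "R = (\<Sum>j\<le>N. (cst (of_real u) + ?I * P) ^ j * B j)"
    have "tau R = R"
    proof (rule polarisation_eq)
      fix z
      have "ev R (z, cnjv z) \<in> \<real>" using tangent[of u z] by (simp add: R_def)
      then show "ev (tau R) (z, cnjv z) = ev R (z, cnjv z)" by (simp add: Reals_cnj_iff)
    qed
    moreover have tp: "tau (Q ^ j) = tau Q ^ j" for Q :: "'n pring" and j by (induction j) simp_all
    have "tau R = (\<Sum>j\<le>N. (cst (of_real u) - ?I * P) ^ j * tau (B j))"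
      unfolding R_def tau_sum by (rule sum.cong[OF refl]) (simp add: tp real cst_simps)
    ultimately show "poly p (cst (of_real u)) = 0"
      by (simp add: p_def R_def poly_sum add.commute mult.commute)
  qed
  have coeff: "(\<Sum>j\<in>{k..J}. of_nat (j choose k) * ((?I * P) ^ (j - k) * B j - (- (?I * P)) ^ (j - k) * tau (B j))) = 0" for k
  proof -
    have "0 = coeff p k" using \<open>p = 0\<close> by simp
    also have "\<dots> = (\<Sum>j\<le>N. if k \<le> j then of_nat (j choose k) * ((?I * P) ^ (j - k) * B j - (- (?I * P)) ^ (j - k) * tau (B j)) else 0)"
      by (simp add: p_def coeff_sum coeff_shift_power sum_subtractf[symmetric] mult.commute[of _ "[:_:]"] del: power_minus_Bit0 power_minus_Bit1)
        (intro sum.cong refl, simp add: algebra_simps)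
    also have "\<dots> = (\<Sum>j\<in>{k..J}. of_nat (j choose k) * ((?I * P) ^ (j - k) * B j - (- (?I * P)) ^ (j - k) * tau (B j)))"
      using \<open>J \<le> N\<close> by (intro sum.mono_neutral_cong_right) (auto simp: top)
    finally show ?thesis by simp
  qed
  from coeff[of J] show r: "tau (B J) = B J" by simp
  {
    assume "1 \<le> J"
    then obtain i where J: "J = Suc i" by (cases J) auto
    have r': "tau (B (Suc i)) = B (Suc i)" using r by (simp only: J)
    have "{i..Suc i} = {i, Suc i}" by auto
    then have "B i - tau (B i) + of_nat (Suc i) * (?I * P * B J + ?I * P * tau (B J)) = 0"
      using coeff[of i] by (simp add: J)
    then show "B (J - 1) - tau (B (J - 1)) = - (2 * ?I * (P * (of_nat J * B J)))"
      by (simp add: r' J algebra_simps del: of_nat_Suc)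
  }
  assume "2 \<le> J"
  then obtain i where J: "J = Suc (Suc i)" by (cases J) (auto simp: numeral_2_eq_2 Suc_le_eq gr0_conv_Suc)
  \<comment> \<open>The contribution of \<open>B J\<close> to u^(J-2) drops out: i P and - i P have
    the same square, and \<open>B J\<close> is real.\<close>
  have "{i..Suc (Suc i)} = {i, Suc i, Suc (Suc i)}" by auto
  then have "B i - tau (B i) + of_nat (Suc i) * (?I * P * B (Suc i) + ?I * P * tau (B (Suc i))) = 0"
    using coeff[of i] r by (simp add: J Suc_diff_le of_nat_1[unfolded One_nat_def] del: of_nat_Suc)
  then show "B (J - 2) - tau (B (J - 2)) =
      - (?I * (P * (of_nat (J - 1) * B (J - 1) + tau (of_nat (J - 1) * B (J - 1)))))"
    by (simp add: J algebra_simps del: of_nat_Suc)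
qed

lemma bihom_00: "bihom 0 0 Q \<Longrightarrow> Q = cst (ev Q (0, 0))"
proof (rule pring_eqI)
  fix x assume "bihom 0 0 Q"
  then have "ev Q (0 *s fst x, 0 *s snd x) = 0 ^ 0 * 0 ^ 0 * ev Q (fst x, snd x)" unfolding bihom_def by blast
  then show "ev Q x = ev (cst (ev Q (0, 0))) x" by simp
qed

text \<open>With z of weight 1 and w of weight \<open>d\<close>, the field has weight
  \<open>k\<close>, and \<open>f j\<close>, \<open>g j\<close> are its coefficients at w^j. Let
  \<open>J\<close> be the largest index with a nonzero coefficient. If \<open>f J\<close> is zero,
  then \<open>g J\<close> is a real constant; otherwise \<open>f J\<close> has degree e = 1 + k - J
  d, and e \<ge> 2, e = 1, e = 0 are the rigid, linear and constant cases.\<close>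

lemma tangent_vanishes:
  fixes f :: "nat \<Rightarrow> 'n \<Rightarrow> 'n pring" and g :: "nat \<Rightarrow> 'n pring"
  assumes d: "3 \<le> d" and k: "1 \<le> k"
    and rigid: "\<And>F e. 2 \<le> e \<Longrightarrow> (\<And>j. bihom e 0 (F j)) \<Longrightarrow> Dz F P + Db F P = 0 \<Longrightarrow> F = (\<lambda>_. 0)"
    and nondeg: "\<And>F e. (\<And>j. bihom e 0 (F j)) \<Longrightarrow> Dz F P = 0 \<Longrightarrow> F = (\<lambda>_. 0)"
    and unbal: "\<And>F c. (\<And>j. bihom 1 0 (F j)) \<Longrightarrow> Dz F P = cst (of_real c) * P \<Longrightarrow> c = (0::real)"
    and f: "\<And>j i. j * d \<le> 1 + k \<Longrightarrow> bihom (1 + k - j * d) 0 (f j i)" "\<And>j i. 1 + k < j * d \<Longrightarrow> f j i = 0"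
    and g: "\<And>j. j * d \<le> d + k \<Longrightarrow> bihom (d + k - j * d) 0 (g j)" "\<And>j. d + k < j * d \<Longrightarrow> g j = 0"
    and jet: "\<And>i. 1 + k = d \<Longrightarrow> f 1 i = 0"
    and tangent: "\<And>z u. Im (\<Sum>j\<le>N. (of_real u + \<i> * ev P (z, cnjv z)) ^ j * ev (g j) (z, cnjv z)) =
      2 * Re (\<Sum>j\<le>N. (of_real u + \<i> * ev P (z, cnjv z)) ^ j * (\<Sum>i\<in>UNIV. ev (f j i) (z, cnjv z) * ev (dz i P) (z, cnjv z)))"
    and j: "j \<le> N"
  shows "f j i = 0" and "g j = 0"
proof -
  define B where "B j = g j - 2 * cst \<i> * Dz (f j) P" for j
  have tangent_B: "(\<Sum>j\<le>N. (of_real u + \<i> * ev P (z, cnjv z)) ^ j * ev (B j) (z, cnjv z)) \<in> \<real>" for z and u :: real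
  proof -
    let ?w = "of_real u + \<i> * ev P (z, cnjv z)"
    have "(\<Sum>j\<le>N. ?w ^ j * ev (B j) (z, cnjv z)) =
        (\<Sum>j\<le>N. ?w ^ j * ev (g j) (z, cnjv z)) - 2 * \<i> * (\<Sum>j\<le>N. ?w ^ j * (\<Sum>i\<in>UNIV. ev (f j i) (z, cnjv z) * ev (dz i P) (z, cnjv z)))"
      unfolding sum_distrib_left sum_subtractf[symmetric]
      by (rule sum.cong[OF refl]) (simp add: B_def Dz_def algebra_simps sum_distrib_left)
    then show ?thesis using tangent[of u z] by (simp add: complex_is_Real_iff)
  qed
  have "\<forall>j\<le>N. g j = 0 \<and> f j = (\<lambda>_. 0)"
  proof (rule ccontr)
    assume "\<not> (\<forall>j\<le>N. g j = 0 \<and> f j = (\<lambda>_. 0))"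
    then have ne: "{j. j \<le> N \<and> \<not> (g j = 0 \<and> f j = (\<lambda>_. 0))} \<noteq> {}" by auto
    define J where "J = Max {j. j \<le> N \<and> \<not> (g j = 0 \<and> f j = (\<lambda>_. 0))}"
    have J: "J \<le> N" "\<not> (g J = 0 \<and> f J = (\<lambda>_. 0))"
      using Max_in[OF _ ne] unfolding J_def by auto
    define B' where "B' j = (if j \<le> N then B j else 0)" for j
    have "B' j = 0" if "j > J" for j
    proof (cases "j \<le> N")
      case True
      then have "g j = 0 \<and> f j = (\<lambda>_. 0)"
        using that Max_ge[of "{j. j \<le> N \<and> \<not> (g j = 0 \<and> f j = (\<lambda>_. 0))}" j] unfolding J_def[symmetric]
        by (metis (mono_tags, lifting) finite_nat_set_iff_bounded_le leD mem_Collect_eq)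
      then show ?thesis by (simp add: B'_def B_def Dz_def)
    qed (simp add: B'_def)
    then have top: "\<forall>j>J. B' j = 0" by blast
    have tB: "(\<Sum>j\<le>N. (of_real u + \<i> * ev P (z, cnjv z)) ^ j * ev (B' j) (z, cnjv z)) \<in> \<real>" for z and u :: real
      using tangent_B[of u z] by (simp add: B'_def)
    note co = tangency_coefficients[OF top J(1) tB]
    have BJ: "B' J = B J" "B' (J - 1) = B (J - 1)" "B' (J - 2) = B (J - 2)"
      using J(1) by (simp_all add: B'_def)
    note co = co[unfolded BJ]
    have Dz_nat: "Dz (\<lambda>j. of_nat n * F j) P = of_nat n * Dz F P" for n F
      by (rule Dz_field_mult)
    have nat_hom: "bihom p q Q \<Longrightarrow> bihom p q (of_nat n * Q)" for p q n and Q :: "'n pring"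
      using bihom_mult[of 0 0 "of_nat n" p q Q] bihom_cst[of "of_nat n"]
      by (simp add: bihom_def)
    have nat0: "(of_nat n :: 'n pring) = 0 \<longleftrightarrow> n = 0" for n by simp
    show False
    proof (cases "f J = (\<lambda>_. 0)")
      case True
      then have gJ: "g J \<noteq> 0" "B J = g J" using J(2) by (auto simp: B_def Dz_def)
      have le: "J * d \<le> d + k" using gJ g(2) by (meson not_le_imp_less)
      \<comment> \<open>A holomorphic \<open>g J\<close> that is real has no part of positive
        degree. In the remaining constant case J d = d + k with k \<ge> 1 gives J \<ge> 2, which
        leaves room for two lower coefficients.\<close>
      have "d + k - J * d = 0"
      proof (rule ccontr)
        assume "d + k - J * d \<noteq> 0"
        then have "g J = 0"
          using co(1) gJ(2) by (intro pure_terms_vanish[OF g(1)[OF le], of 0]) (auto simp: no_pure_terms_def)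
        then show False using gJ by simp
      qed
      then have Jd: "J * d = d + k" using le by simp
      have J2: "2 \<le> J"
      proof (rule ccontr)
        assume "\<not> 2 \<le> J"
        then have "J * d \<le> 1 * d" by (intro mult_right_mono) auto
        then show False using Jd k by simp
      qed
      then obtain i where Ji: "J = i + 2" by (metis le_add_diff_inverse2)
      have Jd': "(J - 1) * d = k" "(J - 2) * d + d = k" using Jd by (simp_all add: Ji algebra_simps)
      define \<gamma> where "\<gamma> = ev (g J) (0, 0)"
      have \<gamma>: "g J = cst \<gamma>" unfolding \<gamma>_def using g(1)[OF le] Jd by (intro bihom_00) simp
      then have "ev (cst (cnj \<gamma>) :: 'n pring) (0, 0) = ev (cst \<gamma> :: 'n pring) (0, 0)" using co(1) gJ(2) by simp
      then have "cnj \<gamma> = \<gamma>" by simp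
      then obtain t where t: "\<gamma> = of_real t" by (metis Reals_cnj_iff Reals_cases)
      \<comment> \<open>The relation at u^(J-1) is multiplied by J - 1, so that (J - 1) f (J - 1)
        plays the role of \<open>f1\<close> in \<open>linear_symmetry\<close>. Its right side then
        carries J (J - 1) t, which has to equal 2 c.\<close>
      define c where "c = real (J * (J - 1)) * t / 2"
      have B1: "of_nat (J - 1) * B (J - 1) = of_nat (J - 1) * g (J - 1) - 2 * cst \<i> * Dz (\<lambda>j. of_nat (J - 1) * f (J - 1) j) P"
        by (simp add: B_def Dz_nat algebra_simps)
      have B0: "B (J - 2) = g (J - 2) - 2 * cst \<i> * Dz (f (J - 2)) P" by (simp add: B_def)
      have 2: "cst (of_nat n) = of_nat n" for n by (rule pring_eqI) simp
      have cc: "2 * cst (complex_of_real c) = of_nat (J - 1) * (of_nat J * cst \<gamma>)"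
        by (rule pring_eqI) (simp add: c_def t)
      have "of_nat (J - 1) * B (J - 1) - tau (of_nat (J - 1) * B (J - 1)) = of_nat (J - 1) * (B (J - 1) - tau (B (J - 1)))"
        by (simp add: algebra_simps)
      also have "\<dots> = - (2 * cst \<i> * (P * (2 * cst (of_real c))))"
      proof -
        have "1 \<le> J" using J2 by simp
        then show ?thesis unfolding co(2)[OF \<open>1 \<le> J\<close>] gJ(2) \<gamma> cc by (simp only: mult_minus_right mult_ac)
      qed
      finally have r1: "of_nat (J - 1) * B (J - 1) - tau (of_nat (J - 1) * B (J - 1)) = - (2 * cst \<i> * (P * (2 * cst (of_real c))))" .
      have "Dz (\<lambda>j. of_nat (J - 1) * f (J - 1) j) P = cst (of_real c) * P"
      proof (rule linear_symmetry[OF _ _ _ _ rigid B1 B0 r1 co(3)[OF J2]])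
        show "bihom 1 0 (of_nat (J - 1) * f (J - 1) j)" for j
          using f(1)[of "J - 1" j] Jd' by (intro nat_hom) simp
        show "bihom (d + 1) 0 (f (J - 2) j)" for j
          by (rule bihom_degree_cong[OF f(1)[of "J - 2" j]]) (use Jd' d in auto)
        show "bihom d 0 (of_nat (J - 1) * g (J - 1))"
          using g(1)[of "J - 1"] Jd' by (intro nat_hom) simp
        show "bihom (2 * d) 0 (g (J - 2))"
          by (rule bihom_degree_cong[OF g(1)[of "J - 2"]]) (use Jd' d in auto)
      qed auto
      then have "c = 0"
        using f(1)[of "J - 1"] Jd' by (intro unbal[of "\<lambda>j. of_nat (J - 1) * f (J - 1) j"] nat_hom) auto
      then show False using J2 gJ(1) \<gamma> t by (auto simp: c_def)
    next
      case False
      then have le: "J * d \<le> 1 + k" using f(2) by (metis ext not_le_imp_less)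
      have le': "J * d \<le> d + k" using le d by linarith
      define e where "e = 1 + k - J * d"
      have fe: "bihom e 0 (f J j)" for j using f(1)[OF le] by (simp add: e_def)
      have ge: "bihom (d + e - 1) 0 (g J)"
        using g(1)[OF le'] le d by (elim bihom_degree_cong) (auto simp: e_def)
      have step: "(J - n) * d = J * d - n * d" if "n \<le> J" for n by (simp add: diff_mult_distrib)
      consider "2 \<le> e" | "e = 1" | "e = 0" by linarith
      then show False
      proof cases
        case 1
        have eq: "g J - tau (g J) = 2 * cst \<i> * (Dz (f J) P + Db (f J) P)"
          using co(1) by (simp add: B_def tau_Dz real algebra_simps cst_simps)
        have np: "no_pure_terms (Dz (f J) P + Db (f J) P)"
          using fe 1 by (intro no_pure_terms_add no_pure_terms_Dz[where e = e]) auto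
        have "g J = 0"
          by (rule pure_terms_vanish[OF ge _ eq no_pure_terms_mult[OF np]]) (use 1 d in auto)
        then have "Dz (f J) P + Db (f J) P = 0" using eq by simp
        then show False using rigid[where F = "f J", OF 1 fe] False by blast
      next
        case 2
        then have Jd: "J * d = k" using le by (simp add: e_def)
        have J1: "1 \<le> J" using Jd k by (cases J) auto
        then have Jd': "(J - 1) * d + d = k" using Jd by (cases J) auto
        have B1: "of_nat J * B J = of_nat J * g J - 2 * cst \<i> * Dz (\<lambda>j. of_nat J * f J j) P"
          by (simp add: B_def Dz_nat algebra_simps)
        have B0: "B (J - 1) = g (J - 1) - 2 * cst \<i> * Dz (f (J - 1)) P" by (simp add: B_def)
        \<comment> \<open>For a linear \<open>f J\<close> the reality of \<open>B J\<close> is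
          itself the first relation of \<open>linear_symmetry\<close>, with c = 0; the relation at
          u^(J-1) provides the second.\<close>
        have r1: "of_nat J * B J - tau (of_nat J * B J) = - (2 * cst \<i> * (P * (2 * cst (of_real 0))))"
          using co(1) by (simp add: cst_simps)
        have r0: "B (J - 1) - tau (B (J - 1)) = - (cst \<i> * (P * (of_nat J * B J + tau (of_nat J * B J))))"
          unfolding co(2)[OF J1] by (simp add: co(1) algebra_simps)
        have "Dz (\<lambda>j. of_nat J * f J j) P = cst (of_real 0) * P"
        proof (rule linear_symmetry[OF _ _ _ _ rigid B1 B0 r1 r0])
          show "bihom 1 0 (of_nat J * f J j)" for j using fe 2 by (intro nat_hom) simp
          show "bihom (d + 1) 0 (f (J - 1) j)" for j
            by (rule bihom_degree_cong[OF f(1)[of "J - 1" j]]) (use Jd' d in auto)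
          show "bihom d 0 (of_nat J * g J)" using ge 2 by (intro nat_hom) simp
          show "bihom (2 * d) 0 (g (J - 1))"
            by (rule bihom_degree_cong[OF g(1)[of "J - 1"]]) (use Jd' d in auto)
        qed auto
        then have "of_nat J * Dz (f J) P = 0" by (simp add: Dz_nat cst_simps)
        then have "Dz (f J) P = 0" using J1 by simp
        then show False using nondeg[where F = "f J", OF fe] False by blast
      next
        case 3
        then have Jd: "J * d = 1 + k" using le by (simp add: e_def)
        have "J \<noteq> 0" using Jd by (cases J) auto
        \<comment> \<open>The jet condition excludes w times a constant field, for which there would
          be no coefficient of index J - 2.\<close>
        moreover have "J \<noteq> 1" using jet Jd False by auto
        ultimately have J2: "2 \<le> J" by simp
        then obtain i where Ji: "J = i + 2" by (metis le_add_diff_inverse2)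
        have Jd': "(J - 1) * d + d = 1 + k" "(J - 2) * d + 2 * d = 1 + k"
          using Jd by (simp_all add: Ji algebra_simps)
        \<comment> \<open>Scaling \<open>B J\<close> by J (J - 1) and \<open>B (J - 1)\<close> by J
          - 1 absorbs the binomial factors, so that the three relations take the form of
          \<open>translation_symmetry\<close>.\<close>
        let ?N = "of_nat (J * (J - 1)) :: 'n pring" and ?n = "of_nat (J - 1) :: 'n pring"
        have B: "?N * B J = ?N * g J - 2 * cst \<i> * Dz (\<lambda>j. ?N * f J j) P"
          by (simp only: Dz_nat) (simp add: B_def algebra_simps)
        have B1: "?n * B (J - 1) = ?n * g (J - 1) - 2 * cst \<i> * Dz (\<lambda>j. ?n * f (J - 1) j) P"
          by (simp add: B_def Dz_nat algebra_simps)
        have B0: "B (J - 2) = g (J - 2) - 2 * cst \<i> * Dz (f (J - 2)) P" by (simp add: B_def)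
        have r2: "tau (?N * B J) = ?N * B J" using co(1) by simp
        have "?n * B (J - 1) - tau (?n * B (J - 1)) = ?n * (B (J - 1) - tau (B (J - 1)))"
          by (simp add: algebra_simps)
        also have "\<dots> = - (2 * cst \<i> * (P * (?N * B J)))"
        proof -
          have "1 \<le> J" using J2 by simp
          then show ?thesis unfolding co(2)[OF \<open>1 \<le> J\<close>] of_nat_mult by (simp only: mult_minus_right mult_ac)
        qed
        finally have r1: "?n * B (J - 1) - tau (?n * B (J - 1)) = - (2 * cst \<i> * (P * (?N * B J)))" .
        have "Dz (\<lambda>j. ?N * f J j) P = 0"
        proof (rule translation_symmetry[OF d _ _ _ _ _ _ rigid B B1 B0 r2 r1 co(3)[OF J2]])
          show "bihom 0 0 (?N * f J j)" for j using fe 3 by (intro nat_hom) simp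
          show "bihom (d - 1) 0 (?N * g J)" using ge 3 by (intro nat_hom) simp
          show "bihom d 0 (?n * f (J - 1) j)" for j
            by (intro nat_hom, rule bihom_degree_cong[OF f(1)[of "J - 1" j]]) (use Jd' d in auto)
          show "bihom (2 * d) 0 (f (J - 2) j)" for j
            by (rule bihom_degree_cong[OF f(1)[of "J - 2" j]]) (use Jd' d in auto)
          show "bihom (2 * d - 1) 0 (?n * g (J - 1))"
            by (intro nat_hom, rule bihom_degree_cong[OF g(1)[of "J - 1"]]) (use Jd' d in auto)
          show "bihom (3 * d - 1) 0 (g (J - 2))"
            by (rule bihom_degree_cong[OF g(1)[of "J - 2"]]) (use Jd' d in auto)
        qed auto
        then have "?N * Dz (f J) P = 0" by (simp only: Dz_nat)
        then have "Dz (f J) P = 0" using J2 by simp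
        then show False using nondeg[where F = "f J", OF fe] False by blast
      qed
    qed
  qed
  then show "f j i = 0" "g j = 0" using j by auto
qed

end

section \<open>Weighted Taylor coefficients, obtained from one-variable function theory\<close>

section \<open>Weighted expansions of holomorphic functions\<close>

text \<open>The multitype weights are rescaled by d = 1 / m: z gets weight 1 and w weight
  \<open>d\<close>, which makes the dilation polynomial in \<open>s\<close>.\<close>

definition dil :: "nat \<Rightarrow> complex \<Rightarrow> 'n::finite cspace \<Rightarrow> 'n cspace" where
  "dil d s x = (s *s fst x, s ^ d * snd x)"

definition cdiff :: "real \<Rightarrow> ('n::finite cspace \<Rightarrow> complex) \<Rightarrow> bool" where
  "cdiff \<epsilon> F \<longleftrightarrow> (\<forall>x\<in>ball 0 \<epsilon>. \<exists>D. (F has_derivative D) (at x) \<and> (\<forall>v. D (mult_i v) = \<i> * D v))"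

lemma complex_linear:
  assumes "bounded_linear D" "\<And>v. D (mult_i v) = \<i> * D v"
  shows "D (h *s a, h * b) = h * D (a, b)"
proof -
  interpret bounded_linear D by fact
  have "(h *s a, h * b) = Re h *\<^sub>R (a, b) + Im h *\<^sub>R mult_i (a, b)"
    by (simp add: mult_i_def fcp_eq_iff complex_eq_iff)
  then have "D (h *s a, h * b) = Re h *\<^sub>R D (a, b) + Im h *\<^sub>R (\<i> * D (a, b))"
    by (simp only: add scaleR assms(2))
  then show ?thesis by (simp add: complex_eq_iff)
qed

lemma bounded_linear_vector_smult_left: "bounded_linear (\<lambda>t::complex. t *s (z :: complex ^ 'n::finite))"
  unfolding linear_conv_bounded_linear[symmetric]
  by (rule linearI) (simp_all add: fcp_eq_iff algebra_simps)

lemma cdiff_curve: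
  assumes F: "cdiff \<epsilon> F" and "open S"
    and \<gamma>: "\<And>t. t \<in> S \<Longrightarrow> (\<gamma> has_derivative (\<lambda>h. (h *s a t, h * b t))) (at t)" "\<And>t. t \<in> S \<Longrightarrow> \<gamma> t \<in> ball 0 \<epsilon>"
  shows "(\<lambda>t. F (\<gamma> t)) holomorphic_on S"
  unfolding holomorphic_on_open[OF \<open>open S\<close>]
proof
  fix t assume t: "t \<in> S"
  obtain D where D: "(F has_derivative D) (at (\<gamma> t))" "\<And>v. D (mult_i v) = \<i> * D v"
    using F \<gamma>(2)[OF t] unfolding cdiff_def by blast
  have "((\<lambda>t. F (\<gamma> t)) has_derivative (\<lambda>h. D (h *s a t, h * b t))) (at t)"
    by (rule has_derivative_compose[OF \<gamma>(1)[OF t] D(1)])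
  then have "((\<lambda>t. F (\<gamma> t)) has_derivative (\<lambda>h. D (a t, b t) * h)) (at t)"
    by (simp add: complex_linear[OF has_derivative_bounded_linear[OF D(1)] D(2)] mult.commute)
  then show "\<exists>f'. ((\<lambda>t. F (\<gamma> t)) has_field_derivative f') (at t)"
    unfolding has_field_derivative_def by blast
qed

lemma dil_has_derivative:
  "((\<lambda>t. dil d t x) has_derivative (\<lambda>h. (h *s fst x, h * (of_nat d * t ^ (d - 1) * snd x)))) (at t)"
  unfolding dil_def
  by (intro has_derivative_Pair bounded_linear_imp_has_derivative bounded_linear_vector_smult_left)
    (auto intro!: derivative_eq_intros simp: mult_ac)

definition cmul :: "complex \<Rightarrow> 'n::finite cspace \<Rightarrow> 'n cspace" where "cmul t v = (t *s fst v, t * snd v)"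

lemma dil_line_has_derivative:
  "((\<lambda>t. dil d s (x + cmul t v)) has_derivative (\<lambda>h. (h *s (s *s fst v), h * (s ^ d * snd v)))) (at t)"
proof -
  have "(\<lambda>t. dil d s (x + cmul t v)) = (\<lambda>t. (s *s fst x + t *s (s *s fst v), s ^ d * snd x + t * (s ^ d * snd v)))"
    by (auto simp: dil_def cmul_def fcp_eq_iff algebra_simps)
  moreover have "((\<lambda>t. (s *s fst x + t *s (s *s fst v), s ^ d * snd x + t * (s ^ d * snd v))) has_derivative
      (\<lambda>h. (0 + h *s (s *s fst v), 0 + h * (s ^ d * snd v)))) (at t)"
    by (intro has_derivative_Pair has_derivative_add has_derivative_const bounded_linear_imp_has_derivative
        bounded_linear_vector_smult_left bounded_linear_mult_left)
  ultimately show ?thesis by simp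
qed

lemma norm_components: "norm (fst x) \<le> norm x" "norm (snd x) \<le> norm x"
  by (metis norm_fst_le prod.collapse) (metis norm_snd_le prod.collapse)

lemma norm_dil:
  assumes "norm s \<le> 1" "1 \<le> d"
  shows "norm (dil d s x) \<le> 2 * norm s * norm x"
proof -
  have "norm s ^ d \<le> norm s ^ 1" using assms by (intro power_decreasing) auto
  then have "norm s ^ d * norm (snd x) \<le> norm s * norm x"
    by (intro mult_mono) (auto simp: norm_components)
  moreover have "norm s * norm (fst x) \<le> norm s * norm x"
    by (intro mult_left_mono norm_components) auto
  moreover have "norm (dil d s x) \<le> norm (s *s fst x) + norm (s ^ d * snd x)"
    unfolding dil_def by (rule norm_Pair_le)
  ultimately show ?thesis by (simp add: norm_vec_smult norm_mult norm_power)
qed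

lemma norm_cmul: "norm (cmul t v) \<le> 2 * norm t * norm v"
  using norm_Pair_le[of "t *s fst v" "t * snd v"] mult_left_mono[OF norm_components(1)[of v], of "norm t"]
    mult_left_mono[OF norm_components(2)[of v], of "norm t"]
  by (simp add: cmul_def norm_vec_smult norm_mult)

lemma dil_dil: "dil d s (dil d t x) = dil d (s * t) x"
  by (simp add: dil_def fcp_eq_iff power_mult_distrib)

lemma dil_1: "dil d 1 x = x"
  by (simp add: dil_def)

text \<open>The weighted homogeneous part of weight \<open>k\<close>, read off along a single
  dilation curve. That it is a polynomial in (z, w) is the content of
  \<open>coef_polynomial\<close>.\<close>

definition coef :: "nat \<Rightarrow> ('n::finite cspace \<Rightarrow> complex) \<Rightarrow> nat \<Rightarrow> 'n cspace \<Rightarrow> complex" where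
  "coef d F k x = (deriv ^^ k) (\<lambda>t. F (dil d t x)) 0 / fact k"

lemma cdiff_continuous: "cdiff \<epsilon> F \<Longrightarrow> continuous_on (ball 0 \<epsilon>) F"
  unfolding cdiff_def by (meson continuous_at_imp_continuous_on has_derivative_continuous)

lemma dilation_expansion:
  fixes F :: "'n::finite cspace \<Rightarrow> complex"
  assumes F: "cdiff \<epsilon> F" and "0 < \<epsilon>" "1 \<le> d" "0 < R"
  obtains \<rho> C where "0 < \<rho>" "\<rho> \<le> 1" "0 \<le> C"
    "\<And>(x::'n cspace) t. norm x \<le> R \<Longrightarrow> norm t < \<rho> \<Longrightarrow> dil d t x \<in> ball 0 \<epsilon>"
    "\<And>x. norm x \<le> R \<Longrightarrow> (\<lambda>t. F (dil d t x)) holomorphic_on ball 0 \<rho>"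
    "\<And>x k. norm x \<le> R \<Longrightarrow> norm (coef d F k x) \<le> C / \<rho> ^ k"
    "\<And>x t. norm x \<le> R \<Longrightarrow> norm t < \<rho> \<Longrightarrow> (\<lambda>k. coef d F k x * t ^ k) sums F (dil d t x)"
proof -
  have "cball 0 (\<epsilon> / 2) \<subseteq> (ball 0 \<epsilon> :: 'n cspace set)" using \<open>0 < \<epsilon>\<close> by auto
  then have "compact (F ` cball 0 (\<epsilon> / 2))"
    by (intro compact_continuous_image continuous_on_subset[OF cdiff_continuous[OF F]] compact_cball)
  then obtain C where "0 < C" "\<forall>y\<in>F ` cball 0 (\<epsilon> / 2). norm y \<le> C"
    using compact_imp_bounded[of "F ` cball 0 (\<epsilon> / 2)"] unfolding bounded_pos by blast
  then have C: "\<And>x. x \<in> cball 0 (\<epsilon> / 2) \<Longrightarrow> norm (F x) \<le> C" "0 < C" by blast+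
  \<comment> \<open>By \<open>norm_dil\<close> a dilation by |t| \<le> 1 has norm at most 2 |t| |x|,
    so this radius keeps the dilated ball of radius \<open>R\<close> within \<epsilon> / 2 of the
    origin.\<close>
  define \<rho>' where "\<rho>' = min 1 (\<epsilon> / (4 * R))"
  have \<rho>': "0 < \<rho>'" "\<rho>' \<le> 1" "2 * \<rho>' * R \<le> \<epsilon> / 2"
    using assms by (auto simp: \<rho>'_def min_def field_simps)
  have small: "dil d t x \<in> cball 0 (\<epsilon> / 2)" if "norm x \<le> R" "norm t < \<rho>'" for x :: "'n cspace" and t
  proof -
    have "norm (dil d t x) \<le> 2 * norm t * norm x" using that \<rho>' \<open>1 \<le> d\<close> by (intro norm_dil) auto
    also have "\<dots> \<le> 2 * \<rho>' * R" using that \<rho>'(1) by (intro mult_mono) auto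
    finally show ?thesis using \<rho>'(3) by simp
  qed
  then have small': "dil d t x \<in> ball 0 \<epsilon>" if "norm x \<le> R" "norm t < \<rho>'" for x :: "'n cspace" and t
    using that \<open>0 < \<epsilon>\<close> by fastforce
  have hol: "(\<lambda>t. F (dil d t x)) holomorphic_on ball 0 \<rho>'" if "norm x \<le> R" for x
    by (rule cdiff_curve[OF F _ dil_has_derivative]) (use small'[OF that] in auto)
  define \<rho> where "\<rho> = \<rho>' / 2"
  have \<rho>: "0 < \<rho>" "\<rho> < \<rho>'" using \<rho>'(1) by (simp_all add: \<rho>_def)
  have hol\<rho>: "(\<lambda>t. F (dil d t x)) holomorphic_on ball 0 \<rho>" if "norm x \<le> R" for x
    using hol[OF that] \<rho> by (auto intro: holomorphic_on_subset)
  show thesis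
  proof (rule that[of \<rho> C])
    fix x :: "'n cspace" and k assume x: "norm x \<le> R"
    have "norm ((deriv ^^ k) (\<lambda>t. F (dil d t x)) 0) \<le> fact k * C / \<rho> ^ k"
    proof (rule Cauchy_inequality[OF hol\<rho>[OF x] _ \<rho>(1)])
      show "continuous_on (cball 0 \<rho>) (\<lambda>t. F (dil d t x))"
        using \<rho>(2) by (intro holomorphic_on_imp_continuous_on holomorphic_on_subset[OF hol[OF x]]) auto
      fix t :: complex assume "norm (0 - t) = \<rho>"
      then show "norm (F (dil d t x)) \<le> C" using \<rho>(2) by (intro C(1) small x) auto
    qed
    then show "norm (coef d F k x) \<le> C / \<rho> ^ k"
      by (simp add: coef_def norm_divide field_simps)
  next
    fix x :: "'n cspace" and t :: complex assume "norm x \<le> R" "norm t < \<rho>"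
    then show "(\<lambda>k. coef d F k x * t ^ k) sums F (dil d t x)"
      using holomorphic_power_series[OF hol\<rho>, of x t] by (simp add: coef_def)
  qed (use \<rho> \<rho>' C small' hol\<rho> in auto)
qed

lemma dilation_remainder:
  fixes F :: "'n::finite cspace \<Rightarrow> complex"
  assumes F: "cdiff \<epsilon> F" and "0 < \<epsilon>" "1 \<le> d" "0 < R"
  obtains \<rho> C where "0 < \<rho>" "\<rho> \<le> 1" "0 \<le> C"
    "\<And>(x::'n cspace) t. norm x \<le> R \<Longrightarrow> norm t < \<rho> \<Longrightarrow> dil d t x \<in> ball 0 \<epsilon>"
    "\<And>x t. norm x \<le> R \<Longrightarrow> norm t < \<rho> \<Longrightarrow>
      norm (F (dil d t x) - (\<Sum>l<K. coef d F l x * t ^ l)) \<le> C * norm t ^ K"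
proof -
  obtain \<rho> C where \<rho>: "0 < \<rho>" "\<rho> \<le> 1" and C: "0 \<le> C" "\<And>x k. norm x \<le> R \<Longrightarrow> norm (coef d F k x) \<le> C / \<rho> ^ k"
    and ball: "\<And>(x::'n cspace) t. norm x \<le> R \<Longrightarrow> norm t < \<rho> \<Longrightarrow> dil d t x \<in> ball 0 \<epsilon>"
    and sums: "\<And>x t. norm x \<le> R \<Longrightarrow> norm t < \<rho> \<Longrightarrow> (\<lambda>k. coef d F k x * t ^ k) sums F (dil d t x)"
    by (rule dilation_expansion[OF assms]) blast
  show thesis
  \<comment> \<open>Halving the radius bounds the ratio of the geometric tail by 1/2, whence the
    factor 2.\<close>
  proof (rule that[of "\<rho> / 2" "2 * C / \<rho> ^ K"])
    fix x :: "'n cspace" and t :: complex assume x: "norm x \<le> R" and t: "norm t < \<rho> / 2"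
    define q where "q = norm t / \<rho>"
    have q: "0 \<le> q" "q < 1 / 2" using t \<rho> by (auto simp: q_def field_simps)
    have t': "norm t < \<rho>" using t \<rho> by simp
    have s: "(\<lambda>k. coef d F (k + K) x * t ^ (k + K)) sums (F (dil d t x) - (\<Sum>l<K. coef d F l x * t ^ l))"
      using sums_split_initial_segment[OF sums[OF x t'], of K] .
    have g: "(\<lambda>k. C * q ^ K * q ^ k) sums (C * q ^ K * (1 / (1 - q)))"
      using q by (intro sums_mult geometric_sums) auto
    have "norm (coef d F (k + K) x * t ^ (k + K)) \<le> C * q ^ K * q ^ k" for k
    proof -
      have "norm (coef d F (k + K) x) * norm t ^ (k + K) \<le> C / \<rho> ^ (k + K) * norm t ^ (k + K)"
        by (intro mult_right_mono C x) auto
      also have "\<dots> = C * q ^ K * q ^ k" by (simp add: q_def power_add power_divide mult_ac)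
      finally show ?thesis by (simp add: norm_mult norm_power)
    qed
    then have "norm (suminf (\<lambda>k. coef d F (k + K) x * t ^ (k + K))) \<le> suminf (\<lambda>k. C * q ^ K * q ^ k)"
      by (rule norm_suminf_le) (rule sums_summable[OF g])
    then have "norm (F (dil d t x) - (\<Sum>l<K. coef d F l x * t ^ l)) \<le> C * q ^ K * (1 / (1 - q))"
      using s g by (simp add: sums_iff)
    also have "\<dots> \<le> C * q ^ K * 2" using q C by (intro mult_left_mono) (auto simp: field_simps)
    finally show "norm (F (dil d t x) - (\<Sum>l<K. coef d F l x * t ^ l)) \<le> 2 * C / \<rho> ^ K * norm t ^ K"
      by (simp add: q_def power_divide mult_ac)
  qed (use \<rho> C ball in auto)
qed

lemma coef_0: "coef d F 0 x = F 0" if "1 \<le> d"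
  using that by (auto simp: coef_def dil_def zero_prod_def power_0_left)

lemma coef_dil:
  assumes F: "cdiff \<epsilon> F" and "0 < \<epsilon>" "1 \<le> d"
  shows "coef d F k (dil d s x) = s ^ k * coef d F k x"
proof -
  obtain \<rho> where \<rho>: "0 < \<rho>" "\<And>y. norm y \<le> norm x + 1 \<Longrightarrow> (\<lambda>t. F (dil d t y)) holomorphic_on ball 0 \<rho>"
    by (rule dilation_expansion[OF assms, of "norm x + 1"]) (auto intro: add_nonneg_pos)
  have "(deriv ^^ k) (\<lambda>t. (\<lambda>t. F (dil d t x)) (s * t)) 0 = s ^ k * (deriv ^^ k) (\<lambda>t. F (dil d t x)) (s * 0)"
  proof (rule higher_deriv_compose_linear[OF \<rho>(2)])
    show "open ((\<lambda>t. s * t) -` ball 0 \<rho>)" by (intro continuous_open_vimage) auto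
  qed (use \<rho>(1) in auto)
  then show ?thesis by (simp add: coef_def dil_dil mult.commute)
qed

text \<open>The point x is the dilation by 1 + |x| of a point of norm at most 2, where the Cauchy
  estimate applies; homogeneity does the rest.\<close>

lemma coef_growth:
  fixes F :: "'n::finite cspace \<Rightarrow> complex"
  assumes F: "cdiff \<epsilon> F" and "0 < \<epsilon>" "1 \<le> d"
  obtains C where "0 \<le> C" "\<And>x. norm (coef d F k x) \<le> C * (1 + norm x) ^ k"
proof -
  obtain \<rho> C where C: "0 < \<rho>" "0 \<le> C" "\<And>x k. norm x \<le> 2 \<Longrightarrow> norm (coef d F k x) \<le> C / \<rho> ^ k"
    by (rule dilation_expansion[OF assms, of 2]) auto
  show thesis
  proof (rule that[of "C / \<rho> ^ k"])
    fix x :: "'n cspace"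
    define s where "s = 1 + norm x"
    have s: "1 \<le> s" "norm x \<le> s" by (simp_all add: s_def)
    have "norm (dil d (of_real (1 / s)) x) \<le> 2 * norm (complex_of_real (1 / s)) * norm x"
      using s \<open>1 \<le> d\<close> by (intro norm_dil) (auto simp: norm_divide)
    also have "\<dots> \<le> 2" using s by (simp add: norm_divide field_simps)
    finally have 2: "norm (coef d F k (dil d (of_real (1 / s)) x)) \<le> C / \<rho> ^ k" by (rule C)
    have "x = dil d (of_real s) (dil d (of_real (1 / s)) x)"
      unfolding dil_dil using s by (simp add: dil_1)
    then have "coef d F k x = of_real s ^ k * coef d F k (dil d (of_real (1 / s)) x)"
      using coef_dil[OF assms] by metis
    then have "norm (coef d F k x) = s ^ k * norm (coef d F k (dil d (of_real (1 / s)) x))"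
      using s by (simp add: norm_mult norm_power)
    also have "\<dots> \<le> s ^ k * (C / \<rho> ^ k)" using 2 s by (intro mult_left_mono) auto
    finally show "norm (coef d F k x) \<le> C / \<rho> ^ k * (1 + norm x) ^ k" by (simp add: s_def mult.commute)
  qed (use C in auto)
qed

text \<open>On a complex line the coefficient is a locally uniform limit, for s tending to 0, of the
  quotients (F(dil s x) - lower terms) / s^k. These are holomorphic by induction on
  \<open>k\<close>.\<close>

lemma coef_entire:
  fixes F :: "'n::finite cspace \<Rightarrow> complex"
  assumes F: "cdiff \<epsilon> F" and "0 < \<epsilon>" "1 \<le> d"
  shows "(\<lambda>t. coef d F k (x + cmul t v)) holomorphic_on UNIV"
proof (induction k rule: less_induct)
  case (less k)
  have ball: "(\<lambda>t. coef d F k (x + cmul t v)) holomorphic_on ball 0 r" if "0 < r" for r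
  proof -
    define R where "R = norm x + 2 * r * norm v + 1"
    have R: "norm (x + cmul t v) \<le> R" if "t \<in> ball 0 r" for t
    proof -
      have "norm (cmul t v) \<le> 2 * norm t * norm v" by (rule norm_cmul)
      also have "\<dots> \<le> 2 * r * norm v" using that by (intro mult_right_mono) auto
      finally show ?thesis unfolding R_def using norm_triangle_ineq[of x "cmul t v"] by simp
    qed
    have "0 < R" using that by (simp add: R_def add_nonneg_pos)
    then obtain \<rho> C where \<rho>: "0 < \<rho>" "0 \<le> C"
      "\<And>(x::'n cspace) t. norm x \<le> R \<Longrightarrow> norm t < \<rho> \<Longrightarrow> dil d t x \<in> ball 0 \<epsilon>"
      "\<And>x t. norm x \<le> R \<Longrightarrow> norm t < \<rho> \<Longrightarrow>
        norm (F (dil d t x) - (\<Sum>l<Suc k. coef d F l x * t ^ l)) \<le> C * norm t ^ Suc k"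
      by (rule dilation_remainder[OF assms, of R "Suc k"]) auto
    define s where "s n = complex_of_real (\<rho> / real (n + 2))" for n
    have ns: "norm (s n) = \<rho> / real (n + 2)" for n
      unfolding s_def norm_of_real using \<rho>(1) by simp
    have s: "s n \<noteq> 0" "norm (s n) < \<rho>" for n
    proof -
      have "0 < \<rho> / real (n + 2)" "\<rho> / real (n + 2) < \<rho> / 1"
        using \<rho>(1) by (simp, intro divide_strict_left_mono) auto
      then show "s n \<noteq> 0" "norm (s n) < \<rho>" unfolding ns[of n, symmetric] by auto
    qed
    define h where "h n t = (F (dil d (s n) (x + cmul t v)) - (\<Sum>l<k. coef d F l (x + cmul t v) * s n ^ l)) / s n ^ k" for n t
    have hol: "h n holomorphic_on ball 0 r" for n
      unfolding h_def
    proof (intro holomorphic_intros)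
      show "(\<lambda>t. F (dil d (s n) (x + cmul t v))) holomorphic_on ball 0 r"
        by (rule cdiff_curve[OF F _ dil_line_has_derivative]) (use \<rho>(3)[OF R s(2)] in auto)
    qed (use s less in \<open>auto intro: holomorphic_on_subset\<close>)
    have close: "dist (h n t) (coef d F k (x + cmul t v)) \<le> C * norm (s n)" if "t \<in> ball 0 r" for n t
    proof -
      have e: "h n t - coef d F k (x + cmul t v) =
          (F (dil d (s n) (x + cmul t v)) - (\<Sum>l<Suc k. coef d F l (x + cmul t v) * s n ^ l)) / s n ^ k"
        using s(1)[of n] by (simp add: h_def field_simps)
      have "dist (h n t) (coef d F k (x + cmul t v)) =
          norm (F (dil d (s n) (x + cmul t v)) - (\<Sum>l<Suc k. coef d F l (x + cmul t v) * s n ^ l)) / norm (s n) ^ k"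
        by (simp only: dist_norm e norm_divide norm_power)
      also have "\<dots> \<le> C * norm (s n) ^ Suc k / norm (s n) ^ k"
        by (intro divide_right_mono \<rho>(4)[OF R[OF that] s(2)]) simp
      finally have "dist (h n t) (coef d F k (x + cmul t v)) \<le> C * norm (s n) ^ Suc k / norm (s n) ^ k" .
      then show ?thesis using s(1)[of n] by simp
    qed
    have lim: "(\<lambda>n. C * norm (s n)) \<longlonglongrightarrow> 0"
    proof -
      have "(\<lambda>n. \<rho> / real (n + 2)) \<longlonglongrightarrow> 0" by (rule LIMSEQ_ignore_initial_segment[OF lim_const_over_n])
      then have "(\<lambda>n. C * (\<rho> / real (n + 2))) \<longlonglongrightarrow> C * 0" by (intro tendsto_intros)
      then show ?thesis by (simp only: ns mult_zero_right)
    qed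
    have ul: "uniform_limit (ball 0 r) h (\<lambda>t. coef d F k (x + cmul t v)) sequentially"
      unfolding uniform_limit_iff
    proof (intro allI impI)
      fix e :: real assume "0 < e"
      then have "\<forall>\<^sub>F n in sequentially. C * norm (s n) < e" by (rule order_tendstoD(2)[OF lim])
      then show "\<forall>\<^sub>F n in sequentially. \<forall>t\<in>ball 0 r. dist (h n t) (coef d F k (x + cmul t v)) < e"
        by eventually_elim (meson close le_less_trans)
    qed
    show ?thesis
    proof (rule holomorphic_uniform_sequence[of _ h])
      fix t assume "t \<in> ball (0::complex) r"
      then obtain e where "0 < e" "cball t e \<subseteq> ball 0 r" using open_contains_cball[of "ball (0::complex) r"] by blast
      then show "\<exists>e>0. cball t e \<subseteq> ball 0 r \<and> uniform_limit (cball t e) h (\<lambda>t. coef d F k (x + cmul t v)) sequentially"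
        using uniform_limit_on_subset[OF ul] by blast
    qed (use hol in auto)
  qed
  show ?case
    unfolding holomorphic_on_open[OF open_UNIV]
  proof
    fix t :: complex
    have "t \<in> ball 0 (norm t + 1)" by simp
    moreover have "(\<lambda>t. coef d F k (x + cmul t v)) holomorphic_on ball 0 (norm t + 1)"
      by (rule ball) (simp add: add_nonneg_pos)
    ultimately show "\<exists>f'. ((\<lambda>t. coef d F k (x + cmul t v)) has_field_derivative f') (at t)"
      using holomorphic_on_open[of "ball (0::complex) (norm t + 1)"] by blast
  qed
qed

text \<open>Liouville: an entire function with growth of order \<open>k\<close> is a polynomial of
  degree at most \<open>k\<close>.\<close>

lemma coef_line:
  fixes F :: "'n::finite cspace \<Rightarrow> complex"
  assumes "cdiff \<epsilon> F" "0 < \<epsilon>" "1 \<le> d"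
  obtains p where "degree p \<le> k" "\<And>t. coef d F k (x + cmul t v) = poly p t"
proof -
  obtain C where C: "0 \<le> C" "\<And>x. norm (coef d F k x) \<le> C * (1 + norm x) ^ k"
    by (rule coef_growth[OF assms]) blast
  let ?f = "\<lambda>t. coef d F k (x + cmul t v)"
  have growth: "norm (?f t) \<le> C * (1 + norm x + 2 * norm v) ^ k * norm t ^ k" if "1 \<le> norm t" for t
  proof -
    have "1 + norm (x + cmul t v) \<le> 1 + norm x + 2 * norm t * norm v"
      using norm_triangle_ineq[of x "cmul t v"] norm_cmul[of t v] by linarith
    also have "\<dots> \<le> norm t * (1 + norm x) + 2 * norm t * norm v"
      using mult_right_mono[OF that, of "1 + norm x"] by simp
    finally have "1 + norm (x + cmul t v) \<le> (1 + norm x + 2 * norm v) * norm t" by (simp add: algebra_simps)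
    then have "(1 + norm (x + cmul t v)) ^ k \<le> ((1 + norm x + 2 * norm v) * norm t) ^ k"
      by (intro power_mono) auto
    then have "C * (1 + norm (x + cmul t v)) ^ k \<le> C * ((1 + norm x + 2 * norm v) * norm t) ^ k"
      using C(1) by (rule mult_left_mono)
    with C(2)[of "x + cmul t v"] show ?thesis unfolding power_mult_distrib mult.assoc by (rule order_trans)
  qed
  define p where "p = (\<Sum>j\<le>k. monom ((deriv ^^ j) ?f 0 / fact j) j)"
  show thesis
  proof (rule that[of p])
    show "degree p \<le> k"
      unfolding p_def by (intro degree_sum_le) (auto intro: order_trans[OF degree_monom_le])
    fix t
    have "?f t = (\<Sum>j\<le>k. (deriv ^^ j) ?f 0 / fact j * t ^ j)"
      by (rule Liouville_polynomial[where f = ?f and A = 1, OF coef_entire[OF assms] growth])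
    also have "\<dots> = poly p t" by (simp only: p_def poly_sum poly_monom)
    finally show "?f t = poly p t" .
  qed
qed

text \<open>Lagrange polynomials at the nodes 0, ..., k recover a polynomial linearly from its
  values, so that dependence on one variable becomes explicit while the others remain
  parameters.\<close>

lemma interpolation_basis:
  obtains L :: "nat \<Rightarrow> complex poly" where "\<And>i. degree (L i) \<le> k"
    "\<And>p t. degree p \<le> k \<Longrightarrow> poly p t = (\<Sum>i\<le>k. poly p (of_nat i) * poly (L i) t)"
proof -
  define L0 :: "nat \<Rightarrow> complex poly" where "L0 i = (\<Prod>j\<in>{..k} - {i}. [:- of_nat j, 1:])" for i
  define L where "L i = (if i \<le> k then Polynomial.smult (1 / poly (L0 i) (of_nat i)) (L0 i) else 0)" for i
  have L0: "poly (L0 i) (of_nat j) = 0 \<longleftrightarrow> j \<noteq> i" if "i \<le> k" "j \<le> k" for i j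
    using that by (auto simp: L0_def poly_prod)
  have deg: "degree (L i) \<le> k" for i
  proof (cases "i \<le> k")
    case True
    have "degree (L0 i) \<le> sum (degree \<circ> (\<lambda>j. [:- of_nat j, 1 :: complex:])) ({..k} - {i})"
      unfolding L0_def by (rule degree_prod_sum_le) simp
    also have "\<dots> = k" using True by simp
    finally show ?thesis by (simp add: L_def)
  qed (simp add: L_def)
  have L: "poly (L i) (of_nat j) = (if i = j then 1 else 0)" if "i \<le> k" "j \<le> k" for i j
    using that L0[OF that] L0[of i i] by (auto simp: L_def)
  show thesis
  proof (rule that[OF deg])
    fix p :: "complex poly" and t assume p: "degree p \<le> k"
    have "p = (\<Sum>i\<le>k. Polynomial.smult (poly p (of_nat i)) (L i))"
    proof (rule poly_eqI_degree[of "of_nat ` {..k}"])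
      fix x :: complex assume "x \<in> of_nat ` {..k}"
      then obtain j where j: "x = of_nat j" "j \<le> k" by auto
      have "(\<Sum>i\<le>k. poly p (of_nat i) * poly (L i) (of_nat j)) = (\<Sum>i\<le>k. if i = j then poly p (of_nat j) else 0)"
        by (rule sum.cong) (auto simp: L j)
      then show "poly p x = poly (\<Sum>i\<le>k. Polynomial.smult (poly p (of_nat i)) (L i)) x"
        using j by (simp add: poly_sum)
    next
      have c: "card (of_nat ` {..k} :: complex set) = Suc k" by (subst card_image) (auto simp: inj_on_def)
      show "degree p < card (of_nat ` {..k} :: complex set)" using p c by simp
      have "degree (\<Sum>i\<le>k. Polynomial.smult (poly p (of_nat i)) (L i)) \<le> k"
        using deg by (intro degree_sum_le) auto
      then show "degree (\<Sum>i\<le>k. Polynomial.smult (poly p (of_nat i)) (L i)) < card (of_nat ` {..k} :: complex set)"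
        using c by simp
    qed
    then have "poly p t = poly (\<Sum>i\<le>k. Polynomial.smult (poly p (of_nat i)) (L i)) t" by simp
    then show "poly p t = (\<Sum>i\<le>k. poly p (of_nat i) * poly (L i) t)" by (simp add: poly_sum)
  qed
qed

lemma poly_le_altdef:
  fixes p :: "complex poly"
  assumes "degree p \<le> k" shows "poly p w = (\<Sum>j\<le>k. coeff p j * w ^ j)"
  unfolding poly_altdef using assms by (intro sum.mono_neutral_left) (auto simp: coeff_eq_0)

lemma pair_poly_poly: "f \<in> pair_poly \<Longrightarrow> (\<lambda>x. poly p (f x)) \<in> pair_poly"
  by (induction p) (auto intro: generated_algebra.intros)

text \<open>Polynomial behaviour is known on lines only. Coordinates are released one at a time, by
  interpolating in the new one while the remaining ones stay frozen at \<open>x0\<close>; the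
  bounded degree makes this work.\<close>

lemma coef_pair_poly:
  fixes F :: "'n::finite cspace \<Rightarrow> complex"
  assumes "cdiff \<epsilon> F" "0 < \<epsilon>" "1 \<le> d"
  shows "(\<lambda>x. coef d F k (fst x, w)) \<in> pair_poly"
proof -
  obtain L :: "nat \<Rightarrow> complex poly" where "\<And>i. degree (L i) \<le> k"
    and L: "\<And>p t. degree p \<le> k \<Longrightarrow> poly p t = (\<Sum>i\<le>k. poly p (of_nat i) * poly (L i) t)"
    by (rule interpolation_basis[of k]) (rule that)
  have "\<forall>x0. (\<lambda>x::(complex ^ 'n) \<times> (complex ^ 'n). coef d F k (\<chi> j. if j \<in> S then fst x $ j else x0 j, w)) \<in> pair_poly" for S
  proof (induction S rule: finite_induct[OF finite])
    case 1
    show ?case by (simp add: generated_algebra.const)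
  next
    case (2 j S)
    show ?case
    proof
      fix x0
      have "coef d F k (\<chi> l. if l \<in> insert j S then fst x $ l else x0 l, w) =
          (\<Sum>i\<le>k. coef d F k (\<chi> l. if l \<in> S then fst x $ l else (x0(j := of_nat i)) l, w) * poly (L i) (fst x $ j))"
        for x :: "(complex ^ 'n) \<times> (complex ^ 'n)"
      proof -
        let ?b = "(\<chi> l. if l \<in> S then fst x $ l else (x0(j := 0)) l, w) :: 'n cspace"
        obtain p where p: "degree p \<le> k" "\<And>t. coef d F k (?b + cmul t (axis j 1, 0)) = poly p t"
          by (rule coef_line[OF assms]) blast
        have b: "?b + cmul t (axis j 1, 0) = (\<chi> l. if l \<in> S then fst x $ l else (x0(j := t)) l, w)" for t
          using 2(2) by (auto simp: cmul_def fcp_eq_iff axis_def)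
        have "(\<chi> l. if l \<in> insert j S then fst x $ l else x0 l) = (\<chi> l. if l \<in> S then fst x $ l else (x0(j := fst x $ j)) l)"
          by (auto simp: fcp_eq_iff)
        then show ?thesis using L[OF p(1), of "fst x $ j"] unfolding p(2)[symmetric] b by simp
      qed
      moreover have "(\<lambda>x::(complex ^ 'n) \<times> (complex ^ 'n). \<Sum>i\<le>k. coef d F k (\<chi> l. if l \<in> S then fst x $ l else (x0(j := of_nat i)) l, w) * poly (L i) (fst x $ j)) \<in> pair_poly"
        by (intro generated_algebra_sum generated_algebra.mult pair_poly_poly pair_poly_fst 2(3)[rule_format])
      ultimately show "(\<lambda>x::(complex ^ 'n) \<times> (complex ^ 'n). coef d F k (\<chi> l. if l \<in> insert j S then fst x $ l else x0 l, w)) \<in> pair_poly"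
        by simp
    qed
  qed
  from this[of UNIV] show ?thesis by simp
qed

text \<open>Interpolation in w gives an expansion in powers of w with coefficients polynomial in z;
  comparing powers of w under dilation makes them homogeneous. The argument \<open>y\<close> is
  arbitrary because these coefficients are holomorphic.\<close>

lemma coef_polynomial:
  fixes F :: "'n::finite cspace \<Rightarrow> complex"
  assumes F: "cdiff \<epsilon> F" "0 < \<epsilon>" "1 \<le> d"
  obtains q :: "nat \<Rightarrow> 'n pring" where
    "\<And>z w y. coef d F k (z, w) = (\<Sum>j\<le>k. w ^ j * ev (q j) (z, y))"
    "\<And>j. j * d \<le> k \<Longrightarrow> bihom (k - j * d) 0 (q j)" "\<And>j. k < j * d \<Longrightarrow> q j = 0"
proof -
  obtain L :: "nat \<Rightarrow> complex poly" where L: "\<And>i. degree (L i) \<le> k"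
    "\<And>p t. degree p \<le> k \<Longrightarrow> poly p t = (\<Sum>i\<le>k. poly p (of_nat i) * poly (L i) t)"
    by (rule interpolation_basis[of k]) (rule that)
  define f where "f j x = (\<Sum>i\<le>k. coef d F k (fst x, of_nat i) * coeff (L i) j)" for j and x :: "(complex ^ 'n) \<times> (complex ^ 'n)"
  have fp: "f j \<in> pair_poly" for j
    unfolding f_def by (intro generated_algebra_sum generated_algebra.mult generated_algebra.const coef_pair_poly[OF F])
  define q where "q j = Abs_pring (f j)" for j
  have ev: "ev (q j) = f j" for j by (simp add: q_def Abs_pring_inverse[OF fp])
  have expand: "coef d F k (z, w) = (\<Sum>j\<le>k. w ^ j * f j (z, y))" for z w y
  proof -
    obtain p where p: "degree p \<le> k" "\<And>t. coef d F k ((z, 0) + cmul t (0, 1)) = poly p t"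
      by (rule coef_line[OF F]) blast
    have p': "coef d F k (z, t) = poly p t" for t using p(2)[of t] by (simp add: cmul_def)
    have "coef d F k (z, w) = (\<Sum>i\<le>k. coef d F k (z, of_nat i) * poly (L i) w)"
      using L(2)[OF p(1), of w] by (simp add: p')
    also have "\<dots> = (\<Sum>i\<le>k. coef d F k (z, of_nat i) * (\<Sum>j\<le>k. coeff (L i) j * w ^ j))"
      by (simp add: poly_le_altdef[OF L(1)])
    also have "\<dots> = (\<Sum>i\<le>k. \<Sum>j\<le>k. coef d F k (z, of_nat i) * coeff (L i) j * w ^ j)"
      by (simp add: sum_distrib_left mult_ac)
    also have "\<dots> = (\<Sum>j\<le>k. \<Sum>i\<le>k. coef d F k (z, of_nat i) * coeff (L i) j * w ^ j)" by (rule sum.swap)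
    finally show ?thesis by (simp add: f_def sum_distrib_left mult_ac)
  qed
  have f0: "f j x = 0" if "k < j" for j x
    using that by (simp add: f_def coeff_eq_0[OF le_less_trans[OF L(1)]])
  have hom: "s ^ (j * d) * f j (s *s fst x, y) = s ^ k * f j x" for s j x y
  proof (cases "j \<le> k")
    case True
    have "(\<Sum>j\<le>k. monom (s ^ (j * d) * f j (s *s fst x, y)) j) = (\<Sum>j\<le>k. monom (s ^ k * f j x) j)" (is "?p = ?p'")
    proof (rule poly_ext)
      fix w
      have "coef d F k (dil d s (fst x, w)) = s ^ k * coef d F k (fst x, w)" by (rule coef_dil[OF F])
      then have "(\<Sum>j\<le>k. (s ^ d * w) ^ j * f j (s *s fst x, y)) = s ^ k * (\<Sum>j\<le>k. w ^ j * f j (fst x, snd x))"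
        by (simp only: dil_def fst_conv snd_conv expand[of _ _ y, of "s *s fst x"] expand[of "fst x" _ "snd x"])
      then show "poly ?p w = poly ?p' w"
        by (simp add: poly_sum poly_monom power_mult_distrib sum_distrib_left mult_ac flip: power_mult)
    qed
    then have "coeff ?p j = coeff ?p' j" by simp
    then show ?thesis using True by (simp add: coeff_sum)
  qed (simp add: f0)
  show thesis
  proof (rule that[of q])
    fix z w y show "coef d F k (z, w) = (\<Sum>j\<le>k. w ^ j * ev (q j) (z, y))" by (simp add: ev expand)
  next
    fix j assume j: "j * d \<le> k"
    show "bihom (k - j * d) 0 (q j)"
    proof (rule bihomI)
      fix s t :: complex and z w :: "complex ^ 'n" assume "s \<noteq> 0"
      have "s ^ (j * d) * f j (s *s z, t *s w) = s ^ (j * d) * (s ^ (k - j * d) * f j (z, w))"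
        using hom[where s = s and j = j and x = "(z, w)" and y = "t *s w"] j by (simp flip: power_add mult.assoc)
      then show "ev (q j) (s *s z, t *s w) = s ^ (k - j * d) * t ^ 0 * ev (q j) (z, w)"
        using \<open>s \<noteq> 0\<close> by (simp add: ev)
    qed
  next
    fix j assume j: "k < j * d"
    show "q j = 0"
    proof (rule pring_eqI)
      fix x :: "(complex ^ 'n) \<times> (complex ^ 'n)"
      obtain p where p: "\<And>t. f j (0 + t *s fst x, 0 + t *s 0) = poly p t" by (rule pair_poly_line[OF fp]) blast
      \<comment> \<open>Homogeneity would have the negative degree -m. So s^m f(s z) = f(z), a
        polynomial identity in s whose value at s = 0 is f(z) = 0.\<close>
      define m where "m = j * d - k"
      have "monom 1 m * p - [:f j x:] = 0"
      proof (rule poly_zero_off_0)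
        fix s :: complex assume "s \<noteq> 0"
        moreover have "s ^ k * (s ^ m * f j (s *s fst x, 0)) = s ^ k * f j x"
          using hom[of s j x 0] j by (simp add: m_def flip: power_add mult.assoc)
        ultimately have "s ^ m * f j (s *s fst x, 0) = f j x" by simp
        then show "poly (monom 1 m * p - [:f j x:]) s = 0" using p[of s] by (simp add: poly_monom)
      qed
      then have "poly (monom 1 m * p - [:f j x:]) 0 = 0" by simp
      then show "ev (q j) x = ev 0 x" using j by (simp add: poly_monom m_def ev power_0_left)
    qed
  qed
qed

lemma coef_continuous:
  fixes F :: "'n::finite cspace \<Rightarrow> complex"
  assumes F: "cdiff \<epsilon> F" "0 < \<epsilon>" "1 \<le> d"
  shows "continuous_on UNIV (coef d F k)"
proof -
  obtain q :: "nat \<Rightarrow> 'n pring" where q: "\<And>z w y. coef d F k (z, w) = (\<Sum>j\<le>k. w ^ j * ev (q j) (z, y))"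
    by (rule coef_polynomial[OF F, of k]) blast
  have "continuous_on UNIV (ev (q j))" for j
    by (intro continuous_at_imp_continuous_on ballI has_derivative_continuous[OF ev_has_derivative])
  then have "continuous_on UNIV (\<lambda>x::'n cspace. ev (q j) (fst x, 0))" for j
    by (rule continuous_on_compose2) (auto intro!: continuous_intros)
  moreover have "coef d F k = (\<lambda>x. \<Sum>j\<le>k. snd x ^ j * ev (q j) (fst x, 0))"
    using q[of "fst _" "snd _" 0] by auto
  ultimately show ?thesis by (auto intro!: continuous_intros)
qed

lemma coef_diff:
  fixes F G :: "'n::finite cspace \<Rightarrow> complex"
  assumes F: "cdiff \<epsilon> F" and G: "cdiff \<epsilon> G" and "0 < \<epsilon>" "1 \<le> d"
  shows "coef d (\<lambda>x. F x - G x) k x = coef d F k x - coef d G k x"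
proof -
  have R: "0 < norm x + 1" by (simp add: add_nonneg_pos)
  obtain \<rho> where \<rho>: "0 < \<rho>" "\<And>y. norm y \<le> norm x + 1 \<Longrightarrow> (\<lambda>t. F (dil d t y)) holomorphic_on ball 0 \<rho>"
    by (rule dilation_expansion[OF F assms(3,4) R]) blast
  obtain \<rho>' where \<rho>': "0 < \<rho>'" "\<And>y. norm y \<le> norm x + 1 \<Longrightarrow> (\<lambda>t. G (dil d t y)) holomorphic_on ball 0 \<rho>'"
    by (rule dilation_expansion[OF G assms(3,4) R]) blast
  have "(deriv ^^ k) (\<lambda>t. F (dil d t x) - G (dil d t x)) 0 =
      (deriv ^^ k) (\<lambda>t. F (dil d t x)) 0 - (deriv ^^ k) (\<lambda>t. G (dil d t x)) 0"
    by (rule higher_deriv_diff[of _ "ball 0 (min \<rho> \<rho>')"])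
      (use \<rho>(1) \<rho>'(1) in \<open>auto intro: holomorphic_on_subset[OF \<rho>(2)] holomorphic_on_subset[OF \<rho>'(2)]\<close>)
  then show ?thesis by (simp add: coef_def diff_divide_distrib)
qed

lemma cdiff_diff: "cdiff \<epsilon> F \<Longrightarrow> cdiff \<epsilon> G \<Longrightarrow> cdiff \<epsilon> (\<lambda>x. F x - G x)"
  unfolding cdiff_def
proof
  fix x :: "'a cspace"
  assume a: "\<forall>x\<in>ball 0 \<epsilon>. \<exists>D. (F has_derivative D) (at x) \<and> (\<forall>v. D (mult_i v) = \<i> * D v)"
    "\<forall>x\<in>ball 0 \<epsilon>. \<exists>D. (G has_derivative D) (at x) \<and> (\<forall>v. D (mult_i v) = \<i> * D v)" "x \<in> ball 0 \<epsilon>"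
  then obtain D E where "(F has_derivative D) (at x)" "\<forall>v. D (mult_i v) = \<i> * D v"
    "(G has_derivative E) (at x)" "\<forall>v. E (mult_i v) = \<i> * E v" by blast
  then show "\<exists>D. ((\<lambda>x. F x - G x) has_derivative D) (at x) \<and> (\<forall>v. D (mult_i v) = \<i> * D v)"
    by (intro exI[of _ "\<lambda>v. D v - E v"]) (auto intro: has_derivative_diff simp: algebra_simps)
qed

text \<open>The base point moves with t because dilated points of M only converge to the model. The
  uniform remainder estimate and the continuity of the coefficient absorb the motion.\<close>

lemma coef_limit:
  fixes F :: "'n::finite cspace \<Rightarrow> complex" and y :: "real \<Rightarrow> 'n cspace"
  assumes F: "cdiff \<epsilon> F" "0 < \<epsilon>" "1 \<le> d" and zero: "\<And>l x. l < K \<Longrightarrow> coef d F l x = 0"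
    and y: "(y \<longlongrightarrow> y0) (at_right 0)"
  shows "((\<lambda>t. F (dil d (of_real t) (y t)) / of_real t ^ K) \<longlongrightarrow> coef d F K y0) (at_right 0)"
proof -
  have "0 < norm y0 + 1" by (simp add: add_nonneg_pos)
  then obtain \<rho> C where \<rho>: "0 < \<rho>" and C: "\<And>x t. norm x \<le> norm y0 + 1 \<Longrightarrow> norm t < \<rho> \<Longrightarrow>
      norm (F (dil d t x) - (\<Sum>l<Suc K. coef d F l x * t ^ l)) \<le> C * norm t ^ Suc K"
    by (rule dilation_remainder[OF F, of _ "Suc K"]) blast
  have "\<forall>\<^sub>F t in at_right 0. norm (y t) < norm y0 + 1"
    by (rule order_tendstoD(2)[OF tendsto_norm[OF y]]) simp
  moreover have "\<forall>\<^sub>F t in at_right 0. t \<in> {0<..<\<rho>}"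
    using \<rho> by (rule eventually_at_right_real)
  ultimately have close: "\<forall>\<^sub>F t in at_right 0. norm (F (dil d (of_real t) (y t)) / of_real t ^ K - coef d F K (y t)) \<le> C * t"
  proof eventually_elim
    case (elim t)
    have "(\<Sum>l<Suc K. coef d F l (y t) * of_real t ^ l) = coef d F K (y t) * of_real t ^ K"
      by (simp add: zero)
    then have "norm (F (dil d (of_real t) (y t)) - coef d F K (y t) * of_real t ^ K) \<le> C * t ^ Suc K"
      using C[of "y t" "of_real t"] elim by simp
    moreover have "F (dil d (of_real t) (y t)) / of_real t ^ K - coef d F K (y t) =
        (F (dil d (of_real t) (y t)) - coef d F K (y t) * of_real t ^ K) / of_real t ^ K"
      using elim by (simp add: field_simps)
    ultimately show ?case using elim by (simp add: norm_divide norm_power field_simps)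
  qed
  have "((\<lambda>t. C * t) \<longlongrightarrow> C * 0) (at_right 0)" by (intro tendsto_intros)
  then have "((\<lambda>t. C * t) \<longlongrightarrow> 0) (at_right 0)" by simp
  then have lim: "((\<lambda>t. F (dil d (of_real t) (y t)) / of_real t ^ K - coef d F K (y t)) \<longlongrightarrow> 0) (at_right 0)"
    by (rule Lim_null_comparison[OF close])
  have "((\<lambda>t. coef d F K (y t)) \<longlongrightarrow> coef d F K y0) (at_right 0)"
    using continuous_on_tendsto_compose[OF coef_continuous[OF F] y] by simp
  from tendsto_add[OF lim this] show ?thesis by simp
qed

lemma coef_all_zero:
  fixes F :: "'n::finite cspace \<Rightarrow> complex"
  assumes F: "cdiff \<epsilon> F" "0 < \<epsilon>" "1 \<le> d" and zero: "\<And>l x. coef d F l x = 0"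
  shows "\<forall>\<^sub>F x in nhds 0. F x = 0"
proof -
  obtain \<rho> where \<rho>: "0 < \<rho>" "\<rho> \<le> 1" and s: "\<And>x t. norm x \<le> 2 \<Longrightarrow> norm t < \<rho> \<Longrightarrow> (\<lambda>k. coef d F k x * t ^ k) sums F (dil d t x)"
    by (rule dilation_expansion[OF F, of 2]) (simp, rule that)
  define t where "t = \<rho> / 2"
  have t: "0 < t" "t < \<rho>" "t \<le> 1" using \<rho> by (auto simp: t_def)
  \<comment> \<open>For such x the dilation by 1 / t has norm at most 2, since t^d \<le> t; the
    expansion that converges there has only zero coefficients.\<close>
  have "F x = 0" if "dist x 0 < t ^ d" for x
  proof -
    have x: "norm (fst x) \<le> t ^ d" "norm (snd x) \<le> t ^ d"
      using that norm_components[of x] by auto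
    define y where "y = dil d (of_real (1 / t)) x"
    have "norm y \<le> norm (complex_of_real (1 / t) *s fst x) + norm (complex_of_real (1 / t) ^ d * snd x)"
      unfolding y_def dil_def by (rule norm_Pair_le)
    also have "\<dots> = norm (fst x) / t + norm (snd x) / t ^ d"
      using t by (simp add: norm_vec_smult norm_mult norm_power norm_divide power_divide)
    also have "\<dots> \<le> 1 + 1"
    proof (rule add_mono)
      have "t ^ d \<le> t ^ 1" using t F(3) by (intro power_decreasing) auto
      then show "norm (fst x) / t \<le> 1" using x t by (simp add: field_simps)
      show "norm (snd x) / t ^ d \<le> 1" using x t by (simp add: field_simps)
    qed
    finally have "norm y \<le> 2" by simp
    then have "(\<lambda>k. coef d F k y * of_real t ^ k) sums F (dil d (of_real t) y)"
      using t by (intro s) auto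
    then have "F (dil d (of_real t) y) = 0" by (simp add: zero sums_iff)
    moreover have "dil d (of_real t) y = x" unfolding y_def dil_dil using t by (simp add: dil_1)
    ultimately show ?thesis by simp
  qed
  then show ?thesis unfolding eventually_nhds_metric using t by (intro exI[of _ "t ^ d"]) auto
qed

section \<open>Estimates for the smooth remainder in the weighted scaling\<close>

section \<open>The remainder term\<close>

lemma smooth_on_bounded:
  fixes f :: "'a::euclidean_space \<Rightarrow> real"
  assumes "open W" "0 \<in> W" "smooth_on W f"
  obtains C \<rho> where "0 < \<rho>" "\<rho> \<le> 1" "0 \<le> C" "cball 0 \<rho> \<subseteq> W" "\<And>x. x \<in> cball 0 \<rho> \<Longrightarrow> \<bar>f x\<bar> \<le> C"
proof -
  obtain \<rho>0 where "0 < \<rho>0" "cball 0 \<rho>0 \<subseteq> W" using assms(1,2) open_contains_cball by blast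
  define \<rho> where "\<rho> = min 1 \<rho>0"
  have \<rho>: "0 < \<rho>" "\<rho> \<le> 1" "cball 0 \<rho> \<subseteq> W"
    using \<open>0 < \<rho>0\<close> \<open>cball 0 \<rho>0 \<subseteq> W\<close> by (auto simp: \<rho>_def)
  have "continuous_on (cball 0 \<rho>) f"
    using \<rho>(3) smooth_on_differentiable[OF assms(3)]
    by (intro continuous_at_imp_continuous_on ballI differentiable_imp_continuous_within) auto
  then have "compact (f ` cball 0 \<rho>)" by (intro compact_continuous_image compact_cball)
  then obtain C where "0 < C" "\<forall>y\<in>f ` cball 0 \<rho>. norm y \<le> C"
    using compact_imp_bounded[of "f ` cball 0 \<rho>"] unfolding bounded_pos by blast
  then show thesis using \<rho> by (intro that[of \<rho> C]) auto
qed

lemma mvt_segment: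
  fixes f :: "'a::real_normed_vector \<Rightarrow> real"
  assumes f: "\<And>x. x \<in> closed_segment a b \<Longrightarrow> (f has_derivative f' x) (at x)"
  obtains \<xi> where "\<xi> \<in> closed_segment a b" "f b - f a = f' \<xi> (b - a)"
proof -
  let ?\<gamma> = "\<lambda>s::real. a + s *\<^sub>R (b - a)"
  have seg: "?\<gamma> s \<in> closed_segment a b" if "0 \<le> s" "s \<le> 1" for s
    using that by (auto simp: closed_segment_def algebra_simps intro!: exI[of _ s])
  have "((\<lambda>s. f (?\<gamma> s)) has_derivative (\<lambda>h. f' (?\<gamma> s) (h *\<^sub>R (b - a)))) (at s within {0..1})"
    if "0 \<le> s" "s \<le> 1" for s
  proof (rule has_derivative_compose[of ?\<gamma>])
    show "(?\<gamma> has_derivative (\<lambda>h. h *\<^sub>R (b - a))) (at s within {0..1})"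
      by (auto intro!: derivative_eq_intros)
    show "(f has_derivative f' (?\<gamma> s)) (at (?\<gamma> s))"
      using seg[OF that] by (rule f)
  qed
  then have "\<exists>s\<in>{0<..<1}. f (?\<gamma> 1) - f (?\<gamma> 0) = f' (?\<gamma> s) ((1 - 0) *\<^sub>R (b - a))"
    by (intro mvt_simple[where f = "\<lambda>s. f (?\<gamma> s)" and f' = "\<lambda>s h. f' (?\<gamma> s) (h *\<^sub>R (b - a))"]) simp_all
  then obtain s where "s \<in> {0<..<1}" "f (?\<gamma> 1) - f (?\<gamma> 0) = f' (?\<gamma> s) ((1 - 0) *\<^sub>R (b - a))"
    by blast
  then show thesis using seg[of s] by (intro that[of "?\<gamma> s"]) auto
qed

lemma mvt_smooth:
  fixes f :: "'a::real_normed_vector \<Rightarrow> real"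
  assumes f: "smooth_on W f" and ab: "closed_segment a b \<subseteq> W"
  obtains \<xi> where "\<xi> \<in> closed_segment a b" "f b - f a = frechet_derivative f (at \<xi>) (b - a)"
  by (rule mvt_segment[of a b f "\<lambda>x. frechet_derivative f (at x)"])
    (use ab in \<open>auto intro: smooth_on_has_derivative[OF f] that\<close>)

lemma z_derivative_bound:
  fixes f :: "(complex ^ 'n::finite) \<times> real \<Rightarrow> real"
  assumes f: "smooth_on W f" "\<xi> \<in> W"
    and A: "\<And>b. b \<in> z_basis \<Longrightarrow> \<bar>frechet_derivative f (at \<xi>) b\<bar> \<le> A"
    and B: "\<bar>frechet_derivative f (at \<xi>) (0, 1)\<bar> \<le> B"
  shows "\<bar>frechet_derivative f (at \<xi>) v\<bar> \<le> real (card (z_basis :: ((complex ^ 'n) \<times> real) set)) * A * norm (fst v) + B * \<bar>snd v\<bar>"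
proof -
  let ?D = "frechet_derivative f (at \<xi>)" and ?Z = "z_basis :: ((complex ^ 'n) \<times> real) set"
  interpret linear ?D using smooth_on_differentiable[OF f] by (rule linear_frechet_derivative)
  have "v = (fst v, 0) + snd v *\<^sub>R (0, 1)" by (simp add: prod_eq_iff)
  then have "v = (\<Sum>b\<in>?Z. inner (fst v, 0) b *\<^sub>R b) + snd v *\<^sub>R (0, 1)"
    unfolding z_basis_expansion[symmetric] .
  then have "?D v = ?D ((\<Sum>b\<in>?Z. inner (fst v, 0) b *\<^sub>R b) + snd v *\<^sub>R (0, 1))" by (rule arg_cong)
  also have "\<dots> = (\<Sum>b\<in>?Z. inner (fst v, 0) b * ?D b) + snd v * ?D (0, 1)"
    by (simp only: add sum scale real_scaleR_def)
  finally have "\<bar>?D v\<bar> \<le> \<bar>\<Sum>b\<in>?Z. inner (fst v, 0) b * ?D b\<bar> + \<bar>snd v * ?D (0, 1)\<bar>" by linarith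
  also have "\<bar>\<Sum>b\<in>?Z. inner (fst v, 0) b * ?D b\<bar> \<le> (\<Sum>b\<in>?Z. norm (fst v) * A)"
  proof (rule order_trans[OF sum_abs], rule sum_mono)
    fix b assume b: "b \<in> ?Z"
    then obtain b' where b': "b = (b', 0)" "b' \<in> Basis" by (auto simp: z_basis_def)
    then have "\<bar>inner (fst v, 0) b\<bar> \<le> norm (fst v)" by (simp add: Basis_le_norm)
    then show "\<bar>inner (fst v, 0) b * ?D b\<bar> \<le> norm (fst v) * A"
      unfolding abs_mult using A[OF b] by (intro mult_mono) auto
  qed
  also have "\<bar>snd v * ?D (0, 1)\<bar> \<le> B * \<bar>snd v\<bar>"
    unfolding abs_mult using mult_right_mono[OF B, of "\<bar>snd v\<bar>"] by (simp add: mult.commute)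
  finally show ?thesis by (simp add: mult_ac)
qed

lemma finite_z_basis: "finite (z_basis :: ((complex ^ 'n::finite) \<times> real) set)"
  by (simp add: z_basis_def)

lemma finite_uniform_bounds:
  assumes "finite B" and ex: "\<And>b. b \<in> B \<Longrightarrow> \<exists>C \<rho>. 0 < \<rho> \<and> \<rho> \<le> (1::real) \<and> 0 \<le> (C::real) \<and> Q b C \<rho>"
    and mono: "\<And>b C \<rho> C' \<rho>'. Q b C \<rho> \<Longrightarrow> C \<le> C' \<Longrightarrow> \<rho>' \<le> \<rho> \<Longrightarrow> Q b C' \<rho>'"
  shows "\<exists>C \<rho>. 0 < \<rho> \<and> \<rho> \<le> 1 \<and> 0 \<le> C \<and> (\<forall>b\<in>B. Q b C \<rho>)"
  using assms(1) ex
proof (induction B rule: finite_induct)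
  case empty
  show ?case by (intro exI[of _ 1]) auto
next
  case (insert b B)
  then obtain C \<rho> where 1: "0 < \<rho>" "\<rho> \<le> 1" "0 \<le> C" "\<forall>b\<in>B. Q b C \<rho>" by auto
  obtain C' \<rho>' where 2: "0 < \<rho>'" "\<rho>' \<le> 1" "0 \<le> C'" "Q b C' \<rho>'" using insert.prems by blast
  have "\<forall>b'\<in>insert b B. Q b' (max C C') (min \<rho> \<rho>')"
    using 1(4) 2(4) mono[of _ C \<rho> "max C C'" "min \<rho> \<rho>'"] mono[of _ C' \<rho>' "max C C'" "min \<rho> \<rho>'"] by auto
  then show ?case using 1 2 by (intro exI[of _ "max C C'"] exI[of _ "min \<rho> \<rho>'"]) auto
qed

text \<open>This measures vanishing to order \<open>k\<close> in z but only to first order in Re w: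
  for |z| \<le> t \<le> 1 and |Re w| \<le> t^d it is of size t^k whenever k \<le> d.\<close>

definition z_bound :: "nat \<Rightarrow> ((complex ^ 'n::finite) \<times> real \<Rightarrow> real) \<Rightarrow> real \<Rightarrow> real \<Rightarrow> bool" where
  "z_bound k f C \<rho> \<longleftrightarrow> (\<forall>x. norm x \<le> \<rho> \<longrightarrow> \<bar>f x\<bar> \<le> C * (norm (fst x) ^ k + \<bar>snd x\<bar>))"

lemma z_boundD: "z_bound k f C \<rho> \<Longrightarrow> norm x \<le> \<rho> \<Longrightarrow> \<bar>f x\<bar> \<le> C * (norm (fst x) ^ k + \<bar>snd x\<bar>)"
  by (simp only: z_bound_def)

lemma z_bound_mono: "z_bound k f C \<rho> \<Longrightarrow> C \<le> C' \<Longrightarrow> \<rho>' \<le> \<rho> \<Longrightarrow> z_bound k f C' \<rho>'"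
  unfolding z_bound_def
  by (meson abs_ge_zero add_nonneg_nonneg mult_right_mono norm_ge_zero order_trans zero_le_power)

text \<open>Mean value theorem on the segment from 0: the z-derivatives satisfy the bound of one
  order less and are multiplied by |z|, while the derivative in Re w is multiplied by Re w and needs
  only to be bounded.\<close>

lemma vanishing_order_bound:
  fixes f :: "(complex ^ 'n::finite) \<times> real \<Rightarrow> real"
  assumes W: "open W" "0 \<in> W" and "smooth_on W f"
    and "\<And>bs. set bs \<subseteq> z_basis \<Longrightarrow> length bs < k \<Longrightarrow> iterated_derivative bs f 0 = 0"
  shows "\<exists>C \<rho>. 0 < \<rho> \<and> \<rho> \<le> 1 \<and> 0 \<le> C \<and> z_bound k f C \<rho>"
  using assms(3,4)
proof (induction k arbitrary: f)
  case 0
  obtain C \<rho> where C: "0 < \<rho>" "\<rho> \<le> 1" "0 \<le> C" "\<And>x. x \<in> cball 0 \<rho> \<Longrightarrow> \<bar>f x\<bar> \<le> C"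
    by (rule smooth_on_bounded[OF W 0(1)]) (rule that)
  have "\<bar>f x\<bar> \<le> C * (1 + \<bar>snd x\<bar>)" if "norm x \<le> \<rho>" for x
    using C(3) C(4)[of x] that by (simp add: distrib_left add_increasing2)
  then show ?case using C by (intro exI[of _ C] exI[of _ \<rho>]) (auto simp: z_bound_def)
next
  case (Suc k)
  let ?Z = "z_basis :: ((complex ^ 'n) \<times> real) set"
  let ?d = "\<lambda>b x. frechet_derivative f (at x) b"
  note smooth_d = smooth_on_derivative[OF Suc.prems(1)]
  have "\<exists>C \<rho>. 0 < \<rho> \<and> \<rho> \<le> 1 \<and> 0 \<le> C \<and> z_bound k (?d b) C \<rho>" if "b \<in> ?Z" for b
  proof (rule Suc.IH[OF smooth_d])
    fix bs :: "((complex ^ 'n) \<times> real) list" assume "set bs \<subseteq> z_basis" "length bs < k"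
    then show "iterated_derivative bs (?d b) 0 = 0" using Suc.prems(2)[of "b # bs"] that by simp
  qed
  then have "\<exists>C \<rho>. 0 < \<rho> \<and> \<rho> \<le> 1 \<and> 0 \<le> C \<and> (\<forall>b\<in>?Z. z_bound k (?d b) C \<rho>)"
    by (intro finite_uniform_bounds[where Q = "\<lambda>b. z_bound k (?d b)", OF finite_z_basis]) (blast, erule (2) z_bound_mono)
  then obtain C1 \<rho>1 where 1: "0 < \<rho>1" "\<rho>1 \<le> 1" "0 \<le> C1" "\<And>b. b \<in> ?Z \<Longrightarrow> z_bound k (?d b) C1 \<rho>1" by blast
  obtain C2 \<rho>2 where 2: "0 < \<rho>2" "\<rho>2 \<le> 1" "0 \<le> C2" "cball 0 \<rho>2 \<subseteq> W"
    "\<And>x. x \<in> cball 0 \<rho>2 \<Longrightarrow> \<bar>?d (0, 1) x\<bar> \<le> C2"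
    by (rule smooth_on_bounded[OF W smooth_d]) (rule that)
  define \<rho> where "\<rho> = min \<rho>1 \<rho>2"
  let ?N = "real (card ?Z)"
  have f0: "f 0 = 0" using Suc.prems(2)[of "[]"] by simp
  have "\<bar>f x\<bar> \<le> (?N * C1 + C2) * (norm (fst x) ^ Suc k + \<bar>snd x\<bar>)" if x: "norm x \<le> \<rho>" for x
  proof -
    have "convex (cball (0 :: (complex ^ 'n) \<times> real) \<rho>)" by simp
    moreover have "0 \<le> \<rho>" using 1(1) 2(1) by (simp add: \<rho>_def)
    ultimately have "closed_segment 0 x \<subseteq> cball 0 \<rho>" using x by (intro closed_segment_subset) auto
    moreover have W': "cball (0 :: (complex ^ 'n) \<times> real) \<rho> \<subseteq> W" using 2(4) by (auto simp: \<rho>_def)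
    ultimately obtain \<xi> where \<xi>: "\<xi> \<in> closed_segment 0 x" "f x - f 0 = ?d (x - 0) \<xi>" "norm \<xi> \<le> \<rho>" "\<xi> \<in> W"
      using mvt_smooth[OF Suc.prems(1), of 0 x] by (metis mem_cball_0 order_trans subsetD)
    obtain s where s: "0 \<le> s" "s \<le> 1" "\<xi> = s *\<^sub>R x" using \<xi>(1) by (auto simp: closed_segment_def)
    have le: "norm (fst \<xi>) \<le> norm (fst x)" "\<bar>snd \<xi>\<bar> \<le> \<bar>snd x\<bar>"
      using s by (auto simp: abs_mult mult_left_le_one_le)
    have x1: "norm (fst x) \<le> 1" using norm_fst_le[of "fst x" "snd x"] x 1(2) by (simp add: \<rho>_def)
    have "\<bar>?d x \<xi>\<bar> \<le> ?N * (C1 * (norm (fst x) ^ k + \<bar>snd x\<bar>)) * norm (fst x) + C2 * \<bar>snd x\<bar>"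
    proof (rule z_derivative_bound[OF Suc.prems(1) \<xi>(4)])
      show "\<bar>?d (0, 1) \<xi>\<bar> \<le> C2" using 2(5)[of \<xi>] \<xi>(3) by (simp add: \<rho>_def)
      fix b assume "b \<in> ?Z"
      then have "\<bar>?d b \<xi>\<bar> \<le> C1 * (norm (fst \<xi>) ^ k + \<bar>snd \<xi>\<bar>)"
        using \<xi>(3) by (intro z_boundD[OF 1(4)]) (auto simp: \<rho>_def)
      also have "\<dots> \<le> C1 * (norm (fst x) ^ k + \<bar>snd x\<bar>)"
        using 1(3) le by (intro mult_left_mono add_mono power_mono) auto
      finally show "\<bar>?d b \<xi>\<bar> \<le> C1 * (norm (fst x) ^ k + \<bar>snd x\<bar>)" .
    qed
    also have "\<dots> = ?N * C1 * (norm (fst x) ^ Suc k + \<bar>snd x\<bar> * norm (fst x)) + C2 * \<bar>snd x\<bar>"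
      by (simp add: algebra_simps)
    also have "\<dots> \<le> ?N * C1 * (norm (fst x) ^ Suc k + \<bar>snd x\<bar>) + C2 * (norm (fst x) ^ Suc k + \<bar>snd x\<bar>)"
      using x1 1(3) 2(3) by (intro add_mono mult_left_mono) (auto simp: mult_left_le)
    finally show ?thesis using \<xi>(2) f0 by (simp add: distrib_right)
  qed
  then show ?case
    using 1 2 by (intro exI[of _ "?N * C1 + C2"] exI[of _ \<rho>]) (auto simp: z_bound_def \<rho>_def)
qed

text \<open>Tuples of at most \<open>d\<close> z-directions have weight at most 1, so first
  z-derivatives of \<open>r\<close> vanish to order \<open>d\<close> in z; the derivative in Re w
  vanishes at 0. With \<tau> of size t and \<sigma> of size t^d, two points differing by t^(1+k) in
  z and t^(d+k) in Re w have values of \<open>r\<close> that differ by o(t^(d+k)): the remainder is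
  invisible in the tangency identity.\<close>

lemma remainder_difference:
  fixes r :: "(complex ^ 'n::finite) \<times> real \<Rightarrow> real"
  assumes W: "open W" "0 \<in> W" "smooth_on W r" and small: "small_remainder (\<lambda>_. m) r" and m: "0 < m" "m * real d = 1"
  obtains C \<rho> where "0 < \<rho>" "0 \<le> C"
    "\<And>a b \<tau> \<sigma>. norm a \<le> \<rho> \<Longrightarrow> norm b \<le> \<rho> \<Longrightarrow> norm (fst a) \<le> \<tau> \<Longrightarrow> norm (fst b) \<le> \<tau> \<Longrightarrow> \<bar>snd a\<bar> \<le> \<sigma> \<Longrightarrow> \<bar>snd b\<bar> \<le> \<sigma> \<Longrightarrow>
      \<bar>r a - r b\<bar> \<le> C * ((\<tau> ^ d + \<sigma>) * norm (fst a - fst b) + (\<tau> + \<sigma>) * \<bar>snd a - snd b\<bar>)"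
proof -
  let ?Z = "z_basis :: ((complex ^ 'n) \<times> real) set"
  let ?d = "\<lambda>b x. frechet_derivative r (at x) b"
  note smooth_d = smooth_on_derivative[OF W(3)]
  have "\<exists>C \<rho>. 0 < \<rho> \<and> \<rho> \<le> 1 \<and> 0 \<le> C \<and> z_bound d (?d b) C \<rho>" if "b \<in> ?Z" for b
  proof (rule vanishing_order_bound[OF W(1,2) smooth_d])
    fix bs :: "((complex ^ 'n) \<times> real) list" assume bs: "set bs \<subseteq> z_basis" "length bs < d"
    then have sub: "set (b # bs) \<subseteq> z_basis" using that by simp
    have "m * real (length (b # bs)) \<le> m * real d" using bs(2) m(1) by (intro mult_left_mono) auto
    then have "set (b # bs) \<subseteq> Basis \<and> sum_list (map (direction_weight (\<lambda>_. m)) (b # bs)) \<le> 1"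
      unfolding weight_sum_z[OF sub] m(2) using sub by (auto simp: Basis_eq_z_basis)
    then have "iterated_derivative (b # bs) r 0 = 0" using small[unfolded small_remainder_def] by blast
    then show "iterated_derivative bs (?d b) 0 = 0" by simp
  qed
  then have "\<exists>C \<rho>. 0 < \<rho> \<and> \<rho> \<le> 1 \<and> 0 \<le> C \<and> (\<forall>b\<in>?Z. z_bound d (?d b) C \<rho>)"
    by (intro finite_uniform_bounds[where Q = "\<lambda>b. z_bound d (?d b)", OF finite_z_basis]) (blast, erule (2) z_bound_mono)
  then obtain C1 \<rho>1 where 1: "0 < \<rho>1" "\<rho>1 \<le> 1" "0 \<le> C1" "\<And>b. b \<in> ?Z \<Longrightarrow> z_bound d (?d b) C1 \<rho>1" by blast
  have "\<exists>C \<rho>. 0 < \<rho> \<and> \<rho> \<le> 1 \<and> 0 \<le> C \<and> z_bound 1 (?d (0, 1)) C \<rho>"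
  proof (rule vanishing_order_bound[OF W(1,2) smooth_d])
    have "set [(0, 1)] \<subseteq> (Basis :: ((complex ^ 'n) \<times> real) set) \<and>
        sum_list (map (direction_weight (\<lambda>_. m)) [(0 :: complex ^ 'n, 1)]) \<le> 1"
      by (simp add: Basis_eq_z_basis direction_weight_def)
    then have "iterated_derivative [(0, 1)] r 0 = 0" using small[unfolded small_remainder_def] by blast
    moreover fix bs :: "((complex ^ 'n) \<times> real) list" assume "length bs < 1"
    ultimately show "iterated_derivative bs (?d (0, 1)) 0 = 0" by simp
  qed
  then obtain C2 \<rho>2 where 2: "0 < \<rho>2" "\<rho>2 \<le> 1" "0 \<le> C2" "z_bound 1 (?d (0, 1)) C2 \<rho>2" by blast
  obtain \<rho>3 where 3: "0 < \<rho>3" "cball 0 \<rho>3 \<subseteq> W" using W(1,2) open_contains_cball by blast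
  define \<rho> where "\<rho> = min \<rho>1 (min \<rho>2 \<rho>3)"
  have \<rho>: "\<rho> \<le> \<rho>1" "\<rho> \<le> \<rho>2" "\<rho> \<le> \<rho>3" "0 < \<rho>" using 1(1) 2(1) 3(1) by (auto simp: \<rho>_def)
  let ?N = "real (card ?Z)"
  show thesis
  proof (rule that[of \<rho> "?N * C1 + C2"])
    fix a b :: "(complex ^ 'n) \<times> real" and \<tau> \<sigma>
    assume ab: "norm a \<le> \<rho>" "norm b \<le> \<rho>" "norm (fst a) \<le> \<tau>" "norm (fst b) \<le> \<tau>" "\<bar>snd a\<bar> \<le> \<sigma>" "\<bar>snd b\<bar> \<le> \<sigma>"
    define K where "K = cball 0 \<rho> \<inter> (cball (0 :: complex ^ 'n) \<tau> \<times> cball (0 :: real) \<sigma>)"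
    have "convex K" unfolding K_def by (intro convex_Int convex_Times convex_cball)
    then have seg: "closed_segment b a \<subseteq> K"
      using ab by (intro closed_segment_subset) (auto simp: K_def mem_Times_iff)
    have KW: "K \<subseteq> W" using 3(2) \<rho>(3) by (auto simp: K_def)
    obtain \<xi> where \<xi>: "\<xi> \<in> closed_segment b a" "r a - r b = ?d (a - b) \<xi>"
      by (rule mvt_smooth[OF W(3) subset_trans[OF seg KW]])
    have \<xi>K: "norm \<xi> \<le> \<rho>" "norm (fst \<xi>) \<le> \<tau>" "\<bar>snd \<xi>\<bar> \<le> \<sigma>" "\<xi> \<in> W"
      using \<xi>(1) seg KW by (auto simp: K_def mem_Times_iff)
    have nn: "0 \<le> \<tau>" "0 \<le> \<sigma>" using ab(3,5) norm_ge_zero[of "fst a"] abs_ge_zero[of "snd a"] by linarith+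
    have "\<bar>?d (a - b) \<xi>\<bar> \<le> ?N * (C1 * (\<tau> ^ d + \<sigma>)) * norm (fst (a - b)) + C2 * (\<tau> + \<sigma>) * \<bar>snd (a - b)\<bar>"
    proof (rule z_derivative_bound[OF W(3) \<xi>K(4)])
      have "\<bar>?d (0, 1) \<xi>\<bar> \<le> C2 * (norm (fst \<xi>) ^ 1 + \<bar>snd \<xi>\<bar>)"
        using \<xi>K(1) \<rho>(2) by (intro z_boundD[OF 2(4)]) simp
      also have "\<dots> \<le> C2 * (\<tau> + \<sigma>)" using 2(3) \<xi>K by (intro mult_left_mono) auto
      finally show "\<bar>?d (0, 1) \<xi>\<bar> \<le> C2 * (\<tau> + \<sigma>)" .
      fix c assume "c \<in> ?Z"
      then have "\<bar>?d c \<xi>\<bar> \<le> C1 * (norm (fst \<xi>) ^ d + \<bar>snd \<xi>\<bar>)"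
        using \<xi>K(1) \<rho>(1) by (intro z_boundD[OF 1(4)]) simp_all
      also have "\<dots> \<le> C1 * (\<tau> ^ d + \<sigma>)"
        using 1(3) \<xi>K by (intro mult_left_mono add_mono power_mono) auto
      finally show "\<bar>?d c \<xi>\<bar> \<le> C1 * (\<tau> ^ d + \<sigma>)" .
    qed
    also have "\<dots> = (?N * C1) * ((\<tau> ^ d + \<sigma>) * norm (fst a - fst b)) + C2 * ((\<tau> + \<sigma>) * \<bar>snd a - snd b\<bar>)"
      by (simp add: mult_ac)
    also have "\<dots> \<le> (?N * C1 + C2) * ((\<tau> ^ d + \<sigma>) * norm (fst a - fst b)) + (?N * C1 + C2) * ((\<tau> + \<sigma>) * \<bar>snd a - snd b\<bar>)"
      using 1(3) 2(3) nn by (intro add_mono mult_right_mono mult_nonneg_nonneg add_nonneg_nonneg zero_le_power) auto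
    finally show "\<bar>r a - r b\<bar> \<le> (?N * C1 + C2) * ((\<tau> ^ d + \<sigma>) * norm (fst a - fst b) + (\<tau> + \<sigma>) * \<bar>snd a - snd b\<bar>)"
      using \<xi>(2) by (simp only: distrib_left)
  qed (use \<rho> 1 2 in auto)
qed

text \<open>The variable w enters through t^d with d \<ge> 2, so the first order in t sees only the
  z-part of the derivative.\<close>

lemma coef_1:
  fixes F :: "'n::finite cspace \<Rightarrow> complex"
  assumes F: "cdiff \<epsilon> F" "0 < \<epsilon>" and d: "2 \<le> d" and D: "(F has_derivative D) (at 0)"
  shows "coef d F 1 (z, w) = D (z, 0)"
proof -
  have "(0 :: 'n cspace) \<in> ball 0 \<epsilon>" using F(2) by simp
  then obtain D' where D': "(F has_derivative D') (at 0)" "\<And>v. D' (mult_i v) = \<i> * D' v"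
    using F(1) unfolding cdiff_def by blast
  have DD: "D' = D" by (rule has_derivative_unique[OF D'(1) D])
  have lin: "D (h *s a, h * b) = h * D (a, b)" for h a b
    using complex_linear[OF has_derivative_bounded_linear[OF D'(1)] D'(2)] by (simp add: DD)
  have lin0: "D (h *s z, 0) = h * D (z, 0)" for h using lin[of h z 0] by simp
  have d0: "dil d 0 (z, w) = 0" using d by (auto simp: dil_def zero_prod_def power_0_left)
  have "((\<lambda>t. F (dil d t (z, w))) has_derivative (\<lambda>h. D (h *s z, h * (of_nat d * 0 ^ (d - 1) * w)))) (at 0)"
    using has_derivative_compose[OF dil_has_derivative[of d "(z, w)" 0], of F D] D by (simp add: d0)
  moreover have "(\<lambda>h. D (h *s z, h * (of_nat d * 0 ^ (d - 1) * w))) = (*) (D (z, 0))"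
    using d by (auto simp: lin0 power_0_left fun_eq_iff mult.commute)
  ultimately have "((\<lambda>t. F (dil d t (z, w))) has_field_derivative D (z, 0)) (at 0)"
    by (simp add: has_field_derivative_def)
  then show ?thesis by (simp add: coef_def DERIV_imp_deriv)
qed

text \<open>On the w-axis F(0, s) = o(s) because the derivative vanishes, and dilation by t means s
  = t^d. At order t^d this contradicts a nonzero coefficient of w.\<close>

lemma coef_w_axis:
  fixes F :: "'n::finite cspace \<Rightarrow> complex"
  assumes F: "cdiff \<epsilon> F" "0 < \<epsilon>" and d: "1 \<le> d" and D: "(F has_derivative (\<lambda>_. 0)) (at 0)" and "F 0 = 0"
    and zero: "\<And>l x. l < d \<Longrightarrow> coef d F l x = 0"
  shows "coef d F d (0, 1) = 0"
proof -
  have l1: "((\<lambda>t. F (dil d (of_real t) (0, 1)) / of_real t ^ d) \<longlongrightarrow> coef d F d (0, 1)) (at_right 0)"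
    by (rule coef_limit[OF F d zero]) simp_all
  have l2: "((\<lambda>t. F (dil d (of_real t) (0, 1)) / of_real t ^ d) \<longlongrightarrow> 0) (at_right 0)"
  proof -
    have "((\<lambda>s::complex. (0 :: complex ^ 'n, s)) has_derivative (\<lambda>h. (0, h))) (at 0)"
      by (intro has_derivative_Pair has_derivative_const has_derivative_ident)
    then have "((\<lambda>s. F (0, s)) has_derivative (\<lambda>h. 0)) (at 0)"
      using has_derivative_compose[of "\<lambda>s. (0, s)" _ 0 UNIV F "\<lambda>_. 0"] D by (simp add: zero_prod_def)
    then have "((\<lambda>s. F (0, s)) has_field_derivative 0) (at 0)"
      by (simp add: has_field_derivative_def flip: lambda_zero)
    then have lim: "((\<lambda>s. F (0, s) / s) \<longlongrightarrow> 0) (at 0)"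
      using \<open>F 0 = 0\<close> by (simp add: has_field_derivative_iff zero_prod_def)
    have "filterlim (\<lambda>t. complex_of_real t ^ d) (at 0) (at_right 0)"
    proof (rule filterlim_atI)
      have "((\<lambda>t. complex_of_real t ^ d) \<longlongrightarrow> of_real 0 ^ d) (at_right 0)" by (intro tendsto_intros)
      then show "((\<lambda>t. complex_of_real t ^ d) \<longlongrightarrow> 0) (at_right 0)" using d by (simp add: power_0_left)
      show "\<forall>\<^sub>F t in at_right 0. complex_of_real t ^ d \<noteq> 0"
        using eventually_at_right_less[of "0::real"] by eventually_elim simp
    qed
    from filterlim_compose[OF lim this] show ?thesis by (simp add: dil_def)
  qed
  show ?thesis by (rule tendsto_unique[OF _ l1 l2]) simp
qed

section \<open>Self-maps of a hypersurface in model form, and their differences\<close>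

section \<open>Local automorphisms\<close>

lemma Dz_chain: "dz i (lsubst A Q) = (\<Sum>j\<in>UNIV. cst (A j i) * lsubst A (dz j Q))"
proof (induction Q)
  case (Zv k)
  have "dz i (lsubst A (Zv k)) = (\<Sum>l\<in>UNIV. cst (A k l) * (if i = l then 1 else 0))"
    by (simp add: lsubst_simps derivation_sum[OF derivation_dz] derivation_mult[OF derivation_dz])
  also have "\<dots> = cst (A k i)" by (simp add: if_distrib cong: if_cong)
  also have "\<dots> = (\<Sum>j\<in>UNIV. cst (A j i) * lsubst A (dz j (Zv k)))"
  proof -
    have "cst (A j i) * lsubst A (dz j (Zv k)) = (if j = k then cst (A k i) else 0)" for j
      using lsubst_simps(3)[of A 1] by (simp add: lsubst_simps cst_simps)
    then show ?thesis by simp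
  qed
  finally show ?case .
next
  case (Wv k)
  then show ?case
    by (simp add: lsubst_simps derivation_sum[OF derivation_dz] derivation_mult[OF derivation_dz])
next
  case (add Q R)
  then show ?case by (simp add: lsubst_simps derivation_add[OF derivation_dz] sum.distrib distrib_left)
next
  case (mult Q R)
  then show ?case
    by (simp add: lsubst_simps derivation_mult[OF derivation_dz] sum.distrib distrib_left sum_distrib_left sum_distrib_right mult_ac)
qed (simp add: lsubst_simps)

locale model_germ = real_bihom "cplx P" Pc d
  for P :: "'n::finite bipoly" and Pc d +
  fixes m :: real and W and r :: "(complex ^ 'n) \<times> real \<Rightarrow> real"
  assumes d: "3 \<le> d" and W: "open W" "0 \<in> W" "smooth_on W r"
    and small: "small_remainder (\<lambda>_. m) r" and m: "0 < m" "m * real d = 1"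
begin

definition p :: "complex ^ 'n \<Rightarrow> real" where "p z = Re (beval P z)"

lemma ev_p: "ev (cplx P) (z, cnjv z) = of_real (p z)"
proof -
  have "cnj (ev (cplx P) (z, cnjv z)) = ev (tau (cplx P)) (z, cnjv z)" by simp
  then have "cnj (ev (cplx P) (z, cnjv z)) = ev (cplx P) (z, cnjv z)" by (simp only: real)
  then show ?thesis by (simp add: p_def beval_cplx complex_eq_iff)
qed

lemma p_scale: "p (s *\<^sub>R z) = s ^ d * p z"
proof -
  have "ev (cplx P) (of_real s *s z, of_real s *s cnjv z) = of_real s ^ d * ev (cplx P) (z, cnjv z)"
  proof -
    have "ev (Pc q) (of_real s *s z, of_real s *s cnjv z) = of_real s ^ d * ev (Pc q) (z, cnjv z)" if "q \<in> {1..<d}" for q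
    proof -
      have "ev (Pc q) (of_real s *s z, of_real s *s cnjv z) = of_real s ^ q * of_real s ^ (d - q) * ev (Pc q) (z, cnjv z)"
        using bihom_comp[OF that] unfolding bihom_def by blast
      then show ?thesis using that by (simp flip: power_add)
    qed
    then show ?thesis by (subst (1 2) sum_comp) (simp add: sum_distrib_left)
  qed
  moreover have "cnjv (of_real s *s z) = of_real s *s cnjv z" by (simp add: cnjv_scale)
  moreover have "s *\<^sub>R z = of_real s *s z" by (simp add: fcp_eq_iff scaleR_conv_of_real[where 'a = complex])
  ultimately have "complex_of_real (p (s *\<^sub>R z)) = of_real (s ^ d * p z)" by (simp flip: ev_p)
  then show ?thesis by (simp only: of_real_eq_iff)
qed

lemma p_has_derivative: "(p has_derivative (\<lambda>v. 2 * Re (\<Sum>j\<in>UNIV. v $ j * ev (dz j (cplx P)) (z, cnjv z)))) (at z)"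
  using real_ev_has_derivative[OF real, of z] by (simp add: p_def[abs_def] beval_cplx)

lemma continuous_p: "continuous_on UNIV p"
  by (intro continuous_at_imp_continuous_on ballI has_derivative_continuous[OF p_has_derivative])

lemma r0: "r 0 = 0"
  using small[unfolded small_remainder_def, rule_format, of "[]"] by simp

lemma r_quotient_limit:
  fixes a b :: "real \<Rightarrow> (complex ^ 'n) \<times> real" and T :: "real \<Rightarrow> real"
  assumes a: "(a \<longlongrightarrow> 0) (at_right 0)" and b: "(b \<longlongrightarrow> 0) (at_right 0)"
    and lim: "((\<lambda>t. (((norm (fst (a t)) + norm (fst (b t))) ^ d + (\<bar>snd (a t)\<bar> + \<bar>snd (b t)\<bar>)) * norm (fst (a t) - fst (b t))
        + ((norm (fst (a t)) + norm (fst (b t))) + (\<bar>snd (a t)\<bar> + \<bar>snd (b t)\<bar>)) * \<bar>snd (a t) - snd (b t)\<bar>) / t ^ l) \<longlongrightarrow> 0) (at_right 0)"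
  shows "((\<lambda>t. (r (a t) - r (b t)) / t ^ l) \<longlongrightarrow> 0) (at_right 0)"
proof -
  let ?E = "\<lambda>t. (((norm (fst (a t)) + norm (fst (b t))) ^ d + (\<bar>snd (a t)\<bar> + \<bar>snd (b t)\<bar>)) * norm (fst (a t) - fst (b t))
        + ((norm (fst (a t)) + norm (fst (b t))) + (\<bar>snd (a t)\<bar> + \<bar>snd (b t)\<bar>)) * \<bar>snd (a t) - snd (b t)\<bar>) / t ^ l"
  obtain C \<rho> where C: "0 < \<rho>" "0 \<le> C"
    "\<And>a b \<tau> \<sigma>. norm a \<le> \<rho> \<Longrightarrow> norm b \<le> \<rho> \<Longrightarrow> norm (fst a) \<le> \<tau> \<Longrightarrow> norm (fst b) \<le> \<tau> \<Longrightarrow> \<bar>snd a\<bar> \<le> \<sigma> \<Longrightarrow> \<bar>snd b\<bar> \<le> \<sigma> \<Longrightarrow>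
      \<bar>r a - r b\<bar> \<le> C * ((\<tau> ^ d + \<sigma>) * norm (fst a - fst b) + (\<tau> + \<sigma>) * \<bar>snd a - snd b\<bar>)"
    by (rule remainder_difference[OF W small m]) (rule that)
  have "((\<lambda>t. C * ?E t) \<longlongrightarrow> C * 0) (at_right 0)" by (intro tendsto_mult tendsto_const lim)
  then have CE: "((\<lambda>t. C * ?E t) \<longlongrightarrow> 0) (at_right 0)" by simp
  have "\<forall>\<^sub>F t in at_right 0. norm (a t) < \<rho>" "\<forall>\<^sub>F t in at_right 0. norm (b t) < \<rho>"
    using order_tendstoD(2)[OF tendsto_norm[OF a], of \<rho>] order_tendstoD(2)[OF tendsto_norm[OF b], of \<rho>] C(1) by simp_all
  then have "\<forall>\<^sub>F t in at_right 0. norm ((r (a t) - r (b t)) / t ^ l) \<le> C * ?E t"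
    using eventually_at_right_less[of "0::real"]
  proof eventually_elim
    case (elim t)
    have "\<bar>r (a t) - r (b t)\<bar> \<le> C * (((norm (fst (a t)) + norm (fst (b t))) ^ d + (\<bar>snd (a t)\<bar> + \<bar>snd (b t)\<bar>)) * norm (fst (a t) - fst (b t))
        + ((norm (fst (a t)) + norm (fst (b t))) + (\<bar>snd (a t)\<bar> + \<bar>snd (b t)\<bar>)) * \<bar>snd (a t) - snd (b t)\<bar>)"
      using elim by (intro C(3)) auto
    then have "\<bar>r (a t) - r (b t)\<bar> / t ^ l \<le> C * (((norm (fst (a t)) + norm (fst (b t))) ^ d + (\<bar>snd (a t)\<bar> + \<bar>snd (b t)\<bar>)) * norm (fst (a t) - fst (b t))
        + ((norm (fst (a t)) + norm (fst (b t))) + (\<bar>snd (a t)\<bar> + \<bar>snd (b t)\<bar>)) * \<bar>snd (a t) - snd (b t)\<bar>) / t ^ l"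
      using elim(3) by (intro divide_right_mono) auto
    then show ?case using elim(3) by (simp add: abs_divide)
  qed
  from Lim_null_comparison[OF this CE] show ?thesis .
qed

text \<open>Arguments of size t in z and t^l in Re w give r = o(t^l): this is the difference
  estimate against r(0) = 0, and l \<le> d lets the term of order t^d be absorbed.\<close>

lemma r_limit:
  fixes a :: "real \<Rightarrow> (complex ^ 'n) \<times> real"
  assumes F: "((\<lambda>t. (1 / t) *\<^sub>R fst (a t)) \<longlongrightarrow> \<alpha>) (at_right 0)" and G: "((\<lambda>t. snd (a t) / t ^ l) \<longlongrightarrow> \<beta>) (at_right 0)"
    and l: "1 \<le> l" "l \<le> d"
  shows "((\<lambda>t. r (a t) / t ^ l) \<longlongrightarrow> 0) (at_right 0)" and "(a \<longlongrightarrow> 0) (at_right 0)"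
proof -
  have t0: "((\<lambda>t::real. t) \<longlongrightarrow> 0) (at_right 0)" by (rule tendsto_ident_at)
  have ev: "\<forall>\<^sub>F t in at_right 0. (0::real) < t" by (rule eventually_at_right_less)
  have "((\<lambda>t. t *\<^sub>R ((1 / t) *\<^sub>R fst (a t))) \<longlongrightarrow> 0 *\<^sub>R \<alpha>) (at_right 0)" by (intro tendsto_scaleR t0 F)
  moreover have "\<forall>\<^sub>F t in at_right 0. t *\<^sub>R ((1 / t) *\<^sub>R fst (a t)) = fst (a t)" using ev by eventually_elim simp
  ultimately have a1: "((\<lambda>t. fst (a t)) \<longlongrightarrow> 0) (at_right 0)" by (simp add: tendsto_cong)
  have "((\<lambda>t. t ^ l * (snd (a t) / t ^ l)) \<longlongrightarrow> 0 ^ l * \<beta>) (at_right 0)" by (intro tendsto_mult tendsto_power t0 G)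
  moreover have "\<forall>\<^sub>F t in at_right 0. t ^ l * (snd (a t) / t ^ l) = snd (a t)" using ev by eventually_elim simp
  ultimately have a2: "((\<lambda>t. snd (a t)) \<longlongrightarrow> 0) (at_right 0)" using l by (simp add: tendsto_cong power_0_left)
  show a: "(a \<longlongrightarrow> 0) (at_right 0)" using tendsto_Pair[OF a1 a2] by (simp add: zero_prod_def)
  let ?f = "\<lambda>t. norm (fst (a t))" and ?s = "\<lambda>t. \<bar>snd (a t)\<bar>"
  have "((\<lambda>t. (norm ((1 / t) *\<^sub>R fst (a t)) ^ d * t ^ (d - l) + \<bar>snd (a t) / t ^ l\<bar>) * norm (fst (a t)) + (norm (fst (a t)) + \<bar>snd (a t)\<bar>) * \<bar>snd (a t) / t ^ l\<bar>)
      \<longlongrightarrow> (norm \<alpha> ^ d * 0 ^ (d - l) + \<bar>\<beta>\<bar>) * norm (0 :: complex ^ 'n) + (norm (0 :: complex ^ 'n) + \<bar>0\<bar>) * \<bar>\<beta>\<bar>) (at_right 0)"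
    by (intro tendsto_intros F G a1 a2 t0)
  moreover have "\<forall>\<^sub>F t in at_right 0.
      (norm ((1 / t) *\<^sub>R fst (a t)) ^ d * t ^ (d - l) + \<bar>snd (a t) / t ^ l\<bar>) * norm (fst (a t)) + (norm (fst (a t)) + \<bar>snd (a t)\<bar>) * \<bar>snd (a t) / t ^ l\<bar> =
      ((?f t ^ d + ?s t) * ?f t + (?f t + ?s t) * ?s t) / t ^ l"
    using ev
  proof eventually_elim
    case (elim t)
    have "t ^ d = t ^ (d - l) * t ^ l" using l by (simp flip: power_add)
    then have "norm ((1 / t) *\<^sub>R fst (a t)) ^ d * t ^ (d - l) = ?f t ^ d / t ^ l"
      using elim by (simp add: power_divide)
    then show ?case using elim by (simp add: abs_divide add_divide_distrib distrib_right)
  qed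
  ultimately have "((\<lambda>t. ((?f t ^ d + ?s t) * ?f t + (?f t + ?s t) * ?s t) / t ^ l) \<longlongrightarrow> 0) (at_right 0)"
    by (simp add: tendsto_cong)
  then show "((\<lambda>t. r (a t) / t ^ l) \<longlongrightarrow> 0) (at_right 0)"
    using r_quotient_limit[OF a tendsto_const, of l] by (simp add: r0)
qed

text \<open>The second component is chosen so that dilation by t puts the point exactly on the
  hypersurface, above (t z, t^d u). For t tending to 0 it converges to the point
  \<open>y0 z u\<close> of the model.\<close>

definition ypt :: "complex ^ 'n \<Rightarrow> real \<Rightarrow> real \<Rightarrow> 'n cspace" where
  "ypt z u t = (z, of_real u + \<i> * of_real (p z + r (t *\<^sub>R z, t ^ d * u) / t ^ d))"

definition y0 :: "complex ^ 'n \<Rightarrow> real \<Rightarrow> 'n cspace" where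
  "y0 z u = (z, of_real u + \<i> * of_real (p z))"

definition xpt :: "complex ^ 'n \<Rightarrow> real \<Rightarrow> real \<Rightarrow> 'n cspace" where
  "xpt z u t = dil d (of_real t) (ypt z u t)"

lemma ypt_limit: "(ypt z u \<longlongrightarrow> y0 z u) (at_right 0)"
proof -
  have "((\<lambda>t. r (t *\<^sub>R z, t ^ d * u) / t ^ d) \<longlongrightarrow> 0) (at_right 0)"
  proof (rule r_limit(1)[where \<alpha> = z and \<beta> = u])
    have ev: "\<forall>\<^sub>F t in at_right 0. (0::real) < t" by (rule eventually_at_right_less)
    then have "\<forall>\<^sub>F t in at_right 0. z = (1 / t) *\<^sub>R fst (t *\<^sub>R z, t ^ d * u)" by eventually_elim simp
    then show "((\<lambda>t. (1 / t) *\<^sub>R fst (t *\<^sub>R z, t ^ d * u)) \<longlongrightarrow> z) (at_right 0)" by (rule Lim_transform_eventually[rotated]) simp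
    from ev have "\<forall>\<^sub>F t in at_right 0. u = snd (t *\<^sub>R z, t ^ d * u) / t ^ d" by eventually_elim simp
    then show "((\<lambda>t. snd (t *\<^sub>R z, t ^ d * u) / t ^ d) \<longlongrightarrow> u) (at_right 0)" by (rule Lim_transform_eventually[rotated]) simp
  qed (use d in auto)
  then have "((\<lambda>t. (z, of_real u + \<i> * of_real (p z + r (t *\<^sub>R z, t ^ d * u) / t ^ d)))
      \<longlongrightarrow> (z, of_real u + \<i> * of_real (p z + 0))) (at_right 0)"
    by (intro tendsto_intros)
  then show ?thesis unfolding ypt_def[abs_def] y0_def by simp
qed

lemma xpt_on_model:
  assumes "0 < t"
  shows "Im (snd (xpt z u t)) = p (fst (xpt z u t)) + r (fst (xpt z u t), Re (snd (xpt z u t)))"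
proof -
  have "fst (xpt z u t) = t *\<^sub>R z"
    by (simp add: xpt_def dil_def ypt_def fcp_eq_iff scaleR_conv_of_real[where 'a = complex])
  moreover have "snd (xpt z u t) = of_real (t ^ d * u) + \<i> * of_real (t ^ d * p z + r (t *\<^sub>R z, t ^ d * u))"
    using assms by (simp add: xpt_def dil_def ypt_def algebra_simps)
  ultimately show ?thesis by (simp add: p_scale)
qed

lemma xpt_limit: "(xpt z u \<longlongrightarrow> 0) (at_right 0)"
proof -
  have "((\<lambda>t. complex_of_real t) \<longlongrightarrow> of_real 0) (at_right 0)" by (intro tendsto_of_real tendsto_ident_at)
  then have t: "((\<lambda>t. complex_of_real t) \<longlongrightarrow> 0) (at_right 0)" by simp
  have y2: "((\<lambda>t. snd (ypt z u t)) \<longlongrightarrow> snd (y0 z u)) (at_right 0)" by (rule tendsto_snd[OF ypt_limit])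
  have "((\<lambda>t. complex_of_real t *s z) \<longlongrightarrow> 0 *s z) (at_right 0)"
    by (rule bounded_linear.tendsto[OF bounded_linear_vector_smult_left t])
  then have "((\<lambda>t. (complex_of_real t *s z, of_real t ^ d * snd (ypt z u t))) \<longlongrightarrow> (0 *s z, 0 ^ d * snd (y0 z u))) (at_right 0)"
    by (intro tendsto_Pair tendsto_mult tendsto_power t y2)
  moreover have "xpt z u = (\<lambda>t. (complex_of_real t *s z, of_real t ^ d * snd (ypt z u t)))"
    by (auto simp: xpt_def dil_def ypt_def)
  ultimately show ?thesis using d by (simp add: power_0_left zero_prod_def)
qed

lemma two_le: "2 \<le> d" and one_le: "1 \<le> d" using d by simp_all

text \<open>The derivative \<open>D\<close> is a parameter, so that two maps with the same 1-jet
  share it; invertibility is recorded as injectivity of \<open>D\<close>.\<close>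

definition germ :: "real \<Rightarrow> ('n cspace \<Rightarrow> 'n cspace) \<Rightarrow> ('n cspace \<Rightarrow> 'n cspace) \<Rightarrow> bool" where
  "germ \<epsilon> D H \<longleftrightarrow> 0 < \<epsilon> \<and> (\<forall>i. cdiff \<epsilon> (\<lambda>x. fst (H x) $ i)) \<and> cdiff \<epsilon> (\<lambda>x. snd (H x)) \<and> H 0 = 0 \<and>
     (H has_derivative D) (at 0) \<and> inj D \<and>
     (\<forall>x\<in>ball 0 \<epsilon>. Im (snd x) = p (fst x) + r (fst x, Re (snd x)) \<longrightarrow>
        Im (snd (H x)) = p (fst (H x)) + r (fst (H x), Re (snd (H x))))"

definition jac :: "('n cspace \<Rightarrow> 'n cspace) \<Rightarrow> 'n \<Rightarrow> 'n \<Rightarrow> complex" where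
  "jac D i k = fst (D (axis k 1, 0)) $ i"

context
  fixes \<epsilon> :: real and D H :: "'n cspace \<Rightarrow> 'n cspace"
  assumes germ: "germ \<epsilon> D H"
begin

lemma germ_simps: "0 < \<epsilon>" "cdiff \<epsilon> (\<lambda>x. fst (H x) $ i)" "cdiff \<epsilon> (\<lambda>x. snd (H x))" "H 0 = 0"
    "(H has_derivative D) (at 0)" "inj D"
  using germ by (auto simp: germ_def)

lemma germ_D:
  "((\<lambda>x. fst (H x) $ i) has_derivative (\<lambda>v. fst (D v) $ i)) (at 0)"
  "((\<lambda>x. snd (H x)) has_derivative (\<lambda>v. snd (D v))) (at 0)"
proof -
  show "((\<lambda>x. fst (H x) $ i) has_derivative (\<lambda>v. fst (D v) $ i)) (at 0)"
    using bounded_linear.has_derivative[OF bounded_linear_compose[OF bounded_linear_vec_nth bounded_linear_fst] germ_simps(5)] by simp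
  show "((\<lambda>x. snd (H x)) has_derivative (\<lambda>v. snd (D v))) (at 0)"
    using bounded_linear.has_derivative[OF bounded_linear_snd germ_simps(5)] .
qed

lemma germ_linear: "fst (D (z, 0)) = lmap (jac D) z"
proof -
  have c: "fst (D (z, 0)) $ i = coef d (\<lambda>x. fst (H x) $ i) 1 (z, 0)" for z i
    using coef_1[OF germ_simps(2,1) two_le germ_D(1), of i z 0] by simp
  have "(0 :: 'n cspace) \<in> ball 0 \<epsilon>" using germ_simps(1) by simp
  then have "\<exists>D'. ((\<lambda>x. fst (H x) $ i) has_derivative D') (at 0) \<and> (\<forall>v. D' (mult_i v) = \<i> * D' v)" for i
    using germ_simps(2)[of i] unfolding cdiff_def by blast
  then have ci: "fst (D (mult_i v)) $ i = \<i> * fst (D v) $ i" for i v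
    using has_derivative_unique[OF germ_D(1)[of i]] by metis
  have lin: "fst (D (h *s a, h * b)) $ i = h * fst (D (a, b)) $ i" for i h a b
    by (rule complex_linear[OF has_derivative_bounded_linear[OF germ_D(1)[of i]] ci])
  interpret linear D using has_derivative_bounded_linear[OF germ_simps(5)] by (rule bounded_linear.linear)
  have "(z, 0) = (\<Sum>k\<in>UNIV. (z $ k *s axis k 1, z $ k * (0::complex)))"
    by (auto simp: prod_eq_iff fst_sum snd_sum fcp_eq_iff axis_def if_distrib cong: if_cong)
  then have "D (z, 0) = D (\<Sum>k\<in>UNIV. (z $ k *s axis k 1, z $ k * 0))" by (rule arg_cong)
  also have "\<dots> = (\<Sum>k\<in>UNIV. D (z $ k *s axis k 1, z $ k * 0))" by (rule sum)
  finally have "D (z, 0) = (\<Sum>k\<in>UNIV. D (z $ k *s axis k 1, z $ k * 0))" .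
  then have "fst (D (z, 0)) $ i = (\<Sum>k\<in>UNIV. z $ k * fst (D (axis k 1, 0)) $ i)" for i
    by (simp only: fst_sum sum_component lin)
  then show ?thesis by (simp add: lmap_def jac_def fcp_eq_iff mult.commute)
qed

lemma germ_F_limit: "((\<lambda>t. (1 / t) *\<^sub>R fst (H (xpt z u t))) \<longlongrightarrow> lmap (jac D) z) (at_right 0)"
proof (rule vec_tendstoI)
  fix i
  have "((\<lambda>t. fst (H (dil d (of_real t) (ypt z u t))) $ i / of_real t ^ 1) \<longlongrightarrow> coef d (\<lambda>x. fst (H x) $ i) 1 (y0 z u)) (at_right 0)"
  proof (rule coef_limit[OF germ_simps(2,1) one_le _ ypt_limit])
    fix l :: nat and x :: "'n cspace" assume "l < 1"
    then show "coef d (\<lambda>x. fst (H x) $ i) l x = 0" by (simp add: coef_0[OF one_le] germ_simps(4))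
  qed
  moreover have "coef d (\<lambda>x. fst (H x) $ i) 1 (y0 z u) = lmap (jac D) z $ i"
    unfolding y0_def coef_1[OF germ_simps(2,1) two_le germ_D(1)] by (simp add: germ_linear)
  ultimately show "((\<lambda>t. ((1 / t) *\<^sub>R fst (H (xpt z u t))) $ i) \<longlongrightarrow> lmap (jac D) z $ i) (at_right 0)"
    by (simp add: xpt_def scaleR_conv_of_real[where 'a = complex] divide_inverse mult.commute)
qed

lemma germ_equation:
  "\<forall>\<^sub>F t in at_right 0. Im (snd (H (xpt z u t))) = p (fst (H (xpt z u t))) + r (fst (H (xpt z u t)), Re (snd (H (xpt z u t))))"
proof -
  have "\<forall>\<^sub>F t in at_right 0. norm (xpt z u t) < \<epsilon>"
    by (rule order_tendstoD(2)[OF tendsto_norm[OF xpt_limit]]) (simp add: germ_simps)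
  then show ?thesis using eventually_at_right_less[of "0::real"]
    by eventually_elim (use germ xpt_on_model in \<open>auto simp: germ_def\<close>)
qed

text \<open>Evaluate Im w = p + r at the image of a point of the hypersurface and divide by t^l:
  \<open>p\<close> contributes at order t^d, where only the linear part of the z-components is
  visible, and \<open>r\<close> is of smaller order.\<close>

lemma germ_level:
  assumes l: "1 \<le> l" "l \<le> d" and zero: "\<And>l' x. l' < l \<Longrightarrow> coef d (\<lambda>x. snd (H x)) l' x = 0"
  shows "Im (coef d (\<lambda>x. snd (H x)) l (y0 z u)) = (if l = d then p (lmap (jac D) z) else 0)"
    and "((\<lambda>t. snd (H (xpt z u t)) / of_real t ^ l) \<longlongrightarrow> coef d (\<lambda>x. snd (H x)) l (y0 z u)) (at_right 0)"
proof -
  let ?c = "coef d (\<lambda>x. snd (H x)) l (y0 z u)"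
  let ?a = "\<lambda>t. (fst (H (xpt z u t)), Re (snd (H (xpt z u t))))"
  have G: "((\<lambda>t. snd (H (xpt z u t)) / of_real t ^ l) \<longlongrightarrow> ?c) (at_right 0)"
    unfolding xpt_def by (rule coef_limit[OF germ_simps(3,1) one_le zero ypt_limit])
  then show "((\<lambda>t. snd (H (xpt z u t)) / of_real t ^ l) \<longlongrightarrow> ?c) (at_right 0)" .
  have ReIm: "Re (snd (H (xpt z u t)) / of_real t ^ l) = Re (snd (H (xpt z u t))) / t ^ l"
    "Im (snd (H (xpt z u t)) / of_real t ^ l) = Im (snd (H (xpt z u t))) / t ^ l" for t
    by (simp_all flip: of_real_power)
  have R: "((\<lambda>t. snd (?a t) / t ^ l) \<longlongrightarrow> Re ?c) (at_right 0)" using tendsto_Re[OF G] by (simp add: ReIm)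
  have F: "((\<lambda>t. (1 / t) *\<^sub>R fst (?a t)) \<longlongrightarrow> lmap (jac D) z) (at_right 0)" using germ_F_limit by simp
  have "((\<lambda>t. p ((1 / t) *\<^sub>R fst (?a t))) \<longlongrightarrow> p (lmap (jac D) z)) (at_right 0)"
    by (rule continuous_on_tendsto_compose[OF continuous_p F]) simp_all
  then have "((\<lambda>t. t ^ (d - l) * p ((1 / t) *\<^sub>R fst (?a t)) + r (?a t) / t ^ l) \<longlongrightarrow> 0 ^ (d - l) * p (lmap (jac D) z) + 0) (at_right 0)"
    by (intro tendsto_add tendsto_mult tendsto_power tendsto_ident_at r_limit(1)[OF F R l])
  moreover have "\<forall>\<^sub>F t in at_right 0. t ^ (d - l) * p ((1 / t) *\<^sub>R fst (?a t)) + r (?a t) / t ^ l = Im (snd (H (xpt z u t)) / of_real t ^ l)"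
    using germ_equation[of z u] eventually_at_right_less[of "0::real"]
  proof eventually_elim
    case (elim t)
    have td: "t ^ d = t ^ (d - l) * t ^ l" using l by (simp flip: power_add)
    have "p (fst (?a t)) = p (t *\<^sub>R ((1 / t) *\<^sub>R fst (?a t)))" using elim(2) by simp
    also have "\<dots> = t ^ (d - l) * t ^ l * p ((1 / t) *\<^sub>R fst (?a t))" unfolding p_scale td ..
    finally show ?case using elim unfolding ReIm by (simp add: add_divide_distrib)
  qed
  ultimately have "((\<lambda>t. Im (snd (H (xpt z u t)) / of_real t ^ l)) \<longlongrightarrow> 0 ^ (d - l) * p (lmap (jac D) z) + 0) (at_right 0)"
    by (rule Lim_transform_eventually)
  from tendsto_unique[OF _ tendsto_Im[OF G] this]
  show "Im ?c = (if l = d then p (lmap (jac D) z) else 0)" using l by (simp add: power_0_left)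
qed

text \<open>Below weight \<open>d\<close> the coefficient cannot involve w. It is a holomorphic
  polynomial in z with real values, and positive degree forces it to vanish.\<close>

lemma germ_G_low: "l < d \<Longrightarrow> coef d (\<lambda>x. snd (H x)) l x = 0"
proof (induction l arbitrary: x rule: less_induct)
  case (less l)
  show ?case
  proof (cases "l = 0")
    case True
    then show ?thesis by (simp add: coef_0[OF one_le] germ_simps(4))
  next
    case False
    obtain q :: "nat \<Rightarrow> 'n pring" where q: "\<And>z w y. coef d (\<lambda>x. snd (H x)) l (z, w) = (\<Sum>j\<le>l. w ^ j * ev (q j) (z, y))"
      "\<And>j. j * d \<le> l \<Longrightarrow> bihom (l - j * d) 0 (q j)" "\<And>j. l < j * d \<Longrightarrow> q j = 0"
      by (rule coef_polynomial[OF germ_simps(3,1) one_le, of l]) (rule that)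
    have q0: "q j = 0" if "j \<noteq> 0" for j
      using that less.prems by (intro q(3)) (cases j, auto)
    have e: "coef d (\<lambda>x. snd (H x)) l (z, w) = ev (q 0) (z, y)" for z w y
    proof -
      have "(\<Sum>j\<le>l. w ^ j * ev (q j) (z, y)) = (\<Sum>j\<in>{0}. w ^ j * ev (q j) (z, y))"
        by (rule sum.mono_neutral_right) (auto simp: q0)
      then show ?thesis by (simp add: q(1)[of z w y])
    qed
    have im: "Im (ev (q 0) (z, cnjv z)) = 0" for z
      using germ_level(1)[of l z 0] False less by (simp add: y0_def e[of _ _ "cnjv z"])
    have "q 0 - tau (q 0) = 0"
      by (rule polarisation) (simp add: complex_eq_iff im)
    then have "q 0 = 0"
      using q(2)[of 0] False by (intro pure_terms_vanish[of l "q 0" 0]) (auto simp: no_pure_terms_def)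
    then show ?thesis using e[of "fst x" "snd x" 0] by simp
  qed
qed

text \<open>In weight \<open>d\<close> the coefficient is a polynomial in z plus a multiple of w.
  Varying u makes the factor real. The polynomial then has imaginary part P o L - c P with L =
  \<open>jac D\<close>, which has no pure terms, so both vanish.\<close>

lemma germ_G_top:
  obtains c :: real where "\<And>z w. coef d (\<lambda>x. snd (H x)) d (z, w) = of_real c * w"
    "lsubst (jac D) (cplx P) = cst (of_real c) * cplx P"
proof -
  obtain q :: "nat \<Rightarrow> 'n pring" where q: "\<And>z w y. coef d (\<lambda>x. snd (H x)) d (z, w) = (\<Sum>j\<le>d. w ^ j * ev (q j) (z, y))"
    "\<And>j. j * d \<le> d \<Longrightarrow> bihom (d - j * d) 0 (q j)" "\<And>j. d < j * d \<Longrightarrow> q j = 0"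
    by (rule coef_polynomial[OF germ_simps(3,1) one_le, of d]) (rule that)
  define \<gamma> where "\<gamma> = ev (q 1) (0, 0)"
  have q1: "q 1 = cst \<gamma>" unfolding \<gamma>_def using q(2)[of 1] by (intro bihom_00) simp
  have q0: "q j = 0" if "j \<notin> {0, 1}" for j
  proof (rule q(3))
    have "1 * d < j * d" using that d by (intro mult_strict_right_mono) auto
    then show "d < j * d" by simp
  qed
  have e: "coef d (\<lambda>x. snd (H x)) d (z, w) = ev (q 0) (z, y) + \<gamma> * w" for z w y
  proof -
    have "(\<Sum>j\<le>d. w ^ j * ev (q j) (z, y)) = (\<Sum>j\<in>{0, 1}. w ^ j * ev (q j) (z, y))"
      using d by (intro sum.mono_neutral_right) (auto simp: q0[simplified])
    then show ?thesis by (simp add: q(1)[of z w y] q1[simplified])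
  qed
  have im: "Im (ev (q 0) (z, y)) + Im \<gamma> * u + Re \<gamma> * p z = p (lmap (jac D) z)" for z y u
    using germ_level(1)[of d z u] germ_G_low one_le by (simp add: y0_def e[of _ _ y] algebra_simps)
  from im[of 0 0 0] im[of 0 0 1] have "Im \<gamma> = 0" by simp
  define c where "c = Re \<gamma>"
  have \<gamma>: "\<gamma> = of_real c" using \<open>Im \<gamma> = 0\<close> by (simp add: c_def complex_eq_iff)
  have im: "Im (ev (q 0) (z, y)) = p (lmap (jac D) z) - c * p z" for z y
    using im[of z y 0] by (simp add: c_def)
  have "q 0 - tau (q 0) = 2 * cst \<i> * (lsubst (jac D) (cplx P) - cst (of_real c) * cplx P)"
  proof (rule polarisation_eq)
    fix z
    show "ev (q 0 - tau (q 0)) (z, cnjv z) = ev (2 * cst \<i> * (lsubst (jac D) (cplx P) - cst (of_real c) * cplx P)) (z, cnjv z)"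
      by (simp add: ev_lsubst ev_p complex_eq_iff im)
  qed
  moreover have "no_pure_terms (lsubst (jac D) (cplx P))"
  proof -
    have "no_pure_terms (\<Sum>q\<in>{1..<d}. lsubst (jac D) (Pc q))"
      by (rule no_pure_terms_sum, rule no_pure_terms_bihom[OF bihom_lsubst[OF bihom_comp]]) auto
    then show ?thesis by (subst sum_comp) (simp only: lsubst_sum)
  qed
  ultimately have "q 0 = 0"
    using q(2)[of 0] one_le no_pure_terms_P
    by (intro pure_terms_vanish[of d "q 0" "2 * cst \<i> * (lsubst (jac D) (cplx P) - cst (of_real c) * cplx P)"]
        no_pure_terms_mult no_pure_terms_diff) auto
  have "lsubst (jac D) (cplx P) = cst (of_real c) * cplx P"
    by (rule polarisation_eq) (use im[of _ 0] \<open>q 0 = 0\<close> in \<open>simp add: ev_lsubst ev_p\<close>)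
  moreover have "coef d (\<lambda>x. snd (H x)) d (z, w) = of_real c * w" for z w
    using e[of z w 0] \<open>q 0 = 0\<close> \<gamma> by simp
  ultimately show thesis by (rule that[rotated])
qed

text \<open>The w-component has no part of weight 1, as d \<ge> 3, so \<open>D\<close> maps the
  z-space into itself and its injectivity passes to \<open>jac D\<close>.\<close>

lemma germ_jac_inverse:
  obtains B :: "'n \<Rightarrow> 'n \<Rightarrow> complex" where "\<And>z. lmap (jac D) (lmap B z) = z"
proof -
  have "coef d (\<lambda>x. snd (H x)) 1 (z, 0) = snd (D (z, 0))" for z
    by (rule coef_1[OF germ_simps(3,1) two_le germ_D(2)])
  then have s: "D (z, 0) = (lmap (jac D) z, 0)" for z
    using germ_G_low[of 1] d by (simp add: prod_eq_iff germ_linear)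
  have lin: "linear (lmap (jac D))" by (rule bounded_linear.linear[OF bounded_linear_lmap])
  have "inj (lmap (jac D))"
  proof (rule injI)
    fix z z' assume "lmap (jac D) z = lmap (jac D) z'"
    then have "D (z, 0) = D (z', 0)" by (simp add: s)
    then show "z = z'" using germ_simps(6) by (simp add: inj_eq)
  qed
  then have "surj (lmap (jac D))" using lin by (intro linear_injective_imp_surjective refl)
  then have "\<forall>k. \<exists>b. lmap (jac D) b = axis k 1" by (metis surjD)
  then obtain b where b: "\<And>k. lmap (jac D) (b k) = axis k 1" by metis
  define B where "B i k = b k $ i" for i k
  show thesis
  proof (rule that[of B], rule lmap_lmap)
    fix i k
    have "(\<Sum>j\<in>UNIV. jac D i j * B j k) = lmap (jac D) (b k) $ i" by (simp add: lmap_def B_def)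
    then show "(\<Sum>j\<in>UNIV. jac D i j * B j k) = (if i = k then 1 else 0)" by (simp add: b axis_def)
  qed
qed

end

end

lemma weighted_quotient:
  "((N / t) ^ d + S / t ^ d) * (E / t ^ k) + M * (\<delta> / t ^ (d + k)) = ((N ^ d + S) * E + M * \<delta>) / (t::real) ^ (d + k)"
  by (simp add: power_divide power_add add_divide_distrib distrib_right)

context model_germ
begin

text \<open>The intermediate point of the mean value theorem is squeezed to z, since the endpoints
  differ by t^k times a convergent vector.\<close>

lemma p_difference_quotient:
  fixes A A' v :: "real \<Rightarrow> complex ^ 'n"
  assumes A': "(A' \<longlongrightarrow> z) (at_right 0)" and v: "(v \<longlongrightarrow> \<alpha>) (at_right 0)" and k: "1 \<le> k"
    and A: "\<forall>\<^sub>F t in at_right 0. A t = A' t + t ^ k *\<^sub>R v t"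
  shows "((\<lambda>t. (p (A t) - p (A' t)) / t ^ k) \<longlongrightarrow> 2 * Re (\<Sum>j\<in>UNIV. \<alpha> $ j * ev (dz j (cplx P)) (z, cnjv z))) (at_right 0)"
proof -
  let ?R = "\<lambda>t \<xi>. \<xi> \<in> closed_segment (A' t) (A t) \<and>
      p (A t) - p (A' t) = 2 * Re (\<Sum>j\<in>UNIV. (A t - A' t) $ j * ev (dz j (cplx P)) (\<xi>, cnjv \<xi>))"
  have "\<exists>\<xi>. ?R t \<xi>" for t
    by (rule mvt_segment[OF p_has_derivative, of "A' t" "A t"]) (rule exI, erule (1) conjI)
  then have "\<forall>t. \<exists>\<xi>. ?R t \<xi>" by (rule allI)
  from choice[OF this] obtain \<xi> where R: "\<forall>t. ?R t (\<xi> t)" by (rule exE)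
  have \<xi>: "\<xi> t \<in> closed_segment (A' t) (A t)"
    "p (A t) - p (A' t) = 2 * Re (\<Sum>j\<in>UNIV. (A t - A' t) $ j * ev (dz j (cplx P)) (\<xi> t, cnjv (\<xi> t)))" for t
    using R[rule_format, of t] by simp_all
  have "((\<lambda>t. t ^ k * norm (v t)) \<longlongrightarrow> 0 ^ k * norm \<alpha>) (at_right 0)"
    by (intro tendsto_intros v)
  then have tv: "((\<lambda>t. t ^ k * norm (v t)) \<longlongrightarrow> 0) (at_right 0)" using k by (simp add: power_0_left)
  have "\<forall>\<^sub>F t in at_right 0. norm (\<xi> t - A' t) \<le> t ^ k * norm (v t)"
    using A eventually_at_right_less[of "0::real"]
  proof eventually_elim
    case (elim t)
    then show ?case using segment_bound(1)[OF \<xi>(1)[of t]] by simp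
  qed
  from Lim_null_comparison[OF this tv] have "((\<lambda>t. \<xi> t - A' t) \<longlongrightarrow> 0) (at_right 0)" .
  from tendsto_add[OF this A'] have \<xi>z: "(\<xi> \<longlongrightarrow> z) (at_right 0)" by simp
  have e: "((\<lambda>t. ev (dz j (cplx P)) (\<xi> t, cnjv (\<xi> t))) \<longlongrightarrow> ev (dz j (cplx P)) (z, cnjv z)) (at_right 0)" for j
    by (rule isCont_tendsto_compose[OF has_derivative_continuous[OF ev_diag_has_derivative] \<xi>z])
  have "((\<lambda>t. 2 * Re (\<Sum>j\<in>UNIV. v t $ j * ev (dz j (cplx P)) (\<xi> t, cnjv (\<xi> t)))) \<longlongrightarrow>
      2 * Re (\<Sum>j\<in>UNIV. \<alpha> $ j * ev (dz j (cplx P)) (z, cnjv z))) (at_right 0)"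
    by (intro tendsto_intros e v)
  moreover have "\<forall>\<^sub>F t in at_right 0. 2 * Re (\<Sum>j\<in>UNIV. v t $ j * ev (dz j (cplx P)) (\<xi> t, cnjv (\<xi> t))) = (p (A t) - p (A' t)) / t ^ k"
    using A eventually_at_right_less[of "0::real"]
  proof eventually_elim
    case (elim t)
    then show ?case
      unfolding \<xi>(2)[of t] by (simp add: sum_divide_distrib sum_distrib_left)
  qed
  ultimately show ?thesis by (rule Lim_transform_eventually)
qed

context
  fixes \<epsilon> :: real and D H H' :: "'n cspace \<Rightarrow> 'n cspace"
  assumes g: "germ \<epsilon> D H" and g': "germ \<epsilon> D H'"
begin

definition \<Delta>F :: "'n \<Rightarrow> 'n cspace \<Rightarrow> complex" where "\<Delta>F i x = fst (H x) $ i - fst (H' x) $ i"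

definition \<Delta>G :: "'n cspace \<Rightarrow> complex" where "\<Delta>G x = snd (H x) - snd (H' x)"

lemma cdiff_\<Delta>: "cdiff \<epsilon> (\<Delta>F i)" "cdiff \<epsilon> \<Delta>G"
  unfolding \<Delta>F_def[abs_def] \<Delta>G_def[abs_def]
  by (intro cdiff_diff germ_simps(2)[OF g] germ_simps(2)[OF g'] germ_simps(3)[OF g] germ_simps(3)[OF g'])+

lemma eps: "0 < \<epsilon>" by (rule germ_simps(1)[OF g])

lemma \<Delta>F_derivative: "(\<Delta>F i has_derivative (\<lambda>_. 0)) (at 0)"
  using has_derivative_diff[OF germ_D(1)[OF g, of i] germ_D(1)[OF g', of i]] by (simp add: \<Delta>F_def[abs_def])

lemma \<Delta>_0: "\<Delta>F i 0 = 0" "\<Delta>G 0 = 0"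
  by (simp_all add: \<Delta>F_def \<Delta>G_def germ_simps(4)[OF g] germ_simps(4)[OF g'])

lemma \<Delta>F_low: "l < 2 \<Longrightarrow> coef d (\<Delta>F i) l x = 0"
  using coef_0[OF one_le, of "\<Delta>F i" x] \<Delta>_0(1)[of i] coef_1[OF cdiff_\<Delta>(1) eps two_le \<Delta>F_derivative, of i "fst x" "snd x"]
  by (auto simp: less_2_cases_iff)

text \<open>In weight \<open>d\<close> the factors of w in both maps are determined by the common
  linear part L through P o L = c P with P nonzero, so they coincide.\<close>

lemma \<Delta>G_low: "l \<le> d \<Longrightarrow> coef d \<Delta>G l x = 0"
proof -
  assume l: "l \<le> d"
  have e: "coef d \<Delta>G l x = coef d (\<lambda>x. snd (H x)) l x - coef d (\<lambda>x. snd (H' x)) l x"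
    unfolding \<Delta>G_def[abs_def] by (rule coef_diff[OF germ_simps(3)[OF g] germ_simps(3)[OF g'] eps one_le])
  show ?thesis
  proof (cases "l = d")
    case True
    obtain c where c: "\<And>z w. coef d (\<lambda>x. snd (H x)) d (z, w) = of_real c * w" "lsubst (jac D) (cplx P) = cst (of_real c) * cplx P"
      by (rule germ_G_top[OF g]) (rule that)
    obtain c' where c': "\<And>z w. coef d (\<lambda>x. snd (H' x)) d (z, w) = of_real c' * w" "lsubst (jac D) (cplx P) = cst (of_real c') * cplx P"
      by (rule germ_G_top[OF g']) (rule that)
    have "cst (of_real c) * cplx P = cst (of_real c') * cplx P" by (rule trans[OF sym[OF c(2)] c'(2)])
    then have "cst (of_real c) * cplx P - cst (of_real c') * cplx P = 0" by (simp only: diff_self)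
    then have "cst (of_real c - of_real c') * cplx P = 0" by (simp only: cst_simps left_diff_distrib)
    then have "cst (complex_of_real c - of_real c') = (0 :: 'n pring)" using nonzero by (metis mult_eq_0_iff)
    then have "complex_of_real c - of_real c' = 0" by (simp only: cst_eq_0_iff)
    then have "c = c'" by simp
    then show ?thesis using e c(1)[of "fst x" "snd x"] c'(1)[of "fst x" "snd x"] True by simp
  qed (use l e germ_G_low[OF g] germ_G_low[OF g'] in simp)
qed

text \<open>Subtract the two equations Im w = p + r at the images of the same point and divide by
  t^(d+k). The difference of \<open>p\<close> becomes a derivative of P at L z, the common linear
  image of z, and the difference of \<open>r\<close> disappears in the limit.\<close>

lemma \<Delta>_tangent:
  assumes k: "1 \<le> k" and zF: "\<And>i l x. l < 1 + k \<Longrightarrow> coef d (\<Delta>F i) l x = 0" and zG: "\<And>l x. l < d + k \<Longrightarrow> coef d \<Delta>G l x = 0"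
  shows "Im (coef d \<Delta>G (d + k) (y0 z u)) =
    2 * Re (\<Sum>j\<in>UNIV. coef d (\<Delta>F j) (1 + k) (y0 z u) * ev (dz j (cplx P)) (lmap (jac D) z, cnjv (lmap (jac D) z)))"
proof -
  let ?\<alpha> = "(\<chi> i. coef d (\<Delta>F i) (1 + k) (y0 z u)) :: complex ^ 'n" and ?\<gamma> = "coef d \<Delta>G (d + k) (y0 z u)"
  let ?a = "\<lambda>t. (fst (H (xpt z u t)), Re (snd (H (xpt z u t))))" and ?b = "\<lambda>t. (fst (H' (xpt z u t)), Re (snd (H' (xpt z u t))))"
  have pos: "\<forall>\<^sub>F t in at_right 0. (0::real) < t" by (rule eventually_at_right_less)
  define v where "v t = (1 / t ^ (1 + k)) *\<^sub>R (fst (?a t) - fst (?b t))" for t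
  have v: "(v \<longlongrightarrow> ?\<alpha>) (at_right 0)"
  proof (rule vec_tendstoI)
    fix i
    have "((\<lambda>t. \<Delta>F i (dil d (of_real t) (ypt z u t)) / of_real t ^ (1 + k)) \<longlongrightarrow> coef d (\<Delta>F i) (1 + k) (y0 z u)) (at_right 0)"
      by (rule coef_limit[OF cdiff_\<Delta>(1) eps one_le zF ypt_limit])
    then show "((\<lambda>t. v t $ i) \<longlongrightarrow> ?\<alpha> $ i) (at_right 0)"
      by (simp add: v_def \<Delta>F_def xpt_def scaleR_conv_of_real[where 'a = complex] divide_inverse mult.commute)
  qed
  have G: "((\<lambda>t. \<Delta>G (xpt z u t) / of_real t ^ (d + k)) \<longlongrightarrow> ?\<gamma>) (at_right 0)"
    unfolding xpt_def by (rule coef_limit[OF cdiff_\<Delta>(2) eps one_le zG ypt_limit])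
  have ReIm: "Re (x / of_real t ^ l) = Re x / t ^ l" "Im (x / of_real t ^ l) = Im x / t ^ l" for x t l
    by (simp_all flip: of_real_power)
  let ?A = "\<lambda>t. (1 / t) *\<^sub>R fst (?a t)" and ?A' = "\<lambda>t. (1 / t) *\<^sub>R fst (?b t)"
  have A: "(?A \<longlongrightarrow> lmap (jac D) z) (at_right 0)" "(?A' \<longlongrightarrow> lmap (jac D) z) (at_right 0)"
    using germ_F_limit[OF g] germ_F_limit[OF g'] by simp_all
  have top: "1 \<le> d" "d \<le> d" using one_le by simp_all
  have "((\<lambda>t. snd (H (xpt z u t)) / of_real t ^ d) \<longlongrightarrow> coef d (\<lambda>x. snd (H x)) d (y0 z u)) (at_right 0)"
    by (rule germ_level(2)[OF g top germ_G_low[OF g]])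
  from tendsto_Re[OF this] have a2: "((\<lambda>t. snd (?a t) / t ^ d) \<longlongrightarrow> Re (coef d (\<lambda>x. snd (H x)) d (y0 z u))) (at_right 0)"
    by (simp add: ReIm)
  have "((\<lambda>t. snd (H' (xpt z u t)) / of_real t ^ d) \<longlongrightarrow> coef d (\<lambda>x. snd (H' x)) d (y0 z u)) (at_right 0)"
    by (rule germ_level(2)[OF g' top germ_G_low[OF g']])
  from tendsto_Re[OF this] have b2: "((\<lambda>t. snd (?b t) / t ^ d) \<longlongrightarrow> Re (coef d (\<lambda>x. snd (H' x)) d (y0 z u))) (at_right 0)"
    by (simp add: ReIm)
  have a0: "(?a \<longlongrightarrow> 0) (at_right 0)" by (rule r_limit(2)[OF A(1) a2 top])
  have b0: "(?b \<longlongrightarrow> 0) (at_right 0)" by (rule r_limit(2)[OF A(2) b2 top])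
  have "((\<lambda>t. (p (?A t) - p (?A' t)) / t ^ k) \<longlongrightarrow>
      2 * Re (\<Sum>j\<in>UNIV. ?\<alpha> $ j * ev (dz j (cplx P)) (lmap (jac D) z, cnjv (lmap (jac D) z)))) (at_right 0)"
  proof (rule p_difference_quotient[OF A(2) v k])
    show "\<forall>\<^sub>F t in at_right 0. ?A t = ?A' t + t ^ k *\<^sub>R v t"
      using pos by eventually_elim (simp add: v_def scaleR_diff_right divide_simps)
  qed
  moreover have "((\<lambda>t. (r (?a t) - r (?b t)) / t ^ (d + k)) \<longlongrightarrow> 0) (at_right 0)"
  proof (rule r_quotient_limit[OF a0 b0])
    let ?\<nu> = "\<lambda>t. norm (fst (?a t)) + norm (fst (?b t))" and ?\<sigma> = "\<lambda>t. \<bar>snd (?a t)\<bar> + \<bar>snd (?b t)\<bar>"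
    have a01: "((\<lambda>t. fst (?a t)) \<longlongrightarrow> 0) (at_right 0)" "((\<lambda>t. snd (?a t)) \<longlongrightarrow> 0) (at_right 0)"
      using tendsto_fst[OF a0] tendsto_snd[OF a0] by simp_all
    have b01: "((\<lambda>t. fst (?b t)) \<longlongrightarrow> 0) (at_right 0)" "((\<lambda>t. snd (?b t)) \<longlongrightarrow> 0) (at_right 0)"
      using tendsto_fst[OF b0] tendsto_snd[OF b0] by simp_all
    let ?n = "norm (lmap (jac D) z) + norm (lmap (jac D) z)"
    let ?s = "\<bar>Re (coef d (\<lambda>x. snd (H x)) d (y0 z u))\<bar> + \<bar>Re (coef d (\<lambda>x. snd (H' x)) d (y0 z u))\<bar>"
    have "((\<lambda>t. ((norm (?A t) + norm (?A' t)) ^ d + (\<bar>snd (?a t) / t ^ d\<bar> + \<bar>snd (?b t) / t ^ d\<bar>)) * (t * norm (v t))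
        + (?\<nu> t + ?\<sigma> t) * \<bar>Re (\<Delta>G (xpt z u t) / of_real t ^ (d + k))\<bar>) \<longlongrightarrow>
        (?n ^ d + ?s) * (0 * norm ?\<alpha>)
        + ((norm (0 :: complex ^ 'n) + norm (0 :: complex ^ 'n)) + (\<bar>0\<bar> + \<bar>0\<bar>)) * \<bar>Re ?\<gamma>\<bar>) (at_right 0)"
      by (intro tendsto_add tendsto_mult tendsto_power tendsto_norm tendsto_rabs A a2 b2 tendsto_ident_at v a01 b01 tendsto_Re[OF G])
    then have lim: "((\<lambda>t. ((norm (?A t) + norm (?A' t)) ^ d + (\<bar>snd (?a t) / t ^ d\<bar> + \<bar>snd (?b t) / t ^ d\<bar>)) * (t * norm (v t))
        + (?\<nu> t + ?\<sigma> t) * \<bar>Re (\<Delta>G (xpt z u t) / of_real t ^ (d + k))\<bar>) \<longlongrightarrow> 0) (at_right 0)"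
      by (simp only: mult_zero_left mult_zero_right norm_zero abs_zero add_0_left)
    have "\<forall>\<^sub>F t in at_right 0. ((norm (?A t) + norm (?A' t)) ^ d + (\<bar>snd (?a t) / t ^ d\<bar> + \<bar>snd (?b t) / t ^ d\<bar>)) * (t * norm (v t))
        + (?\<nu> t + ?\<sigma> t) * \<bar>Re (\<Delta>G (xpt z u t) / of_real t ^ (d + k))\<bar> =
        ((?\<nu> t ^ d + ?\<sigma> t) * norm (fst (?a t) - fst (?b t)) + (?\<nu> t + ?\<sigma> t) * \<bar>snd (?a t) - snd (?b t)\<bar>) / t ^ (d + k)"
      using pos
    proof eventually_elim
      case (elim t)
      have 1: "norm (?A t) + norm (?A' t) = ?\<nu> t / t" using elim by (simp add: add_divide_distrib)
      have 2: "\<bar>snd (?a t) / t ^ d\<bar> + \<bar>snd (?b t) / t ^ d\<bar> = ?\<sigma> t / t ^ d"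
        using elim by (simp add: abs_divide add_divide_distrib)
      have 3: "t * norm (v t) = norm (fst (?a t) - fst (?b t)) / t ^ k" using elim by (simp add: v_def)
      have 4: "\<bar>Re (\<Delta>G (xpt z u t) / of_real t ^ (d + k))\<bar> = \<bar>snd (?a t) - snd (?b t)\<bar> / t ^ (d + k)"
        unfolding ReIm using elim by (simp add: \<Delta>G_def abs_divide)
      show ?case
        unfolding 1 2 3 4 by (rule weighted_quotient)
    qed
    from Lim_transform_eventually[OF lim this]
    show "((\<lambda>t. ((?\<nu> t ^ d + ?\<sigma> t) * norm (fst (?a t) - fst (?b t)) + (?\<nu> t + ?\<sigma> t) * \<bar>snd (?a t) - snd (?b t)\<bar>) / t ^ (d + k)) \<longlongrightarrow> 0) (at_right 0)" .
  qed
  ultimately have "((\<lambda>t. (p (?A t) - p (?A' t)) / t ^ k + (r (?a t) - r (?b t)) / t ^ (d + k)) \<longlongrightarrow>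
      2 * Re (\<Sum>j\<in>UNIV. ?\<alpha> $ j * ev (dz j (cplx P)) (lmap (jac D) z, cnjv (lmap (jac D) z))) + 0) (at_right 0)"
    by (rule tendsto_add)
  moreover have "\<forall>\<^sub>F t in at_right 0. (p (?A t) - p (?A' t)) / t ^ k + (r (?a t) - r (?b t)) / t ^ (d + k) = Im (\<Delta>G (xpt z u t) / of_real t ^ (d + k))"
    using pos germ_equation[OF g, of z u] germ_equation[OF g', of z u]
  proof eventually_elim
    case (elim t)
    have "(p (?A t) - p (?A' t)) / t ^ k = (p (fst (?a t)) - p (fst (?b t))) / t ^ (d + k)"
      unfolding p_scale using elim(1) by (simp add: power_add power_divide diff_divide_distrib)
    then show ?case unfolding ReIm \<Delta>G_def using elim(2,3) by (simp add: diff_divide_distrib add_divide_distrib)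
  qed
  ultimately have "((\<lambda>t. Im (\<Delta>G (xpt z u t) / of_real t ^ (d + k))) \<longlongrightarrow>
      2 * Re (\<Sum>j\<in>UNIV. ?\<alpha> $ j * ev (dz j (cplx P)) (lmap (jac D) z, cnjv (lmap (jac D) z))) + 0) (at_right 0)"
    by (rule Lim_transform_eventually)
  from tendsto_unique[OF _ tendsto_Im[OF G] this] show ?thesis by simp
qed

text \<open>Tangency comes out at L z. Applying the inverse of L to the z-components and dividing
  the w-component by the factor c of P o L = c P moves it back to z, where
  \<open>tangent_vanishes\<close> applies. The induction on \<open>k\<close> supplies the vanishing
  of all lower weights.\<close>

lemma \<Delta>_coefficients_vanish:
  assumes rigid: "\<And>F e. 2 \<le> e \<Longrightarrow> (\<And>j. bihom e 0 (F j)) \<Longrightarrow> Dz F (cplx P) + Db F (cplx P) = 0 \<Longrightarrow> F = (\<lambda>_. 0)"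
    and nondeg: "\<And>F e. (\<And>j. bihom e 0 (F j)) \<Longrightarrow> Dz F (cplx P) = 0 \<Longrightarrow> F = (\<lambda>_. 0)"
    and unbal: "\<And>F c. (\<And>j. bihom 1 0 (F j)) \<Longrightarrow> Dz F (cplx P) = cst (of_real c) * cplx P \<Longrightarrow> c = (0::real)"
  shows "\<forall>x. (\<forall>i. coef d (\<Delta>F i) (1 + k) x = 0) \<and> coef d \<Delta>G (d + k) x = 0"
proof (induction k rule: less_induct)
  case (less k)
  show ?case
  proof (cases "k = 0")
    case True
    then show ?thesis using \<Delta>F_low[of 1] \<Delta>G_low[of d] by simp
  next
    case False
    then have k: "1 \<le> k" by simp
    have zF: "coef d (\<Delta>F i) l x = 0" if "l < 1 + k" for i l x
    proof (cases l)
      case (Suc l')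
      then have "\<forall>x. (\<forall>i. coef d (\<Delta>F i) (1 + l') x = 0) \<and> coef d \<Delta>G (d + l') x = 0"
        using that by (intro less) simp
      then have "coef d (\<Delta>F i) (1 + l') x = 0" by blast
      then show ?thesis by (simp add: Suc)
    qed (simp add: \<Delta>F_low)
    have zG: "coef d \<Delta>G l x = 0" if "l < d + k" for l x
    proof (cases "l < d")
      case False
      then have "\<forall>x. (\<forall>i. coef d (\<Delta>F i) (1 + (l - d)) x = 0) \<and> coef d \<Delta>G (d + (l - d)) x = 0"
        using that by (intro less) (simp add: less_diff_conv2)
      then have "coef d \<Delta>G (d + (l - d)) x = 0" by blast
      then show ?thesis using False by simp
    qed (simp add: \<Delta>G_low)
    define Q where "Q i q \<longleftrightarrow> (\<forall>z w y. coef d (\<Delta>F i) (1 + k) (z, w) = (\<Sum>j\<le>1 + k. w ^ j * ev (q j) (z, y))) \<and>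
        (\<forall>j. j * d \<le> 1 + k \<longrightarrow> bihom (1 + k - j * d) 0 (q j)) \<and> (\<forall>j. 1 + k < j * d \<longrightarrow> q j = 0)"
      for i and q :: "nat \<Rightarrow> 'n pring"
    have "\<forall>i. \<exists>q. Q i q"
    proof
      fix i
      obtain q :: "nat \<Rightarrow> 'n pring" where
        a: "\<And>z w y. coef d (\<Delta>F i) (1 + k) (z, w) = (\<Sum>j\<le>1 + k. w ^ j * ev (q j) (z, y))"
          "\<And>j. j * d \<le> 1 + k \<Longrightarrow> bihom (1 + k - j * d) 0 (q j)" "\<And>j. 1 + k < j * d \<Longrightarrow> q j = 0"
        by (rule coef_polynomial[OF cdiff_\<Delta>(1) eps one_le, of i "1 + k"]) (rule that)
      have "Q i q" unfolding Q_def by (intro conjI allI impI a)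
      show "\<exists>q. Q i q" by (rule exI[where x = q], rule \<open>Q i q\<close>)
    qed
    from choice[OF this] obtain q where Q: "\<forall>i. Q i (q i)" by (rule exE)
    have q: "\<And>i z w y. coef d (\<Delta>F i) (1 + k) (z, w) = (\<Sum>j\<le>1 + k. w ^ j * ev (q i j) (z, y))"
      "\<And>i j. j * d \<le> 1 + k \<Longrightarrow> bihom (1 + k - j * d) 0 (q i j)" "\<And>i j. 1 + k < j * d \<Longrightarrow> q i j = 0"
      using Q unfolding Q_def by blast+
    obtain qG :: "nat \<Rightarrow> 'n pring" where
      qG: "\<And>z w y. coef d \<Delta>G (d + k) (z, w) = (\<Sum>j\<le>d + k. w ^ j * ev (qG j) (z, y))"
      "\<And>j. j * d \<le> d + k \<Longrightarrow> bihom (d + k - j * d) 0 (qG j)" "\<And>j. d + k < j * d \<Longrightarrow> qG j = 0"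
      by (rule coef_polynomial[OF cdiff_\<Delta>(2) eps one_le, of "d + k"]) (rule that)
    have q': "coef d (\<Delta>F i) (1 + k) (z, w) = (\<Sum>j\<le>d + k. w ^ j * ev (q i j) (z, y))" for i z w y
      unfolding q(1)[of i z w y]
    proof (rule sum.mono_neutral_left)
      show "\<forall>j\<in>{..d + k} - {..1 + k}. w ^ j * ev (q i j) (z, y) = 0"
      proof
        fix j assume "j \<in> {..d + k} - {..1 + k}"
        then have "1 + k < j * 1" by simp
        also have "\<dots> \<le> j * d" using one_le by (intro mult_left_mono) auto
        finally show "w ^ j * ev (q i j) (z, y) = 0" by (simp add: q(3))
      qed
    qed (use d in auto)
    obtain B where B: "\<And>z. lmap (jac D) (lmap B z) = z" by (rule germ_jac_inverse[OF g]) (rule that)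
    obtain c where c: "lsubst (jac D) (cplx P) = cst (of_real c) * cplx P" by (rule germ_G_top[OF g]) (rule that)
    have c0: "c \<noteq> 0"
    proof
      assume "c = 0"
      then have "ev (cplx P) (lmap (jac D) (lmap B z), cnjv (lmap (jac D) (lmap B z))) = 0" for z
        using c ev_lsubst[of "jac D" "cplx P" "lmap B z" "lmap B z"] by (simp add: cst_simps)
      then have "cplx P = 0" by (intro polarisation) (simp add: B)
      then show False using nonzero by simp
    qed
    define f where "f j i = (\<Sum>l\<in>UNIV. cst (B i l) * q l j)" for j i
    define gg where "gg j = cst (1 / of_real c) * qG j" for j
    have fq: "(\<Sum>i\<in>UNIV. jac D l i * ev (f j i) x) = ev (q l j) x" for l j x
    proof -
      have "(\<Sum>i\<in>UNIV. jac D l i * ev (f j i) x) = lmap (jac D) (lmap B (\<chi> l. ev (q l j) x)) $ l"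
        by (simp add: lmap_def f_def)
      then show ?thesis by (simp add: B)
    qed
    have dzP: "of_real c * ev (dz i (cplx P)) (z, cnjv z) =
        (\<Sum>l\<in>UNIV. jac D l i * ev (dz l (cplx P)) (lmap (jac D) z, cnjv (lmap (jac D) z)))" for i z
    proof -
      have "dz i (cst (of_real c) * cplx P) = (\<Sum>l\<in>UNIV. cst (jac D l i) * lsubst (jac D) (dz l (cplx P)))"
        unfolding c[symmetric] by (rule Dz_chain)
      then have "cst (of_real c) * dz i (cplx P) = (\<Sum>l\<in>UNIV. cst (jac D l i) * lsubst (jac D) (dz l (cplx P)))"
        by (simp add: derivation_mult[OF derivation_dz])
      then have "ev (cst (of_real c) * dz i (cplx P)) (z, cnjv z) =
          ev (\<Sum>l\<in>UNIV. cst (jac D l i) * lsubst (jac D) (dz l (cplx P))) (z, cnjv z)" by simp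
      then show ?thesis by (simp add: ev_lsubst)
    qed
    have tangent: "Im (\<Sum>j\<le>d + k. (of_real u + \<i> * ev (cplx P) (z, cnjv z)) ^ j * ev (gg j) (z, cnjv z)) =
      2 * Re (\<Sum>j\<le>d + k. (of_real u + \<i> * ev (cplx P) (z, cnjv z)) ^ j * (\<Sum>i\<in>UNIV. ev (f j i) (z, cnjv z) * ev (dz i (cplx P)) (z, cnjv z)))"
      for z and u :: real
    proof -
      let ?w = "of_real u + \<i> * ev (cplx P) (z, cnjv z)"
      let ?e = "\<lambda>l. ev (dz l (cplx P)) (lmap (jac D) z, cnjv (lmap (jac D) z))"
      let ?S = "\<Sum>j\<le>d + k. ?w ^ j * (\<Sum>i\<in>UNIV. ev (f j i) (z, cnjv z) * ev (dz i (cplx P)) (z, cnjv z))"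
      have y: "y0 z u = (z, ?w)" by (simp add: y0_def ev_p)
      have inner: "of_real c * (\<Sum>i\<in>UNIV. ev (f j i) (z, cnjv z) * ev (dz i (cplx P)) (z, cnjv z)) = (\<Sum>l\<in>UNIV. ev (q l j) (z, cnjv z) * ?e l)" for j
      proof -
        have "of_real c * (\<Sum>i\<in>UNIV. ev (f j i) (z, cnjv z) * ev (dz i (cplx P)) (z, cnjv z)) =
            (\<Sum>i\<in>UNIV. ev (f j i) (z, cnjv z) * (of_real c * ev (dz i (cplx P)) (z, cnjv z)))"
          by (simp add: sum_distrib_left mult.left_commute)
        also have "\<dots> = (\<Sum>i\<in>UNIV. \<Sum>l\<in>UNIV. jac D l i * ev (f j i) (z, cnjv z) * ?e l)"
          by (simp add: dzP sum_distrib_left mult_ac)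
        also have "\<dots> = (\<Sum>l\<in>UNIV. \<Sum>i\<in>UNIV. jac D l i * ev (f j i) (z, cnjv z) * ?e l)" by (rule sum.swap)
        also have "\<dots> = (\<Sum>l\<in>UNIV. ev (q l j) (z, cnjv z) * ?e l)" by (simp add: fq flip: sum_distrib_right)
        finally show ?thesis .
      qed
      have "of_real c * ?S = (\<Sum>j\<le>d + k. of_real c * (?w ^ j * (\<Sum>i\<in>UNIV. ev (f j i) (z, cnjv z) * ev (dz i (cplx P)) (z, cnjv z))))"
        by (rule sum_distrib_left)
      also have "\<dots> = (\<Sum>j\<le>d + k. ?w ^ j * (\<Sum>l\<in>UNIV. ev (q l j) (z, cnjv z) * ?e l))"
        by (rule sum.cong[OF refl]) (simp only: mult.left_commute[of "of_real c"] inner)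
      also have "\<dots> = (\<Sum>j\<le>d + k. \<Sum>l\<in>UNIV. ?w ^ j * ev (q l j) (z, cnjv z) * ?e l)"
        by (simp add: sum_distrib_left mult.assoc)
      also have "\<dots> = (\<Sum>l\<in>UNIV. \<Sum>j\<le>d + k. ?w ^ j * ev (q l j) (z, cnjv z) * ?e l)" by (rule sum.swap)
      also have "\<dots> = (\<Sum>l\<in>UNIV. coef d (\<Delta>F l) (1 + k) (y0 z u) * ?e l)"
        unfolding y q'[of _ z ?w "cnjv z"] by (simp only: sum_distrib_right)
      finally have S: "2 * Re (of_real c * ?S) = Im (coef d \<Delta>G (d + k) (y0 z u))"
        by (simp only: \<Delta>_tangent[OF k zF zG])
      have "of_real c * (\<Sum>j\<le>d + k. ?w ^ j * ev (gg j) (z, cnjv z)) = coef d \<Delta>G (d + k) (y0 z u)"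
        unfolding y qG(1)[of z ?w "cnjv z"] sum_distrib_left
        by (rule sum.cong[OF refl]) (use c0 in \<open>simp add: gg_def\<close>)
      then have "2 * Re (of_real c * ?S) = Im (of_real c * (\<Sum>j\<le>d + k. ?w ^ j * ev (gg j) (z, cnjv z)))"
        using S by simp
      then have "c * (2 * Re ?S) = c * Im (\<Sum>j\<le>d + k. ?w ^ j * ev (gg j) (z, cnjv z))"
        by (simp only: Re_complex_of_real Im_complex_of_real times_complex.sel mult_zero_left diff_zero add_0_right mult.left_commute)
      from this[unfolded mult_left_cancel[OF c0]] show ?thesis by (rule sym)
    qed
    \<comment> \<open>For 1 + k = d the coefficient of w in a z-component is a constant, and on the
      w-axis the whole part of weight \<open>d\<close> reduces to it; equality of the 1-jets makes
      it 0.\<close>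
    have jet: "f 1 i = 0" if dk: "1 + k = d" for i
    proof -
      have "q l 1 = 0" for l
      proof -
        have w0: "coef d (\<Delta>F l) d (0, 1) = 0"
          using zF dk by (intro coef_w_axis[OF cdiff_\<Delta>(1) eps one_le \<Delta>F_derivative \<Delta>_0(1)]) simp
        have qs: "(\<Sum>j\<le>1 + k. ev (q l j) (0, 0)) = coef d (\<Delta>F l) (1 + k) (0, 1)"
          by (simp only: q(1)[of l 0 1 0] power_one mult_1)
        have "(\<Sum>j\<le>1 + k. ev (q l j) (0, 0)) = 0" unfolding qs unfolding dk by (rule w0)
        moreover have "(\<Sum>j\<le>1 + k. ev (q l j) (0, 0)) = (\<Sum>j\<in>{0, 1}. ev (q l j) (0, 0))"
        proof (rule sum.mono_neutral_right)
          show "\<forall>j\<in>{..1 + k} - {0, 1}. ev (q l j) (0, 0) = 0"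
          proof
            fix j assume "j \<in> {..1 + k} - {0, 1}"
            then have "1 * d < j * d" using one_le by (intro mult_strict_right_mono) auto
            then show "ev (q l j) (0, 0) = 0" using dk by (simp add: q(3))
          qed
        qed (use k in auto)
        moreover have "ev (q l 0) (0, 0) = 0" using bihom_at_0(1)[OF q(2)[of 0 l], of 0] k by simp
        ultimately have "ev (q l 1) (0, 0) = 0" by simp
        moreover have "q l 1 = cst (ev (q l 1) (0, 0))" using q(2)[of 1 l] dk by (intro bihom_00) simp
        ultimately show "q l 1 = 0" by (simp add: cst_simps)
      qed
      then show ?thesis by (simp add: f_def)
    qed
    have hf: "bihom (1 + k - j * d) 0 (f j i)" if "j * d \<le> 1 + k" for j i
      unfolding f_def by (intro bihom_sum bihom_cst_mult q(2) that)
    have hf0: "f j i = 0" if "1 + k < j * d" for j i using that by (simp add: f_def q(3))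
    have hg: "bihom (d + k - j * d) 0 (gg j)" if "j * d \<le> d + k" for j
      unfolding gg_def by (intro bihom_cst_mult qG(2) that)
    have hg0: "gg j = 0" if "d + k < j * d" for j using that by (simp add: gg_def qG(3))
    have f0: "f j i = 0" if "j \<le> d + k" for j i
      by (rule tangent_vanishes(1)[where f = f and g = gg and N = "d + k" and k = k])
        (rule d, rule k, (rule rigid; assumption), (rule nondeg; assumption), (rule unbal; assumption),
          erule hf, erule hf0, erule hg, erule hg0, erule jet, rule tangent, rule that)
    have "gg j = 0" if "j \<le> d + k" for j
      by (rule tangent_vanishes(2)[where f = f and g = gg and N = "d + k" and k = k])
        (rule d, rule k, (rule rigid; assumption), (rule nondeg; assumption), (rule unbal; assumption),
          erule hf, erule hf0, erule hg, erule hg0, erule jet, rule tangent, rule that)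
    then have "ev (qG j) x = 0" if "j \<le> d + k" for j x
      using that c0 by (simp add: gg_def)
    moreover have "ev (q l j) x = 0" if "j \<le> d + k" for l j x
      unfolding fq[symmetric, of l j x] using f0[OF that] by simp
    ultimately have "coef d (\<Delta>F i) (1 + k) (z, w) = 0" "coef d \<Delta>G (d + k) (z, w) = 0" for i z w
      unfolding q'[of i z w 0] qG(1)[of z w 0] by simp_all
    then show ?thesis unfolding split_paired_All by blast
  qed
qed

end

end

section \<open>From automorphisms of M at p to self-maps in multitype coordinates\<close>

lemma holo_map_on_cdiff:
  assumes h: "holo_map_on U H" and "ball 0 \<epsilon> \<subseteq> U"
  shows "cdiff \<epsilon> (\<lambda>x. fst (H x) $ i)" "cdiff \<epsilon> (\<lambda>x. snd (H x))"
proof -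
  have D: "\<exists>D. (H has_derivative D) (at x) \<and> (\<forall>v. D (mult_i v) = mult_i (D v))" if "x \<in> ball 0 \<epsilon>" for x
    using assms that by (auto simp: holo_map_on_def)
  show "cdiff \<epsilon> (\<lambda>x. fst (H x) $ i)"
    unfolding cdiff_def
  proof
    fix x :: "'a cspace" assume "x \<in> ball 0 \<epsilon>"
    then obtain D where "(H has_derivative D) (at x)" and m: "\<forall>v. D (mult_i v) = mult_i (D v)" using D by blast
    have m': "fst (D (mult_i v)) $ i = \<i> * fst (D v) $ i" for v
      unfolding m[rule_format] by (simp add: mult_i_def)
    from \<open>(H has_derivative D) (at x)\<close> have "((\<lambda>x. fst (H x) $ i) has_derivative (\<lambda>v. fst (D v) $ i)) (at x)"
      by (intro bounded_linear.has_derivative[OF bounded_linear_vec_nth] has_derivative_fst)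
    then show "\<exists>D. ((\<lambda>x. fst (H x) $ i) has_derivative D) (at x) \<and> (\<forall>v. D (mult_i v) = \<i> * D v)"
      by (intro exI[of _ "\<lambda>v. fst (D v) $ i"] conjI allI m')
  qed
  show "cdiff \<epsilon> (\<lambda>x. snd (H x))"
    unfolding cdiff_def
  proof
    fix x :: "'a cspace" assume "x \<in> ball 0 \<epsilon>"
    then obtain D where "(H has_derivative D) (at x)" and m: "\<forall>v. D (mult_i v) = mult_i (D v)" using D by blast
    have m': "snd (D (mult_i v)) = \<i> * snd (D v)" for v
      unfolding m[rule_format] by (simp add: mult_i_def)
    from \<open>(H has_derivative D) (at x)\<close> have "((\<lambda>x. snd (H x)) has_derivative (\<lambda>v. snd (D v))) (at x)"
      by (intro has_derivative_snd)
    then show "\<exists>D. ((\<lambda>x. snd (H x)) has_derivative D) (at x) \<and> (\<forall>v. D (mult_i v) = \<i> * D v)"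
      by (intro exI[of _ "\<lambda>v. snd (D v)"] conjI allI m')
  qed
qed

lemma holo_map_on_continuous: "holo_map_on U f \<Longrightarrow> continuous_on U f"
  unfolding holo_map_on_def by (meson continuous_at_imp_continuous_on has_derivative_continuous)

lemma holo_map_on_subset: "holo_map_on U f \<Longrightarrow> open V \<Longrightarrow> V \<subseteq> U \<Longrightarrow> holo_map_on V f"
  unfolding holo_map_on_def by blast

lemma biholomorphic_inverse:
  assumes "biholomorphic U V f"
  shows "\<And>x. x \<in> U \<Longrightarrow> f x \<in> V" "\<And>x. x \<in> U \<Longrightarrow> inv_into U f (f x) = x"
    "\<And>y. y \<in> V \<Longrightarrow> inv_into U f y \<in> U" "\<And>y. y \<in> V \<Longrightarrow> f (inv_into U f y) = y"
    "open U" "open V" "holo_map_on U f" "holo_map_on V (inv_into U f)" "inj_on f U"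
proof -
  have b: "bij_betw f U V" and h: "holo_map_on U f" "holo_map_on V (inv_into U f)"
    using assms by (auto simp: biholomorphic_def)
  show "\<And>x. x \<in> U \<Longrightarrow> f x \<in> V" using b by (auto simp: bij_betw_def)
  show "\<And>x. x \<in> U \<Longrightarrow> inv_into U f (f x) = x" using b by (simp add: bij_betw_def)
  show "\<And>y. y \<in> V \<Longrightarrow> inv_into U f y \<in> U" using b by (auto simp: bij_betw_def intro: inv_into_into)
  show "\<And>y. y \<in> V \<Longrightarrow> f (inv_into U f y) = y" using b by (auto simp: bij_betw_def intro: f_inv_into_f)
  show "open U" "open V" using h by (simp_all add: holo_map_on_def)
  show "holo_map_on U f" "holo_map_on V (inv_into U f)" using h .
  show "inj_on f U" using b by (simp add: bij_betw_def)
qed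

lemma biholomorphic_derivative:
  assumes bih: "biholomorphic U V f" and q: "q \<in> U"
  obtains Df Dg where "(f has_derivative Df) (at q)" "(inv_into U f has_derivative Dg) (at (f q))" "inj Df" "inj Dg"
proof -
  note b = biholomorphic_inverse[OF bih]
  obtain Df where Df: "(f has_derivative Df) (at q)" using b(7) q by (auto simp: holo_map_on_def)
  obtain Dg where Dg: "(inv_into U f has_derivative Dg) (at (f q))" using b(8) b(1)[OF q] by (auto simp: holo_map_on_def)
  have "((\<lambda>x. inv_into U f (f x)) has_derivative (\<lambda>v. Dg (Df v))) (at q)" by (rule has_derivative_compose[OF Df Dg])
  then have "((\<lambda>x. x) has_derivative (\<lambda>v. Dg (Df v))) (at q)"
    by (rule has_derivative_transform_within_open[OF _ b(5) q b(2)])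
  from has_derivative_unique[OF this has_derivative_ident] have 1: "Dg (Df v) = v" for v by (rule fun_cong)
  have "(f has_derivative Df) (at (inv_into U f (f q)))" using Df b(2)[OF q] by simp
  then have "((\<lambda>y. f (inv_into U f y)) has_derivative (\<lambda>v. Df (Dg v))) (at (f q))" by (rule has_derivative_compose[OF Dg])
  then have "((\<lambda>y. y) has_derivative (\<lambda>v. Df (Dg v))) (at (f q))"
    by (rule has_derivative_transform_within_open[OF _ b(6) b(1)[OF q] b(4)])
  from has_derivative_unique[OF this has_derivative_ident] have 2: "Df (Dg v) = v" for v by (rule fun_cong)
  show thesis by (rule that[OF Df Dg]) (rule inj_on_inverseI[of _ Dg], rule 1, rule inj_on_inverseI[of _ Df], rule 2)
qed

context model_germ
begin

lemma germ_mono: "germ \<epsilon> D H \<Longrightarrow> 0 < \<epsilon>' \<Longrightarrow> \<epsilon>' \<le> \<epsilon> \<Longrightarrow> germ \<epsilon>' D H"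
proof -
  assume a: "germ \<epsilon> D H" "0 < \<epsilon>'" "\<epsilon>' \<le> \<epsilon>"
  then have sub: "ball 0 \<epsilon>' \<subseteq> (ball 0 \<epsilon> :: 'n cspace set)" by auto
  have "cdiff \<epsilon>' F" if "cdiff \<epsilon> F" for F :: "'n cspace \<Rightarrow> complex"
    using that sub unfolding cdiff_def by blast
  then show "germ \<epsilon>' D H" using a sub unfolding germ_def by blast
qed

lemma germ_unique:
  assumes g: "germ \<epsilon> D H" "germ \<epsilon> D H'"
    and rigid: "\<And>F e. 2 \<le> e \<Longrightarrow> (\<And>j. bihom e 0 (F j)) \<Longrightarrow> Dz F (cplx P) + Db F (cplx P) = 0 \<Longrightarrow> F = (\<lambda>_. 0)"
    and nondeg: "\<And>F e. (\<And>j. bihom e 0 (F j)) \<Longrightarrow> Dz F (cplx P) = 0 \<Longrightarrow> F = (\<lambda>_. 0)"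
    and unbal: "\<And>F c. (\<And>j. bihom 1 0 (F j)) \<Longrightarrow> Dz F (cplx P) = cst (of_real c) * cplx P \<Longrightarrow> c = (0::real)"
  shows "\<forall>\<^sub>F x in nhds 0. H x = H' x"
proof -
  have zero: "\<forall>x. (\<forall>i. coef d (\<Delta>F H H' i) (1 + k) x = 0) \<and> coef d (\<Delta>G H H') (d + k) x = 0" for k
    by (rule \<Delta>_coefficients_vanish[OF g])
      ((rule rigid; assumption), (rule nondeg; assumption), (rule unbal; assumption))
  have "coef d (\<Delta>F H H' i) l x = 0" for i l x
  proof (cases l)
    case (Suc l')
    then show ?thesis using spec[OF zero[of l'], of x] by simp
  qed (simp add: \<Delta>F_low[OF g])
  then have F: "\<forall>\<^sub>F x in nhds 0. \<Delta>F H H' i x = 0" for i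
    by (rule coef_all_zero[OF cdiff_\<Delta>(1)[OF g] eps[OF g] one_le])
  have "coef d (\<Delta>G H H') l x = 0" for l x
  proof (cases "l < d")
    case False
    then show ?thesis using spec[OF zero[of "l - d"], of x] by simp
  qed (simp add: \<Delta>G_low[OF g])
  then have G: "\<forall>\<^sub>F x in nhds 0. \<Delta>G H H' x = 0"
    by (rule coef_all_zero[OF cdiff_\<Delta>(2)[OF g] eps[OF g] one_le])
  have "\<forall>\<^sub>F x in nhds 0. \<forall>i. \<Delta>F H H' i x = 0"
    using F by (rule eventually_all_finite)
  with G show ?thesis
    by eventually_elim (simp add: \<Delta>F_def[OF g] \<Delta>G_def[OF g] prod_eq_iff fcp_eq_iff)
qed

lemma conjugate_germ:
  assumes bih: "biholomorphic U V \<phi>" and q: "q \<in> U" "\<phi> q = 0"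
    and M: "\<phi> ` (M \<inter> U) = {(z, w) \<in> V. Im w = Re (beval P z) + r (z, Re w)}"
    and D: "(\<phi> has_derivative D1) (at q)" "(inv_into U \<phi> has_derivative D2) (at 0)" "inj D1" "inj D2"
    and f: "f \<in> stability_group M q"
  shows "\<exists>\<epsilon>. germ \<epsilon> (\<lambda>v. D1 (frechet_derivative f (at q) (D2 v))) (\<lambda>x. \<phi> (f (inv_into U \<phi> x)))"
proof -
  let ?\<psi> = "inv_into U \<phi>" and ?E = "frechet_derivative f (at q)"
  note b = biholomorphic_inverse[OF bih]
  obtain U1 V1 where U1: "q \<in> U1" "biholomorphic U1 V1 f" "f ` (M \<inter> U1) \<subseteq> M" "f q = q"
    using f by (auto simp: stability_group_def)
  note b1 = biholomorphic_inverse[OF U1(2)]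
  define X where "X = V \<inter> ?\<psi> -` (U1 \<inter> f -` U)"
  have o1: "open (U1 \<inter> f -` U)"
    by (rule continuous_open_preimage[OF holo_map_on_continuous[OF b1(7)] b1(5) b(5)])
  have oX: "open X" unfolding X_def
    by (rule continuous_open_preimage[OF holo_map_on_continuous[OF b(8)] b(6) o1])
  have "0 \<in> V" using b(1)[OF q(1)] q(2) by simp
  have \<psi>0: "?\<psi> 0 = q" using b(2)[OF q(1)] q(2) by simp
  have "0 \<in> X" using \<open>0 \<in> V\<close> q U1 \<psi>0 by (simp add: X_def)
  then obtain \<epsilon> where \<epsilon>: "0 < \<epsilon>" "ball 0 \<epsilon> \<subseteq> X" using oX open_contains_ball by blast
  have h1: "holo_map_on X ?\<psi>" by (rule holo_map_on_subset[OF b(8) oX]) (auto simp: X_def)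
  have h2: "holo_map_on X (\<lambda>x. f (?\<psi> x))" by (rule holo_map_on_compose[OF h1 b1(7)]) (auto simp: X_def)
  have h3: "holo_map_on X (\<lambda>x. \<phi> (f (?\<psi> x)))" by (rule holo_map_on_compose[OF h2 b(7)]) (auto simp: X_def)
  obtain E E' where "(f has_derivative E) (at q)" "inj E" by (rule biholomorphic_derivative[OF U1(2,1)]) (rule that)
  then have E: "(f has_derivative ?E) (at q)" "inj ?E" using frechet_derivative_at by metis+
  have "((\<lambda>x. f (?\<psi> x)) has_derivative (\<lambda>v. ?E (D2 v))) (at 0)"
    by (rule has_derivative_compose[OF D(2)]) (simp add: \<psi>0 E)
  then have der: "((\<lambda>x. \<phi> (f (?\<psi> x))) has_derivative (\<lambda>v. D1 (?E (D2 v)))) (at 0)"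
    by (rule has_derivative_compose) (simp add: \<psi>0 U1(4) D)
  have injd: "inj (\<lambda>v. D1 (?E (D2 v)))"
    using inj_compose[OF D(3) inj_compose[OF E(2) D(4)]] by (simp only: o_def)
  have Mx: "Im (snd (\<phi> (f (?\<psi> x)))) = p (fst (\<phi> (f (?\<psi> x)))) + r (fst (\<phi> (f (?\<psi> x))), Re (snd (\<phi> (f (?\<psi> x)))))"
    if x: "x \<in> ball 0 \<epsilon>" "Im (snd x) = p (fst x) + r (fst x, Re (snd x))" for x
  proof -
    have "x \<in> X" using x(1) \<epsilon>(2) by blast
    then have xX: "x \<in> V" "?\<psi> x \<in> U1" "f (?\<psi> x) \<in> U" unfolding X_def by blast+
    then have "x \<in> {(z, w) \<in> V. Im w = Re (beval P z) + r (z, Re w)}"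
      using x(2) by (auto simp: p_def split_beta)
    then obtain y where y: "x = \<phi> y" "y \<in> M" "y \<in> U" unfolding M[symmetric] by blast
    have "?\<psi> x \<in> M" unfolding y(1) b(2)[OF y(3)] by (rule y(2))
    then have "f (?\<psi> x) \<in> M" using U1(3) xX(2) by blast
    then have "\<phi> (f (?\<psi> x)) \<in> \<phi> ` (M \<inter> U)" using xX(3) by blast
    then show ?thesis unfolding M by (auto simp: p_def split_beta)
  qed
  have H0: "\<phi> (f (?\<psi> 0)) = 0" by (simp add: \<psi>0 U1(4) q(2))
  have "germ \<epsilon> (\<lambda>v. D1 (?E (D2 v))) (\<lambda>x. \<phi> (f (?\<psi> x)))"
    unfolding germ_def
    by (intro conjI allI ballI impI \<epsilon>(1) holo_map_on_cdiff[OF h3 \<epsilon>(2)] H0 der injd) (rule Mx; assumption)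
  then show ?thesis by blast
qed

end

lemma model_real_bihom:
  fixes P :: "'n::finite bipoly"
  assumes P: "real_valued P" "P \<noteq> 0" "bi_whomogeneous (\<lambda>_. m) 1 P" "no_pluriharmonic_terms P" and "0 < m"
    and nd: "holomorphically_nondegenerate (model_hypersurface P)"
  obtains Pc d where "real_bihom (cplx P) Pc d" "m * real d = 1"
    "\<And>\<alpha> \<beta>. (\<alpha>, \<beta>) \<in> Poly_Mapping.keys P \<Longrightarrow> 1 \<le> sum \<alpha> UNIV \<and> 1 \<le> sum \<beta> UNIV \<and> sum \<alpha> UNIV + sum \<beta> UNIV = d"
proof -
  let ?K = "Poly_Mapping.keys P"
  have real: "tau (cplx P) = cplx P"
    using P(1) by (intro polarisation_eq) (simp add: real_valued_def beval_cplx Reals_cnj_iff)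
  have wt: "m * real (sum (fst k) UNIV + sum (snd k) UNIV) = 1" if "k \<in> ?K" for k
    using P(3) that unfolding bi_whomogeneous_def by (auto simp: wdeg_const distrib_left split_beta)
  have "?K \<noteq> {}" using P(2) by simp
  then obtain k0 where k0: "k0 \<in> ?K" by blast
  define d where "d = sum (fst k0) UNIV + sum (snd k0) UNIV"
  have d: "m * real d = 1" using wt[OF k0] by (simp only: d_def)
  have deg: "sum (fst k) UNIV + sum (snd k) UNIV = d" if "k \<in> ?K" for k
  proof -
    have "m * real (sum (fst k) UNIV + sum (snd k) UNIV) = m * real d" using wt[OF that] d by simp
    then show ?thesis using \<open>0 < m\<close> by (simp only: mult_left_cancel of_nat_eq_iff)
  qed
  have pos: "1 \<le> sum (fst k) UNIV" "1 \<le> sum (snd k) UNIV" if "k \<in> ?K" for k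
  proof -
    have "fst k \<noteq> (\<lambda>_. 0)" "snd k \<noteq> (\<lambda>_. 0)"
      using P(4) that unfolding no_pluriharmonic_terms_def by auto
    then have "sum (fst k) UNIV \<noteq> 0" "sum (snd k) UNIV \<noteq> 0" by (simp_all only: sum_nat_eq_0_UNIV not_False_eq_True)
    then show "1 \<le> sum (fst k) UNIV" "1 \<le> sum (snd k) UNIV" by linarith+
  qed
  define Pc where "Pc q = (\<Sum>k\<in>{k\<in>?K. sum (fst k) UNIV = q}. term_of (Poly_Mapping.lookup P k) k)" for q
  have "real_bihom (cplx P) Pc d"
  proof
    show "tau (cplx P) = cplx P" by (rule real)
    \<comment> \<open>That a nonzero coefficient family does not evaluate to zero is drawn from
      nondegeneracy: a constant field would annihilate the zero polynomial.\<close>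
    show "cplx P \<noteq> 0"
    proof
      assume "cplx P = 0"
      then have "Dz (\<lambda>_. 1) (cplx P) = 0" by (simp add: derivation_0[OF derivation_Dz])
      then have "(\<lambda>_. 1) = (\<lambda>_::'n. 0 :: 'n pring)"
        using nondegenerate_field[where F = "\<lambda>_. 1" and e = 0, OF nd real] by simp
      then show False by (auto dest: fun_cong)
    qed
    have "sum (fst k) UNIV \<in> {1..<d}" if "k \<in> ?K" for k using deg[OF that] pos[OF that] by auto
    then have "(\<lambda>k. sum (fst k) UNIV) ` ?K \<subseteq> {1..<d}" by blast
    then show "cplx P = sum Pc {1..<d}"
      unfolding cplx_def Pc_def by (intro sum.group[symmetric]) auto
    fix q assume "q \<in> {1..<d}"
    show "bihom q (d - q) (Pc q)"
      unfolding Pc_def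
    proof (rule bihom_sum)
      fix k assume k: "k \<in> {k \<in> ?K. sum (fst k) UNIV = q}"
      then have "sum (fst k) UNIV = q" "sum (snd k) UNIV = d - q" using deg[of k] by auto
      then show "bihom q (d - q) (term_of (Poly_Mapping.lookup P k) k)" by (intro bihom_degree_cong[OF bihom_term_of])
    qed
  qed
  then show thesis
  proof (rule that[OF _ d])
    fix \<alpha> \<beta> assume "(\<alpha>, \<beta>) \<in> ?K"
    then show "1 \<le> sum \<alpha> UNIV \<and> 1 \<le> sum \<beta> UNIV \<and> sum \<alpha> UNIV + sum \<beta> UNIV = d"
      using deg[of "(\<alpha>, \<beta>)"] pos[of "(\<alpha>, \<beta>)"] by simp
  qed
qed

theorem theorem1p8:
  fixes M :: "('n::{finite,linorder}) cspace set" and p :: "'n cspace"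
    and \<mu> :: "'n \<Rightarrow> real" and P :: "'n bipoly" and \<phi> g h :: "'n cspace \<Rightarrow> 'n cspace"
  assumes "smooth_hypersurface M" and "p \<in> M" and "finite_type M p"
    and "multitype M p \<mu>" and "\<forall>j. \<mu> j \<noteq> 0"
    and "weighted_coordinates M p \<mu> \<phi> P"
    and "holomorphically_nondegenerate (model_hypersurface P)"
    and "\<forall>i j. \<mu> i = \<mu> j"
    and "\<forall>Q. model_polynomial M p Q \<longrightarrow> \<not> balanced Q"
    and "\<not> chain_hypersurface \<mu> P"
    and "g \<in> stability_group M p" and "h \<in> stability_group M p"
    and "same_1_jet p g h"
  shows "same_germ p g h"
proof -
  define m where "m = \<mu> undefined"
  have \<mu>: "\<mu> = (\<lambda>_. m)" using assms(8) by (auto simp: m_def)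
  have "0 \<le> m" "m \<noteq> 0"
    using assms(4,5) by (auto simp: m_def multitype_def weight_def)
  then have m: "0 < m" by simp
  note mt = assms(4)[unfolded \<mu>] and wc = assms(6)[unfolded \<mu>]
  have unbalanced: "\<not> balanced Q" if "weighted_coordinates M p (\<lambda>_. m) \<phi>' Q" for \<phi>' Q
    using assms(9) mt that unfolding model_polynomial_def by blast
  obtain U V W r where c: "p \<in> U" "biholomorphic U V \<phi>" "\<phi> p = 0" "open W" "\<forall>(z, w)\<in>V. (z, Re w) \<in> W"
    "smooth_on W r" "small_remainder (\<lambda>_. m) r"
    "\<phi> ` (M \<inter> U) = {(z, w) \<in> V. Im w = Re (beval P z) + r (z, Re w)}"
    and P: "real_valued P" "P \<noteq> 0" "bi_whomogeneous (\<lambda>_. m) 1 P" "no_pluriharmonic_terms P"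
    using wc unfolding weighted_coordinates_def by blast
  obtain Pc d where rb: "real_bihom (cplx P) Pc d" and md: "m * real d = 1"
    and keys: "\<And>\<alpha> \<beta>. (\<alpha>, \<beta>) \<in> Poly_Mapping.keys P \<Longrightarrow> 1 \<le> sum \<alpha> UNIV \<and> 1 \<le> sum \<beta> UNIV \<and> sum \<alpha> UNIV + sum \<beta> UNIV = d"
    by (rule model_real_bihom[OF P m assms(7)]) (rule that)
  interpret real_bihom "cplx P" Pc d by (rule rb)
  \<comment> \<open>Without pluriharmonic terms a polynomial of degree 2 has bidegree (1, 1) only,
    so it is balanced with all weights equal to 1.\<close>
  have "d \<noteq> 2"
  proof
    assume "d = 2"
    then have "sum \<alpha> UNIV = 1 \<and> sum \<beta> UNIV = 1" if "(\<alpha>, \<beta>) \<in> Poly_Mapping.keys P" for \<alpha> \<beta>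
      using keys[OF that] by linarith
    then have "wdeg (\<lambda>_. 1) \<alpha> = 1 \<and> wdeg (\<lambda>_. 1) \<beta> = 1" if "(\<alpha>, \<beta>) \<in> Poly_Mapping.keys P" for \<alpha> \<beta>
      using that by (simp add: wdeg_const del: of_nat_sum)
    moreover have "(\<lambda>_::'n. 1::real) \<noteq> (\<lambda>_. 0)" by (auto dest: fun_cong)
    ultimately have "balanced P"
      unfolding balanced_def by (intro exI[of _ "\<lambda>_. 1"]) auto
    then show False using unbalanced[OF wc] by simp
  qed
  then have d: "3 \<le> d" using two_le_d by linarith
  note b = biholomorphic_inverse[OF c(2)]
  have "0 \<in> V" using b(1)[OF c(1)] c(3) by simp
  then have W0: "0 \<in> W" using c(5) by (force simp: zero_prod_def)
  interpret mg: model_germ P Pc d m W r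
    by (unfold_locales; fact d W0 c(4) c(6) c(7) m md)
  obtain D1 D2 where D: "(\<phi> has_derivative D1) (at p)" "(inv_into U \<phi> has_derivative D2) (at (\<phi> p))" "inj D1" "inj D2"
    by (rule biholomorphic_derivative[OF c(2,1)]) (rule that)
  let ?D = "\<lambda>v. D1 (frechet_derivative g (at p) (D2 v))"
  have jet: "frechet_derivative h (at p) = frechet_derivative g (at p)"
    using assms(13) by (simp add: same_1_jet_def)
  from mg.conjugate_germ[OF c(2,1,3,8) D(1) D(2)[unfolded c(3)] D(3,4) assms(11)]
  obtain \<epsilon>1 where g: "mg.germ \<epsilon>1 ?D (\<lambda>x. \<phi> (g (inv_into U \<phi> x)))" by (rule exE)
  from mg.conjugate_germ[OF c(2,1,3,8) D(1) D(2)[unfolded c(3)] D(3,4) assms(12), unfolded jet]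
  obtain \<epsilon>2 where h: "mg.germ \<epsilon>2 ?D (\<lambda>x. \<phi> (h (inv_into U \<phi> x)))" by (rule exE)
  have \<epsilon>: "0 < min \<epsilon>1 \<epsilon>2" using mg.germ_simps(1)[OF g] mg.germ_simps(1)[OF h] by simp
  have "\<forall>\<^sub>F x in nhds 0. \<phi> (g (inv_into U \<phi> x)) = \<phi> (h (inv_into U \<phi> x))"
  proof (rule mg.germ_unique[OF mg.germ_mono[OF g \<epsilon>] mg.germ_mono[OF h \<epsilon>]])
    fix F :: "'n \<Rightarrow> 'n pring" and e assume e: "2 \<le> e" "\<And>j. bihom e 0 (F j)" "Dz F (cplx P) + Db F (cplx P) = 0"
    show "F = (\<lambda>_. 0)"
    proof (rule ccontr)
      assume "F \<noteq> (\<lambda>_. 0)"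
      then have "chain_hypersurface (\<lambda>_. m) P"
        by (intro chain_hypersurfaceI[where Y = F, OF rb e(2,1) _ e(3) m])
      then show False using assms(10) by (simp add: \<mu>)
    qed
  next
    fix F :: "'n \<Rightarrow> 'n pring" and e assume F: "\<And>j. bihom e 0 (F j)" "Dz F (cplx P) = 0"
    show "F = (\<lambda>_. 0)" by (rule nondegenerate_field[where F = F, OF assms(7) real F])
  next
    fix F :: "'n \<Rightarrow> 'n pring" and c :: real
    assume F: "\<And>j. bihom 1 0 (F j)" "Dz F (cplx P) = cst (of_real c) * cplx P"
    show "c = 0"
    proof (rule ccontr)
      assume "c \<noteq> 0"
      have "\<exists>\<phi> Q. weighted_coordinates M p (\<lambda>_. m) \<phi> Q \<and> balanced Q"
        by (rule balanced_coordinates[OF wc m md rb _ F(2) \<open>c \<noteq> 0\<close>]) (rule F(1))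
      then show False using unbalanced by blast
    qed
  qed auto
  moreover have lim: "filterlim \<phi> (nhds 0) (nhds p)"
  proof -
    have "(\<phi> \<longlongrightarrow> \<phi> p) (at p)" using has_derivative_continuous[OF D(1)] by (simp add: continuous_within)
    then have "(\<phi> \<longlongrightarrow> \<phi> p) (nhds p)" by (simp only: tendsto_at_iff_tendsto_nhds)
    then show ?thesis by (simp only: c(3))
  qed
  ultimately have e1: "\<forall>\<^sub>F q in nhds p. \<phi> (g (inv_into U \<phi> (\<phi> q))) = \<phi> (h (inv_into U \<phi> (\<phi> q)))"
    by (rule eventually_compose_filterlim)
  have e2: "\<forall>\<^sub>F q in nhds p. q \<in> U" using b(5) c(1) by (rule eventually_nhds_in_open)
  \<comment> \<open>Injectivity of the chart is available only on \<open>U\<close>, so the images of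
    nearby points under both automorphisms have to lie there.\<close>
  have e3: "\<forall>\<^sub>F q in nhds p. f q \<in> U" if f: "f \<in> stability_group M p" for f
  proof -
    obtain U1 V1 where U1: "p \<in> U1" "biholomorphic U1 V1 f" "f p = p"
      using f unfolding stability_group_def by blast
    note b1 = biholomorphic_inverse[OF U1(2)]
    have "open (U1 \<inter> f -` U)"
      by (rule continuous_open_preimage[OF holo_map_on_continuous[OF b1(7)] b1(5) b(5)])
    then have "\<forall>\<^sub>F q in nhds p. q \<in> U1 \<inter> f -` U" by (rule eventually_nhds_in_open) (simp add: U1 c(1))
    then show ?thesis by eventually_elim simp
  qed
  show ?thesis
    unfolding same_germ_def using e1 e2 e3[OF assms(11)] e3[OF assms(12)]
  proof eventually_elim
    case (elim q)
    have "\<phi> (g q) = \<phi> (h q)" using elim(1) unfolding b(2)[OF elim(2)] .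
    then show "g q = h q" by (rule inj_onD[OF b(9) _ elim(3,4)])
  qed
qed

end
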